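(* Let $(K,<)$ be an almost real closed field with respect to some ordered abelian group $G$. Then $(K,<)$ is strongly NIP if and only if $G$ is strongly NIP.
   Context: Ordered fields are structures in the language $\{+,-,\cdot,0,1,<\}$ of ordered rings, and (totally) ordered abelian groups are structures in the language $\{+,0,<\}$. An ordered field $(K,<)$ is almost real closed with respect to an ordered abelian group $G$ if there is a henselian valuation $v$ on $K$ (possibly trivial) whose residue field $Kv$ is real closed and whose ordered value group $vK$ is $G$. A structure is strongly NIP (also called strongly dependent) if its complete theory is. A complete theory is strongly NIP if in a monster model there are no formulas $\varphi_i(x;y_i)$ ($i<\omega$, $x$ a single variable) and parameters $b_{i,j}$ ($i,j<\omega$) such that for every $\eta\colon\omega\to\omega$ the set $\{\varphi_i(x;b_{i,\eta(i)}) : i<\omega\}\cup\{\neg\varphi_i(x;b_{i,j}) : i<\omega,\ j\neq\eta(i)\}$ is consistent. *)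

theory Defs
  imports
    "HOL-Library.Countable_Set"
    "HOL-Computational_Algebra.Polynomial"
    "HOL-Algebra.QuotRing"
begin

section \<open>First-order logic\<close>

record ('f, 'r) language =
  fun_arity :: "'f \<Rightarrow> nat"
  rel_arity :: "'r \<Rightarrow> nat"

datatype 'f tm = Var nat | Fn 'f "'f tm list"

datatype ('f, 'r) fm =
    Eq "'f tm" "'f tm"
  | Rel 'r "'f tm list"
  | Neg "('f, 'r) fm"
  | Conj "('f, 'r) fm" "('f, 'r) fm"
  | Exi nat "('f, 'r) fm"

fun wf_tm :: "('f, 'r) language \<Rightarrow> 'f tm \<Rightarrow> bool" where
  "wf_tm L (Var n) \<longleftrightarrow> True"
| "wf_tm L (Fn f ts) \<longleftrightarrow> length ts = fun_arity L f \<and> list_all (wf_tm L) ts"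

primrec wf_fm :: "('f, 'r) language \<Rightarrow> ('f, 'r) fm \<Rightarrow> bool" where
  "wf_fm L (Eq s t) \<longleftrightarrow> wf_tm L s \<and> wf_tm L t"
| "wf_fm L (Rel r ts) \<longleftrightarrow> length ts = rel_arity L r \<and> list_all (wf_tm L) ts"
| "wf_fm L (Neg p) \<longleftrightarrow> wf_fm L p"
| "wf_fm L (Conj p q) \<longleftrightarrow> wf_fm L p \<and> wf_fm L q"
| "wf_fm L (Exi n p) \<longleftrightarrow> wf_fm L p"

primrec fv_tm :: "'f tm \<Rightarrow> nat set" where
  "fv_tm (Var n) = {n}"
| "fv_tm (Fn f ts) = \<Union> (set (map fv_tm ts))"

primrec fv_fm :: "('f, 'r) fm \<Rightarrow> nat set" where
  "fv_fm (Eq s t) = fv_tm s \<union> fv_tm t"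
| "fv_fm (Rel r ts) = (\<Union>t\<in>set ts. fv_tm t)"
| "fv_fm (Neg p) = fv_fm p"
| "fv_fm (Conj p q) = fv_fm p \<union> fv_fm q"
| "fv_fm (Exi n p) = fv_fm p - {n}"

record ('f, 'r, 'a) struc =
  univ :: "'a set"
  fun_interp :: "'f \<Rightarrow> 'a list \<Rightarrow> 'a"
  rel_interp :: "'r \<Rightarrow> 'a list \<Rightarrow> bool"

definition is_structure :: "('f, 'r) language \<Rightarrow> ('f, 'r, 'a) struc \<Rightarrow> bool" where
  "is_structure L M \<longleftrightarrow> univ M \<noteq> {} \<and>
     (\<forall>f as. length as = fun_arity L f \<and> set as \<subseteq> univ M \<longrightarrow> fun_interp M f as \<in> univ M)"

primrec tm_val :: "('f, 'r, 'a) struc \<Rightarrow> (nat \<Rightarrow> 'a) \<Rightarrow> 'f tm \<Rightarrow> 'a" where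
  "tm_val M e (Var n) = e n"
| "tm_val M e (Fn f ts) = fun_interp M f (map (tm_val M e) ts)"

primrec sat :: "('f, 'r, 'a) struc \<Rightarrow> (nat \<Rightarrow> 'a) \<Rightarrow> ('f, 'r) fm \<Rightarrow> bool" where
  "sat M e (Eq s t) \<longleftrightarrow> tm_val M e s = tm_val M e t"
| "sat M e (Rel r ts) \<longleftrightarrow> rel_interp M r (map (tm_val M e) ts)"
| "sat M e (Neg p) \<longleftrightarrow> \<not> sat M e p"
| "sat M e (Conj p q) \<longleftrightarrow> sat M e p \<and> sat M e q"
| "sat M e (Exi n p) \<longleftrightarrow> (\<exists>a\<in>univ M. sat M (e(n := a)) p)"

definition complete_theory :: "('f, 'r) language \<Rightarrow> ('f, 'r, 'a) struc \<Rightarrow> ('f, 'r) fm set" where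
  "complete_theory L M =
     {p. wf_fm L p \<and> fv_fm p = {} \<and> (\<forall>e. range e \<subseteq> univ M \<longrightarrow> sat M e p)}"

definition is_model ::
    "('f, 'r) language \<Rightarrow> ('f, 'r) fm set \<Rightarrow> ('f, 'r, 'a) struc \<Rightarrow> bool" where
  "is_model L T M \<longleftrightarrow> is_structure L M \<and>
     (\<forall>p\<in>T. \<forall>e. range e \<subseteq> univ M \<longrightarrow> sat M e p)"


section \<open>Strong NIP\<close>

text \<open>
  A formula \<open>p(x; b)\<close> in the single variable \<open>x\<close> with parameters is encoded as a pair \<open>(p, b)\<close>:
  the distinguished variable \<open>x\<close> is variable \<open>0\<close>, and \<open>b\<close> is an assignment supplying the
  parameters for all other variables (finitely many of which occur in \<open>p\<close>); the value \<open>b 0\<close>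
  is irrelevant.
\<close>

definition realizes ::
    "('f, 'r, 'a) struc \<Rightarrow> 'a \<Rightarrow> (('f, 'r) fm \<times> (nat \<Rightarrow> 'a)) set \<Rightarrow> bool" where
  "realizes N a \<Gamma> \<longleftrightarrow> (\<forall>(p, b)\<in>\<Gamma>. sat N (b(0 := a)) p)"

text \<open>
  By compactness, a set of formulas with parameters in \<open>N\<close> is consistent (with the elementary
  diagram of \<open>N\<close>) iff it is finitely satisfiable in \<open>N\<close>.
\<close>

definition consistent_in ::
    "('f, 'r, 'a) struc \<Rightarrow> (('f, 'r) fm \<times> (nat \<Rightarrow> 'a)) set \<Rightarrow> bool" where
  "consistent_in N \<Gamma> \<longleftrightarrow> (\<forall>\<Delta>\<subseteq>\<Gamma>. finite \<Delta> \<longrightarrow> (\<exists>a\<in>univ N. realizes N a \<Delta>))"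

definition aleph1_saturated :: "('f, 'r) language \<Rightarrow> ('f, 'r, 'a) struc \<Rightarrow> bool" where
  "aleph1_saturated L N \<longleftrightarrow>
     (\<forall>A \<Gamma>. countable A \<and> A \<subseteq> univ N \<and> (\<forall>(p, b)\<in>\<Gamma>. wf_fm L p \<and> range b \<subseteq> A)
        \<and> consistent_in N \<Gamma> \<longrightarrow> (\<exists>a\<in>univ N. realizes N a \<Gamma>))"

text \<open>
  Only countably many formulas and parameters are involved in the definition of strong NIP, so
  saturation for types over countable parameter sets is all that is required of a monster model.
\<close>

definition monster_model ::
    "('f, 'r) language \<Rightarrow> ('f, 'r) fm set \<Rightarrow> ('f, 'r, 'a) struc \<Rightarrow> bool" where
  "monster_model L T N \<longleftrightarrow> is_model L T N \<and> aleph1_saturated L N"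

definition strong_NIP_violation ::
    "('f, 'r) language \<Rightarrow> ('f, 'r, 'a) struc \<Rightarrow> (nat \<Rightarrow> ('f, 'r) fm) \<Rightarrow>
     (nat \<Rightarrow> nat \<Rightarrow> nat \<Rightarrow> 'a) \<Rightarrow> bool" where
  "strong_NIP_violation L N \<phi> b \<longleftrightarrow>
     (\<forall>i. wf_fm L (\<phi> i)) \<and> (\<forall>i j. range (b i j) \<subseteq> univ N) \<and>
     (\<forall>\<eta> :: nat \<Rightarrow> nat.
        consistent_in N ({(\<phi> i, b i (\<eta> i)) | i. True} \<union> {(Neg (\<phi> i), b i j) | i j. j \<noteq> \<eta> i}))"

text \<open>
  A complete theory in a countable language has a monster model in the above sense whose universe
  is a subset of the type \<open>nat \<Rightarrow> nat\<close>: take an ultrapower, along a nonprincipal ultrafilter on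
  the natural numbers, of a countable model (and choose representatives).  Whether a violation
  exists does not depend on the choice of the monster model.
\<close>

definition strongly_NIP_theory ::
    "('f::countable, 'r::countable) language \<Rightarrow> ('f, 'r) fm set \<Rightarrow> bool" where
  "strongly_NIP_theory L T \<longleftrightarrow>
     (\<exists>N :: ('f, 'r, nat \<Rightarrow> nat) struc.
        monster_model L T N \<and> (\<nexists>\<phi> b. strong_NIP_violation L N \<phi> b))"

definition strongly_NIP ::
    "('f::countable, 'r::countable) language \<Rightarrow> ('f, 'r, 'a) struc \<Rightarrow> bool" where
  "strongly_NIP L M \<longleftrightarrow> strongly_NIP_theory L (complete_theory L M)"


section \<open>Ordered fields and ordered abelian groups as structures\<close>

datatype oring_fun = RPlus | RMinus | RTimes | RZero | ROne
datatype ogroup_fun = GPlus | GZero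
datatype order_rel = Less

instance oring_fun :: countable by countable_datatype
instance ogroup_fun :: countable by countable_datatype
instance order_rel :: countable by countable_datatype

definition oring_language :: "(oring_fun, order_rel) language" where
  "oring_language =
     \<lparr>fun_arity = (\<lambda>f. case f of RPlus \<Rightarrow> 2 | RMinus \<Rightarrow> 2 | RTimes \<Rightarrow> 2 | RZero \<Rightarrow> 0 | ROne \<Rightarrow> 0),
      rel_arity = (\<lambda>_. 2)\<rparr>"

definition ogroup_language :: "(ogroup_fun, order_rel) language" where
  "ogroup_language =
     \<lparr>fun_arity = (\<lambda>f. case f of GPlus \<Rightarrow> 2 | GZero \<Rightarrow> 0),
      rel_arity = (\<lambda>_. 2)\<rparr>"

text \<open>The values on argument lists of the wrong length are irrelevant.\<close>

definition ofield_structure :: "(oring_fun, order_rel, 'k::linordered_field) struc" where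
  "ofield_structure =
     \<lparr>univ = UNIV,
      fun_interp = (\<lambda>f as. case f of
          RPlus \<Rightarrow> as ! 0 + as ! 1 | RMinus \<Rightarrow> as ! 0 - as ! 1 | RTimes \<Rightarrow> as ! 0 * as ! 1
        | RZero \<Rightarrow> 0 | ROne \<Rightarrow> 1),
      rel_interp = (\<lambda>_ as. as ! 0 < as ! 1)\<rparr>"

definition ogroup_structure ::
    "(ogroup_fun, order_rel, 'g::linordered_ab_group_add) struc" where
  "ogroup_structure =
     \<lparr>univ = UNIV,
      fun_interp = (\<lambda>f as. case f of GPlus \<Rightarrow> as ! 0 + as ! 1 | GZero \<Rightarrow> 0),
      rel_interp = (\<lambda>_ as. as ! 0 < as ! 1)\<rparr>"


section \<open>Almost real closed fields\<close>

text \<open>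
  A valuation is given by its restriction to the nonzero elements; the convention \<open>v 0 = \<infinity>\<close> is
  implemented by treating \<open>0\<close> separately, and the value that the function takes at \<open>0\<close> is
  irrelevant.
\<close>

definition valuation :: "('k::field \<Rightarrow> 'g::linordered_ab_group_add) \<Rightarrow> bool" where
  "valuation v \<longleftrightarrow>
     (\<forall>x y. x \<noteq> 0 \<and> y \<noteq> 0 \<longrightarrow> v (x * y) = v x + v y) \<and>
     (\<forall>x y. x \<noteq> 0 \<and> y \<noteq> 0 \<and> x + y \<noteq> 0 \<longrightarrow> min (v x) (v y) \<le> v (x + y))"

definition value_group :: "('k::field \<Rightarrow> 'g::linordered_ab_group_add) \<Rightarrow> 'g set" where
  "value_group v = v ` (UNIV - {0})"

definition valuation_ideal :: "('k::field \<Rightarrow> 'g::linordered_ab_group_add) \<Rightarrow> 'k set" where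
  "valuation_ideal v = {x. x = 0 \<or> v x > 0}"

definition valuation_ring :: "('k::field \<Rightarrow> 'g::linordered_ab_group_add) \<Rightarrow> 'k ring" where
  "valuation_ring v =
     \<lparr>carrier = {x. x = 0 \<or> v x \<ge> 0}, mult = (*), one = 1, zero = 0, add = (+)\<rparr>"

definition residue_field :: "('k::field \<Rightarrow> 'g::linordered_ab_group_add) \<Rightarrow> 'k set ring" where
  "residue_field v = valuation_ring v Quot valuation_ideal v"

definition henselian :: "('k::field \<Rightarrow> 'g::linordered_ab_group_add) \<Rightarrow> bool" where
  "henselian v \<longleftrightarrow> valuation v \<and>
     (\<forall>(f :: 'k poly) a.
        (\<forall>i. coeff f i \<in> carrier (valuation_ring v)) \<and> a \<in> carrier (valuation_ring v) \<and>
        poly f a \<in> valuation_ideal v \<and>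
        poly (pderiv f) a \<noteq> 0 \<and> v (poly (pderiv f) a) = 0 \<longrightarrow>
        (\<exists>b\<in>carrier (valuation_ring v). poly f b = 0 \<and> b - a \<in> valuation_ideal v))"

text \<open>
  Real closed: formally real, every element is a square up to sign, and every polynomial of odd
  degree has a root.
\<close>

definition real_closed :: "('a, 'b) ring_scheme \<Rightarrow> bool" where
  "real_closed R \<longleftrightarrow> Ring.field R \<and>
     (\<forall>n (a :: nat \<Rightarrow> 'a). a \<in> {..<n} \<rightarrow> carrier R \<longrightarrow>
        (\<Oplus>\<^bsub>R\<^esub>i\<in>{..<n}. a i \<otimes>\<^bsub>R\<^esub> a i) \<noteq> \<ominus>\<^bsub>R\<^esub> \<one>\<^bsub>R\<^esub>) \<and>
     (\<forall>a\<in>carrier R. \<exists>b\<in>carrier R. a = b \<otimes>\<^bsub>R\<^esub> b \<or> \<ominus>\<^bsub>R\<^esub> a = b \<otimes>\<^bsub>R\<^esub> b) \<and>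
     (\<forall>n (a :: nat \<Rightarrow> 'a). odd n \<and> a \<in> {..n} \<rightarrow> carrier R \<and> a n \<noteq> \<zero>\<^bsub>R\<^esub> \<longrightarrow>
        (\<exists>x\<in>carrier R. (\<Oplus>\<^bsub>R\<^esub>i\<in>{..n}. a i \<otimes>\<^bsub>R\<^esub> x [^]\<^bsub>R\<^esub> i) = \<zero>\<^bsub>R\<^esub>))"

definition almost_real_closed ::
    "'k::linordered_field itself \<Rightarrow> 'g::linordered_ab_group_add itself \<Rightarrow> bool" where
  "almost_real_closed _ _ \<longleftrightarrow>
     (\<exists>v :: 'k \<Rightarrow> 'g. henselian v \<and> real_closed (residue_field v) \<and> value_group v = UNIV)"

end

theory Submission
 imports
  Defs
  "HOL-Algebra.Algebraic_Closure_Type"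
  "HOL-Computational_Algebra.Polynomial_FPS"
  "HOL-Library.Product_Lexorder"
begin

text \<open>
  Violations of strong NIP are moved between the field and the group, after replacing both by
  ultrapowers. A violation in the field \<open>K\<close> yields mutually indiscernible rows of Skolemised sequences and
  an element \<open>c\<close> on which every row alternates. An extension theorem for countable partial isomorphisms
  that respect types in the value group shows that moving a single row is an isomorphism over \<open>c\<close> unless it
  changes the cut of \<open>c\<close> or the type of the values \<open>v (c - a)\<close>. All but finitely many rows therefore alternate
  already in \<open>G\<close> on the single element \<open>max v (c - a)\<close>. Conversely, if for some \<open>N\<close> the group \<open>G\<close> has
  no nontrivial \<open>N\<close>-divisible convex subgroup, then \<open>v\<close> is definable from the order and \<open>N\<close>-th powers, so
  that \<open>G\<close> is interpretable in \<open>K\<close>; otherwise a back-and-forth modulo the largest divisible convex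
  subgroups shows that \<open>G\<close> is elementarily equivalent to the multiplicative group of positive elements of \<open>K\<close>.
\<close>

text \<open>When \<open>G\<close> is divisible and nontrivial, \<open>K\<close> is real closed and,
  by o-minimality, the ordered field does not define \<open>v\<close>. So \<open>G\<close> cannot
  always be interpreted through \<open>v\<close>, hence the case distinction. In the second case the
  positive elements of \<open>K\<close> are an extension of \<open>G\<close> (reversed) by the
  positive units; these units have all roots, so they are hidden inside \<open>Dv\<close>. In the
  other direction the obstacle is that \<open>v (c - a)\<close> depends on \<open>c\<close>, which
  lies outside \<open>G\<close>. If \<open>d\<close> is an entry of one row that is at least as
  close to \<open>c\<close> as all relevant entries of the other rows, then \<open>v (c - a)\<close>
  is either \<open>v (d - a)\<close> or the maximum \<gamma>. The formulas in \<open>G\<close> then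
  have \<open>v (d - a)\<close> and \<open>v a\<close> as parameters and \<gamma> as their variable.
  Only the value group carries a type condition. Residues form a real closed field, where cuts
  decide everything, and a positive element of \<open>K\<close> has an n-th root as soon as its
  value is n-divisible, so neither a residue sort nor angular components occur. Rows are Skolemised
  so that each is a relatively algebraically closed subfield; over such a field every polynomial is
  already stable and every algebraic residue present.\<close>

notation iff (infixr "<->" 25)
abbreviation "Lring \<equiv> oring_language"
abbreviation "OFld \<equiv> ofield_structure"
abbreviation "Lgrp \<equiv> ogroup_language"
abbreviation "OGrp \<equiv> ogroup_structure"

hide_const (open) up_ring.coeff up_ring.monom module.smult Polynomials.degree Polynomials.lead_coeff

section \<open>Types and saturation\<close>

instance tm :: (countable) countable by countable_datatype
instance fm :: (countable, countable) countable by countable_datatype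

lemma finite_fv_tm [simp]: "finite (fv_tm t)"
 by (induction t) auto

lemma finite_fv_fm [simp]: "finite (fv_fm p)"
 by (induction p) auto

lemma tm_val_cong:
 "(!!n. n:fv_tm t ==> e n = e' n) ==> tm_val M e t = tm_val M e' t"
proof (induction t)
 case (Fn f ts)
 have "map (tm_val M e) ts = map (tm_val M e') ts" using Fn by (intro map_cong) auto
 thus ?case by (simp del: map_eq_conv)
qed auto

lemma sat_cong:
 "(!!n. n:fv_fm p ==> e n = e' n) ==> sat M e p = sat M e' p"
proof (induction p arbitrary: e e')
 case (Eq s t)
 thus ?case using tm_val_cong[of s e e' M] tm_val_cong[of t e e' M] by auto
next
 case (Rel r ts)
 have "map (tm_val M e) ts = map (tm_val M e') ts"
  using Rel by (intro map_cong refl tm_val_cong) auto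
 thus ?case by (simp del: map_eq_conv)
next
 case (Neg p)
 have "sat M e p = sat M e' p" by (rule Neg.IH, rule Neg.prems, simp)
 thus ?case by simp
next
 case (Conj p q)
 have "sat M e p = sat M e' p" by (rule Conj.IH(1), rule Conj.prems, simp)
 moreover have "sat M e q = sat M e' q" by (rule Conj.IH(2), rule Conj.prems, simp)
 ultimately show ?case by simp
next
 case (Exi n p)
 have "sat M (e(n := a)) p = sat M (e'(n := a)) p" for a
  by (rule Exi.IH) (use Exi.prems in auto)
 thus ?case by simp
qed

lemma tm_val_univ:
 assumes "is_structure L M"
 shows "wf_tm L t ==> range e \<subseteq> univ M ==> tm_val M e t:univ M"
proof (induction t)
 case (Fn f ts)
 have "set (map (tm_val M e) ts) \<subseteq> univ M" using Fn by (auto simp: list_all_iff)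
 thus ?case using assms Fn.prems by (simp add: is_structure_def)
qed auto

primrec subst_tm :: "(nat => 'f tm) => 'f tm => 'f tm" where
 "subst_tm \<sigma> (Var n) = \<sigma> n"
| "subst_tm \<sigma> (Fn f ts) = Fn f (map (subst_tm \<sigma>) ts)"

text \<open>A quantifier always renames its variable above the variables of the terms substituted in
  its body, so \<open>sat_subst\<close> holds without any freshness assumption.\<close>

primrec subst_fm :: "('f, 'r) fm => (nat => 'f tm) => ('f, 'r) fm" where
 "subst_fm (Eq s t) \<sigma> = Eq (subst_tm \<sigma> s) (subst_tm \<sigma> t)"
| "subst_fm (Rel r ts) \<sigma> = Rel r (map (subst_tm \<sigma>) ts)"
| "subst_fm (Neg p) \<sigma> = Neg (subst_fm p \<sigma>)"
| "subst_fm (Conj p q) \<sigma> = Conj (subst_fm p \<sigma>) (subst_fm q \<sigma>)"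
| "subst_fm (Exi n p) \<sigma> =
   (let m = Suc (Max (insert 0 (\<Union>x\<in>fv_fm p. fv_tm (\<sigma> x)))) in Exi m (subst_fm p (\<sigma>(n := Var m))))"

lemma tm_val_subst [simp]: "tm_val M e (subst_tm \<sigma> t) = tm_val M (%n. tm_val M e (\<sigma> n)) t"
 by (induction t) (auto simp: comp_def intro!: arg_cong[where f = "fun_interp M _"])

lemma fresh_notin:
 assumes "x:fv_fm p"
 shows "Suc (Max (insert 0 (\<Union>x\<in>fv_fm p. fv_tm (\<sigma> x)))) ~: fv_tm (\<sigma> x)"
proof
 let ?S = "insert 0 (\<Union>x\<in>fv_fm p. fv_tm (\<sigma> x))"
 assume "Suc (Max ?S):fv_tm (\<sigma> x)"
 hence "Suc (Max ?S):?S" using assms by blast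
 hence "Suc (Max ?S) <= Max ?S" by (intro Max_ge) auto
 thus False by simp
qed

lemma sat_subst [simp]: "sat M e (subst_fm p \<sigma>) = sat M (%n. tm_val M e (\<sigma> n)) p"
proof (induction p arbitrary: e \<sigma>)
 case (Exi n p)
 define m where "m = Suc (Max (insert 0 (\<Union>x\<in>fv_fm p. fv_tm (\<sigma> x))))"
 have "sat M (%k. tm_val M (e(m := a)) ((\<sigma>(n := Var m)) k)) p
   = sat M ((%k. tm_val M e (\<sigma> k))(n := a)) p" for a
 proof (rule sat_cong)
  fix k assume k: "k:fv_fm p"
  have "m ~: fv_tm (\<sigma> k)" using fresh_notin[OF k] unfolding m_def .
  hence "tm_val M (e(m := a)) (\<sigma> k) = tm_val M e (\<sigma> k)" by (intro tm_val_cong) auto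
  thus "tm_val M (e(m := a)) ((\<sigma>(n := Var m)) k) = ((%k. tm_val M e (\<sigma> k))(n := a)) k"
   by auto
 qed
 thus ?case by (simp add: Let_def Exi.IH del: fun_upd_apply flip: m_def)
qed (auto simp: comp_def)

lemma wf_subst_tm: "wf_tm L t ==> (!!n. wf_tm L (\<sigma> n)) ==> wf_tm L (subst_tm \<sigma> t)"
 by (induction t) (auto simp: list_all_iff)

lemma wf_subst: "wf_fm L p ==> (!!n. wf_tm L (\<sigma> n)) ==> wf_fm L (subst_fm p \<sigma>)"
 by (induction p arbitrary: \<sigma>) (auto simp: list_all_iff Let_def wf_subst_tm)

lemma fv_subst_tm: "fv_tm (subst_tm \<sigma> t) = (\<Union>n\<in>fv_tm t. fv_tm (\<sigma> n))"
 by (induction t) auto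

lemma fv_subst: "fv_fm (subst_fm p \<sigma>) \<subseteq> (\<Union>n\<in>fv_fm p. fv_tm (\<sigma> n))"
proof (induction p arbitrary: \<sigma>)
 case (Exi n p)
 define m where "m = Suc (Max (insert 0 (\<Union>x\<in>fv_fm p. fv_tm (\<sigma> x))))"
 have "fv_fm (subst_fm p (\<sigma>(n := Var m))) \<subseteq> (\<Union>k\<in>fv_fm p. fv_tm ((\<sigma>(n := Var m)) k))"
  by (rule Exi.IH)
 hence "fv_fm (subst_fm p (\<sigma>(n := Var m))) - {m} \<subseteq> (\<Union>k\<in>fv_fm p - {n}. fv_tm (\<sigma> k))"
  by (fastforce split: if_splits)
 thus ?case by (simp add: Let_def flip: m_def)
qed (fastforce simp: fv_subst_tm)+

text \<open>The empty conjunction is a closed tautology, so it contributes no free variable.\<close>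

primrec conjs :: "('f, 'r) fm list => ('f, 'r) fm" where
 "conjs [] = Neg (Exi 0 (Neg (Eq (Var 0) (Var 0))))"
| "conjs (p # ps) = Conj p (conjs ps)"

lemma sat_conjs [simp]: "sat M e (conjs ps) <-> (ALL p:set ps. sat M e p)"
 by (induction ps) auto

lemma wf_conjs [simp]: "wf_fm L (conjs ps) <-> (ALL p:set ps. wf_fm L p)"
 by (induction ps) auto

lemma fv_conjs [simp]: "fv_fm (conjs ps) = (\<Union>p\<in>set ps. fv_fm p)"
 by (induction ps) auto

text \<open>A set of pairs as a partial elementary map: variables take pairs, one structure reads
  the first components and the other the second. Relations make inverses, composition and unions
  immediate. For \<open>R = {}\<close> only sentences qualify, which gives elementary
  equivalence.\<close>

definition tpeq ::
  "('f, 'r) language => ('f, 'r, 'a) struc => ('f, 'r, 'b) struc => ('a \<times> 'b) set => bool" where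
 "tpeq L M N R <->
   (ALL p \<rho>. wf_fm L p & \<rho> ` fv_fm p \<subseteq> R --> sat M (fst \<circ> \<rho>) p = sat N (snd \<circ> \<rho>) p)"

lemma tpeqD: "tpeq L M N R ==> wf_fm L p ==> (!!n. n:fv_fm p ==> (e n, e' n):R) ==>
  sat M e p = sat N e' p"
 unfolding tpeq_def comp_def by (drule spec[of _ p], drule spec[of _ "%n. (e n, e' n)"]) auto

lemma tpeqI: "(!!p e e'. wf_fm L p ==> (!!n. n:fv_fm p ==> (e n, e' n):R) ==>
  sat M e p ==> sat N e' p) ==> tpeq L M N R"
 unfolding tpeq_def
proof (intro allI impI, elim conjE)
 fix p \<rho>
 assume *: "!!p e e'. wf_fm L p ==> (!!n. n:fv_fm p ==> (e n, e' n):R) ==>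
  sat M e p ==> sat N e' p" and p: "wf_fm L p" "\<rho> ` fv_fm p \<subseteq> R"
 thus "sat M (fst \<circ> \<rho>) p = sat N (snd \<circ> \<rho>) p"
  using *[of p "fst \<circ> \<rho>" "snd \<circ> \<rho>"] *[of "Neg p" "fst \<circ> \<rho>" "snd \<circ> \<rho>"] by (auto simp: image_subset_iff)
qed

lemma tpeq_mono: "tpeq L M N R ==> R' \<subseteq> R ==> tpeq L M N R'"
 unfolding tpeq_def by blast

lemma tpeq_converse: "tpeq L M N R ==> tpeq L N M (R\<inverse>)"
 by (rule tpeqI) (auto dest!: tpeqD[of L M N R])

lemma tpeq_comp:
 assumes "tpeq L M N R" "tpeq L N K S"
 shows "tpeq L M K (R O S)"
proof (rule tpeqI)
 fix p e e'
 assume p: "wf_fm L p" "!!n. n:fv_fm p ==> (e n, e' n):R O S" "sat M e p"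
 have "EX x. n:fv_fm p --> (e n, x):R & (x, e' n):S" for n using p(2)[of n] by blast
 then obtain f where "!!n. n:fv_fm p ==> (e n, f n):R & (f n, e' n):S" by metis
 thus "sat K e' p" using tpeqD[OF assms(1) p(1), of e f] tpeqD[OF assms(2) p(1), of f e'] p(3) by blast
qed

lemma tpeq_comp_empty: "tpeq L M N {} ==> tpeq L N K {} ==> tpeq L M K {}"
 using tpeq_comp by fastforce

text \<open>Each free variable of a formula brings its own term with its own assignment. The pairing
  function gives every term a private copy of its variables, so that the single assignment
  \<open>\<tau>\<close> serves all of them.\<close>

lemma tpeq_terms:
 assumes "tpeq L M N R"
 shows "tpeq L M N {(tm_val M (fst \<circ> \<rho>) t, tm_val N (snd \<circ> \<rho>) t) | \<rho> t. wf_tm L t & range \<rho> \<subseteq> R}"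
  (is "tpeq L M N ?T")
proof (rule tpeqI)
 fix p e e'
 assume p: "wf_fm L p" "!!n. n:fv_fm p ==> (e n, e' n):?T" "sat M e p"
 have "EX \<rho> t. n:fv_fm p --> e n = tm_val M (fst \<circ> \<rho>) t & e' n = tm_val N (snd \<circ> \<rho>) t & wf_tm L t & range \<rho> \<subseteq> R" for n
  using p(2)[of n] by auto
 then obtain \<rho> t where *: "!!n. n:fv_fm p ==> e n = tm_val M (fst \<circ> \<rho> n) (t n) & e' n = tm_val N (snd \<circ> \<rho> n) (t n)
   & wf_tm L (t n) & range (\<rho> n) \<subseteq> R" by metis
 define \<tau> where "\<tau> x = (case prod_decode x of (k, n) => \<rho> k n)" for x
 define \<sigma> where "\<sigma> n = (if n:fv_fm p then subst_tm (%m. Var (prod_encode (n, m))) (t n) else Var 0)" for n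
 have wf: "wf_fm L (subst_fm p \<sigma>)" using p * by (intro wf_subst) (auto simp: \<sigma>_def intro!: wf_subst_tm)
 have "sat M (fst \<circ> \<tau>) (subst_fm p \<sigma>)"
  unfolding sat_subst using p(3)
  by (rule iffD2[OF sat_cong, rotated]) (auto simp: \<sigma>_def * \<tau>_def comp_def)
 moreover have "(fst (\<tau> n), snd (\<tau> n)):R" if n: "n:fv_fm (subst_fm p \<sigma>)" for n
 proof -
  obtain k where k: "k:fv_fm p" "n:fv_tm (\<sigma> k)" using n fv_subst[of p \<sigma>] by blast
  then obtain m where "n = prod_encode (k, m)" by (auto simp: \<sigma>_def fv_subst_tm)
  thus ?thesis using *[OF k(1)] by (auto simp: \<tau>_def)
 qed
 ultimately have "sat N (snd \<circ> \<tau>) (subst_fm p \<sigma>)" using tpeqD[OF assms wf, of "fst \<circ> \<tau>" "snd \<circ> \<tau>"] by simp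
 thus "sat N e' p"
  unfolding sat_subst
  by (rule iffD1[OF sat_cong, rotated]) (auto simp: \<sigma>_def * \<tau>_def comp_def)
qed

text \<open>Finitely many formulas with parameters are merged into one by renaming variables apart.\<close>

lemma tpeq_realizes:
 fixes L :: "('f, 'r) language" and M :: "('f, 'r, 'a) struc" and N :: "('f, 'r, 'b) struc"
 assumes tp: "tpeq L M N R" and "finite \<Delta>"
  and wf: "!!p \<rho>. (p, \<rho>):\<Delta> ==> wf_fm L p & \<rho> ` (fv_fm p - {0}) \<subseteq> R"
  and a: "a:univ M" "!!p \<rho>. (p, \<rho>):\<Delta> ==> sat M ((fst \<circ> \<rho>)(0 := a)) p"
 shows "EX b:univ N. ALL (p, \<rho>):\<Delta>. sat N ((snd \<circ> \<rho>)(0 := b)) p"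
proof -
 obtain xs where xs: "set xs = \<Delta>" using \<open>finite \<Delta>\<close> finite_list by blast
 \<comment> \<open>Variable 0, the one to be realised, is shared by all formulas; \<open>Suc\<close>
   keeps the private copies of the other variables away from it.\<close>
 define \<sigma> :: "nat => nat => 'f tm" where "\<sigma> k n = Var (if n = 0 then 0 else Suc (prod_encode (k, n)))" for k n
 define P where "P = conjs (map (%k. subst_fm (fst (xs ! k)) (\<sigma> k)) [0..<length xs])"
 define \<rho> where "\<rho> x = (case prod_decode (x - 1) of (k, n) => snd (xs ! k) n)" for x
 have mem: "(fst (xs ! k), snd (xs ! k)):\<Delta>" if "k < length xs" for k using that xs by auto
 have P: "sat K (h(0 := c)) P <-> (ALL k<length xs. sat K ((%n. h (Suc (prod_encode (k, n))))(0 := c)) (fst (xs ! k)))"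
  for K :: "('f, 'r, 'a) struc" and h c
 proof -
  have "(%n. tm_val K (h(0 := c)) (\<sigma> k n)) = (%n. h (Suc (prod_encode (k, n))))(0 := c)" for k
   by (auto simp: \<sigma>_def)
  thus ?thesis by (auto simp: P_def)
 qed
 have P': "sat K (h(0 := c)) P <-> (ALL k<length xs. sat K ((%n. h (Suc (prod_encode (k, n))))(0 := c)) (fst (xs ! k)))"
  for K :: "('f, 'r, 'b) struc" and h c
 proof -
  have "(%n. tm_val K (h(0 := c)) (\<sigma> k n)) = (%n. h (Suc (prod_encode (k, n))))(0 := c)" for k
   by (auto simp: \<sigma>_def)
  thus ?thesis by (auto simp: P_def)
 qed
 have "sat M ((fst \<circ> \<rho>)(0 := a)) P"
  unfolding P P' using a(2)[OF mem] by (simp add: \<rho>_def comp_def)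
 hence "sat M (fst \<circ> \<rho>) (Exi 0 P)" using a(1) by auto
 moreover have "wf_fm L (fst (xs ! k))" if "k < length xs" for k using wf[OF mem[OF that]] by blast
 hence "wf_fm L (Exi 0 P)" by (auto simp: P_def \<sigma>_def intro!: wf_subst)
 moreover have "\<rho> n:R" if n: "n:fv_fm (Exi 0 P)" for n
 proof -
  obtain k where k: "k < length xs" "n:fv_fm (subst_fm (fst (xs ! k)) (\<sigma> k))" and "n ~= 0"
   using n by (auto simp: P_def)
  then obtain m where m: "m:fv_fm (fst (xs ! k))" "n:fv_tm (\<sigma> k m)" using fv_subst by blast
  hence "m ~= 0" "n = Suc (prod_encode (k, m))" using \<open>n ~= 0\<close> by (auto simp: \<sigma>_def split: if_splits)
  thus ?thesis using wf[OF mem[OF k(1)]] m by (auto simp: \<rho>_def)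
 qed
 ultimately have "sat N (snd \<circ> \<rho>) (Exi 0 P)" using tpeqD[OF tp, of "Exi 0 P" "fst \<circ> \<rho>" "snd \<circ> \<rho>"] by simp
 then obtain b where b: "b:univ N" "sat N ((snd \<circ> \<rho>)(0 := b)) P" by auto
 have "sat N ((snd \<circ> \<rho>')(0 := b)) p" if in_D: "(p, \<rho>'):\<Delta>" for p \<rho>'
 proof -
  obtain k where k: "k < length xs" "xs ! k = (p, \<rho>')"
   using in_D unfolding xs[symmetric] in_set_conv_nth by blast
  thus ?thesis using b(2) unfolding P P' by (auto simp: \<rho>_def comp_def dest!: spec[of _ k])
 qed
 thus ?thesis using b(1) by auto
qed

lemma saturated_realize:
 assumes sat: "aleph1_saturated L N" and ne: "univ N ~= {}" and A: "countable A" "A \<subseteq> univ N"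
  and wf: "!!p b. (p, b):\<Gamma> ==> wf_fm L p & b ` (fv_fm p - {0}) \<subseteq> A"
  and fin: "!!\<Delta>. finite \<Delta> ==> \<Delta> \<subseteq> \<Gamma> ==> EX a:univ N. ALL (p, b):\<Delta>. sat N (b(0 := a)) p"
 shows "EX a:univ N. ALL (p, b):\<Gamma>. sat N (b(0 := a)) p"
proof -
 obtain u where u: "u:univ N" using ne by blast
 \<comment> \<open>Values at variables that do not occur are reset to \<open>u\<close>, because
   \<open>aleph1_saturated\<close> constrains the whole range of an assignment.\<close>
 define g where "g = (%(p :: ('a, 'b) fm, b). (p, %n. if n:fv_fm p - {0} then b n else u))"
 have g: "sat N ((snd (g (p, b)))(0 := a)) p = sat N (b(0 := a)) p" for p b a
  by (rule sat_cong) (auto simp: g_def)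
 have "EX a:univ N. realizes N a (g ` \<Gamma>)"
 proof (rule sat[unfolded aleph1_saturated_def, rule_format], intro conjI)
  show "countable (insert u A)" "insert u A \<subseteq> univ N" using A u by auto
  show "ALL (p, b):g ` \<Gamma>. wf_fm L p & range b \<subseteq> insert u A"
   using wf by (fastforce simp: g_def)
  show "consistent_in N (g ` \<Gamma>)"
   unfolding consistent_in_def
  proof (intro allI impI)
   fix \<Delta> assume "\<Delta> \<subseteq> g ` \<Gamma>" "finite \<Delta>"
   then obtain \<Delta>' where D: "\<Delta>' \<subseteq> \<Gamma>" "finite \<Delta>'" "\<Delta> = g ` \<Delta>'" by (meson finite_subset_image)
   obtain a where "a:univ N" "ALL (p, b):\<Delta>'. sat N (b(0 := a)) p" using fin[OF D(2,1)] by blast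
   hence "realizes N a \<Delta>" unfolding realizes_def D(3) using g by (fastforce simp: g_def)
   thus "EX a:univ N. realizes N a \<Delta>" using \<open>a:univ N\<close> by blast
  qed
 qed
 then obtain a where "a:univ N" "realizes N a (g ` \<Gamma>)" by blast
 hence "ALL (p, b):\<Gamma>. sat N (b(0 := a)) p" unfolding realizes_def using g by (fastforce simp: g_def)
 thus ?thesis using \<open>a:univ N\<close> by blast
qed

text \<open>The type of \<open>a\<close> over the domain, read over the range, is finitely
  satisfiable by \<open>tpeq_realizes\<close>, and saturation of \<open>N\<close> realises
  it.\<close>

lemma tpeq_extend:
 assumes tp: "tpeq L M N R" and R: "countable R" "R \<subseteq> univ M \<times> univ N"
  and sat: "aleph1_saturated L N" and ne: "univ N ~= {}" and a: "a:univ M"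
 shows "EX b:univ N. tpeq L M N (insert (a, b) R)"
proof -
 define \<Gamma> where "\<Gamma> = {(p, snd \<circ> \<rho>) | p \<rho>. wf_fm L p & \<rho> ` (fv_fm p - {0}) \<subseteq> R & sat M ((fst \<circ> \<rho>)(0 := a)) p}"
 have "EX b:univ N. ALL (p, e):\<Gamma>. sat N (e(0 := b)) p"
 proof (rule saturated_realize[OF sat ne, of "snd ` R"])
  show "countable (snd ` R)" "snd ` R \<subseteq> univ N" using R by auto
  show "wf_fm L p & b ` (fv_fm p - {0}) \<subseteq> snd ` R" if "(p, b):\<Gamma>" for p b
   using that by (auto simp: \<Gamma>_def)
  show "EX b:univ N. ALL (p, e):\<Delta>. sat N (e(0 := b)) p" if D: "finite \<Delta>" "\<Delta> \<subseteq> \<Gamma>" for \<Delta>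
  proof -
   have "\<Delta> \<subseteq> (%(p, \<rho>). (p, snd \<circ> \<rho>)) ` {(p, \<rho>). wf_fm L p & \<rho> ` (fv_fm p - {0}) \<subseteq> R & sat M ((fst \<circ> \<rho>)(0 := a)) p}"
    using D(2) by (fastforce simp: \<Gamma>_def)
   then obtain \<Delta>' where D': "\<Delta>' \<subseteq> {(p, \<rho>). wf_fm L p & \<rho> ` (fv_fm p - {0}) \<subseteq> R & sat M ((fst \<circ> \<rho>)(0 := a)) p}"
    "finite \<Delta>'" "\<Delta> = (%(p, \<rho>). (p, snd \<circ> \<rho>)) ` \<Delta>'"
    using D(1) finite_subset_image by meson
   have "EX b:univ N. ALL (p, \<rho>):\<Delta>'. sat N ((snd \<circ> \<rho>)(0 := b)) p"
    by (rule tpeq_realizes[OF tp D'(2) _ a]) (use D'(1) in auto)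
   thus ?thesis unfolding D'(3) by fastforce
  qed
 qed
 then obtain b where b: "b:univ N" "!!p e. (p, e):\<Gamma> ==> sat N (e(0 := b)) p" by blast
 have "tpeq L M N (insert (a, b) R)"
 proof (rule tpeqI)
  fix p e e'
  assume p: "wf_fm L p" "!!n. n:fv_fm p ==> (e n, e' n):insert (a, b) R" "sat M e p"
  \<comment> \<open>Variables that carry the new pair become variable 0 and all others move up by
    one; this puts \<open>p\<close> into the shape of the members of
    \<open>\<Gamma>\<close>.\<close>
  define \<sigma> :: "nat => 'a tm" where "\<sigma> n = Var (if (e n, e' n) = (a, b) then 0 else Suc n)" for n
  define \<rho> where "\<rho> n = (e (n - 1), e' (n - 1))" for n
  have "sat M ((fst \<circ> \<rho>)(0 := a)) (subst_fm p \<sigma>)"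
   unfolding sat_subst by (rule iffD2[OF sat_cong p(3)]) (auto simp: \<sigma>_def \<rho>_def)
  moreover have "wf_fm L (subst_fm p \<sigma>)" using p(1) by (intro wf_subst) (auto simp: \<sigma>_def)
  moreover have "\<rho> ` (fv_fm (subst_fm p \<sigma>) - {0}) \<subseteq> R"
  proof
   fix x assume "x:\<rho> ` (fv_fm (subst_fm p \<sigma>) - {0})"
   then obtain n where n: "x = \<rho> n" "n ~= 0" "n:fv_fm (subst_fm p \<sigma>)" by auto
   then obtain k where k: "k:fv_fm p" "n:fv_tm (\<sigma> k)" using fv_subst[of p \<sigma>] by blast
   hence "n = Suc k" "(e k, e' k) ~= (a, b)" using n(2) by (auto simp: \<sigma>_def split: if_splits)
   thus "x:R" using p(2)[OF k(1)] n(1) by (auto simp: \<rho>_def)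
  qed
  ultimately have "(subst_fm p \<sigma>, snd \<circ> \<rho>):\<Gamma>" unfolding \<Gamma>_def by blast
  hence "sat N ((snd \<circ> \<rho>)(0 := b)) (subst_fm p \<sigma>)" by (rule b(2))
  thus "sat N e' p"
   unfolding sat_subst by (rule iffD1[OF sat_cong, rotated]) (auto simp: \<sigma>_def \<rho>_def)
 qed
 thus ?thesis using b(1) by blast
qed

lemma tpeq_Union:
 assumes "!!k. tpeq L M N (R k)" "!!k. R k \<subseteq> R (Suc k)"
 shows "tpeq L M N (\<Union>k::nat. R k)"
proof (rule tpeqI)
 fix p e e'
 assume p: "wf_fm L p" "!!n. n:fv_fm p ==> (e n, e' n):(\<Union>k. R k)" "sat M e p"
 hence "ALL n:fv_fm p. EX k. (e n, e' n):R k" by blast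
 then obtain k where k: "!!n. n:fv_fm p ==> (e n, e' n):R (k n)" unfolding bchoice_iff by blast
 define m where "m = Max (insert 0 (k ` fv_fm p))"
 have "(e n, e' n):R m" if "n:fv_fm p" for n
 proof -
  have "k n <= m" using that by (simp add: m_def)
  from lift_Suc_mono_le[of R, OF assms(2) this] show ?thesis using k[OF that] by blast
 qed
 thus "sat N e' p" using tpeqD[OF assms(1)[of m] p(1), of e e'] p(3) by simp
qed

lemma tpeq_extend_countable:
 assumes tp: "tpeq L M N R" and R: "countable R" "R \<subseteq> univ M \<times> univ N"
  and sat: "aleph1_saturated L N" and ne: "univ N ~= {}" and S: "countable S" "S \<subseteq> univ M"
 shows "EX R'. R \<subseteq> R' & countable R' & R' \<subseteq> univ M \<times> univ N & tpeq L M N R' & S \<subseteq> fst ` R'"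
proof (cases "S = {}")
 case True
 thus ?thesis using assms by blast
next
 case False
 let ?Q = "%W. countable W & W \<subseteq> univ M \<times> univ N & tpeq L M N W & R \<subseteq> W"
 have "EX F. ALL k. ?Q (F k) & (F k \<subseteq> F (Suc k) & from_nat_into S k:fst ` F (Suc k))"
 proof (rule dependent_nat_choice)
  show "EX W. ?Q W" using assms by blast
  fix W k assume W: "?Q W"
  have "from_nat_into S k:univ M" using from_nat_into[OF False] S by blast
  from tpeq_extend[OF _ _ _ sat ne this, of W] W obtain b
   where "b:univ N" "tpeq L M N (insert (from_nat_into S k, b) W)" by blast
  thus "EX Y. ?Q Y & (W \<subseteq> Y & from_nat_into S k:fst ` Y)"
   using W S \<open>from_nat_into S k:univ M\<close> by (intro exI[of _ "insert (from_nat_into S k, b) W"]) auto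
 qed
 then obtain F where F0: "ALL k. ?Q (F k) & (F k \<subseteq> F (Suc k) & from_nat_into S k:fst ` F (Suc k))"
  by (rule exE)
 hence F: "!!k. ?Q (F k)" "!!k. F k \<subseteq> F (Suc k)" "!!k. from_nat_into S k:fst ` F (Suc k)" by simp_all
 show ?thesis
 proof (intro exI[of _ "\<Union>k. F k"] conjI)
  show "tpeq L M N (\<Union>k. F k)" by (rule tpeq_Union) (use F in auto)
  show "S \<subseteq> fst ` (\<Union>k. F k)"
  proof
   fix s assume "s:S"
   then obtain k where "s = from_nat_into S k" using from_nat_into_surj[OF S(1)] by metis
   thus "s:fst ` (\<Union>k. F k)" using F(3)[of k] by blast
  qed
 qed (use F in auto)
qed

lemma is_model_complete_theory:
 fixes M :: "('f, 'r, 'a) struc" and N :: "('f, 'r, 'b) struc"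
 assumes "is_structure L M" "is_structure L N"
 shows "is_model L (complete_theory L M) N <-> tpeq L M N {}"
proof
 obtain u w where u: "u:univ M" "w:univ N" using assms by (auto simp: is_structure_def)
 assume m: "is_model L (complete_theory L M) N"
 show "tpeq L M N {}"
 proof (rule tpeqI)
  fix p and e :: "nat => 'a" and e' :: "nat => 'b"
  assume p: "wf_fm L p" "!!n. n:fv_fm p ==> (e n, e' n):{}" "sat M e p"
  hence fv: "fv_fm p = {}" by blast
  have "sat M e2 p" for e2 using p(3) fv sat_cong[of p e2 e M] by simp
  hence "p:complete_theory L M" using p(1) fv by (simp add: complete_theory_def)
  hence "sat N (%_. w) p" using m u(2) by (simp add: is_model_def image_subset_iff)
  thus "sat N e' p" using fv sat_cong[of p "%_. w" e' N] by simp
 qed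
next
 obtain u where u: "u:univ M" using assms by (auto simp: is_structure_def)
 assume t: "tpeq L M N {}"
 have "sat N e p" if "p:complete_theory L M" for p e
 proof -
  have "wf_fm L p" "fv_fm p = {}" "range (%_::nat. u) \<subseteq> univ M ==> sat M (%_. u) p"
   using that by (simp_all add: complete_theory_def)
  hence "sat M (%_. u) p" "wf_fm L p" "fv_fm p = {}" using u by auto
  thus ?thesis using tpeqD[OF t, of p "%_. u" e] by simp
 qed
 thus "is_model L (complete_theory L M) N" using assms by (simp add: is_model_def)
qed

abbreviation pattern :: "(nat => ('f, 'r) fm) => (nat => nat => nat => 'a) => (nat => nat) =>
  (('f, 'r) fm \<times> (nat => 'a)) set" where
 "pattern \<phi> b \<eta> \<equiv> {(\<phi> i, b i (\<eta> i)) | i. True} \<union> {(Neg (\<phi> i), b i j) | i j. j ~= \<eta> i}"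

text \<open>A violation uses only countably many parameters. Saturation of \<open>N'\<close> carries
  all of them over by one partial elementary map, under which finite parts of the patterns stay
  satisfiable.\<close>

lemma strong_NIP_violation_transfer:
 assumes tp: "tpeq L N N' {}" and N': "is_structure L N'" "aleph1_saturated L N'"
  and viol: "strong_NIP_violation L N \<phi> b"
 shows "EX b'. strong_NIP_violation L N' \<phi> b'"
proof -
 define S where "S = (\<Union>i j. range (b i j))"
 have S: "countable S" "S \<subseteq> univ N" using viol unfolding S_def strong_NIP_violation_def by (simp, blast)
 have ne: "univ N' ~= {}" using N' by (simp add: is_structure_def)
 obtain R where R: "R \<subseteq> univ N \<times> univ N'" "tpeq L N N' R" "S \<subseteq> fst ` R"
  using tpeq_extend_countable[OF tp _ _ N'(2) ne S] by auto
 hence "EX y. x:S --> (x, y):R" for x by force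
 then obtain g where g: "!!x. x:S ==> (x, g x):R" by metis
 have gb: "(b i j n, g (b i j n)):R" for i j n by (rule g) (auto simp: S_def)
 have wf: "wf_fm L (\<phi> i)" for i using viol by (simp add: strong_NIP_violation_def)
 have "strong_NIP_violation L N' \<phi> (%i j. g \<circ> b i j)"
  unfolding strong_NIP_violation_def
 proof (intro conjI allI)
  show "wf_fm L (\<phi> i)" for i by (rule wf)
  show "range (g \<circ> b i j) \<subseteq> univ N'" for i j using gb R(1) by auto
  fix \<eta> :: "nat => nat"
  define P where "P = pattern \<phi> b \<eta>"
  define Q where "Q = pattern \<phi> (%i j. g \<circ> b i j) \<eta>"
  define h where "h = (%(p :: ('a, 'b) fm, e :: nat => 'c). (p, g \<circ> e))"
  have Q: "Q \<subseteq> h ` P"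
  proof
   fix x assume "x:Q"
   then consider (pos) i where "x = (\<phi> i, g \<circ> b i (\<eta> i))"
    | (neg) i j where "x = (Neg (\<phi> i), g \<circ> b i j)" "j ~= \<eta> i" unfolding Q_def by blast
   thus "x:h ` P"
   proof cases
    case (pos i)
    thus ?thesis by (intro image_eqI[of _ _ "(\<phi> i, b i (\<eta> i))"]) (auto simp: P_def h_def)
   next
    case (neg i j)
    thus ?thesis by (intro image_eqI[of _ _ "(Neg (\<phi> i), b i j)"]) (auto simp: P_def h_def)
   qed
  qed
  have PR: "wf_fm L p & range (%n. (e n, g (e n))) \<subseteq> R" if "(p, e):P" for p e
   using that wf gb by (auto simp: P_def)
  show "consistent_in N' (pattern \<phi> (%i j. g \<circ> b i j) \<eta>)"
   unfolding Q_def[symmetric] consistent_in_def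
  proof (intro allI impI)
   fix \<Delta> assume "\<Delta> \<subseteq> Q" "finite \<Delta>"
   then obtain \<Delta>' where D: "\<Delta>' \<subseteq> P" "finite \<Delta>'" "\<Delta> = h ` \<Delta>'"
    using Q by (meson finite_subset_image order_trans)
   have "consistent_in N P" using viol by (simp add: strong_NIP_violation_def P_def)
   then obtain a where a: "a:univ N" "realizes N a \<Delta>'" using D by (auto simp: consistent_in_def)
   let ?D = "(%(p, e). (p, %n. (e n, g (e n)))) ` \<Delta>'"
   have "EX b:univ N'. ALL (p, \<rho>):?D. sat N' ((snd \<circ> \<rho>)(0 := b)) p"
    by (rule tpeq_realizes[OF R(2) _ _ a(1)])
     (use D a(2) PR in \<open>fastforce simp: realizes_def comp_def\<close>)+
   thus "EX a:univ N'. realizes N' a \<Delta>"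
    unfolding realizes_def D(3) by (fastforce simp: comp_def h_def)
  qed
 qed
 thus ?thesis by blast
qed

section \<open>Skolem sequences and ultrapowers\<close>

text \<open>Variable \<open>Suc n\<close> of a formula refers to the \<open>n\<close>-th member of the sequence; the position of a
  witness depends on the formula only, not on the structure.\<close>

definition wit :: "('f::countable, 'r::countable) fm => nat" where
 "wit p = 2 * prod_encode (to_nat p, Max (insert 0 (fv_fm p))) + 1"

definition skolem_seq ::
  "('f::countable, 'r::countable) language => ('f, 'r, 'a) struc => (nat => 'a) => bool" where
 "skolem_seq L M B <-> range B \<subseteq> univ M &
   (ALL p. wf_fm L p --> sat M (%n. B (n - 1)) (Exi 0 p) --> sat M ((%n. B (n - 1))(0 := B (wit p))) p)"

text \<open>Even positions copy \<open>b\<close>, and position \<open>wit p\<close> receives a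
  witness of \<open>p\<close>. Cutting the assignment off at \<open>m\<close> makes the recursion
  terminate and loses nothing, since \<open>wit p\<close> exceeds every variable of
  \<open>p\<close>.\<close>

function skolem_ext :: "('f::countable, 'r::countable, 'a) struc => (nat => 'a) => nat => 'a" where
 "skolem_ext M b m = (if even m then b (m div 2) else
   (let p = from_nat (fst (prod_decode (m div 2)));
     e = (%n. if n - 1 < m then skolem_ext M b (n - 1) else b 0)
   in if EX a:univ M. sat M (e(0 := a)) p then SOME a. a:univ M & sat M (e(0 := a)) p else b 0))"
 by pat_completeness auto
termination by (relation "measure (%(M, b, m). m)") auto

declare skolem_ext.simps [simp del]

lemma skolem_ext_even: "skolem_ext M b (2 * n) = b n"
 by (simp add: skolem_ext.simps)

lemma skolem_ext_univ:
 assumes "range b \<subseteq> univ M"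
 shows "skolem_ext M b m:univ M"
proof -
 have "b n:univ M" for n using assms by auto
 moreover have "(SOME a. a:univ M & sat M (e(0 := a)) p):univ M"
  if "EX a:univ M. sat M (e(0 := a)) p" for e p
  using someI_ex[of "%a. a:univ M & sat M (e(0 := a)) p"] that by blast
 ultimately show ?thesis by (subst skolem_ext.simps) (simp add: Let_def)
qed

lemma skolem_seq_ext:
 assumes "range b \<subseteq> univ M"
 shows "skolem_seq L M (skolem_ext M b)"
 unfolding skolem_seq_def
proof (intro conjI allI impI)
 let ?B = "skolem_ext M b"
 show "range ?B \<subseteq> univ M" using skolem_ext_univ[OF assms] by blast
 fix p assume p: "wf_fm L p" "sat M (%n. ?B (n - 1)) (Exi 0 p)"
 define m where "m = wit p"
 define e where "e = (%n. if n - 1 < m then ?B (n - 1) else b 0)"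
 have m: "odd m" "from_nat (fst (prod_decode (m div 2))) = p" by (simp_all add: m_def wit_def)
 have less: "n - 1 < m" if "n:fv_fm p" for n
 proof -
  have "n <= Max (insert 0 (fv_fm p))" using that by simp
  also have "\<dots> <= prod_encode (to_nat p, Max (insert 0 (fv_fm p)))" by (rule le_prod_encode_2)
  finally show ?thesis by (simp add: m_def wit_def)
 qed
 have e: "sat M (e(0 := a)) p = sat M ((%n. ?B (n - 1))(0 := a)) p" for a
  by (rule sat_cong) (use less in \<open>auto simp: e_def\<close>)
 have ex: "EX a:univ M. sat M (e(0 := a)) p" using p(2) e by simp
 have "?B m = (SOME a. a:univ M & sat M (e(0 := a)) p)"
  using ex m by (subst skolem_ext.simps) (simp add: Let_def e_def)
 hence "sat M (e(0 := ?B m)) p"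
  using someI_ex[of "%a. a:univ M & sat M (e(0 := a)) p"] ex by auto
 thus "sat M ((%n. ?B (n - 1))(0 := ?B (wit p))) p" unfolding e m_def .
qed

lemma skolem_seqD:
 assumes "skolem_seq L M B" "wf_fm L p" "a:univ M" "sat M ((%n. B (\<rho> n))(0 := a)) p"
 shows "EX m. sat M ((%n. B (\<rho> n))(0 := B m)) p"
proof -
 define \<sigma> :: "nat => 'a tm" where "\<sigma> n = Var (if n = 0 then 0 else Suc (\<rho> n))" for n
 have *: "sat M ((%n. B (n - 1))(0 := c)) (subst_fm p \<sigma>) = sat M ((%n. B (\<rho> n))(0 := c)) p" for c
  unfolding sat_subst by (rule sat_cong) (auto simp: \<sigma>_def)
 have "wf_fm L (subst_fm p \<sigma>)" using assms(2) by (intro wf_subst) (auto simp: \<sigma>_def)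
 thus ?thesis using assms(1,3,4) unfolding skolem_seq_def by (metis * sat.simps(5))
qed

lemma skolem_closed_tm:
 assumes "skolem_seq L M B" "is_structure L M" "wf_tm L t" "range e \<subseteq> range B"
 shows "tm_val M e t:range B"
proof -
 have "EX k. e n = B k" for n using assms(4) by blast
 then obtain \<rho> where \<rho>: "!!n. e n = B (\<rho> n)" by metis
 let ?p = "Eq (Var 0) (subst_tm (%n. Var (Suc n)) t) :: ('a, 'b) fm"
 have v: "tm_val M ((%n. B (\<rho> (n - 1)))(0 := c)) (subst_tm (%n. Var (Suc n)) t) = tm_val M e t" for c
  unfolding tm_val_subst by (rule tm_val_cong) (simp add: \<rho>)
 have "range e \<subseteq> univ M" using assms(1,4) by (auto simp: skolem_seq_def)
 hence "tm_val M e t:univ M" using tm_val_univ assms by blast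
 moreover have "sat M ((%n. B (\<rho> (n - 1)))(0 := tm_val M e t)) ?p" using v by simp
 moreover have "wf_fm L ?p" using assms(3) by (auto intro: wf_subst_tm)
 ultimately obtain m where "sat M ((%n. B (\<rho> (n - 1)))(0 := B m)) ?p"
  using skolem_seqD[OF assms(1), of ?p _ "%n. \<rho> (n - 1)"] by blast
 hence "B m = tm_val M e t" using v by simp
 thus ?thesis by (metis rangeI)
qed

text \<open>The Tarski-Vaught test: witnesses for formulas with parameters in \<open>range B\<close>
  are found in \<open>range B\<close>, which is therefore an elementary substructure.\<close>

lemma sat_skolem_hull:
 assumes "skolem_seq L M B"
 shows "wf_fm L p ==> range e \<subseteq> range B ==> sat (M\<lparr>univ := range B\<rparr>) e p = sat M e p"
proof (induction p arbitrary: e)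
 case (Eq s t)
 have "tm_val (M\<lparr>univ := range B\<rparr>) e t = tm_val M e t" for t
  by (induction t) (auto intro!: arg_cong[where f = "fun_interp M _"])
 thus ?case by simp
next
 case (Rel r ts)
 have "tm_val (M\<lparr>univ := range B\<rparr>) e t = tm_val M e t" for t
  by (induction t) (auto intro!: arg_cong[where f = "fun_interp M _"])
 hence "map (tm_val (M\<lparr>univ := range B\<rparr>) e) ts = map (tm_val M e) ts" by simp
 thus ?case by (simp del: map_eq_conv)
next
 case (Exi k p)
 have "sat (M\<lparr>univ := range B\<rparr>) (e(k := a)) p = sat M (e(k := a)) p" if "a:range B" for a
  using Exi that by (intro Exi.IH) auto
 moreover have "EX a:range B. sat M (e(k := a)) p" if sat_a: "a:univ M" "sat M (e(k := a)) p" for a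
 proof -
  have "EX k. e n = B k" for n using Exi.prems(2) by blast
  then obtain \<rho> where \<rho>: "!!n. e n = B (\<rho> n)" by metis
  define \<sigma> :: "nat => 'a tm" where "\<sigma> n = Var (if n = k then 0 else Suc n)" for n
  have *: "sat M ((%n. B (\<rho> (n - 1)))(0 := c)) (subst_fm p \<sigma>) = sat M (e(k := c)) p" for c
   unfolding sat_subst by (rule sat_cong) (auto simp: \<sigma>_def \<rho>)
  have "wf_fm L (subst_fm p \<sigma>)" using Exi.prems by (intro wf_subst) (auto simp: \<sigma>_def)
  thus ?thesis
   using skolem_seqD[OF assms, of "subst_fm p \<sigma>" a "%n. \<rho> (n - 1)"] sat_a unfolding * by blast
 qed
 moreover have "range B \<subseteq> univ M" using assms by (simp add: skolem_seq_def)
 ultimately have "(EX a:range B. sat (M\<lparr>univ := range B\<rparr>) (e(k := a)) p) = (EX a:univ M. sat M (e(k := a)) p)"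
  by (meson subset_iff)
 thus ?case by simp
qed auto

text \<open>Smaller filters contain more sets, so an ultrafilter is a minimal filter other than
  \<open>bot\<close>; lying below \<open>sequentially\<close> means containing all cofinite
  sets.\<close>

definition free_ultra :: "nat filter => bool" where
 "free_ultra U <-> U <= sequentially & U ~= bot & (ALL F<=U. F ~= bot --> F = U)"

lemma free_ultra_exists: "EX U. free_ultra U"
proof -
 let ?P = "%x y :: nat filter. y <= x"
 let ?A = "{F :: nat filter. F <= sequentially & F ~= bot}"
 have "EX m:?A. ALL z:?A. ?P m z --> z = m"
 proof (rule predicate_Zorn)
  show "partial_order_on ?A (relation_of ?P ?A)"
   by (rule partial_order_on_relation_ofI) auto
  fix C assume C: "C:Chains (relation_of ?P ?A)"
  hence CA: "C \<subseteq> ?A" by (rule Chains_relation_of)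
  have lin: "x <= y | y <= x" if "x:C" "y:C" for x y
   using C that by (auto simp: Chains_def relation_of_def)
  show "EX u:?A. ALL a:C. ?P a u"
  proof (cases "C = {}")
   case True
   thus ?thesis by (intro bexI[of _ sequentially]) auto
  next
   case False
   have ev: "eventually P (Inf C) <-> (EX b:C. eventually P b)" for P
   proof (rule eventually_Inf_base)
    show "EX x:C. x <= inf F G" if "F:C" "G:C" for F G
     using lin[OF that] that by (auto intro: bexI[of _ F] bexI[of _ G])
   qed (use False in auto)
   have "Inf C ~= bot" using ev[of "%_. False"] CA by (auto simp: trivial_limit_def)
   moreover obtain c where c: "c:C" using False by blast
   have "Inf C <= sequentially" using Inf_lower[OF c] CA c by (auto intro: order_trans)
   ultimately show ?thesis by (intro bexI[of _ "Inf C"]) (auto intro: Inf_lower)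
  qed
 qed
 then obtain m where m: "m:?A" and m2: "ALL z:?A. z <= m --> z = m" by (rule bexE)
 have "F = m" if "F <= m" "F ~= bot" for F using m m2 that order_trans[of F m sequentially] by simp
 thus ?thesis using m by (intro exI[of _ m]) (simp add: free_ultra_def)
qed

definition ultra :: "nat filter" ("\<U>") where "\<U> = (SOME U. free_ultra U)"

lemma free_ultra_ultra: "free_ultra \<U>"
 unfolding ultra_def using free_ultra_exists by (rule someI_ex)

lemma ultra_neq_bot [simp]: "\<U> ~= bot" using free_ultra_ultra by (simp add: free_ultra_def)

lemma ultra_ge: "eventually (%n. m <= n) \<U>"
 using free_ultra_ultra eventually_ge_at_top[of m] by (auto simp: free_ultra_def le_filter_def)

text \<open>If \<open>P\<close> is not large, restricting the ultrafilter to the complement of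
  \<open>P\<close> gives a proper filter, which by minimality is the ultrafilter itself.\<close>

lemma ultra_not [simp]: "eventually (%n. ~ P n) \<U> <-> ~ eventually P \<U>"
proof
 assume "eventually (%n. ~ P n) \<U>"
 thus "~ eventually P \<U>"
  using eventually_elim2[of "%n. ~ P n" \<U> P "%_. False"] by auto
next
 assume *: "~ eventually P \<U>"
 define F where "F = inf \<U> (principal {n. ~ P n})"
 have "F ~= bot"
  using * by (auto simp: F_def trivial_limit_def eventually_inf_principal elim!: eventually_mono)
 hence "F = \<U>" using free_ultra_ultra by (auto simp: free_ultra_def F_def)
 hence "\<U> <= principal {n. ~ P n}" unfolding F_def by (metis inf.cobounded2)
 thus "eventually (%n. ~ P n) \<U>" by (simp add: le_principal)
qed

lemma ultra_conj: "eventually (%n. P n & Q n) \<U> <-> eventually P \<U> & eventually Q \<U>"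
 by (rule eventually_conj_iff)

lemma ultra_ex: "eventually P \<U> ==> EX n. P n"
 using eventually_happens'[OF ultra_neq_bot] by blast

lemma ultra_iff:
 "eventually (%n. P n = Q n) \<U> ==> eventually P \<U> = eventually Q \<U>"
 by (auto elim: eventually_elim2)

text \<open>\<open>q\<close> sends a sequence of elements of \<open>M\<close> to its class in the ultrapower \<open>N\<close>.\<close>

definition is_ultrapower ::
  "('f, 'r) language => ('f, 'r, 'a) struc => ('f, 'r, 'b) struc => ((nat => 'a) => 'b) => bool" where
 "is_ultrapower L M N q <->
   q ` {f. range f \<subseteq> univ M} = univ N &
   (ALL f g. range f \<subseteq> univ M & range g \<subseteq> univ M --> q f = q g <-> eventually (%n. f n = g n) \<U>) &
   (ALL F fs. length fs = fun_arity L F & (ALL f:set fs. range f \<subseteq> univ M) -->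
    fun_interp N F (map q fs) = q (%n. fun_interp M F (map (%f. f n) fs))) &
   (ALL R fs. length fs = rel_arity L R & (ALL f:set fs. range f \<subseteq> univ M) -->
    rel_interp N R (map q fs) = eventually (%n. rel_interp M R (map (%f. f n) fs)) \<U>)"

context
 fixes L :: "('f, 'r) language" and M :: "('f, 'r, 'a) struc" and N :: "('f, 'r, 'b) struc" and q
 assumes M: "is_structure L M" and up: "is_ultrapower L M N q"
begin

lemma up_univ: "range f \<subseteq> univ M ==> q f:univ N"
 using up unfolding is_ultrapower_def by blast

lemma up_surj: "x:univ N ==> EX f. range f \<subseteq> univ M & x = q f"
 using up unfolding is_ultrapower_def by blast

lemma up_eq: "range f \<subseteq> univ M ==> range g \<subseteq> univ M ==> q f = q g <-> eventually (%n. f n = g n) \<U>"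
 using up unfolding is_ultrapower_def by blast

lemma up_fun: "length fs = fun_arity L F ==> ALL f:set fs. range f \<subseteq> univ M ==>
  fun_interp N F (map q fs) = q (%n. fun_interp M F (map (%f. f n) fs))"
 using up unfolding is_ultrapower_def by blast

lemma up_rel: "length fs = rel_arity L R ==> ALL f:set fs. range f \<subseteq> univ M ==>
  rel_interp N R (map q fs) = eventually (%n. rel_interp M R (map (%f. f n) fs)) \<U>"
 using up unfolding is_ultrapower_def by blast

lemma up_structure: "is_structure L N"
 unfolding is_structure_def
proof (intro conjI allI impI)
 obtain u where "u:univ M" using M by (auto simp: is_structure_def)
 thus "univ N ~= {}" using up_univ[of "%_. u"] by auto
 fix F as assume as: "length as = fun_arity L F & set as \<subseteq> univ N"
 hence "ALL a:set as. EX f. range f \<subseteq> univ M & a = q f" using up_surj by blast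
 then obtain h where h: "!!a. a:set as ==> range (h a) \<subseteq> univ M & a = q (h a)" unfolding bchoice_iff by blast
 have "as = map q (map h as)" using h by (induction as) auto
 hence "fun_interp N F as = q (%n. fun_interp M F (map (%f. f n) (map h as)))"
  using up_fun[of "map h as" F] as h by auto
 moreover have "range (%n. fun_interp M F (map (%f. f n) (map h as))) \<subseteq> univ M"
 proof
  fix x assume "x:range (%n. fun_interp M F (map (%f. f n) (map h as)))"
  then obtain n where n: "x = fun_interp M F (map (%f. f n) (map h as))" by blast
  have "set (map (%f. f n) (map h as)) \<subseteq> univ M" using h by auto
  thus "x:univ M" unfolding n using M as by (simp add: is_structure_def)
 qed
 ultimately show "fun_interp N F as:univ N" using up_univ by simp
qed

lemma up_tm_val:
 assumes "!!k. range (e k) \<subseteq> univ M"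
 shows "wf_tm L t ==> tm_val N (%k. q (e k)) t = q (%n. tm_val M (%k. e k n) t)"
proof (induction t)
 case (Fn F ts)
 let ?g = "%t n. tm_val M (%k. e k n) t"
 have "map (tm_val N (%k. q (e k))) ts = map q (map ?g ts)"
  using Fn by (auto simp: list_all_iff)
 hence "tm_val N (%k. q (e k)) (Fn F ts) = fun_interp N F (map q (map ?g ts))" by (simp del: map_map)
 also have "\<dots> = q (%n. fun_interp M F (map (%f. f n) (map ?g ts)))"
 proof (rule up_fun)
  show "length (map ?g ts) = fun_arity L F" using Fn.prems by simp
  show "ALL f:set (map ?g ts). range f \<subseteq> univ M"
   using Fn.prems tm_val_univ[OF M] assms by (auto simp: list_all_iff image_subset_iff)
 qed
 finally show ?case by (simp add: comp_def)
qed auto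

theorem Los:
 assumes "wf_fm L p" "!!k. range (e k) \<subseteq> univ M"
 shows "sat N (%k. q (e k)) p <-> eventually (%n. sat M (%k. e k n) p) \<U>"
 using assms
proof (induction p arbitrary: e)
 case (Eq s t)
 have "range (%n. tm_val M (%k. e k n) t) \<subseteq> univ M" if "wf_tm L t" for t
  using tm_val_univ[OF M that] Eq.prems(2) by (auto simp: image_subset_iff)
 thus ?case using Eq.prems by (simp add: up_tm_val up_eq)
next
 case (Rel R ts)
 let ?g = "%t n. tm_val M (%k. e k n) t"
 have "map (tm_val N (%k. q (e k))) ts = map q (map ?g ts)"
  using Rel by (auto simp: list_all_iff up_tm_val)
 hence "sat N (%k. q (e k)) (Rel R ts) = rel_interp N R (map q (map ?g ts))" by (simp del: map_map)
 also have "\<dots> = eventually (%n. rel_interp M R (map (%f. f n) (map ?g ts))) \<U>"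
 proof (rule up_rel)
  show "length (map ?g ts) = rel_arity L R" using Rel.prems by simp
  show "ALL f:set (map ?g ts). range f \<subseteq> univ M"
   using Rel.prems tm_val_univ[OF M] by (auto simp: list_all_iff image_subset_iff)
 qed
 finally show ?case by (simp add: comp_def)
next
 case (Exi m p)
 have IH: "sat N ((%k. q (e k))(m := q f)) p <-> eventually (%n. sat M ((%k. e k n)(m := f n)) p) \<U>"
  if "range f \<subseteq> univ M" for f
 proof -
  have "(%k. q (e k))(m := q f) = (%k. q ((e(m := f)) k))" by auto
  moreover have "(%k. (e(m := f)) k n) = (%k. e k n)(m := f n)" for n by auto
  ultimately show ?thesis using Exi.IH[of "e(m := f)"] Exi.prems that by auto
 qed
 show ?case
 proof
  assume "sat N (%k. q (e k)) (Exi m p)"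
  then obtain a where "a:univ N" "sat N ((%k. q (e k))(m := a)) p" by auto
  then obtain f where f: "range f \<subseteq> univ M" "sat N ((%k. q (e k))(m := q f)) p" using up_surj by blast
  show "eventually (%n. sat M (%k. e k n) (Exi m p)) \<U>"
   using f(2) unfolding IH[OF f(1)] by (rule eventually_mono) (use f(1) in auto)
 next
  assume *: "eventually (%n. sat M (%k. e k n) (Exi m p)) \<U>"
  obtain u where u: "u:univ M" using M by (auto simp: is_structure_def)
  \<comment> \<open>A witness is chosen in each coordinate that has one; \<open>u\<close> fills the
    remaining coordinates, which form a small set.\<close>
  define f where "f n = (if sat M (%k. e k n) (Exi m p)
    then SOME a. a:univ M & sat M ((%k. e k n)(m := a)) p else u)" for n
  have f: "f n:univ M & (sat M (%k. e k n) (Exi m p) --> sat M ((%k. e k n)(m := f n)) p)" for n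
   using someI_ex[of "%a. a:univ M & sat M ((%k. e k n)(m := a)) p"] u
   by (auto simp: f_def)
  have r: "range f \<subseteq> univ M" using f by blast
  have "sat N ((%k. q (e k))(m := q f)) p"
   unfolding IH[OF r] using * by (rule eventually_mono) (use f in blast)
  thus "sat N (%k. q (e k)) (Exi m p)" using up_univ[OF r] by auto
 qed
next
 case (Conj p1 p2)
 have "sat N (%k. q (e k)) p1 <-> eventually (%n. sat M (%k. e k n) p1) \<U>"
  "sat N (%k. q (e k)) p2 <-> eventually (%n. sat M (%k. e k n) p2) \<U>"
  using Conj by simp_all
 thus ?case by (simp add: ultra_conj)
next
 case (Neg p)
 have "sat N (%k. q (e k)) p <-> eventually (%n. sat M (%k. e k n) p) \<U>" using Neg by simp
 thus ?case by simp
qed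

lemma up_tpeq: "tpeq L M N {}"
proof (rule tpeqI)
 fix p and e :: "nat => 'a" and e' :: "nat => 'b"
 assume p: "wf_fm L p" "!!n. n:fv_fm p ==> (e n, e' n):{}" "sat M e p"
 obtain u where u: "u:univ M" using M by (auto simp: is_structure_def)
 have "sat N (%k. q ((%k n. u) k)) p <-> eventually (%n. sat M (%k. (%k n. u) k n) p) \<U>"
  by (rule Los[OF p(1)]) (use u in auto)
 moreover have "sat M (%k. u) p = sat M e p" using p(2) by (intro sat_cong) auto
 moreover have "sat N (%k. q (%n. u)) p = sat N e' p" using p(2) by (intro sat_cong) auto
 ultimately show "sat N e' p" using p(3) by simp
qed

text \<open>In coordinate \<open>n\<close> as many of the first formulas as possible are realised at
  once. Each initial segment is realisable in almost every coordinate, so every single formula holds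
  in almost all of them.\<close>

lemma up_saturated_countable:
 fixes P :: "nat => ('f, 'r) fm" and b :: "nat => nat => 'b"
 assumes wf: "!!i. wf_fm L (P i)" and b: "!!i. range (b i) \<subseteq> univ N"
  and fin: "!!m. EX a:univ N. ALL i<m. sat N ((b i)(0 := a)) (P i)"
 shows "EX a:univ N. ALL i. sat N ((b i)(0 := a)) (P i)"
proof -
 have "EX f. range f \<subseteq> univ M & b i k = q f" for i k using b up_surj by blast
 then obtain r where r: "!!i k. range (r i k) \<subseteq> univ M" "!!i k. b i k = q (r i k)" by metis
 have L1: "sat N ((b i)(0 := q f)) (P i) <-> eventually (%n. sat M ((%k. r i k n)(0 := f n)) (P i)) \<U>"
  if "range f \<subseteq> univ M" for f i
 proof -
  have "(b i)(0 := q f) = (%k. q (((r i)(0 := f)) k))" by (auto simp: r(2))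
  moreover have "(%k. ((r i)(0 := f)) k n) = (%k. r i k n)(0 := f n)" for n by auto
  ultimately show ?thesis using Los[OF wf, of "(r i)(0 := f)"] that r(1) by auto
 qed
 define W where "W m n <-> (EX a:univ M. ALL i<m. sat M ((%k. r i k n)(0 := a)) (P i))" for m n
 have W: "eventually (W m) \<U>" for m
 proof -
  obtain f where f: "range f \<subseteq> univ M" "ALL i<m. sat N ((b i)(0 := q f)) (P i)"
   using fin[of m] up_surj by blast
  hence "ALL i:{..<m}. eventually (%n. sat M ((%k. r i k n)(0 := f n)) (P i)) \<U>" using L1 by simp
  hence "eventually (%n. ALL i:{..<m}. sat M ((%k. r i k n)(0 := f n)) (P i)) \<U>"
   by (intro eventually_ball_finite) auto
  thus ?thesis
  proof (rule eventually_mono)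
   fix n assume "ALL i:{..<m}. sat M ((%k. r i k n)(0 := f n)) (P i)"
   thus "W m n" unfolding W_def using f(1) by (intro bexI[of _ "f n"]) auto
  qed
 qed
 have W0: "W 0 n" for n using M by (auto simp: W_def is_structure_def)
 \<comment> \<open>The cap \<open>m <= n\<close> makes the maximum exist; it does no harm because
   every bound is exceeded almost everywhere.\<close>
 define k where "k n = Max {m. m <= n & W m n}" for n
 have kW: "W (k n) n" for n
 proof -
  have "k n:{m. m <= n & W m n}" unfolding k_def
  proof (rule Max_in)
   have "0:{m. m <= n & W m n}" using W0 by simp
   thus "{m. m <= n & W m n} ~= {}" by blast
  qed auto
  thus ?thesis by simp
 qed
 hence "EX a. a:univ M & (ALL i<k n. sat M ((%j. r i j n)(0 := a)) (P i))" for n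
  unfolding W_def by blast
 then obtain f where f: "!!n. f n:univ M" "!!n i. i < k n ==> sat M ((%j. r i j n)(0 := f n)) (P i)" by metis
 have rf: "range f \<subseteq> univ M" using f by blast
 have "sat N ((b i)(0 := q f)) (P i)" for i
  unfolding L1[OF rf] using eventually_conj[OF W[of "Suc i"] ultra_ge[of "Suc i"]]
 proof (rule eventually_mono)
  fix n assume "W (Suc i) n & Suc i <= n"
  hence "Suc i <= k n" unfolding k_def by (intro Max_ge) auto
  thus "sat M ((%j. r i j n)(0 := f n)) (P i)" using f(2) by simp
 qed
 thus ?thesis using up_univ[OF rf] by blast
qed

end

lemma up_saturated:
 fixes L :: "('f::countable, 'r::countable) language"
 assumes M: "is_structure L M" and up: "is_ultrapower L M N q"
 shows "aleph1_saturated L N"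
 unfolding aleph1_saturated_def
proof (intro allI impI, elim conjE)
 fix A \<Gamma>
 assume A: "countable A" "A \<subseteq> univ N" and wf: "ALL (p, b):\<Gamma>. wf_fm L p & range b \<subseteq> A"
  and cons: "consistent_in N \<Gamma>"
 have ne: "univ N ~= {}" using up_structure[OF M up] by (simp add: is_structure_def)
 show "EX a:univ N. realizes N a \<Gamma>"
 proof (cases "\<Gamma> = {}")
  case True
  thus ?thesis using ne by (auto simp: realizes_def)
 next
  case False
  \<comment> \<open>\<open>\<Gamma>\<close> may be uncountable, because its assignments carry
    irrelevant values. Keeping only the values up to the largest variable of the formula leaves
    finite lists over \<open>A\<close>, hence countably many conditions.\<close>
  define h where "h = (%(p :: ('f, 'r) fm, b :: nat => 'b). (p, map b [0..<Suc (Max (insert 0 (fv_fm p)))]))"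
  have h: "sat N ((%n. snd (h (p, b)) ! n)(0 := a)) p = sat N (b(0 := a)) p" for p b a
  proof (rule sat_cong)
   fix n assume "n:fv_fm p"
   hence "n <= Max (insert 0 (fv_fm p))" by simp
   thus "((%n. snd (h (p, b)) ! n)(0 := a)) n = (b(0 := a)) n" by (simp add: h_def del: upt_Suc)
  qed
  have "h ` \<Gamma> \<subseteq> UNIV \<times> lists A" using wf by (fastforce simp: h_def)
  hence "countable (h ` \<Gamma>)" by (rule countable_subset) (intro countable_SIGMA countable_lists A(1) countableI_type)
  hence rng: "range (from_nat_into (h ` \<Gamma>)) = h ` \<Gamma>"
   using False by (intro range_from_nat_into) auto
  have "EX g. g:\<Gamma> & h g = from_nat_into (h ` \<Gamma>) i" for i
  proof -
   have "from_nat_into (h ` \<Gamma>) i:h ` \<Gamma>" using False by (intro from_nat_into) auto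
   thus ?thesis by force
  qed
  then obtain g where g: "!!i. g i:\<Gamma>" "!!i. h (g i) = from_nat_into (h ` \<Gamma>) i" by metis
  have "EX a:univ N. ALL i. sat N ((snd (g i))(0 := a)) (fst (g i))"
  proof (rule up_saturated_countable[OF M up])
   show "wf_fm L (fst (g i))" for i using wf g(1)[of i] by (auto simp: case_prod_beta)
   show "range (snd (g i)) \<subseteq> univ N" for i using wf g(1)[of i] A(2) by (auto simp: case_prod_beta)
   show "EX a:univ N. ALL i<m. sat N ((snd (g i))(0 := a)) (fst (g i))" for m
   proof -
    have "g ` {..<m} \<subseteq> \<Gamma>" using g(1) by auto
    then obtain a where "a:univ N" "realizes N a (g ` {..<m})"
     using cons unfolding consistent_in_def by blast
    thus ?thesis by (auto simp: realizes_def case_prod_beta)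
   qed
  qed
  then obtain a where a: "a:univ N" "!!i. sat N ((snd (g i))(0 := a)) (fst (g i))" by blast
  have "sat N (b(0 := a)) p" if "(p, b):\<Gamma>" for p b
  proof -
   have "h (p, b):range (from_nat_into (h ` \<Gamma>))" unfolding rng using that by blast
   then obtain i where i: "h (p, b) = h (g i)" using g(2) by auto
   obtain p' b' where g': "g i = (p', b')" by fastforce
   have "p' = p" using i by (simp add: g' h_def)
   thus ?thesis using a(2)[of i] h[of p b a] h[of p b' a] i by (simp add: g')
  qed
  thus ?thesis using a(1) by (auto simp: realizes_def)
 qed
qed

text \<open>The universe is to consist of functions from \<open>nat\<close> to \<open>nat\<close>.
  So \<open>M\<close> is first replaced by a countable Skolem hull enumerated by \<open>B\<close>,
  and a member of the ultrapower is represented by a sequence of indices into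
  \<open>B\<close>.\<close>

lemma monster_exists:
 fixes L :: "('f::countable, 'r::countable) language" and M :: "('f, 'r, 'a) struc"
 assumes M: "is_structure L M"
 shows "EX N :: ('f, 'r, nat => nat) struc. is_structure L N & aleph1_saturated L N & tpeq L M N {}"
proof -
 obtain u where u: "u:univ M" using M by (auto simp: is_structure_def)
 define B where "B = skolem_ext M (%_. u)"
 have B: "skolem_seq L M B" unfolding B_def by (rule skolem_seq_ext) (use u in auto)
 define M0 where "M0 = M\<lparr>univ := range B\<rparr>"
 have M0: "is_structure L M0"
  unfolding is_structure_def
 proof (intro conjI allI impI)
  fix F as assume as: "length as = fun_arity L F & set as \<subseteq> univ M0"
  define e where "e n = (if n < length as then as ! n else B 0)" for n
  have "map (tm_val M e) (map Var [0..<length as]) = as" by (rule nth_equalityI) (auto simp: e_def)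
  hence *: "tm_val M e (Fn F (map Var [0..<length as])) = fun_interp M F as" by (simp del: map_map)
  have "wf_tm L (Fn F (map Var [0..<length as]))" using as by (auto simp: list_all_iff)
  moreover have "e n:range B" for n
   using as nth_mem[of n as] by (auto simp: e_def M0_def)
  ultimately have "tm_val M e (Fn F (map Var [0..<length as])):range B"
   by (intro skolem_closed_tm[OF B M]) auto
  thus "fun_interp M0 F as:univ M0" unfolding * by (simp add: M0_def)
 qed (simp add: M0_def)
 have MM0: "tpeq L M M0 {}"
 proof (rule tpeqI)
  fix p and e e' :: "nat => 'a"
  assume p: "wf_fm L p" "!!n. n:fv_fm p ==> (e n, e' n):{}" "sat M e p"
  have "sat M (%_. B 0) p" using p(2,3) sat_cong[of p e "%_. B 0"] by blast
  hence "sat M0 (%_. B 0) p" using sat_skolem_hull[OF B p(1), of "%_. B 0"] by (auto simp: M0_def)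
  thus "sat M0 e' p" using p(2) sat_cong[of p e' "%_. B 0"] by blast
 qed
 \<comment> \<open>The condition under \<open>SOME\<close> depends only on the class of
   \<open>g\<close> modulo the ultrafilter, so equivalent sequences get literally the same
   representative.\<close>
 define q where "q g = (SOME f. eventually (%n. B (f n) = g n) \<U>)" for g :: "nat => 'a"
 define N where "N = \<lparr>univ = q ` {g. range g \<subseteq> range B},
   fun_interp = (%F xs. q (%n. fun_interp M F (map (%x. B (x n)) xs))),
   rel_interp = (%R xs. eventually (%n. rel_interp M R (map (%x. B (x n)) xs)) \<U>)\<rparr>"
 have q: "eventually (%n. B (q g n) = g n) \<U>" if "range g \<subseteq> range B" for g
 proof -
  have "EX k. B k = g n" for n using that by (metis UNIV_I image_iff subset_eq)
  then obtain f where "!!n. B (f n) = g n" by metis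
  hence "EX f. eventually (%n. B (f n) = g n) \<U>" by (intro exI[of _ f]) simp
  thus ?thesis unfolding q_def by (rule someI_ex)
 qed
 have qeq: "q f = q g" if "eventually (%n. f n = g n) \<U>" for f g
 proof -
  have "eventually (%n. B (h n) = f n) \<U> = eventually (%n. B (h n) = g n) \<U>" for h
   by (rule ultra_iff) (use that in \<open>auto elim: eventually_mono\<close>)
  thus ?thesis by (simp add: q_def)
 qed
 have qs: "eventually (%n. map (%x. B (x n)) (map q fs) = map (%f. f n) fs) \<U>"
  if "ALL f:set fs. range f \<subseteq> range B" for fs
 proof -
  have "eventually (%n. ALL f:set fs. B (q f n) = f n) \<U>"
   by (rule eventually_ball_finite) (use that q in auto)
  thus ?thesis by (rule eventually_mono) auto
 qed
 have up: "is_ultrapower L M0 N q"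
  unfolding is_ultrapower_def
 proof (intro conjI allI impI, goal_cases)
  case 1
  show ?case by (simp add: N_def M0_def)
 next
  case (2 f g)
  hence r: "range f \<subseteq> range B" "range g \<subseteq> range B" by (auto simp: M0_def)
  show ?case
  proof
   assume "q f = q g"
   thus "eventually (%n. f n = g n) \<U>"
    using q[OF r(1)] q[OF r(2)] by (auto elim: eventually_elim2)
  qed (rule qeq)
 next
  case (3 F fs)
  hence "eventually (%n. fun_interp M F (map (%x. B (x n)) (map q fs)) = fun_interp M F (map (%f. f n) fs)) \<U>"
   using qs[of fs] by (auto simp: M0_def simp del: map_map map_eq_conv elim!: eventually_mono)
  hence "q (%n. fun_interp M F (map (%x. B (x n)) (map q fs))) = q (%n. fun_interp M F (map (%f. f n) fs))"
   by (rule qeq)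
  thus ?case by (simp add: N_def M0_def del: map_map)
 next
  case (4 R fs)
  hence "eventually (%n. rel_interp M R (map (%x. B (x n)) (map q fs)) = rel_interp M R (map (%f. f n) fs)) \<U>"
   using qs[of fs] by (auto simp: M0_def simp del: map_map map_eq_conv elim!: eventually_mono)
  hence "eventually (%n. rel_interp M R (map (%x. B (x n)) (map q fs))) \<U> = eventually (%n. rel_interp M R (map (%f. f n) fs)) \<U>"
   by (rule ultra_iff)
  thus ?case by (simp add: N_def M0_def del: map_map)
 qed
 show ?thesis
  using up_structure[OF M0 up] up_saturated[OF M0 up] tpeq_comp_empty[OF MM0 up_tpeq[OF M0 up]] by blast
qed

text \<open>Violations transfer between any two saturated models of the theory, so the monster model
  on \<open>nat => nat\<close> may be exchanged for one of any type, in particular for the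
  ultrapowers of \<open>K\<close> and \<open>G\<close>.\<close>

theorem strongly_NIP_iff:
 fixes L :: "('f::countable, 'r::countable) language" and M :: "('f, 'r, 'a) struc"
  and N :: "('f, 'r, 'b) struc"
 assumes M: "is_structure L M" and N: "is_structure L N" "aleph1_saturated L N" "tpeq L M N {}"
 shows "strongly_NIP L M <-> (\<nexists>\<phi> b. strong_NIP_violation L N \<phi> b)"
proof -
 have mon: "monster_model L (complete_theory L M) N' <->
   is_structure L N' & aleph1_saturated L N' & tpeq L M N' {}" for N' :: "('f, 'r, nat => nat) struc"
  unfolding monster_model_def using is_model_complete_theory[OF M, of N'] by (auto simp: is_model_def)
 have tr: "(EX \<phi> b. strong_NIP_violation L N \<phi> b) <-> (EX \<phi> b. strong_NIP_violation L N' \<phi> b)"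
  if N': "is_structure L N'" "aleph1_saturated L N'" "tpeq L M N' {}" for N' :: "('f, 'r, nat => nat) struc"
 proof -
  have "tpeq L N N' {}" using tpeq_comp_empty[of L N M N'] tpeq_converse[OF N(3)] N'(3) by simp
  moreover have "tpeq L N' N {}" using tpeq_comp_empty[of L N' M N] tpeq_converse[OF N'(3)] N(3) by simp
  ultimately show ?thesis using strong_NIP_violation_transfer N N' by meson
 qed
 show ?thesis
  unfolding strongly_NIP_def strongly_NIP_theory_def mon using monster_exists[OF M] tr by metis
qed

section \<open>Subfields and real closed subfields\<close>

definition subfield_set :: "'a::field set => bool" where
 "subfield_set A <-> 1:A & (ALL x:A. ALL y:A. x - y:A & x * y:A) & (ALL x:A. inverse x:A)"

definition polys_over :: "'a::zero set => 'a poly set" where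
 "polys_over A = {p. ALL i. coeff p i:A}"

lemma polys_overD: "p:polys_over A ==> coeff p i:A"
 by (simp add: polys_over_def)

context
 fixes A :: "'a::field set"
 assumes A: "subfield_set A"
begin

lemma sf_1 [simp]: "1:A" using A by (simp add: subfield_set_def)
lemma sf_diff: "x:A ==> y:A ==> x - y:A" using A by (simp add: subfield_set_def)
lemma sf_0 [simp]: "0:A" using sf_diff[OF sf_1 sf_1] by simp
lemma sf_minus: "x:A ==> - x:A" using sf_diff[OF sf_0, of x] by simp
lemma sf_add: "x:A ==> y:A ==> x + y:A" using sf_diff[of x "- y"] sf_minus[of y] by simp
lemma sf_mult: "x:A ==> y:A ==> x * y:A" using A by (simp add: subfield_set_def)
lemma sf_inverse: "x:A ==> inverse x:A" using A by (simp add: subfield_set_def)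
lemma sf_divide: "x:A ==> y:A ==> x / y:A" by (simp add: divide_inverse sf_mult sf_inverse)
lemma sf_power: "x:A ==> x ^ n:A" by (induction n) (auto intro: sf_mult)
lemma sf_of_nat [simp]: "of_nat n:A" by (induction n) (auto intro: sf_add)
lemma sf_numeral [simp]: "numeral n:A" using sf_of_nat[of "numeral n"] by simp
lemma sf_sum: "(!!i. i:I ==> f i:A) ==> sum f I:A"
 by (induction I rule: infinite_finite_induct) (auto intro: sf_add)

lemmas sf_intros = sf_1 sf_0 sf_diff sf_minus sf_add sf_mult sf_inverse sf_divide sf_power sf_of_nat sf_numeral

lemma po_0 [simp]: "0:polys_over A" by (simp add: polys_over_def)
lemma po_add: "p:polys_over A ==> q:polys_over A ==> p + q:polys_over A"
 by (simp add: polys_over_def sf_add)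
lemma po_minus: "p:polys_over A ==> - p:polys_over A"
 by (simp add: polys_over_def sf_minus)
lemma po_diff: "p:polys_over A ==> q:polys_over A ==> p - q:polys_over A"
 by (simp add: polys_over_def sf_diff)
lemma po_mult: "p:polys_over A ==> q:polys_over A ==> p * q:polys_over A"
 by (auto simp: polys_over_def coeff_mult intro!: sf_sum sf_mult)
lemma po_pCons: "a:A ==> p:polys_over A ==> pCons a p:polys_over A"
 by (auto simp: polys_over_def coeff_pCons split: nat.splits)
lemma po_smult: "a:A ==> p:polys_over A ==> smult a p:polys_over A"
 by (simp add: polys_over_def sf_mult)
lemma po_monom: "a:A ==> monom a n:polys_over A"
 by (simp add: polys_over_def)
lemma po_pderiv: "p:polys_over A ==> pderiv p:polys_over A"
 by (simp add: polys_over_def coeff_pderiv sf_mult sf_add)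
lemma po_poly: "p:polys_over A ==> x:A ==> poly p x:A"
 by (auto simp: poly_altdef polys_over_def intro!: sf_sum sf_mult sf_power)

lemma po_divmod:
 assumes d: "d:polys_over A" "d ~= 0"
 shows "p:polys_over A ==>
  EX q:polys_over A. EX r:polys_over A. p = q * d + r & (r = 0 | degree r < degree d)"
proof (induction "degree p" arbitrary: p rule: less_induct)
 case less
 show ?case
 proof (cases "degree p < degree d | p = 0")
  case True
  thus ?thesis using less.prems by (intro bexI[of _ 0] bexI[of _ p]) auto
 next
  case False
  define m where "m = monom (lead_coeff p / lead_coeff d) (degree p - degree d)"
  have m: "m:polys_over A" unfolding m_def
   using d less.prems by (intro po_monom sf_divide) (auto simp: polys_over_def)
  have c0: "lead_coeff p ~= 0" "lead_coeff d ~= 0" using False d by auto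
  have m0: "m ~= 0" using c0 by (simp add: m_def)
  have dm: "degree (m * d) = degree p" using False d c0 m0
   by (subst degree_mult_eq) (auto simp: m_def degree_monom_eq)
  have "coeff (m * d) (degree p) = lead_coeff m * lead_coeff d"
   using dm by (metis lead_coeff_mult)
  also have "\<dots> = lead_coeff p" using c0 by (simp add: m_def degree_monom_eq)
  finally have lc: "coeff (m * d) (degree p) = coeff p (degree p)" .
  define p' where "p' = p - m * d"
  have p': "p':polys_over A" unfolding p'_def using less.prems m d by (intro po_diff po_mult) auto
  have "coeff p' (degree p) = 0" using lc by (simp add: p'_def)
  moreover have "degree p' <= degree p" unfolding p'_def using dm by (intro degree_diff_le) auto
  ultimately have dp: "p' = 0 | degree p' < degree p"
   by (metis eq_zero_or_degree_less)
  have "EX q:polys_over A. EX r:polys_over A. p' = q * d + r & (r = 0 | degree r < degree d)"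
  proof (cases "p' = 0")
   case True
   thus ?thesis by (intro bexI[of _ 0]) auto
  qed (use less.hyps[of p'] dp p' in auto)
  then obtain q r where qr: "q:polys_over A" "r:polys_over A" "p' = q * d + r" "r = 0 | degree r < degree d"
   by blast
  have "p = (q + m) * d + r" using qr(3) by (simp add: p'_def algebra_simps)
  thus ?thesis using qr po_add[OF qr(1) m] by blast
 qed
qed

lemma po_root_factor:
 assumes "p:polys_over A" "a:A" "poly p a = 0"
 shows "EX q:polys_over A. p = [:-a, 1:] * q"
proof -
 have d: "[:-a, 1:]:polys_over A" using assms by (intro po_pCons) (auto intro: sf_minus)
 obtain q r where qr: "q:polys_over A" "p = q * [:-a, 1:] + r" "r = 0 | degree r < degree [:-a, 1:]"
  using po_divmod[OF d _ assms(1)] by auto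
 have "poly r a = 0" using assms(3) qr(2) by simp
 hence "r = 0" using qr(3) by (auto elim!: degree_eq_zeroE)
 thus ?thesis using qr by (auto simp: mult.commute)
qed

end

lemma degree_linear_mult: "q ~= 0 ==> degree ([:a, 1:] * q) = Suc (degree q)" for a :: "'a::idom"
 by (subst degree_mult_eq) auto

subsection \<open>Newton's identities\<close>

lemma fps_geometric_mult:
 "(1 - fps_const r * fps_X) * Abs_fps (%m. r ^ Suc m) = fps_const (r :: 'a::comm_ring_1)"
proof (rule fps_ext)
 fix n show "((1 - fps_const r * fps_X) * Abs_fps (%m. r ^ Suc m)) $ n = fps_const r $ n"
  by (cases n) (simp_all add: left_diff_distrib mult.assoc)
qed

text \<open>The logarithmic derivative: the factor \<open>1 - r X\<close> contributes
  \<open>- r / (1 - r X)\<close>, whose coefficients are the negated powers of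
  \<open>r\<close>.\<close>

lemma fps_deriv_prod_linear:
 fixes rs :: "'a::comm_ring_1 list"
 defines "F \<equiv> %rs. prod_list (map (%r. 1 - fps_const r * fps_X) rs)"
  and "S \<equiv> %rs. Abs_fps (%m. sum_list (map (%r. r ^ Suc m) rs))"
 shows "fps_deriv (F rs) = - (F rs * S rs)"
proof (induction rs)
 case Nil
 have "Abs_fps (%m. 0 :: 'a) = 0" by (rule fps_ext) simp
 thus ?case by (simp add: F_def S_def)
next
 case (Cons r rs)
 have S: "S (r # rs) = Abs_fps (%m. r ^ Suc m) + S rs" by (rule fps_ext) (simp add: S_def)
 have "fps_deriv (F (r # rs)) = - fps_const r * F rs + (1 - fps_const r * fps_X) * fps_deriv (F rs)"
  by (simp add: F_def algebra_simps fps_const_neg[symmetric] del: fps_const_neg)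
 also have "\<dots> = - ((1 - fps_const r * fps_X) * Abs_fps (%m. r ^ Suc m)) * F rs + (1 - fps_const r * fps_X) * (- (F rs * S rs))"
  unfolding Cons.IH fps_geometric_mult ..
 also have "\<dots> = - (F (r # rs) * S (r # rs))" unfolding S by (simp add: F_def algebra_simps)
 finally show ?case .
qed

lemma newton_identity:
 fixes rs :: "'a::field list"
 defines "F \<equiv> prod_list (map (%r. [:1, -r:]) rs)"
 shows "of_nat (Suc m) * coeff F (Suc m) = - (\<Sum>i\<le>m. coeff F i * sum_list (map (%r. r ^ Suc (m - i)) rs))"
proof -
 have *: "fps_of_poly F = prod_list (map (%r. 1 - fps_const r * fps_X) rs)"
  unfolding F_def fps_of_poly_prod_list
  by (rule arg_cong[of _ _ prod_list]) (simp add: fps_of_poly_pCons fps_const_neg[symmetric] del: fps_const_neg)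
 have "fps_deriv (fps_of_poly F) $ m = (- (fps_of_poly F * Abs_fps (%m. sum_list (map (%r. r ^ Suc m) rs)))) $ m"
  unfolding * fps_deriv_prod_linear ..
 thus ?thesis by (simp add: fps_mult_nth atLeast0AtMost algebra_simps)
qed

lemma coeff_0_prod_linear [simp]: "coeff (prod_list (map (%r. [:1, -r:]) rs)) 0 = (1 :: 'a::idom)"
 by (induction rs) (simp_all add: coeff_mult)

text \<open>Newton's identities are solved for the highest power sum, whose coefficient is 1.
  Together with the converse \<open>coeffs_in_subfield\<close>, this takes the place of the theorem
  on symmetric polynomials.\<close>

lemma power_sums_in_subfield:
 fixes rs :: "'a::field list"
 assumes K: "subfield_set K" and F: "prod_list (map (%r. [:1, -r:]) rs):polys_over K"
 shows "sum_list (map (%r. r ^ m) rs):K"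
proof (cases m)
 case 0
 have "sum_list (map (%r. 1) rs) = (of_nat (length rs) :: 'a)" by (induction rs) auto
 thus ?thesis using 0 K by (simp add: sf_of_nat)
next
 case (Suc k)
 let ?F = "prod_list (map (%r. [:1, -r:]) rs)"
 have "sum_list (map (%r. r ^ Suc k) rs):K" for k
 proof (induction k rule: less_induct)
  case (less k)
  have "of_nat (Suc k) * coeff ?F (Suc k) = - (\<Sum>i\<le>k. coeff ?F i * sum_list (map (%r. r ^ Suc (k - i)) rs))"
   by (rule newton_identity)
  also have "(\<Sum>i\<le>k. coeff ?F i * sum_list (map (%r. r ^ Suc (k - i)) rs))
    = sum_list (map (%r. r ^ Suc k) rs) + (\<Sum>i\<in>{..k} - {0}. coeff ?F i * sum_list (map (%r. r ^ Suc (k - i)) rs))"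
   by (subst sum.remove[of _ 0]) auto
  finally have e: "of_nat (Suc k) * coeff ?F (Suc k) = - (sum_list (map (%r. r ^ Suc k) rs) + (\<Sum>i\<in>{..k} - {0}. coeff ?F i * sum_list (map (%r. r ^ Suc (k - i)) rs)))" .
  have "sum_list (map (%r. r ^ Suc k) rs) =
    - (of_nat (Suc k) * coeff ?F (Suc k)) - (\<Sum>i\<in>{..k} - {0}. coeff ?F i * sum_list (map (%r. r ^ Suc (k - i)) rs))"
   unfolding e by simp
  also have "\<dots>:K"
  proof (intro sf_diff[OF K] sf_minus[OF K] sf_mult[OF K] sf_of_nat[OF K] polys_overD[OF F] sf_sum[OF K])
   fix i assume "i:{..k} - {0}"
   hence "k - i < k" by auto
   thus "sum_list (map (%r. r ^ Suc (k - i)) rs):K" by (rule less)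
  qed
  finally show ?case .
 qed
 thus ?thesis using Suc by blast
qed

text \<open>Now Newton's identities are solved for the coefficient, which means dividing by
  \<open>Suc m\<close>; here characteristic zero enters.\<close>

lemma coeffs_in_subfield:
 fixes rs :: "'a::field_char_0 list"
 assumes K: "subfield_set K" and S: "!!m. sum_list (map (%r. r ^ m) rs):K"
 shows "prod_list (map (%r. [:1, -r:]) rs):polys_over K"
proof -
 let ?F = "prod_list (map (%r. [:1, -r:]) rs)"
 have "coeff ?F k:K" for k
 proof (induction k rule: less_induct)
  case (less k)
  show ?case
  proof (cases k)
   case 0
   thus ?thesis using K by (simp add: sf_1)
  next
   case (Suc m)
   have "coeff ?F (Suc m) = of_nat (Suc m) * coeff ?F (Suc m) / of_nat (Suc m)"
    by (rule nonzero_mult_div_cancel_left[symmetric]) (rule of_nat_neq_0)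
   also have "\<dots> = - (\<Sum>i\<le>m. coeff ?F i * sum_list (map (%r. r ^ Suc (m - i)) rs)) / of_nat (Suc m)"
    by (simp only: newton_identity)
   also have "\<dots>:K"
    using less Suc by (intro sf_divide[OF K] sf_minus[OF K] sf_sum[OF K] sf_mult[OF K] S sf_of_nat[OF K]) auto
   finally show ?thesis using Suc by simp
  qed
 qed
 thus ?thesis by (simp add: polys_over_def)
qed

lemma reflect_prod_linear:
 "reflect_poly (prod_list (map (%r. [:-r, 1:]) rs)) = prod_list (map (%r. [:1, -r :: 'a::field:]) rs)"
proof -
 have "reflect_poly [:-r, 1:] = [:1, -r:]" for r :: 'a
  by (cases "r = 0") (simp_all add: reflect_poly_def)
 thus ?thesis by (simp add: reflect_poly_prod_list comp_def)
qed

lemma reflect_polys_over: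
 assumes K: "subfield_set K"
 shows "p:polys_over K <-> reflect_poly p:polys_over K"
proof
 assume p: "p:polys_over K"
 thus "reflect_poly p:polys_over K"
  unfolding polys_over_def mem_Collect_eq coeff_reflect_poly using sf_0[OF K] by simp
next
 assume r: "reflect_poly p:polys_over K"
 have "coeff p i:K" for i
 proof (cases "i <= degree p")
  case True
  thus ?thesis using polys_overD[OF r, of "degree p - i"] by (simp add: coeff_reflect_poly split: if_splits)
 qed (use K in \<open>simp add: coeff_eq_0 sf_0\<close>)
 thus "p:polys_over K" by (simp add: polys_over_def)
qed

subsection \<open>The fundamental theorem of algebra after Laplace\<close>

text \<open>Stated for a subset of an ordered field, because the real closed field of interest is a
  coefficient field inside \<open>K\<close> that inherits the order of \<open>K\<close>.\<close>

definition rc_subfield :: "'a::linordered_field set => bool" where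
 "rc_subfield C <-> subfield_set C & (ALL x:C. x >= 0 --> (EX y:C. y * y = x)) &
   (ALL p:polys_over C. odd (degree p) --> (EX x:C. poly p x = 0))"

lemma subfield_image:
 assumes K: "subfield_set K" and hom: "h 1 = 1" "!!x y. h (x - y) = h x - h y" "!!x y. h (x * y) = h x * h y"
  "!!x. h (inverse x) = inverse (h x)"
 shows "subfield_set (h ` K)"
 unfolding subfield_set_def
proof (intro conjI ballI)
 show "1:h ` K" using K hom(1) by (metis image_eqI sf_1)
next
 fix u w assume "u:h ` K" "w:h ` K"
 then obtain x y where xy: "x:K" "y:K" "u = h x" "w = h y" by blast
 show "u - w:h ` K" unfolding xy hom(2)[symmetric] using sf_diff[OF K] xy by blast
 show "u * w:h ` K" unfolding xy hom(3)[symmetric] using sf_mult[OF K] xy by blast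
next
 fix u assume "u:h ` K"
 then obtain x where x: "x:K" "u = h x" by blast
 show "inverse u:h ` K" unfolding x hom(4)[symmetric] using sf_inverse[OF K] x by blast
qed

lemma double_sum_pairs:
 fixes f :: "nat => nat => 'a::field_char_0"
 assumes "!!i j. f i j = f j i"
 shows "(\<Sum>(i, j) | i < j & j < n. f i j) = ((\<Sum>i<n. \<Sum>j<n. f i j) - (\<Sum>i<n. f i i)) / 2"
proof -
 let ?L = "{(i, j). i < j & j < n}" and ?G = "{(i, j). j < i & i < n}" and ?D = "{(i, j). i = j & i < n}"
 have fin: "finite ?L" "finite ?G" "finite ?D"
  by (rule finite_subset[of _ "{..<n} \<times> {..<n}"]; auto)+
 have "(\<Sum>i<n. \<Sum>j<n. f i j) = (\<Sum>(i, j)\<in>{..<n} \<times> {..<n}. f i j)" by (simp add: sum.cartesian_product)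
 also have "{..<n} \<times> {..<n} = (?L \<union> ?G) \<union> ?D" by auto
 also have "(\<Sum>(i, j)\<in>(?L \<union> ?G) \<union> ?D. f i j) = (\<Sum>(i, j)\<in>?L. f i j) + (\<Sum>(i, j)\<in>?G. f i j) + (\<Sum>(i, j)\<in>?D. f i j)"
  by (subst sum.union_disjoint, use fin in auto)+
 also have "(\<Sum>(i, j)\<in>?G. f i j) = (\<Sum>(i, j)\<in>?L. f i j)"
  by (rule sum.reindex_bij_witness[of _ "%(i, j). (j, i)" "%(i, j). (j, i)"]) (auto simp: assms)
 also have "(\<Sum>(i, j)\<in>?D. f i j) = (\<Sum>i<n. f i i)"
  by (rule sum.reindex_bij_witness[of _ "%i. (i, i)" fst]) auto
 finally show ?thesis by (simp add: field_simps)
qed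

text \<open>By Newton it suffices that the power sums of the candidates
  \<open>r_i + r_j + t r_i r_j\<close> lie in \<open>K\<close>. Summed over all pairs they expand
  into products of power sums of the roots; the sum over \<open>i < j\<close> is half of what
  remains after removing the diagonal.\<close>

lemma laplace_poly:
 fixes rs :: "'a::field_char_0 list"
 assumes K: "subfield_set K" and t: "t:K"
  and F: "prod_list (map (%r. [:-r, 1:]) rs):polys_over K"
 defines "n \<equiv> length rs"
 shows "(\<Prod>(i, j) | i < j & j < n. [:- (rs ! i + rs ! j + t * rs ! i * rs ! j), 1:]):polys_over K"
proof -
 define s where "s = (%(i, j). rs ! i + rs ! j + t * rs ! i * rs ! j)"
 let ?L = "{(i, j). i < j & j < n}"
 have finL: "finite ?L" by (rule finite_subset[of _ "{..<n} \<times> {..<n}"]) auto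
 have ps: "(\<Sum>i<n. (rs ! i) ^ m):K" for m
 proof -
  have "(\<Sum>i<n. (rs ! i) ^ m) = sum_list (map (%r. r ^ m) rs)"
   by (simp add: sum_list_sum_nth n_def atLeast0LessThan)
  thus ?thesis
   using power_sums_in_subfield[OF K] F reflect_polys_over[OF K] reflect_prod_linear by metis
 qed
 \<comment> \<open>The free exponents \<open>a\<close> and \<open>b\<close> absorb the monomials
   that appear when one factor \<open>s (i, j)\<close> is expanded.\<close>
 have dbl: "(\<Sum>i<n. \<Sum>j<n. (rs ! i) ^ a * (rs ! j) ^ b * s (i, j) ^ m):K" for a b m
 proof (induction m arbitrary: a b)
  case 0
  have "(\<Sum>i<n. \<Sum>j<n. (rs ! i) ^ a * (rs ! j) ^ b) = (\<Sum>i<n. (rs ! i) ^ a) * (\<Sum>j<n. (rs ! j) ^ b)"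
   by (simp add: sum_product)
  thus ?case using sf_mult[OF K ps ps] by simp
 next
  case (Suc m)
  have "(\<Sum>i<n. \<Sum>j<n. (rs ! i) ^ a * (rs ! j) ^ b * s (i, j) ^ Suc m) =
    (\<Sum>i<n. \<Sum>j<n. (rs ! i) ^ Suc a * (rs ! j) ^ b * s (i, j) ^ m) +
    (\<Sum>i<n. \<Sum>j<n. (rs ! i) ^ a * (rs ! j) ^ Suc b * s (i, j) ^ m) +
    t * (\<Sum>i<n. \<Sum>j<n. (rs ! i) ^ Suc a * (rs ! j) ^ Suc b * s (i, j) ^ m)"
   unfolding sum_distrib_left sum.distrib[symmetric] by (intro sum.cong refl) (simp add: s_def algebra_simps)
  also have "\<dots>:K" by (intro sf_add[OF K] sf_mult[OF K] t Suc.IH)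
  finally show ?case .
 qed
 have diag: "(\<Sum>i<n. (rs ! i) ^ a * s (i, i) ^ m):K" for a m
 proof (induction m arbitrary: a)
  case 0
  thus ?case using ps by simp
 next
  case (Suc m)
  have "(\<Sum>i<n. (rs ! i) ^ a * s (i, i) ^ Suc m) =
    2 * (\<Sum>i<n. (rs ! i) ^ Suc a * s (i, i) ^ m) + t * (\<Sum>i<n. (rs ! i) ^ Suc (Suc a) * s (i, i) ^ m)"
   unfolding sum_distrib_left sum.distrib[symmetric] by (intro sum.cong refl) (simp add: s_def algebra_simps)
  also have "\<dots>:K" by (intro sf_add[OF K] sf_mult[OF K] t Suc.IH sf_numeral[OF K])
  finally show ?case .
 qed
 obtain ls where ls: "set ls = ?L" "distinct ls" using finite_distinct_list[OF finL] by blast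
 have prod_ls: "(\<Prod>x\<in>?L. g x) = prod_list (map g ls)" for g :: "nat \<times> nat => 'a poly"
  using prod.distinct_set_conv_list[OF ls(2), of g] ls(1) by simp
 have sum_ls: "(\<Sum>x\<in>?L. g x) = sum_list (map g ls)" for g :: "nat \<times> nat => 'a"
  using sum.distinct_set_conv_list[OF ls(2), of g] ls(1) by simp
 have pw: "sum_list (map (%r. r ^ m) (map s ls)):K" for m
 proof -
  have "sum_list (map (%r. r ^ m) (map s ls)) = (\<Sum>x\<in>?L. s x ^ m)" by (simp add: sum_ls comp_def)
  also have "\<dots> = (\<Sum>(i, j) | i < j & j < n. s (i, j) ^ m)" by (simp add: case_prod_beta)
  also have "\<dots> = ((\<Sum>i<n. \<Sum>j<n. s (i, j) ^ m) - (\<Sum>i<n. s (i, i) ^ m)) / 2"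
   by (rule double_sum_pairs) (simp add: s_def algebra_simps)
  also have "\<dots>:K" using dbl[of 0 0 m] diag[of 0 m]
   by (intro sf_divide[OF K] sf_diff[OF K] sf_numeral[OF K]) simp_all
  finally show ?thesis .
 qed
 have "(\<Prod>(i, j) | i < j & j < n. [:- (rs ! i + rs ! j + t * rs ! i * rs ! j), 1:]) = (\<Prod>x\<in>?L. [:- s x, 1:])"
  by (simp add: s_def case_prod_beta)
 also have "\<dots> = prod_list (map (%r. [:- r, 1:]) (map s ls))" by (simp add: prod_ls comp_def)
 also have "\<dots>:polys_over K"
  using coeffs_in_subfield[OF K pw] by (subst reflect_polys_over[OF K]) (simp only: reflect_prod_linear)
 finally show ?thesis .
qed

lemma card_pairs_less: "2 * card {(i, j). i < j & j < (n :: nat)} = n * (n - 1)"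
proof (induction n)
 case (Suc n)
 have "{(i, j). i < j & j < Suc n} = {(i, j). i < j & j < n} \<union> (%i. (i, n)) ` {..<n}" by auto
 moreover have "finite {(i, j). i < j & j < n}" by (rule finite_subset[of _ "{..<n} \<times> {..<n}"]) auto
 moreover have c: "card ((%i. (i, n)) ` {..<n}) = n" by (subst card_image) (auto simp: inj_on_def)
 moreover have "card ({(i, j). i < j & j < n} \<union> (%i. (i, n)) ` {..<n}) = card {(i, j). i < j & j < n} + card ((%i. (i, n)) ` {..<n})"
  by (rule card_Un_disjoint) (use calculation(2) in auto)
 ultimately have "card {(i, j). i < j & j < Suc n} = card {(i, j). i < j & j < n} + n" by (simp only:)
 thus ?case using Suc by (cases n) (auto simp: algebra_simps)
qed auto

text \<open>Induction on the power of 2 in the degree \<open>n\<close>: the polynomial of the pair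
  candidates has degree \<open>n (n - 1) / 2\<close>, with one factor 2 less. For every natural
  \<open>t\<close> some pair has its candidate in \<open>Z\<close>. A pair that serves two values of
  \<open>t\<close> has its sum and product in \<open>Z\<close>, and a square root of the
  discriminant then gives the root.\<close>

lemma laplace_root:
 fixes K Z :: "'a::{alg_closed_field, field_char_0} set"
 assumes K: "subfield_set K" and Z: "subfield_set Z" "K \<subseteq> Z"
  and odd: "!!p. p:polys_over K ==> odd (degree p) ==> EX x:K. poly p x = 0"
  and sqrt: "!!z. z:Z ==> EX w:Z. w * w = z"
 shows "p:polys_over K ==> degree p = 2 ^ e * m ==> odd m ==> EX z:Z. poly p z = 0"
proof (induction e arbitrary: p m)
 case 0
 thus ?case using odd[of p] Z(2) by auto
next
 case (Suc e)
 have p0: "p ~= 0" using Suc.prems by (auto simp: odd_pos)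
 obtain A where A: "size A = degree p" "p = smult (lead_coeff p) (\<Prod>x\<in>#A. [:-x, 1:])"
  using alg_closed_imp_factorization[OF p0] by blast
 obtain rs where rs: "mset rs = A" using ex_mset by blast
 define n where "n = length rs"
 have n: "n = degree p" using A(1) rs by (metis n_def size_mset)
 define F where "F = prod_list (map (%r. [:-r, 1:]) rs)"
 have pF: "p = smult (lead_coeff p) F"
  using A(2) rs by (metis F_def mset_map prod_mset_prod_list)
 have lc: "lead_coeff p ~= 0" using p0 by simp
 have "F = smult (inverse (lead_coeff p)) p" using lc by (subst (2) pF) simp
 hence F: "F:polys_over K"
  using Suc.prems(1) by (metis po_smult[OF K] polys_overD sf_inverse[OF K])
 define Lp where "Lp = {(i, j). i < j & j < n}"
 have finL: "finite Lp" unfolding Lp_def by (rule finite_subset[of _ "{..<n} \<times> {..<n}"]) auto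
 define s where "s t = (%(i, j). rs ! i + rs ! j + t * rs ! i * rs ! j)" for t
 have m2: "2 * card Lp = 2 * (2 ^ e * (m * (n - 1)))"
  unfolding Lp_def card_pairs_less using n Suc.prems(2) by simp
 have npos: "n > 0" "even n" using n Suc.prems by (auto simp: odd_pos)
 have odd': "odd (m * (n - 1))" using Suc.prems(3) npos by (auto simp: even_diff_nat)
 have "EX x:Lp. s (of_nat t) x:Z" for t :: nat
 proof -
  define Q where "Q = (\<Prod>x\<in>Lp. [:- s (of_nat t) x, 1:])"
  have "Q = (\<Prod>(i, j) | i < j & j < n. [:- (rs ! i + rs ! j + of_nat t * rs ! i * rs ! j), 1:])"
   by (simp add: Q_def s_def case_prod_beta Lp_def)
  hence "Q:polys_over K"
   using laplace_poly[OF K sf_of_nat[OF K] F[unfolded F_def], of t] by (simp add: n_def)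
  moreover have "degree Q = 2 ^ e * (m * (n - 1))"
   unfolding Q_def using m2 by (subst degree_prod_sum_eq) simp_all
  ultimately obtain z where z: "z:Z" "poly Q z = 0" using Suc.IH odd' by blast
  then obtain x where "x:Lp" "poly [:- s (of_nat t) x, 1:] z = 0"
   unfolding Q_def poly_prod using finL by (auto simp: prod_zero_iff)
  thus ?thesis using z(1) by (intro bexI[of _ x]) auto
 qed
 hence "ALL t :: nat. EX x. x:Lp & s (of_nat t) x:Z" by blast
 then obtain g where g0: "ALL t :: nat. g t:Lp & s (of_nat t) (g t):Z" unfolding choice_iff by (rule exE)
 have g: "g t:Lp" "s (of_nat t) (g t):Z" for t :: nat
  using conjunct1[OF g0[rule_format, of t]] conjunct2[OF g0[rule_format, of t]] .
 \<comment> \<open>Infinitely many \<open>t\<close> and finitely many pairs: some pair occurs for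
   two different \<open>t\<close>.\<close>
 have "range g \<subseteq> Lp" using g(1) by (rule image_subsetI)
 hence "~ inj g" using finite_subset[OF _ finL] range_inj_infinite by blast
 then obtain t1 t2 where t: "t1 ~= t2" "g t1 = g t2" by (auto simp: inj_def)
 obtain i j where ij: "g t1 = (i, j)" "i < j" "j < n" using g(1)[of t1] by (auto simp: Lp_def)
 let ?a = "rs ! i" and ?b = "rs ! j"
 define d where "d = (of_nat t1 - of_nat t2 :: 'a)"
 have d: "d ~= 0" "d:Z" using t(1) Z(1) by (auto simp: d_def intro!: sf_diff[OF Z(1)] sf_of_nat[OF Z(1)])
 have s12: "?a + ?b + of_nat t1 * ?a * ?b:Z" "?a + ?b + of_nat t2 * ?a * ?b:Z"
  using g(2)[of t1] g(2)[of t2] unfolding t(2)[symmetric] ij(1) by (simp_all add: s_def)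
 have "(?a + ?b + of_nat t1 * ?a * ?b) - (?a + ?b + of_nat t2 * ?a * ?b) = d * (?a * ?b)"
  by (simp add: d_def algebra_simps)
 hence "d * (?a * ?b):Z" using sf_diff[OF Z(1) s12] by simp
 hence ab: "?a * ?b:Z" using sf_divide[OF Z(1) _ d(2), of "d * (?a * ?b)"] d(1) by simp
 have "?a + ?b = (?a + ?b + of_nat t1 * ?a * ?b) - of_nat t1 * (?a * ?b)" by simp
 also have "\<dots>:Z" by (intro sf_diff[OF Z(1)] s12 sf_mult[OF Z(1)] ab sf_of_nat[OF Z(1)])
 finally have apb: "?a + ?b:Z" .
 have "(?a - ?b) * (?a - ?b) = (?a + ?b) * (?a + ?b) - 4 * (?a * ?b)" by (simp add: algebra_simps)
 also have "\<dots>:Z" by (intro sf_diff[OF Z(1)] sf_mult[OF Z(1)] ab apb sf_numeral[OF Z(1)])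
 finally have "(?a - ?b) * (?a - ?b):Z" .
 then obtain w where w: "w:Z" "w * w = (?a - ?b) * (?a - ?b)" using sqrt by blast
 hence "w = ?a - ?b | w = - (?a - ?b)" by (simp add: square_eq_iff)
 hence "?a - ?b:Z" using w(1) sf_minus[OF Z(1) w(1)] by auto
 hence "((?a + ?b) + (?a - ?b)) / 2:Z"
  by (rule sf_divide[OF Z(1) sf_add[OF Z(1) apb] sf_numeral[OF Z(1)]])
 hence "?a:Z" by simp
 moreover have "poly F ?a = 0"
 proof -
  have "poly (prod_list (map (%r. [:-r, 1:]) xs)) x = 0" if "x:set xs" for x :: 'a and xs
   using that by (induction xs) auto
  moreover have "?a:set rs" using ij by (simp add: n_def)
  ultimately show ?thesis unfolding F_def by blast
 qed
 hence "poly p ?a = 0" by (subst pF) simp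
 ultimately show ?case by blast
qed

lemma poly_map_poly_hom:
 assumes "h 0 = 0" "!!x y. h (x + y) = h x + h y" "!!x y. h (x * y) = h x * h y"
 shows "poly (map_poly h p) (h x) = h (poly p x)"
 by (induction p) (simp_all add: assms map_poly_pCons)

text \<open>\<open>Z\<close> is the field \<open>C(\<iota>)\<close> inside an algebraic closure. It
  is closed under square roots, so Laplace's argument applies to it over the copy of
  \<open>C\<close>.\<close>

lemma rc_complex_root:
 fixes C :: "'a::linordered_field set"
 assumes C: "rc_subfield C" and p: "p:polys_over C" "degree p > 0"
 shows "EX \<iota>::'a alg_closure. EX x:C. EX y:C. \<iota> * \<iota> = -1 & poly (map_poly to_ac p) (to_ac x + \<iota> * to_ac y) = 0"
proof -
 have CS: "subfield_set C" using C by (simp add: rc_subfield_def)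
 obtain \<iota> :: "'a alg_closure" where i: "\<iota> ^ 2 = -1"
  using nth_root_exists[of 2 "-1 :: 'a alg_closure"] by auto
 hence ii: "\<iota> * \<iota> = -1" by (simp add: power2_eq_square)
 define K where "K = to_ac ` C"
 have K: "subfield_set K" unfolding K_def by (rule subfield_image[OF CS]) simp_all
 define Z where "Z = {to_ac x + \<iota> * to_ac y | x y. x:C & y:C}"
 have ZI: "to_ac x + \<iota> * to_ac y:Z" if "x:C" "y:C" for x y using that unfolding Z_def by blast
 have KZ: "K \<subseteq> Z"
 proof
  fix k assume "k:K"
  then obtain x where "x:C" "k = to_ac x + \<iota> * to_ac 0" by (auto simp: K_def)
  thus "k:Z" using ZI[OF _ sf_0[OF CS]] by simp
 qed
 have Z: "subfield_set Z"
  unfolding subfield_set_def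
 proof (intro conjI ballI)
  show "1:Z" using KZ sf_1[OF K] by blast
 next
  fix u w assume "u:Z" "w:Z"
  then obtain a b c d where u: "u = to_ac a + \<iota> * to_ac b" "w = to_ac c + \<iota> * to_ac d"
   and abcd: "a:C" "b:C" "c:C" "d:C" unfolding Z_def by blast
  have "u - w = to_ac (a - c) + \<iota> * to_ac (b - d)" by (simp add: u algebra_simps)
  also have "\<dots>:Z" by (intro ZI sf_diff[OF CS] abcd)
  finally show "u - w:Z" .
  have "u * w = to_ac a * to_ac c + (\<iota> * \<iota>) * (to_ac b * to_ac d) + \<iota> * (to_ac a * to_ac d + to_ac b * to_ac c)"
   by (simp add: u algebra_simps)
  also have "\<dots> = to_ac (a * c - b * d) + \<iota> * to_ac (a * d + b * c)" unfolding ii by simp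
  also have "\<dots>:Z" by (intro ZI sf_diff[OF CS] sf_add[OF CS] sf_mult[OF CS] abcd)
  finally show "u * w:Z" .
 next
  fix u assume "u:Z"
  then obtain a b where u: "u = to_ac a + \<iota> * to_ac b" and ab: "a:C" "b:C" unfolding Z_def by blast
  show "inverse u:Z"
  proof (cases "a = 0 & b = 0")
   case True
   thus ?thesis using sf_0[OF K] KZ by (auto simp: u)
  next
   case False
   define n where "n = a * a + b * b"
   have n: "n ~= 0" using False by (simp add: n_def sum_squares_eq_zero_iff)
   have nC: "n:C" unfolding n_def by (intro sf_add[OF CS] sf_mult[OF CS] ab)
   have "u * (to_ac (a / n) + \<iota> * to_ac (- b / n)) =
     (to_ac a * to_ac a - (\<iota> * \<iota>) * (to_ac b * to_ac b)) / to_ac n"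
    by (simp add: u field_simps n)
   also have "\<dots> = to_ac n / to_ac n" unfolding ii by (simp add: n_def)
   also have "\<dots> = 1" using n by simp
   finally have "inverse u = to_ac (a / n) + \<iota> * to_ac (- b / n)" by (rule inverse_unique)
   also have "\<dots>:Z" by (intro ZI sf_divide[OF CS] sf_minus[OF CS] ab nC)
   finally show ?thesis .
  qed
 qed
 have sqrt: "EX w:Z. w * w = z" if "z:Z" for z
 proof -
  obtain a b where z: "z = to_ac a + \<iota> * to_ac b" and ab: "a:C" "b:C" using \<open>z:Z\<close> unfolding Z_def by blast
  have sq: "EX y:C. y * y = x" if "x:C" "x >= 0" for x using C that by (simp add: rc_subfield_def)
  obtain m0 where m0: "m0:C" "m0 * m0 = a * a + b * b"
   using sq[of "a * a + b * b"] sf_add[OF CS] sf_mult[OF CS] ab by auto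
  \<comment> \<open>\<open>m\<close> is the modulus of \<open>z\<close>. Half the sum and half the
    difference of \<open>m\<close> and \<open>a\<close> are the squares of the real and imaginary
    part of a root; the sign of the latter is fixed by \<open>2 x y' = b\<close>.\<close>
  define m where "m = \<bar>m0\<bar>"
  have m: "m:C" "m * m = a * a + b * b" "m >= 0"
   using m0 sf_minus[OF CS] by (auto simp: m_def abs_if)
  have "a\<^sup>2 <= m\<^sup>2" using m(2) by (simp add: power2_eq_square)
  hence am: "\<bar>a\<bar> <= m" using abs_le_square_iff[of a m] m(3) by simp
  hence nn: "(m + a) / 2 >= 0" "(m - a) / 2 >= 0" by (simp_all add: abs_le_iff)
  have inC: "(m + a) / 2:C" "(m - a) / 2:C"
   by (intro sf_divide[OF CS] sf_numeral[OF CS] sf_add[OF CS] sf_diff[OF CS] ab m)+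
  obtain x y where xy: "x:C" "y:C" "x * x = (m + a) / 2" "y * y = (m - a) / 2"
   using sq[OF inC(1) nn(1)] sq[OF inC(2) nn(2)] by blast
  have "(2 * x * y) * (2 * x * y) = 4 * (x * x) * (y * y)" by (simp add: algebra_simps)
  also have "\<dots> = m * m - a * a" unfolding xy by (simp add: field_simps)
  also have "\<dots> = b * b" using m(2) by simp
  finally have "2 * x * y = b | 2 * x * y = - b" by (simp only: square_eq_iff)
  then obtain y' where y': "y':C" "y' * y' = (m - a) / 2" "2 * x * y' = b"
  proof
   assume "2 * x * y = b" thus ?thesis using that xy by blast
  next
   assume "2 * x * y = - b" thus ?thesis using that[of "- y"] xy sf_minus[OF CS] by simp
  qed
  define w where "w = to_ac x + \<iota> * to_ac y'"
  have "w * w = to_ac (x * x) + (\<iota> * \<iota>) * to_ac (y' * y') + \<iota> * to_ac (2 * x * y')"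
   by (simp add: w_def algebra_simps)
  also have "\<dots> = to_ac (x * x - y' * y') + \<iota> * to_ac (2 * x * y')" unfolding ii by simp
  also have "x * x - y' * y' = a" unfolding xy y' by (simp add: field_simps)
  finally have "w * w = z" using y' by (simp add: z)
  moreover have "w:Z" unfolding w_def by (intro ZI xy y')
  ultimately show ?thesis by blast
 qed
 have odd: "EX x:K. poly q x = 0" if q: "q:polys_over K" "odd (degree q)" for q
 proof -
  define q0 where "q0 = map_poly of_ac q"
  have q0: "coeff q0 k:C" for k
  proof -
   obtain c where "c:C" "coeff q k = to_ac c" using polys_overD[OF q(1), of k] by (auto simp: K_def)
   thus ?thesis by (simp add: q0_def coeff_map_poly)
  qed
  have qq: "q = map_poly to_ac q0"
  proof (rule poly_eqI)
   fix k
   obtain c where "c:C" "coeff q k = to_ac c" using polys_overD[OF q(1), of k] by (auto simp: K_def)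
   thus "coeff q k = coeff (map_poly to_ac q0) k" by (simp add: q0_def coeff_map_poly)
  qed
  have "degree q0 = degree q" unfolding qq by (rule degree_map_poly[symmetric]) simp
  then obtain x where x: "x:C" "poly q0 x = 0"
   using C q(2) q0 unfolding rc_subfield_def polys_over_def by force
  have "poly q (to_ac x) = 0" unfolding qq by (subst poly_map_poly_hom) (simp_all add: x)
  thus ?thesis using x(1) by (auto simp: K_def)
 qed
 have pK: "map_poly to_ac p:polys_over K" using p(1) by (auto simp: polys_over_def K_def coeff_map_poly)
 have dp: "degree (map_poly to_ac p) = degree p" by (rule degree_map_poly) simp
 obtain e m where em: "degree p = 2 ^ e * m" "odd m"
  using p(2) by (metis multiplicity_decompose' dvd_refl not_is_unit_0 mult.commute neq0_conv odd_one) 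
 obtain z where "z:Z" "poly (map_poly to_ac p) z = 0"
  using laplace_root[OF K Z KZ odd sqrt pK, of e m] em dp by metis
 thus ?thesis unfolding Z_def using ii by blast
qed

text \<open>A complex root yields either a linear factor or a quadratic factor that is positive
  everywhere; dividing it out keeps a sign change and lowers the degree, unless the linear factor
  already has its root between \<open>a\<close> and \<open>b\<close>.\<close>

theorem rc_IVT:
 fixes C :: "'a::linordered_field set"
 assumes C: "rc_subfield C"
 shows "p:polys_over C ==> a:C ==> b:C ==> a < b ==> poly p a < 0 ==> poly p b > 0 ==>
  EX x:C. a < x & x < b & poly p x = 0"
proof (induction "degree p" arbitrary: p rule: less_induct)
 case less
 have CS: "subfield_set C" using C by (simp add: rc_subfield_def)
 have p0: "p ~= 0" using less.prems by auto
 have "degree p > 0"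
 proof (rule ccontr)
  assume "~ degree p > 0"
  then obtain c where "p = [:c:]" by (auto elim: degree_eq_zeroE)
  thus False using less.prems by simp
 qed
 then obtain \<iota> x y where z: "\<iota> * \<iota> = -1" "x:C" "y:C"
   "poly (map_poly to_ac p) (to_ac x + \<iota> * to_ac y) = 0"
  using rc_complex_root[OF C less.prems(1)] by blast
 show ?case
 proof (cases "y = 0")
  case True
  hence "to_ac (poly p x) = 0"
   using z(4) poly_map_poly_hom[of to_ac p x] by simp
  hence px: "poly p x = 0" by simp
  obtain s where s: "s:polys_over C" "p = [:-x, 1:] * s" using po_root_factor[OF CS less.prems(1) z(2) px] by blast
  have s0: "s ~= 0" using s p0 by auto
  hence ds: "degree s < degree p" unfolding s(2) by (subst degree_linear_mult) auto
  have val: "poly p c = (c - x) * poly s c" for c unfolding s(2) by (simp add: algebra_simps)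
  consider "a < x & x < b" | "x < a" | "b < x" using px less.prems by (metis less_irrefl linorder_neqE)
  thus ?thesis
  proof cases
   case 1
   thus ?thesis using px z(2) by blast
  next
   case 2
   hence "poly s a < 0" "poly s b > 0"
    using less.prems val by (auto simp: mult_less_0_iff zero_less_mult_iff)
   thus ?thesis using less.hyps[OF ds s(1)] less.prems val by auto
  next
   case 3
   hence "poly (- s) a < 0" "poly (- s) b > 0"
    using less.prems val by (auto simp: mult_less_0_iff zero_less_mult_iff)
   then obtain w where "w:C" "a < w" "w < b" "poly (- s) w = 0"
    using less.hyps[of "- s"] ds po_minus[OF CS s(1)] less.prems by auto
   thus ?thesis using val by auto
  qed
 next
  case False
  \<comment> \<open>The minimal polynomial of the non-real root over \<open>C\<close>. The linear
    remainder vanishes at that root, so its real and imaginary parts vanish and it is zero.\<close>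
  define q where "q = [:x * x + y * y, - 2 * x, 1:]"
  have q: "q:polys_over C" unfolding q_def
   by (intro po_pCons[OF CS] po_0[OF CS] sf_add[OF CS] sf_mult[OF CS] sf_1[OF CS] sf_minus[OF CS] sf_numeral[OF CS] z)
  have qv: "poly q c = (c - x) * (c - x) + y * y" for c by (simp add: q_def algebra_simps)
  have qpos: "poly q c > 0" for c unfolding qv by (rule add_nonneg_pos) (use False in \<open>auto simp: zero_less_mult_iff\<close>)
  obtain s r where sr: "s:polys_over C" "r:polys_over C" "p = s * q + r" "r = 0 | degree r < degree q"
   using po_divmod[OF CS q _ less.prems(1)] by (auto simp: q_def)
  let ?z = "to_ac x + \<iota> * to_ac y" and ?h = "map_poly to_ac"
  have "degree r < 2" using sr(4) by (auto simp: q_def)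
  hence "coeff r k = 0" if "k >= 2" for k using that by (intro coeff_eq_0) linarith
  hence "coeff r k = coeff [:coeff r 0, coeff r 1:] k" for k
   by (cases "k = 0 | k = 1") (auto simp: coeff_pCons split: nat.splits)
  hence "r = [:coeff r 0, coeff r 1:]" by (rule poly_eqI)
  then obtain r0 r1 where r: "r = [:r0, r1:]" by blast
  have hom: "?h (f + g) = ?h f + ?h g" "?h (f * g) = ?h f * ?h g" for f g :: "'a poly"
  proof -
   show "?h (f + g) = ?h f + ?h g" by (rule poly_eqI) (simp add: coeff_map_poly)
   show "?h (f * g) = ?h f * ?h g" by (rule poly_eqI) (simp add: coeff_map_poly coeff_mult to_ac_sum)
  qed
  have "poly (?h q) ?z = (\<iota> * \<iota> + 1) * (to_ac y * to_ac y)"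
   by (simp add: q_def map_poly_pCons algebra_simps)
  hence "poly (?h q) ?z = 0" using z(1) by simp
  hence "poly (?h r) ?z = 0" using z(4) unfolding sr(3) hom by simp
  hence "to_ac r0 + to_ac r1 * ?z = 0" by (simp add: r map_poly_pCons algebra_simps)
  hence *: "to_ac (r0 + r1 * x) = - (\<iota> * to_ac (r1 * y))" by (simp add: algebra_simps eq_neg_iff_add_eq_0)
  have "to_ac (r0 + r1 * x) * to_ac (r0 + r1 * x) = (\<iota> * \<iota>) * (to_ac (r1 * y) * to_ac (r1 * y))"
   unfolding * by (simp add: algebra_simps)
  hence "to_ac ((r0 + r1 * x) * (r0 + r1 * x) + (r1 * y) * (r1 * y)) = 0"
   unfolding z(1) by (simp only: to_ac_add to_ac_mult) simp
  hence "(r0 + r1 * x) * (r0 + r1 * x) + (r1 * y) * (r1 * y) = 0" by (simp only: to_ac_eq_0_iff)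
  hence "r0 + r1 * x = 0" "r1 * y = 0" by (simp_all only: sum_squares_eq_zero_iff)
  hence "r = 0" using False by (simp add: r)
  hence ps: "p = s * q" using sr(3) by simp
  have val: "poly p c = poly s c * poly q c" for c by (simp add: ps)
  have s0: "s ~= 0" "q ~= 0" using ps p0 by auto
  have ds: "degree s < degree p" unfolding ps using s0 by (subst degree_mult_eq) (auto simp: q_def)
  have "poly s a < 0" "poly s b > 0"
   using less.prems qpos[of a] qpos[of b] by (auto simp: val mult_less_0_iff zero_less_mult_iff)
  thus ?thesis using less.hyps[OF ds sr(1)] less.prems val by auto
 qed
qed

subsection \<open>Rolle's theorem and cuts in real closed fields\<close>

context
 fixes C :: "'a::linordered_field set"
 assumes C: "rc_subfield C"
begin

lemma rc_sf: "subfield_set C" using C by (simp add: rc_subfield_def)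

lemma rc_sign_change:
 assumes "p:polys_over C" "a:C" "b:C" "poly p a > 0 <-> ~ poly p b > 0"
 shows "EX x:C. min a b <= x & x <= max a b & poly p x = 0"
proof -
 have *: "EX x:C. a <= x & x <= b & poly p x = 0"
  if p: "p:polys_over C" and ab: "a:C" "b:C" "a <= b" "poly p a <= 0" "poly p b >= 0" for a b p
 proof (cases "poly p a = 0 | poly p b = 0")
  case True
  thus ?thesis using ab by blast
 next
  case False
  hence "a < b" "poly p a < 0" "poly p b > 0" using ab by (auto simp: order.order_iff_strict)
  thus ?thesis using rc_IVT[OF C p ab(1,2)] by (meson less_imp_le)
 qed
 have m: "- p:polys_over C" by (rule po_minus[OF rc_sf assms(1)])
 show ?thesis
 proof (cases "a <= b")
  case True
  show ?thesis
  proof (cases "poly p a > 0")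
   case pos: True
   thus ?thesis using *[OF m assms(2,3) True] assms(4) True by (auto simp: min_def max_def)
  next
   case False
   thus ?thesis using *[OF assms(1,2,3) True] assms(4) True by (auto simp: min_def max_def)
  qed
 next
  case ba: False
  hence le: "b <= a" by simp
  show ?thesis
  proof (cases "poly p a > 0")
   case pos: True
   thus ?thesis using *[OF assms(1,3,2) le] assms(4) ba by (auto simp: min_def max_def)
  next
   case False
   thus ?thesis using *[OF m assms(3,2) le] assms(4) ba by (auto simp: min_def max_def)
  qed
 qed
qed

lemma rc_factor_out:
 assumes "p:polys_over C" "p ~= 0" "a:C"
 shows "EX m. EX q:polys_over C. p = [:-a, 1:] ^ m * q & poly q a ~= 0"
 using assms
proof (induction "degree p" arbitrary: p rule: less_induct)
 case less
 show ?case
 proof (cases "poly p a = 0")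
  case True
  obtain s where s: "s:polys_over C" "p = [:-a, 1:] * s"
   using po_root_factor[OF rc_sf less.prems(1,3) True] by blast
  hence "s ~= 0" using less.prems by auto
  hence "degree s < degree p" unfolding s(2) by (subst degree_linear_mult) auto
  then obtain m q where q: "q:polys_over C" "s = [:-a, 1:] ^ m * q" "poly q a ~= 0"
   using less.hyps[OF _ s(1) \<open>s ~= 0\<close> less.prems(3)] by blast
  have "p = [:-a, 1:] ^ Suc m * q" by (simp only: s(2) q(2) power_Suc mult.assoc)
  thus ?thesis using q by blast
 next
  case False
  thus ?thesis using less.prems by (intro exI[of _ 0] bexI[of _ p]) auto
 qed
qed

text \<open>Algebraic proof: with \<open>c\<close> the next root after \<open>a\<close>, the
  cofactor \<open>q\<close> of the two root factors keeps its sign on the interval, and the relevant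
  part \<open>g\<close> of the derivative changes sign.\<close>

lemma rc_Rolle:
 assumes p: "p:polys_over C" and ab: "a:C" "b:C" "a < b" "poly p a = 0" "poly p b = 0"
 shows "EX x:C. a < x & x < b & poly (pderiv p) x = 0"
proof (cases "p = 0")
 case True
 have "(a + b) / 2:C" by (intro sf_divide[OF rc_sf] sf_add[OF rc_sf] sf_numeral[OF rc_sf] ab)
 thus ?thesis using True ab by (intro bexI[of _ "(a + b) / 2"]) auto
next
 case p0: False
 define Z where "Z = {x. poly p x = 0} \<inter> {x:C. a < x}"
 have Z: "finite Z" "b:Z" using p0 ab by (auto simp: Z_def poly_roots_finite)
 define c where "c = Min Z"
 have cZ: "c:Z" unfolding c_def using Z by (intro Min_in) auto
 hence c: "c:C" "a < c" "poly p c = 0" by (auto simp: Z_def)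
 have cb: "c <= b" unfolding c_def using Z by simp
 have min: "~ (a < x & x < c & poly p x = 0)" if "x:C" for x
 proof
  assume "a < x & x < c & poly p x = 0"
  hence "x:Z" using that by (simp add: Z_def)
  hence "c <= x" unfolding c_def using Z(1) by simp
  thus False using \<open>a < x & x < c & poly p x = 0\<close> by simp
 qed
 obtain m u where u: "u:polys_over C" "p = [:-a, 1:] ^ m * u" "poly u a ~= 0"
  using rc_factor_out[OF p p0 ab(1)] by blast
 have "m ~= 0" using u ab(4) by (cases m) auto
 then obtain i where i: "m = Suc i" by (cases m) auto
 have "u ~= 0" using u by auto
 obtain l q where q: "q:polys_over C" "u = [:-c, 1:] ^ l * q" "poly q c ~= 0"
  using rc_factor_out[OF u(1) \<open>u ~= 0\<close> c(1)] by blast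
 have "poly u c = 0" using c u(2) by auto
 hence "l ~= 0" using q by (cases l) auto
 then obtain k where k: "l = Suc k" by (cases l) auto
 have qa: "poly q a ~= 0" using u(3) q(2) by auto
 have pv: "poly p x = (x - a) ^ Suc i * ((x - c) ^ Suc k * poly q x)" for x
 proof -
  have "poly [:-y, 1:] x = x - y" for y by simp
  thus ?thesis unfolding u(2) q(2) i k poly_mult poly_power by (simp only:)
 qed
 have qsign: "poly q a > 0 <-> poly q c > 0"
 proof (rule ccontr)
  assume "~ ?thesis"
  then obtain x where x: "x:C" "a <= x" "x <= c" "poly q x = 0"
   using rc_sign_change[OF q(1) ab(1) c(1)] c(2) by auto
  hence "a < x" "x < c" using qa q(3) by (auto simp: order.order_iff_strict)
  thus False using min[OF x(1)] pv x(4) by simp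
 qed
 \<comment> \<open>\<open>g\<close> is what remains of the derivative after removing
   \<open>(x - a) ^ i * (x - c) ^ k\<close>. At \<open>a\<close> and at \<open>c\<close> two of its
   three summands vanish, which gives opposite signs.\<close>
 define g where "g = smult (of_nat (Suc i)) ([:-c, 1:] * q) + smult (of_nat (Suc k)) ([:-a, 1:] * q)
   + [:-a, 1:] * [:-c, 1:] * pderiv q"
 have lin: "[:-x, 1:]:polys_over C" if "x:C" for x
  by (intro po_pCons[OF rc_sf] sf_minus[OF rc_sf] that sf_1[OF rc_sf] po_0[OF rc_sf])
 have g: "g:polys_over C" unfolding g_def
  by (intro po_add[OF rc_sf] po_smult[OF rc_sf] po_mult[OF rc_sf] po_pderiv[OF rc_sf] sf_of_nat[OF rc_sf] lin q ab c)
 have dp: "poly (pderiv p) x = (x - a) ^ i * (x - c) ^ k * poly g x" for x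
 proof -
  have "pderiv p = pderiv ([:-a, 1:] ^ Suc i * ([:-c, 1:] ^ Suc k * q))" using u(2) q(2) i k by simp
  thus ?thesis
   by (simp only: pderiv_mult pderiv_power_Suc) (simp add: g_def pderiv_pCons algebra_simps)
 qed
 have ga: "poly g a = - (of_nat (Suc i) * (c - a)) * poly q a" by (simp add: g_def algebra_simps)
 have gc: "poly g c = (of_nat (Suc k) * (c - a)) * poly q c" by (simp add: g_def algebra_simps)
 have pos: "of_nat (Suc i) * (c - a) > 0" "of_nat (Suc k) * (c - a) > 0" using c(2) by (simp_all del: of_nat_Suc)
 have gne: "poly g a ~= 0" "poly g c ~= 0" unfolding ga gc using qa q(3) pos by (auto simp del: of_nat_Suc)
 have "poly g a > 0 <-> ~ poly g c > 0"
  unfolding ga gc using pos qsign qa q(3)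
  by (auto simp: zero_less_mult_iff mult_less_0_iff simp del: of_nat_Suc)
 then obtain x where x: "x:C" "a <= x" "x <= c" "poly g x = 0"
  using rc_sign_change[OF g ab(1) c(1)] c(2) by auto
 hence "a < x" "x < c" using gne by (auto simp: order.order_iff_strict)
 thus ?thesis using x cb dp by (intro bexI[of _ x]) auto
qed

text \<open>Without critical points inside, Rolle leaves at most one root in the interval, so the
  sign is constant on each side of \<open>x\<close>; that the two signs differ needs a second use of
  Rolle.\<close>

lemma rc_crossing:
 assumes p: "p:polys_over C" and z: "z1:C" "z2:C" "x:C" "z1 < x" "x < z2"
  and px: "poly p x = 0" and ne: "poly p z1 ~= 0" "poly p z2 ~= 0"
  and d: "!!w. w:C ==> z1 < w ==> w < z2 ==> poly (pderiv p) w ~= 0"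
 shows "poly p z1 > 0 <-> ~ poly p z2 > 0"
  and "e:C ==> z1 <= e ==> e < x ==> poly p e > 0 <-> poly p z1 > 0"
  and "e:C ==> x < e ==> e <= z2 ==> poly p e > 0 <-> poly p z2 > 0"
proof -
 have uniq: "y = x" if y: "y:C" "z1 <= y" "y <= z2" "poly p y = 0" for y
 proof (rule ccontr)
  assume "y ~= x"
  then consider "y < x" | "x < y" by fastforce
  thus False
  proof cases
   case 1
   thus False using rc_Rolle[OF p y(1) z(3) 1 y(4) px] d y z by fastforce
  next
   case 2
   thus False using rc_Rolle[OF p z(3) y(1) 2 px y(4)] d y z by fastforce
  qed
 qed
 show "e:C ==> z1 <= e ==> e < x ==> poly p e > 0 <-> poly p z1 > 0"
 proof (rule ccontr)
  assume e: "e:C" "z1 <= e" "e < x" and "~ (poly p e > 0 <-> poly p z1 > 0)"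
  then obtain y where "y:C" "z1 <= y" "y <= e" "poly p y = 0"
   using rc_sign_change[OF p z(1) e(1)] by auto
  thus False using uniq[of y] e z by auto
 qed
 show "e:C ==> x < e ==> e <= z2 ==> poly p e > 0 <-> poly p z2 > 0"
 proof (rule ccontr)
  assume e: "e:C" "x < e" "e <= z2" and "~ (poly p e > 0 <-> poly p z2 > 0)"
  then obtain y where "y:C" "e <= y" "y <= z2" "poly p y = 0"
   using rc_sign_change[OF p e(1) z(2)] by auto
  thus False using uniq[of y] e z by auto
 qed
 have no: False if p: "q:polys_over C" and q: "poly q x = 0" "poly q z1 > 0" "poly q z2 > 0"
  and dq: "!!w. w:C ==> z1 < w ==> w < z2 ==> poly (pderiv q) w ~= 0" for q
 proof -
  \<comment> \<open>If both ends were positive, lowering the polynomial by a level below both end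
    values would produce a root on either side of \<open>x\<close>, hence a critical point between
    them.\<close>
  define \<mu> where "\<mu> = min (poly q z1) (poly q z2) / 2"
  have mu: "\<mu>:C" unfolding \<mu>_def min_def
   using po_poly[OF rc_sf p z(1)] po_poly[OF rc_sf p z(2)] sf_divide[OF rc_sf _ sf_numeral[OF rc_sf]] by auto
  have mup: "\<mu> > 0" "\<mu> < poly q z1" "\<mu> < poly q z2" using q by (auto simp: \<mu>_def min_def)
  define f where "f = q - [:\<mu>:]"
  have f: "f:polys_over C" unfolding f_def
   by (intro po_diff[OF rc_sf] p po_pCons[OF rc_sf] mu po_0[OF rc_sf])
  have fv: "poly f w = poly q w - \<mu>" for w by (simp add: f_def)
  obtain y1 where y1: "y1:C" "z1 <= y1" "y1 <= x" "poly f y1 = 0"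
   using rc_sign_change[OF f z(1) z(3)] z(4) mup q by (auto simp: fv)
  obtain y2 where y2: "y2:C" "x <= y2" "y2 <= z2" "poly f y2 = 0"
   using rc_sign_change[OF f z(3) z(2)] z(5) mup q by (auto simp: fv)
  have "y1 ~= x" "y2 ~= x" using y1(4) y2(4) mup q by (auto simp: fv)
  hence "y1 < y2" using y1(3) y2(2) by simp
  then obtain w where w: "w:C" "y1 < w" "w < y2" "poly (pderiv f) w = 0"
   using rc_Rolle[OF f y1(1) y2(1) _ y1(4) y2(4)] by blast
  have "pderiv f = pderiv q" by (simp add: f_def pderiv_diff pderiv_pCons)
  thus False using dq[OF w(1)] w y1(2) y2(3) by auto
 qed
 show "poly p z1 > 0 <-> ~ poly p z2 > 0"
 proof (rule ccontr)
  assume *: "~ ?thesis"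
  show False
  proof (cases "poly p z1 > 0")
   case True
   thus False using no[OF p px] * d by blast
  next
   case False
   hence "poly (- p) z1 > 0" "poly (- p) z2 > 0" using * ne by auto
   thus False using no[OF po_minus[OF rc_sf p]] px d by (auto simp: pderiv_minus)
  qed
 qed
qed

end

subsection \<open>Partial isomorphisms of ordered fields\<close>

text \<open>The sign condition, applied to differences, makes the relation single-valued and
  injective; it is an isomorphism of ordered subfields, kept symmetric so that arguments can be
  inverted.\<close>

definition ofield_rel :: "('a::linordered_field \<times> 'a) set => bool" where
 "ofield_rel R <-> (1, 1):R &
   (ALL x x' y y'. (x, x'):R --> (y, y'):R --> (x - y, x' - y'):R & (x * y, x' * y'):R) &
   (ALL x x'. (x, x'):R --> (inverse x, inverse x'):R) &
   (ALL x x'. (x, x'):R --> 0 < x <-> 0 < x')"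

definition pairpoly :: "('a::zero \<times> 'a) set => 'a poly => 'a poly => bool" where
 "pairpoly R p p' <-> (ALL i. (coeff p i, coeff p' i):R)"

lemma ofield_rel_converse: "ofield_rel R ==> ofield_rel (R\<inverse>)"
 by (auto simp: ofield_rel_def)

lemma pairpoly_converse: "pairpoly R p p' ==> pairpoly (R\<inverse>) p' p"
 by (simp add: pairpoly_def)

context
 fixes R :: "('a::linordered_field \<times> 'a) set"
 assumes R: "ofield_rel R"
begin

lemma or_1: "(1, 1):R" using R by (simp add: ofield_rel_def)
lemma or_diff: "(x, x'):R ==> (y, y'):R ==> (x - y, x' - y'):R" using R by (simp add: ofield_rel_def)
lemma or_mult: "(x, x'):R ==> (y, y'):R ==> (x * y, x' * y'):R" using R by (simp add: ofield_rel_def)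
lemma or_inverse: "(x, x'):R ==> (inverse x, inverse x'):R" using R by (simp add: ofield_rel_def)
lemma or_pos: "(x, x'):R ==> 0 < x <-> 0 < x'" using R by (auto simp: ofield_rel_def)
lemma or_0: "(0, 0):R" using or_diff[OF or_1 or_1] by simp
lemma or_minus: "(x, x'):R ==> (- x, - x'):R" using or_diff[OF or_0, of x x'] by simp
lemma or_add: "(x, x'):R ==> (y, y'):R ==> (x + y, x' + y'):R"
 using or_diff[of x x' "- y" "- y'"] or_minus[of y y'] by simp
lemma or_divide: "(x, x'):R ==> (y, y'):R ==> (x / y, x' / y'):R"
 by (simp add: divide_inverse or_mult or_inverse)
lemma or_power: "(x, x'):R ==> (x ^ n, x' ^ n):R" by (induction n) (auto intro: or_mult or_1)
lemma or_of_nat: "(of_nat n, of_nat n):R" by (induction n) (auto intro: or_add or_0 or_1)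
lemma or_numeral: "(numeral n, numeral n):R" using or_of_nat[of "numeral n"] by simp
lemma or_neg: "(x, x'):R ==> x < 0 <-> x' < 0" using or_pos[OF or_minus, of x x'] by simp
lemma or_zero: "(x, x'):R ==> x = 0 <-> x' = 0" using or_pos[of x x'] or_neg[of x x'] by force
lemma or_less: "(x, x'):R ==> (y, y'):R ==> x < y <-> x' < y'" using or_pos[OF or_diff, of y y' x x'] by simp
lemma or_le: "(x, x'):R ==> (y, y'):R ==> x <= y <-> x' <= y'" using or_less[of y y' x x'] by force
lemma or_eq: "(x, x'):R ==> (y, y'):R ==> x = y <-> x' = y'" using or_zero[OF or_diff, of x x' y y'] by simp
lemma or_abs: "(x, x'):R ==> (\<bar>x\<bar>, \<bar>x'\<bar>):R" using or_neg[of x x'] or_minus[of x x'] by (auto simp: abs_if)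
lemma or_sum: "(!!i. i:I ==> (f i, f' i):R) ==> (sum f I, sum f' I):R"
 by (induction I rule: infinite_finite_induct) (auto intro: or_add or_0)

lemma or_dom: "subfield_set (fst ` R)"
 unfolding subfield_set_def
proof (intro conjI ballI)
 show "1:fst ` R" using image_eqI[OF _ or_1, of 1 fst] by simp
 fix x assume "x:fst ` R"
 then obtain x' where x: "(x, x'):R" by auto
 show "inverse x:fst ` R" using image_eqI[OF _ or_inverse[OF x], of _ fst] by simp
 fix y assume "y:fst ` R"
 then obtain y' where y: "(y, y'):R" by auto
 show "x - y:fst ` R" using image_eqI[OF _ or_diff[OF x y], of _ fst] by simp
 show "x * y:fst ` R" using image_eqI[OF _ or_mult[OF x y], of _ fst] by simp
qed

lemma pp_0: "pairpoly R 0 0" by (simp add: pairpoly_def or_0)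
lemma pp_add: "pairpoly R p p' ==> pairpoly R q q' ==> pairpoly R (p + q) (p' + q')"
 by (simp add: pairpoly_def or_add)
lemma pp_diff: "pairpoly R p p' ==> pairpoly R q q' ==> pairpoly R (p - q) (p' - q')"
 by (simp add: pairpoly_def or_diff)
lemma pp_mult: "pairpoly R p p' ==> pairpoly R q q' ==> pairpoly R (p * q) (p' * q')"
 by (auto simp: pairpoly_def coeff_mult intro!: or_sum or_mult)
lemma pp_smult: "(a, a'):R ==> pairpoly R p p' ==> pairpoly R (smult a p) (smult a' p')"
 by (simp add: pairpoly_def or_mult)
lemma pp_pCons: "(a, a'):R ==> pairpoly R p p' ==> pairpoly R (pCons a p) (pCons a' p')"
 by (auto simp: pairpoly_def coeff_pCons split: nat.splits)
lemma pp_pderiv: "pairpoly R p p' ==> pairpoly R (pderiv p) (pderiv p')"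
 by (simp add: pairpoly_def coeff_pderiv or_mult or_add or_1 or_of_nat)
lemma pp_coeff_zero: "pairpoly R p p' ==> coeff p i = 0 <-> coeff p' i = 0"
 unfolding pairpoly_def by (rule or_zero) blast
lemma pp_degree: "pairpoly R p p' ==> degree p = degree p'"
 unfolding degree_def by (simp add: pp_coeff_zero)
lemma pp_zero: "pairpoly R p p' ==> p = 0 <-> p' = 0"
 unfolding poly_eq_iff by (simp add: pp_coeff_zero)
lemma pp_poly: "pairpoly R p p' ==> (x, x'):R ==> (poly p x, poly p' x'):R"
 unfolding poly_altdef using pp_degree[of p p']
 by (auto simp: pairpoly_def intro!: or_sum or_mult or_power)

lemma pp_exists: "p:polys_over (fst ` R) ==> EX p'. pairpoly R p p'"
proof (induction p)
 case 0
 thus ?case using pp_0 by blast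
next
 case (pCons a p)
 have "coeff p i:fst ` R" for i using polys_overD[OF pCons.prems, of "Suc i"] by simp
 then obtain p' where "pairpoly R p p'" using pCons.IH by (auto simp: polys_over_def)
 moreover obtain a' where "(a, a'):R" using polys_overD[OF pCons.prems, of 0] by auto
 ultimately show ?case using pp_pCons by blast
qed

lemma pp_dom: "pairpoly R p p' ==> p:polys_over (fst ` R)"
 by (force simp: pairpoly_def polys_over_def)

lemma pp_root_factor:
 assumes "pairpoly R p p'" "(a, a'):R" "poly p a = 0"
 shows "EX q q'. pairpoly R q q' & p = [:-a, 1:] * q"
proof -
 have "a:fst ` R" using assms by force
 then obtain q where "q:polys_over (fst ` R)" "p = [:-a, 1:] * q"
  using po_root_factor[OF or_dom pp_dom[OF assms(1)] _ assms(3)] by blast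
 thus ?thesis using pp_exists by blast
qed

end

lemma or_ran: "ofield_rel R ==> subfield_set (snd ` R)"
 using or_dom[OF ofield_rel_converse] by (simp add: Domain_fst[symmetric] Range_snd[symmetric])

lemma poly_root_degree_pos: "p ~= 0 ==> poly p x = 0 ==> 0 < degree p"
 by (rule ccontr) (auto elim!: degree_eq_zeroE)

text \<open>The bound is built from the coefficients by field operations and absolute values, so a
  partial isomorphism carries it along with the polynomial; that is how
  \<open>rc_root_transfer\<close> uses it.\<close>

lemma cauchy_bound:
 fixes p :: "'a::linordered_field poly"
 assumes "p ~= 0" "poly p x = 0"
 shows "\<bar>x\<bar> <= 1 + (\<Sum>i<degree p. \<bar>coeff p i / lead_coeff p\<bar>)"
proof (rule ccontr)
 define n where "n = degree p"
 define S where "S = (\<Sum>i<n. \<bar>coeff p i / lead_coeff p\<bar>)"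
 assume "~ ?thesis"
 hence x: "\<bar>x\<bar> > 1 + S" by (simp add: S_def n_def)
 have S0: "S >= 0" unfolding S_def by (rule sum_nonneg) simp
 have lc: "lead_coeff p ~= 0" using assms by simp
 have "n ~= 0" using poly_root_degree_pos[OF assms] by (simp add: n_def)
 then obtain m where m: "n = Suc m" by (cases n) auto
 have x1: "1 <= \<bar>x\<bar>" using x S0 by simp
 have "0 = poly p x / lead_coeff p" using assms by simp
 also have "\<dots> = (\<Sum>i\<le>n. coeff p i / lead_coeff p * x ^ i)"
  by (simp add: poly_altdef n_def sum_divide_distrib)
 also have "\<dots> = (\<Sum>i<n. coeff p i / lead_coeff p * x ^ i) + x ^ n"
  using lc by (simp add: lessThan_Suc_atMost[symmetric] n_def)
 finally have "x ^ n = - (\<Sum>i<n. coeff p i / lead_coeff p * x ^ i)" by (simp add: eq_neg_iff_add_eq_0 add.commute)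
 hence "\<bar>x\<bar> ^ n = \<bar>\<Sum>i<n. coeff p i / lead_coeff p * x ^ i\<bar>" by (metis abs_minus_cancel power_abs)
 also have "\<dots> <= (\<Sum>i<n. \<bar>coeff p i / lead_coeff p * x ^ i\<bar>)" by (rule sum_abs)
 also have "\<dots> <= (\<Sum>i<n. \<bar>coeff p i / lead_coeff p\<bar> * \<bar>x\<bar> ^ m)"
 proof (rule sum_mono)
  fix i assume "i:{..<n}"
  hence "\<bar>x\<bar> ^ i <= \<bar>x\<bar> ^ m" using x1 m by (intro power_increasing) auto
  thus "\<bar>coeff p i / lead_coeff p * x ^ i\<bar> <= \<bar>coeff p i / lead_coeff p\<bar> * \<bar>x\<bar> ^ m"
   unfolding abs_mult power_abs by (rule mult_left_mono) simp
 qed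
 also have "\<dots> = S * \<bar>x\<bar> ^ m" by (simp add: S_def sum_distrib_right)
 finally have "\<bar>x\<bar> * \<bar>x\<bar> ^ m <= S * \<bar>x\<bar> ^ m" by (simp add: m)
 moreover have "\<bar>x\<bar> ^ m > 0" using x1 by simp
 ultimately have "\<bar>x\<bar> <= S" by (simp only: mult_le_cancel_right_pos)
 thus False using x by simp
qed

definition same_cut :: "('a::linorder \<times> 'a) set => 'a => 'a => bool" where
 "same_cut H c c' <-> (ALL b b'. (b, b'):H --> (b < c <-> b' < c') & b ~= c & b' ~= c')"

text \<open>As far as finitely many points are concerned, \<open>c\<close> can be replaced by an
  element of the domain: a midpoint of its two neighbours, or an extreme point moved by 1.\<close>

lemma cut_approx:
 fixes H :: "('a::linordered_field \<times> 'a) set"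
 assumes H: "ofield_rel H" and Z: "finite Z" "Z \<subseteq> fst ` H" and Zc: "!!z. z:Z ==> z ~= c"
 shows "EX e e'. (e, e'):H & (ALL z:Z. z ~= e & (z < e <-> z < c))"
proof -
 have that: ?thesis if "(e, e'):H" "!!z. z:Z ==> z ~= e & (z < e <-> z < c)" for e e'
  using that by blast
 let ?l = "{z:Z. z < c}" and ?u = "{z:Z. z > c}"
 have fin: "finite ?l" "finite ?u" using Z(1) by auto
 have inH: "EX m'. (m, m'):H" if "m:Z" for m using that Z(2) by force
 consider "?l = {}" "?u = {}" | "?l ~= {}" "?u = {}" | "?l = {}" "?u ~= {}" | "?l ~= {}" "?u ~= {}" by blast
 thus ?thesis
 proof cases
  case 1
  hence "Z = {}" using Zc by (auto simp: neq_iff)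
  thus ?thesis using that[OF or_0[OF H]] by simp
 next
  case 2
  define m where "m = Max ?l"
  have "m:?l" unfolding m_def using Max_in[OF fin(1) 2(1)] .
  then obtain m' where m': "(m, m'):H" using inH by blast
  have "z ~= m + 1 & (z < m + 1 <-> z < c)" if "z:Z" for z
  proof -
   have "z < c" using Zc[OF that] 2(2) that by (auto simp: neq_iff)
   hence "z <= m" unfolding m_def using fin(1) that by simp
   thus ?thesis using \<open>z < c\<close> by (auto intro: le_less_trans simp: less_add_one)
  qed
  thus ?thesis using that[OF or_add[OF H m' or_1[OF H]]] by blast
 next
  case 3
  define m where "m = Min ?u"
  have "m:?u" unfolding m_def using Min_in[OF fin(2) 3(2)] .
  then obtain m' where m': "(m, m'):H" using inH by blast
  have "z ~= m - 1 & (z < m - 1 <-> z < c)" if "z:Z" for z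
  proof -
   have "c < z" using Zc[OF that] 3(1) that by (auto simp: neq_iff)
   hence "m <= z" unfolding m_def using fin(2) that by simp
   moreover have "m - 1 < m" by simp
   ultimately show ?thesis using \<open>c < z\<close> by auto
  qed
  thus ?thesis using that[OF or_diff[OF H m' or_1[OF H]]] by blast
 next
  case 4
  define m where "m = Max ?l"
  have ml: "m:?l" unfolding m_def using Max_in[OF fin(1) 4(1)] .
  then obtain m' where m': "(m, m'):H" using inH by blast
  define n where "n = Min ?u"
  have nu: "n:?u" unfolding n_def using Min_in[OF fin(2) 4(2)] .
  then obtain n' where n': "(n, n'):H" using inH by blast
  have mn: "m < (m + n) / 2" "(m + n) / 2 < n" using ml nu by auto
  have "z ~= (m + n) / 2 & (z < (m + n) / 2 <-> z < c)" if "z:Z" for z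
  proof (cases "z < c")
   case True
   hence "z <= m" unfolding m_def using fin(1) that by simp
   thus ?thesis using True mn by auto
  next
   case False
   hence "c < z" using Zc[OF that] by auto
   hence "n <= z" unfolding n_def using fin(2) that by simp
   thus ?thesis using False mn by auto
  qed
  thus ?thesis using that[OF or_divide[OF H or_add[OF H m' n'] or_numeral[OF H]]] by blast
 qed
qed

text \<open>All roots of the two polynomials in \<open>C\<close> are in the domain and range. An
  element \<open>e\<close> on the same side of each root of \<open>p\<close> as \<open>c\<close> has
  no root between itself and \<open>c\<close>, and the sign at \<open>e\<close> is preserved by the
  isomorphism.\<close>

lemma rc_sign_transfer:
 fixes C :: "'a::linordered_field set"
 assumes C: "rc_subfield C" and H: "ofield_rel H" "H \<subseteq> C \<times> C" and c: "c:C" "c':C" "same_cut H c c'"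
  and p: "pairpoly H p p'" "p ~= 0"
  and roots: "!!x. x:C ==> poly p x = 0 ==> x:fst ` H" "!!x. x:C ==> poly p' x = 0 ==> x:snd ` H"
 shows "poly p c > 0 <-> poly p' c' > 0" "poly p c ~= 0" "poly p' c' ~= 0"
proof -
 have po: "p:polys_over C" "p':polys_over C" using p(1) H(2) by (auto simp: pairpoly_def polys_over_def)
 define Z where "Z = {z. poly p z = 0} \<inter> fst ` H"
 have Z: "finite Z" using p(2) by (simp add: Z_def poly_roots_finite)
 have cH: "c ~: fst ` H" "c' ~: snd ` H" using c(3) by (force simp: same_cut_def)+
 have Zc: "z ~= c" if "z:Z" for z using that cH by (auto simp: Z_def)
 have Zs: "Z \<subseteq> fst ` H" by (simp add: Z_def)
 obtain e e' where e: "(e, e'):H" and esep: "!!z. z:Z ==> z ~= e & (z < e <-> z < c)"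
  using cut_approx[OF H(1) Z Zs, of c] Zc by blast
 have eC: "e:C" "e':C" using e H(2) by auto
 have 1: "poly p e > 0 <-> poly p c > 0"
 proof (rule ccontr)
  assume "~ ?thesis"
  then obtain x where x: "x:C" "min e c <= x" "x <= max e c" "poly p x = 0"
   using rc_sign_change[OF C po(1) eC(1) c(1)] by blast
  hence xZ: "x:Z" using roots(1) by (simp add: Z_def)
  thus False using esep[OF xZ] Zc[OF xZ] x by (auto simp: min_def max_def split: if_splits)
 qed
 have 2: "poly p' e' > 0 <-> poly p' c' > 0"
 proof (rule ccontr)
  assume "~ ?thesis"
  then obtain x' where x: "x':C" "min e' c' <= x'" "x' <= max e' c'" "poly p' x' = 0"
   using rc_sign_change[OF C po(2) eC(2) c(2)] by blast
  then obtain x where xx: "(x, x'):H" using roots(2) by force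
  hence "poly p x = 0" using or_zero[OF H(1) pp_poly[OF H(1) p(1) xx]] x(4) by simp
  hence xZ: "x:Z" using xx by (force simp: Z_def)
  have "x' ~= e'" "x' < e' <-> x < e" "x' < c' <-> x < c" "x' ~= c'"
   using or_eq[OF H(1) xx e] esep[OF xZ] or_less[OF H(1) xx e] c(3) xx by (auto simp: same_cut_def)
  thus False using esep[OF xZ] x by (auto simp: min_def max_def split: if_splits)
 qed
 show "poly p c > 0 <-> poly p' c' > 0" using 1 2 or_pos[OF H(1) pp_poly[OF H(1) p(1) e]] by simp
 show "poly p c ~= 0" using roots(1)[OF c(1)] cH by blast
 show "poly p' c' ~= 0" using roots(2)[OF c(2)] cH by blast
qed

text \<open>Since \<open>p\<close> has least degree among polynomials with missing roots, the roots
  of its derivative are in the domain. Between two neighbouring ones \<open>p\<close> has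
  \<open>x\<close> as its only root, located by a sign change, and the sign change is visible on the
  other side too.\<close>

lemma rc_root_transfer:
 fixes C :: "'a::linordered_field set"
 assumes C: "rc_subfield C" and H: "ofield_rel H" "H \<subseteq> C \<times> C"
  and p: "pairpoly H p p'" "p ~= 0" and x: "x:C" "poly p x = 0" "x ~: fst ` H"
  and low: "!!q q' y. pairpoly H q q' ==> q ~= 0 ==> degree q < degree p ==> y:C ==>
    (poly q y = 0 --> y:fst ` H) & (poly q' y = 0 --> y:snd ` H)"
 shows "EX x':C. poly p' x' = 0 & same_cut H x x'"
proof -
 have po: "p:polys_over C" "p':polys_over C" using p(1) H(2) by (auto simp: pairpoly_def polys_over_def)
 have dpos: "degree p > 0" by (rule poly_root_degree_pos[OF p(2) x(2)])
 have norootH: "poly p b ~= 0" if b: "(b, b'):H" for b b'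
 proof
  assume "poly p b = 0"
  then obtain s s' where s: "pairpoly H s s'" "p = [:-b, 1:] * s" using pp_root_factor[OF H(1) p(1) b] by blast
  hence "s ~= 0" using p(2) by auto
  hence "degree s < degree p" unfolding s(2) by (subst degree_linear_mult) auto
  moreover have "poly s x = 0"
   using x(2,3) b unfolding s(2) by (auto simp: image_iff)
  ultimately show False using low[OF s(1) \<open>s ~= 0\<close> _ x(1)] x(3) by blast
 qed
 have norootH': "poly p' b' ~= 0" if b: "(b, b'):H" for b b'
  using or_zero[OF H(1) pp_poly[OF H(1) p(1) b]] norootH[OF b] by simp
 have pd: "pairpoly H (pderiv p) (pderiv p')" by (rule pp_pderiv[OF H(1) p(1)])
 have pd0: "pderiv p ~= 0" "degree (pderiv p) < degree p"
  using dpos by (simp_all add: pderiv_eq_0_iff degree_pderiv)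
 define D where "D = {d. poly (pderiv p) d = 0} \<inter> fst ` H"
 have D: "finite D" using pd0 by (simp add: D_def poly_roots_finite)
 have xD: "x ~: D" using x(3) by (simp add: D_def)
 have rootD: "d:D" if "d:C" "poly (pderiv p) d = 0" for d
  using low[OF pd pd0 that(1)] that by (simp add: D_def)
 \<comment> \<open>The root bound plus 1 replaces a neighbouring critical point when there is none
   on that side of \<open>x\<close>.\<close>
 define \<beta> where "\<beta> = 1 + (\<Sum>i<degree p. \<bar>coeff p i / lead_coeff p\<bar>)"
 have \<beta>: "\<bar>x\<bar> < \<beta> + 1" using cauchy_bound[OF p(2) x(2)] by (simp add: \<beta>_def less_add_one le_less_trans)
 have "(\<beta>, 1 + (\<Sum>i<degree p. \<bar>coeff p' i / coeff p' (degree p)\<bar>)):H" unfolding \<beta>_def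
  using p(1) by (intro or_add[OF H(1)] or_1[OF H(1)] or_sum[OF H(1)] or_abs[OF H(1)] or_divide[OF H(1)]) (auto simp: pairpoly_def)
 then obtain \<beta>' where \<beta>H: "(\<beta> + 1, \<beta>'):H" using or_add[OF H(1) _ or_1[OF H(1)]] by blast
 have inH: "EX d'. (d, d'):H" if "d:D" for d using that by (auto simp: D_def)
 obtain z1 z1' where z1: "(z1, z1'):H" "z1 < x" "!!d. d:D ==> d < x ==> d <= z1"
 proof (cases "{d:D. d < x} = {}")
  case True
  show thesis by (rule that[OF or_minus[OF H(1) \<beta>H]]) (use \<beta> True in \<open>auto simp: abs_if split: if_splits\<close>)
 next
  case False
  have "Max {d:D. d < x}:{d:D. d < x}" using D False by (intro Max_in) auto
  moreover from this obtain m' where "(Max {d:D. d < x}, m'):H" using inH by blast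
  ultimately show thesis using that D by auto
 qed
 obtain z2 z2' where z2: "(z2, z2'):H" "x < z2" "!!d. d:D ==> x < d ==> z2 <= d"
 proof (cases "{d:D. x < d} = {}")
  case True
  show thesis by (rule that[OF \<beta>H]) (use \<beta> True in \<open>auto simp: abs_if split: if_splits\<close>)
 next
  case False
  have "Min {d:D. x < d}:{d:D. x < d}" using D False by (intro Min_in) auto
  moreover from this obtain m' where "(Min {d:D. x < d}, m'):H" using inH by blast
  ultimately show thesis using that D by auto
 qed
 have zC: "z1:C" "z1':C" "z2:C" "z2':C" using z1 z2 H(2) by auto
 have noD: "poly (pderiv p) w ~= 0" if "w:C" "z1 < w" "w < z2" for w
 proof
  assume "poly (pderiv p) w = 0"
  hence "w:D" using rootD that by blast
  thus False using z1(3)[of w] z2(3)[of w] that xD by (metis leD linorder_neqE)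
 qed
 have cr: "poly p z1 > 0 <-> ~ poly p z2 > 0"
  "!!e. e:C ==> z1 <= e ==> e < x ==> poly p e > 0 <-> poly p z1 > 0"
  "!!e. e:C ==> x < e ==> e <= z2 ==> poly p e > 0 <-> poly p z2 > 0"
  using rc_crossing[OF C po(1) zC(1,3) x(1) z1(2) z2(2) x(2) norootH[OF z1(1)] norootH[OF z2(1)]] noD
  by blast+
 have zz': "z1' < z2'" using or_less[OF H(1) z1(1) z2(1)] z1(2) z2(2) by simp
 have sg: "poly p z1 > 0 <-> poly p' z1' > 0" "poly p z2 > 0 <-> poly p' z2' > 0"
  using or_pos[OF H(1) pp_poly[OF H(1) p(1)]] z1(1) z2(1) by blast+
 have "poly p' z1' > 0 <-> ~ poly p' z2' > 0" using cr(1) sg by simp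
 then obtain x' where x': "x':C" "min z1' z2' <= x'" "x' <= max z1' z2'" "poly p' x' = 0"
  using rc_sign_change[OF C po(2) zC(2,4)] by blast
 have x'z: "z1' < x'" "x' < z2'"
  using x' zz' norootH'[OF z1(1)] norootH'[OF z2(1)] by (auto simp: order.order_iff_strict)
 have noD': "poly (pderiv p') w' ~= 0" if w': "w':C" "z1' < w'" "w' < z2'" for w'
 proof
  assume 0: "poly (pderiv p') w' = 0"
  then obtain w where w: "(w, w'):H" using low[OF pd pd0 w'(1)] by auto
  hence "poly (pderiv p) w = 0" using or_zero[OF H(1) pp_poly[OF H(1) pd w]] 0 by simp
  moreover have "z1 < w" "w < z2" using or_less[OF H(1) z1(1) w] or_less[OF H(1) w z2(1)] w' by auto
  moreover have "w:C" using w H(2) by auto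
  ultimately show False using noD by blast
 qed
 have cr': "poly p' z1' > 0 <-> ~ poly p' z2' > 0"
  "!!e. e:C ==> z1' <= e ==> e < x' ==> poly p' e > 0 <-> poly p' z1' > 0"
  "!!e. e:C ==> x' < e ==> e <= z2' ==> poly p' e > 0 <-> poly p' z2' > 0"
  using rc_crossing[OF C po(2) zC(2,4) x'(1) x'z x'(4) norootH'[OF z1(1)] norootH'[OF z2(1)]] noD'
  by blast+
 have "(b < x <-> b' < x') & b ~= x & b' ~= x'" if b: "(b, b'):H" for b b'
 proof -
  have ne: "b ~= x" "b' ~= x'" using norootH[OF b] norootH'[OF b] x(2) x'(4) by auto
  have bC: "b:C" "b':C" using b H(2) by auto
  have sb: "poly p b > 0 <-> poly p' b' > 0" by (rule or_pos[OF H(1) pp_poly[OF H(1) p(1) b]])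
  have le: "z1 <= b <-> z1' <= b'" "b <= z2 <-> b' <= z2'" using or_le[OF H(1)] z1(1) z2(1) b by blast+
  consider "b < z1" | "z2 < b" | "z1 <= b" "b <= z2" by fastforce
  hence "b < x <-> b' < x'"
  proof cases
   case 1
   thus ?thesis using le z1(2) x'z by auto
  next
   case 2
   thus ?thesis using le z2(2) x'z by auto
  next
   case 3
   thus ?thesis using cr(1) cr(2)[OF bC(1)] cr(3)[OF bC(1)] cr'(2)[OF bC(2)] cr'(3)[OF bC(2)] sb sg ne le
    by (metis linorder_neqE)
  qed
  thus ?thesis using ne by blast
 qed
 thus ?thesis using x' by (auto simp: same_cut_def)
qed

section \<open>Henselian valuations with real closed residue field\<close>

definition adjoin :: "'a::field set => 'a => 'a set" where
 "adjoin A x = {poly p x / poly q x | p q. p:polys_over A & q:polys_over A & poly q x ~= 0}"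

lemma adjoin_subfield:
 assumes A: "subfield_set A"
 shows "subfield_set (adjoin A x)" "A \<subseteq> adjoin A x" "x:adjoin A x"
proof -
 have I: "poly p x / poly q x:adjoin A x" if "p:polys_over A" "q:polys_over A" for p q
 proof (cases "poly q x = 0")
  case True
  thus ?thesis unfolding adjoin_def
   using po_0[OF A] po_pCons[OF A sf_1[OF A] po_0[OF A]] by (intro CollectI exI[of _ 0] exI[of _ "[:1:]"]) auto
 next
  case False
  thus ?thesis unfolding adjoin_def using that by blast
 qed
 have I1: "poly p x:adjoin A x" if "p:polys_over A" for p
  using I[OF that po_pCons[OF A sf_1[OF A] po_0[OF A]]] by simp
 show "A \<subseteq> adjoin A x"
 proof
  fix a assume "a:A"
  thus "a:adjoin A x" using I1[OF po_pCons[OF A _ po_0[OF A]], of a] by simp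
 qed
 show "x:adjoin A x" using I1[OF po_pCons[OF A sf_0[OF A] po_pCons[OF A sf_1[OF A] po_0[OF A]]]] by simp
 show "subfield_set (adjoin A x)"
  unfolding subfield_set_def
 proof (intro conjI ballI)
  show "1:adjoin A x" using I1[OF po_pCons[OF A sf_1[OF A] po_0[OF A]]] by simp
  fix a assume "a:adjoin A x"
  then obtain p q where a: "a = poly p x / poly q x" "p:polys_over A" "q:polys_over A" "poly q x ~= 0"
   unfolding adjoin_def by blast
  show "inverse a:adjoin A x" using I[OF a(3,2)] by (simp add: a(1))
  fix b assume "b:adjoin A x"
  then obtain r s where b: "b = poly r x / poly s x" "r:polys_over A" "s:polys_over A" "poly s x ~= 0"
   unfolding adjoin_def by blast
  have "a - b = poly (p * s - r * q) x / poly (q * s) x"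
   unfolding a(1) b(1) using a(4) b(4) by (simp add: diff_frac_eq)
  thus "a - b:adjoin A x" using I[OF po_diff[OF A po_mult[OF A] po_mult[OF A]] po_mult[OF A]] a b by metis
  have "a * b = poly (p * r) x / poly (q * s) x" unfolding a(1) b(1) by simp
  thus "a * b:adjoin A x" using I[OF po_mult[OF A] po_mult[OF A]] a b by metis
 qed
qed

primrec nmul :: "nat => 'g::monoid_add => 'g" where
 "nmul 0 g = 0"
| "nmul (Suc n) g = g + nmul n g"

lemma nmul_zero [simp]: "nmul n (0 :: 'g::monoid_add) = 0" by (induction n) auto

lemma nmul_add: "nmul n (g + h) = nmul n g + nmul n (h :: 'g::comm_monoid_add)"
 by (induction n) (simp_all add: ac_simps)

lemma nmul_add_left: "nmul (m + n) g = nmul m g + nmul n (g :: 'g::monoid_add)"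
 by (induction m) (simp_all add: add.assoc)

lemma nmul_mult: "nmul (m * n) g = nmul m (nmul n (g :: 'g::comm_monoid_add))"
 by (induction m) (simp_all add: nmul_add_left nmul_add)

lemma nmul_minus: "nmul n (- g) = - nmul n (g :: 'g::ab_group_add)"
 by (induction n) simp_all

lemma nmul_diff: "nmul n (g - h) = nmul n g - nmul n (h :: 'g::ab_group_add)"
 by (induction n) (simp_all add: algebra_simps)

lemma nmul_pos: "g > 0 ==> n > 0 ==> nmul n (g :: 'g::linordered_ab_group_add) > 0"
proof (induction n)
 case (Suc n)
 thus ?case by (cases n) (auto intro: add_pos_pos)
qed auto

lemma nmul_eq_0_iff: "nmul n (g :: 'g::linordered_ab_group_add) = 0 <-> n = 0 | g = 0"
proof -
 have "g > 0 ==> n > 0 ==> nmul n g ~= 0" for g :: 'g using nmul_pos[of g n] by auto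
 from this[of g] this[of "- g"] show ?thesis by (cases "g = 0"; cases "n = 0") (auto simp: nmul_minus neq_iff)
qed

lemma nmul_less_iff: "n > 0 ==> nmul n g < nmul n (h :: 'g::linordered_ab_group_add) <-> g < h"
proof -
 assume n: "n > 0"
 have *: "g < h ==> nmul n g < nmul n h" for g h :: 'g
  using nmul_pos[of "h - g" n] n by (simp add: nmul_diff)
 show ?thesis using *[of g h] *[of h g] by (metis less_irrefl linorder_neqE order.strict_trans)
qed

definition negl :: "('k::zero => 'g::linorder) => 'k => 'k => bool" where
 "negl v y x <-> x ~= 0 & (y = 0 | v x < v y)"

text \<open>The value of \<open>0\<close> is normalised to \<open>0\<close>; it is never used as \<open>\<infinity>\<close>. The relation \<open>negl v y x\<close>
  means \<open>v x < v y\<close> with the convention \<open>v 0 = \<infinity>\<close>.\<close>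

locale arc_field =
 fixes v :: "'k::linordered_field => 'g::linordered_ab_group_add"
 assumes v_0 [simp]: "v 0 = 0"
  and v_mult: "x ~= 0 ==> y ~= 0 ==> v (x * y) = v x + v y"
  and v_add: "x ~= 0 ==> y ~= 0 ==> x + y ~= 0 ==> min (v x) (v y) <= v (x + y)"
  and v_surj: "EX x. x ~= 0 & v x = g"
  and hensel: "(!!i. 0 <= v (coeff f i)) ==> 0 <= v a ==> negl v (poly f a) 1 ==>
    poly (pderiv f) a ~= 0 ==> v (poly (pderiv f) a) = 0 ==> EX b. poly f b = 0 & negl v (b - a) 1"
  and v_of_nat: "n > 0 ==> v (of_nat n) = 0"
  and res_square: "0 <= v a ==> EX b. negl v (a - b * b) 1 | negl v (a + b * b) 1"
  and res_odd: "odd (degree f) ==> (!!i. 0 <= v (coeff f i)) ==> v (lead_coeff f) = 0 ==>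
    EX x. 0 <= v x & negl v (poly f x) 1"
begin

lemma v_1 [simp]: "v 1 = 0" using v_of_nat[of 1] by simp

lemma v_neg1 [simp]: "v (- 1) = 0"
proof -
 have "v (- 1) + v (- 1) = 0" using v_mult[of "- 1" "- 1"] by simp
 thus ?thesis by (simp add: double_zero)
qed

lemma v_minus [simp]: "v (- x) = v x"
 using v_mult[of "- 1" x] by (cases "x = 0") auto

lemma v_abs [simp]: "v \<bar>x\<bar> = v x" by (simp add: abs_if)

lemma v_inverse [simp]: "v (inverse x) = - v x"
proof (cases "x = 0")
 case False
 hence "v x + v (inverse x) = 0" using v_mult[of x "inverse x"] by simp
 thus ?thesis by (simp add: eq_neg_iff_add_eq_0 add.commute)
qed simp

lemma v_divide: "x ~= 0 ==> y ~= 0 ==> v (x / y) = v x - v y"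
 by (simp add: divide_inverse v_mult)

lemma v_power: "x ~= 0 ==> v (x ^ n) = nmul n (v x)"
 by (induction n) (simp_all add: v_mult)

lemma v_surj_pos: "EX x>0. v x = g"
proof -
 obtain x where "x ~= 0" "v x = g" using v_surj by blast
 thus ?thesis by (intro exI[of _ "\<bar>x\<bar>"]) auto
qed

abbreviation neglv :: "'k => 'k => bool" (infix "<<" 50) where "y << x \<equiv> negl v y x"

lemma negl_0 [simp]: "0 << x <-> x ~= 0" by (simp add: negl_def)
lemma negl_0_right [simp]: "~ x << 0" by (simp add: negl_def)
lemma negl_irrefl [simp]: "~ x << x" by (simp add: negl_def)
lemma negl_minus [simp]: "- y << x <-> y << x" by (simp add: negl_def)
lemma negl_minus_right [simp]: "y << - x <-> y << x" by (simp add: negl_def)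
lemma negl_diff_commute: "y - z << x <-> z - y << x" using negl_minus[of "y - z" x] by simp

lemma negl_trans: "z << y ==> y << x ==> z << x" by (auto simp: negl_def)

lemma negl_le_trans: "z << y ==> y ~= 0 ==> x ~= 0 ==> v x <= v y ==> z << x"
 by (auto simp: negl_def)

lemma negl_add: "y << x ==> z << x ==> y + z << x"
 using v_add[of y z] unfolding negl_def
 by (cases "y = 0"; cases "z = 0"; cases "y + z = 0") (auto simp: min_def split: if_splits)

lemma negl_diff: "y << x ==> z << x ==> y - z << x"
 using negl_add[of y x "- z"] by simp

lemma negl_sum: "x ~= 0 ==> (!!i. i:I ==> f i << x) ==> sum f I << x"
 by (induction I rule: infinite_finite_induct) (auto intro: negl_add)

lemma negl_mult_iff: "z ~= 0 ==> z * y << z * x <-> y << x"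
 by (cases "x = 0"; cases "y = 0") (auto simp: negl_def v_mult)

lemma negl_divide_iff: "z ~= 0 ==> y / z << x / z <-> y << x"
 using negl_mult_iff[of "inverse z" y x] by (simp add: field_simps)

lemma negl_mult: "y << x ==> z ~= 0 ==> z * y << z * x"
 by (simp add: negl_mult_iff)

lemma negl_1_iff: "x ~= 0 ==> y << x <-> y / x << 1"
 using negl_divide_iff[of x y x] by simp

lemma v_add_eq: "y << x ==> v (x + y) = v x & x + y ~= 0"
proof -
 assume y: "y << x"
 hence x: "x ~= 0" by (auto simp: negl_def)
 show ?thesis
 proof (cases "y = 0")
  case False
  have vxy: "v x < v y" using y False by (simp add: negl_def)
  have ne: "x + y ~= 0"
  proof
   assume "x + y = 0"
   hence "v y = v x" using v_minus[of x] by (simp add: eq_neg_iff_add_eq_0[symmetric] add.commute)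
   thus False using vxy by simp
  qed
  have "v x <= v (x + y)" using v_add[OF x False ne] vxy by simp
  moreover have "min (v (x + y)) (v y) <= v x" using v_add[of "x + y" "- y"] ne False x by simp
  ultimately show ?thesis using ne vxy by (auto simp: min_def split: if_splits)
 qed (use x in simp)
qed

lemma v_eq_of_negl_diff: "x - y << y ==> v x = v y & x ~= 0 & y ~= 0"
 using v_add_eq[of "x - y" y] by (auto simp: negl_def)

lemma v_ring_add: "0 <= v x ==> 0 <= v y ==> 0 <= v (x + y)"
 using v_add[of x y] by (cases "x = 0"; cases "y = 0"; cases "x + y = 0") (auto simp: min_def split: if_splits)

lemma v_ring_diff: "0 <= v x ==> 0 <= v y ==> 0 <= v (x - y)"
 using v_ring_add[of x "- y"] by simp

lemma v_ring_mult: "0 <= v x ==> 0 <= v y ==> 0 <= v (x * y)"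
 using v_mult[of x y] by (cases "x = 0 | y = 0") auto

lemma v_ring_power: "0 <= v x ==> 0 <= v (x ^ n)"
 by (induction n) (auto intro: v_ring_mult)

lemma v_ring_sum: "(!!i. i:I ==> 0 <= v (f i)) ==> 0 <= v (sum f I)"
 by (induction I rule: infinite_finite_induct) (auto intro: v_ring_add)

lemma v_ring_poly: "(!!i. 0 <= v (coeff f i)) ==> 0 <= v x ==> 0 <= v (poly f x)"
 unfolding poly_altdef by (intro v_ring_sum v_ring_mult v_ring_power)

lemma negl_1_ring: "x << 1 ==> 0 <= v x" by (auto simp: negl_def)

lemma negl_1_mult: "x << 1 ==> 0 <= v y ==> y * x << 1"
 by (cases "x = 0"; cases "y = 0") (auto simp: negl_def v_mult intro: add_nonneg_pos)

lemma not_negl_1: "0 <= v x ==> ~ x << 1 <-> x ~= 0 & v x = 0"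
 by (auto simp: negl_def)

lemma poly_cong_mod:
 assumes "!!i. 0 <= v (coeff f i)" "0 <= v a" "0 <= v b" "a - b << 1"
 shows "poly f a - poly f b << 1"
 using assms(1)
proof (induction f)
 case (pCons c f)
 have f: "0 <= v (coeff f i)" for i using pCons.prems[of "Suc i"] by simp
 have "poly (pCons c f) a - poly (pCons c f) b = a * (poly f a - poly f b) + poly f b * (a - b)"
  by (simp add: algebra_simps)
 moreover have "a * (poly f a - poly f b) << 1" using pCons.IH f assms by (intro negl_1_mult) auto
 moreover have "poly f b * (a - b) << 1" using assms f by (intro negl_1_mult v_ring_poly) auto
 ultimately show ?case using negl_add by metis
qed simp

lemma one_plus_square:
 assumes "a << 1"
 shows "EX b. b * b = 1 + a"
proof -
 define f where "f = [:- (1 + a), 0, 1:]"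
 have 2: "v 2 = 0" using v_of_nat[of 2] by simp
 have "0 <= v (coeff f i)" for i
  using v_ring_add[of 1 a] negl_1_ring[OF assms] v_minus[of "1 + a"]
  by (auto simp: f_def coeff_pCons simp del: v_minus minus_add_distrib split: nat.splits)
 moreover have "poly f 1 << 1" using assms negl_minus[of a 1] by (simp add: f_def)
 moreover have "poly (pderiv f) 1 = 2" by (simp add: f_def pderiv_pCons)
 ultimately obtain b where "poly f b = 0" using hensel[of f 1] 2 by auto
 thus ?thesis by (intro exI[of _ b]) (simp add: f_def algebra_simps)
qed

text \<open>\<open>1 + a\<close> is a square by Hensel, hence positive. This is why a henselian
  valuation of this kind is convex for the order of \<open>K\<close>.\<close>

lemma one_plus_pos: "a << 1 ==> 1 + a > 0"
proof -
 assume a: "a << 1"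
 obtain b where b: "b * b = 1 + a" using one_plus_square[OF a] by blast
 hence "1 + a >= 0" by (metis zero_le_square)
 moreover have "1 + a ~= 0" using v_add_eq[OF a] by simp
 ultimately show ?thesis by simp
qed

lemma pos_add_negl: "z << y ==> y + z > 0 <-> y > 0"
proof -
 assume z: "z << y"
 hence y: "y ~= 0" by (auto simp: negl_def)
 hence "1 + z / y > 0" using one_plus_pos z negl_1_iff by blast
 moreover have "y + z = y * (1 + z / y)" using y by (simp add: field_simps)
 ultimately show ?thesis by (simp add: zero_less_mult_iff)
qed

lemma pos_iff_of_negl_diff: "x - y << y ==> x > 0 <-> y > 0"
 using pos_add_negl[of "x - y" y] by simp

lemma convex: "0 < x ==> x <= y ==> v y <= v x"
proof (rule ccontr)
 assume x: "0 < x" "x <= y" "~ v y <= v x"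
 hence "y << x" by (auto simp: negl_def)
 hence "x - y > 0" using pos_add_negl[of "- y" x] x by simp
 thus False using x by simp
qed

lemma less_of_negl: "x > 0 ==> y << x ==> y < x"
 using pos_add_negl[of "- y" x] by simp

lemma hensel_root_power:
 assumes x: "v x = 0" "x ~= 0" and y: "y ^ n - x << 1" "0 <= v y" and n: "n > 0"
 shows "EX z. z ^ n = x"
proof -
 define f where "f = monom 1 n - [:x:]"
 have "0 <= v (coeff f i)" for i
 proof -
  have "coeff f i = (if i = n then 1 else if i = 0 then - x else 0)"
   using n by (auto simp: f_def coeff_pCons split: nat.splits)
  thus ?thesis using x by auto
 qed
 moreover have "poly f y << 1" using y(1) by (simp add: f_def poly_monom)
 moreover have "v (y ^ n) = 0 & y ^ n ~= 0" using v_eq_of_negl_diff[of "y ^ n" x] y(1) x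
  by (simp add: negl_def)
 hence y0: "y ~= 0" "v y = 0" using n by (auto simp: v_power nmul_eq_0_iff)
 have "poly (pderiv f) y = of_nat n * y ^ (n - 1)"
  by (simp add: f_def pderiv_diff pderiv_monom poly_monom pderiv_pCons)
 hence "poly (pderiv f) y ~= 0 & v (poly (pderiv f) y) = 0"
  using y0 n by (simp add: v_mult v_power v_of_nat)
 ultimately obtain z where "poly f z = 0" using hensel[of f y] y(2) by auto
 thus ?thesis by (intro exI[of _ z]) (simp add: f_def poly_monom)
qed

text \<open>Even exponents are halved by a square root and odd ones handled by a residue root of
  \<open>X ^ n - x\<close>; Hensel's lemma lifts both, as the derivative is a unit.\<close>

lemma unit_root: "x > 0 ==> v x = 0 ==> n > 0 ==> EX z>0. z ^ n = x"
proof (induction n arbitrary: x rule: less_induct)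
 case (less n)
 show ?case
 proof (cases "even n")
  case True
  then obtain m where m: "n = 2 * m" "m > 0" "m < n" using less.prems(3) by (auto elim!: evenE)
  obtain b where b: "x - b * b << 1 | x + b * b << 1" using res_square[of x] less.prems by auto
  \<comment> \<open>A sum of a positive and a non-negative element is at least the first, so by
    convexity its value cannot exceed \<open>v x\<close>.\<close>
  have "~ x + b * b << 1"
  proof
   assume "x + b * b << 1"
   moreover have "v (x + b * b) <= v x" using less.prems by (intro convex) auto
   moreover have "x + b * b > 0" using less.prems by (simp add: add_pos_nonneg)
   ultimately show False using less.prems by (auto simp: negl_def)
  qed
  hence b2: "b ^ 2 - x << 1" using b negl_diff_commute by (simp add: power2_eq_square)
  hence "v (b ^ 2) = 0 & b ~= 0" using v_eq_of_negl_diff[of "b ^ 2" x] less.prems by (simp add: negl_def)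
  hence "v b = 0" using v_power[of b 2] by (simp add: nmul_eq_0_iff)
  then obtain y where y: "y ^ 2 = x" using hensel_root_power[OF less.prems(2) _ b2] less.prems by auto
  hence y0: "\<bar>y\<bar> > 0" "\<bar>y\<bar> ^ 2 = x" using less.prems by auto
  hence "v \<bar>y\<bar> = 0"
   using less.prems(2) v_power[of "\<bar>y\<bar>" 2] by (simp add: nmul_eq_0_iff)
  then obtain z where "z > 0" "z ^ m = \<bar>y\<bar>" using less.IH[OF m(3) y0(1)] m(2) by blast
  thus ?thesis using y0 m(1) by (intro exI[of _ z]) (simp add: power_mult mult.commute power_even_eq)
 next
  case False
  define f where "f = monom 1 n - [:x:]"
  have cf: "coeff f i = (if i = n then 1 else if i = 0 then - x else 0)" for i
   using less.prems(3) by (auto simp: f_def coeff_pCons split: nat.splits)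
  have df: "degree f = n"
   by (rule antisym, rule degree_le) (auto simp: cf le_degree)
  have "EX y. 0 <= v y & poly f y << 1"
   by (rule res_odd) (use False less.prems in \<open>auto simp: df cf\<close>)
  then obtain y where y: "0 <= v y" "y ^ n - x << 1" by (auto simp: f_def poly_monom)
  then obtain z where z: "z ^ n = x" using hensel_root_power[OF less.prems(2) _ y(2,1)] less.prems by auto
  have "z > 0" using less.prems(1,3) False unfolding z[symmetric] by (auto simp: zero_less_power_eq)
  thus ?thesis using z by blast
 qed
qed

text \<open>The value is the only obstruction to a root of a positive element: dividing by
  \<open>t ^ n\<close> with \<open>v t = g\<close> reduces to a positive unit.\<close>

lemma root_exists: "x > 0 ==> v x = nmul n g ==> n > 0 ==> EX z>0. z ^ n = x & v z = g"
proof -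
 assume x: "x > 0" "v x = nmul n g" "n > 0"
 obtain t where t: "t > 0" "v t = g" using v_surj_pos by blast
 have "x / t ^ n > 0" "v (x / t ^ n) = 0" using x t by (simp_all add: v_divide v_power)
 then obtain z where z: "z > 0" "z ^ n = x / t ^ n" using unit_root x(3) by blast
 have "nmul n (v z) = 0" using z v_power[of z n] \<open>v (x / t ^ n) = 0\<close> by simp
 hence "v z = 0" using x(3) by (simp add: nmul_eq_0_iff)
 thus ?thesis using z t by (intro exI[of _ "z * t"]) (simp add: power_mult_distrib v_mult)
qed

subsection \<open>A coefficient field\<close>

lemma subfield_in_ring_unit:
 assumes A: "subfield_set A" "!!a. a:A ==> 0 <= v a" and a: "a:A"
 shows "v a = 0"
 using A(2)[OF a] A(2)[OF sf_inverse[OF A(1) a]] by simp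

text \<open>A maximal subfield of the valuation ring; the rational numbers show that there are such
  subfields. By maximality and Hensel's lemma it represents every residue, and the residue
  conditions then make it real closed.\<close>

lemma coefficient_field_exists:
 "EX C. rc_subfield C & (ALL c:C. 0 <= v c) & (ALL x. 0 <= v x --> (EX c:C. x - c << 1))"
proof -
 let ?S = "{A. subfield_set A & (ALL a:A. 0 <= v a)}"
 have "EX M:?S. ALL Y:?S. M \<subseteq> Y --> Y = M"
 proof (rule subset_Zorn_nonempty)
  have "subfield_set (range (of_rat :: rat => 'k))"
   by (rule subfield_image) (simp_all add: subfield_set_def of_rat_diff of_rat_mult of_rat_inverse)
  moreover have "0 <= v (of_rat q)" for q
  proof (cases q)
   case (Fract a b)
   have i: "v (of_int k) = 0" for k :: int
   proof (cases k rule: int_cases2)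
    case (nonneg n)
    thus ?thesis using v_of_nat[of n] by (cases "n = 0") auto
   next
    case (nonpos n)
    thus ?thesis using v_of_nat[of n] by (cases "n = 0") auto
   qed
   show ?thesis
   proof (cases "a = 0")
    case True
    thus ?thesis using Fract by (simp add: rat_number_collapse)
   next
    case False
    thus ?thesis using Fract i by (simp add: of_rat_rat v_divide)
   qed
  qed
  ultimately show "?S ~= {}" by blast
  fix Ch assume Ch: "Ch ~= {}" "subset.chain ?S Ch"
  have sub: "A:?S" if "A:Ch" for A using Ch(2) that by (auto simp: subset.chain_def)
  have lin: "A \<subseteq> B | B \<subseteq> A" if "A:Ch" "B:Ch" for A B
   using Ch(2) that unfolding subset.chain_def by blast
  have "subfield_set (\<Union>Ch)"
   unfolding subfield_set_def
  proof (intro conjI ballI)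
   show "1:\<Union>Ch" using Ch(1) sub sf_1 by blast
   fix x assume "x:\<Union>Ch"
   then obtain A where A: "A:Ch" "x:A" by blast
   show "inverse x:\<Union>Ch" using A sub[OF A(1)] sf_inverse by blast
   fix y assume "y:\<Union>Ch"
   then obtain B where B: "B:Ch" "y:B" by blast
   obtain D where D: "D:Ch" "x:D" "y:D" using lin[OF A(1) B(1)] A B by blast
   show "x - y:\<Union>Ch" using D sub[OF D(1)] sf_diff by blast
   show "x * y:\<Union>Ch" using D sub[OF D(1)] sf_mult by blast
  qed
  thus "\<Union>Ch \<in> ?S" using sub by blast
 qed
 then obtain C where CS: "C:?S" and CM: "ALL Y:?S. C \<subseteq> Y --> Y = C" by (rule bexE)
 have C: "subfield_set C" "!!a. a:C ==> 0 <= v a" using CS by auto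
 have max: "Y = C" if "subfield_set Y" "!!a. a:Y ==> 0 <= v a" "C \<subseteq> Y" for Y
  using CM that by simp
 have unit: "v a = 0" if "a:C" for a using subfield_in_ring_unit[OF C that] .
 have cO: "0 <= v (coeff p i)" if "p:polys_over C" for p i using C(2) polys_overD[OF that] by blast
 \<comment> \<open>If no polynomial over \<open>C\<close> has a nonzero non-unit value at
   \<open>b\<close>, then adjoining \<open>b\<close> stays in the valuation ring, so maximality puts
   \<open>b\<close> into \<open>C\<close>. The convention \<open>v 0 = 0\<close> lets the premise
   cover vanishing values.\<close>
 have memI: "b:C" if b: "!!s. s:polys_over C ==> v (poly s b) = 0" for b
 proof -
  have "0 <= v a" if aa: "a:adjoin C b" for a
  proof -
   obtain p q where pq: "a = poly p b / poly q b" "p:polys_over C" "q:polys_over C" "poly q b ~= 0"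
    using aa unfolding adjoin_def by blast
   thus ?thesis using b[OF pq(2)] b[OF pq(3)] v_divide[of "poly p b" "poly q b"]
    by (cases "poly p b = 0") auto
  qed
  hence "adjoin C b = C" using max[OF adjoin_subfield(1)[OF C(1)]] adjoin_subfield(2)[OF C(1)] by blast
  thus ?thesis using adjoin_subfield(3)[OF C(1)] by blast
 qed
 have lift: "EX c:C. x - c << 1" if x: "0 <= v x" for x
 \<comment> \<open>The cases are whether the residue of \<open>x\<close> is transcendental or
   algebraic over \<open>C\<close>. In the second case a polynomial of least degree has a unit
   derivative at \<open>x\<close>, and its root near \<open>x\<close> belongs to
   \<open>C\<close>.\<close>
 proof (cases "EX p. p:polys_over C & p ~= 0 & poly p x << 1")
  case False
  have "v (poly s x) = 0" if "s:polys_over C" for s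
   using False not_negl_1[OF v_ring_poly[OF cO[OF that] x]] that by (cases "s = 0") auto
  hence "x:C" by (rule memI)
  thus ?thesis by (intro bexI[of _ x]) auto
 next
  case True
  obtain p where p: "p:polys_over C" "p ~= 0" "poly p x << 1"
   and min: "!!q. q:polys_over C ==> q ~= 0 ==> poly q x << 1 ==> degree p <= degree q"
   using ex_has_least_nat[of "%p. p:polys_over C & p ~= 0 & poly p x << 1" _ degree] True by metis
  have dp: "degree p > 0"
  proof (rule ccontr)
   assume "~ degree p > 0"
   then obtain c where c: "p = [:c:]" by (auto elim: degree_eq_zeroE)
   hence "c:C" using polys_overD[OF p(1), of 0] by simp
   thus False using p unit[of c] c by (simp add: negl_def)
  qed
  have d: "pderiv p:polys_over C" "pderiv p ~= 0" "degree (pderiv p) < degree p"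
   using dp po_pderiv[OF C(1) p(1)] by (simp_all add: pderiv_eq_0_iff degree_pderiv)
  hence "~ poly (pderiv p) x << 1" using min[OF d(1,2)] by auto
  hence "poly (pderiv p) x ~= 0 & v (poly (pderiv p) x) = 0"
   using not_negl_1[OF v_ring_poly[OF cO[OF d(1)] x]] by blast
  then obtain b where b: "poly p b = 0" "b - x << 1" using hensel[OF cO[OF p(1)] x p(3)] by blast
  have bO: "0 <= v b" using v_ring_add[OF negl_1_ring[OF b(2)] x] by simp
  have "v (poly s b) = 0" if s: "s:polys_over C" for s
  proof -
   obtain q r where qr: "r:polys_over C" "s = q * p + r" "r = 0 | degree r < degree p"
    using po_divmod[OF C(1) p(1,2) s] by blast
   have sb: "poly s b = poly r b" by (simp add: qr(2) b(1))
   show ?thesis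
   proof (cases "r = 0")
    case False
    hence "~ poly r x << 1" using min[OF qr(1)] qr(3) by auto
    moreover have "poly r x - poly r b << 1"
     by (rule poly_cong_mod) (use cO[OF qr(1)] x bO b(2) negl_diff_commute in auto)
    ultimately have "~ poly r b << 1" using negl_add[of "poly r x - poly r b" 1 "poly r b"] by auto
    thus ?thesis using not_negl_1[OF v_ring_poly[OF cO[OF qr(1)] bO]] sb by simp
   qed (simp add: sb)
  qed
  hence "b:C" by (rule memI)
  thus ?thesis using b(2) negl_diff_commute by blast
 qed
 have zero: "c = 0" if "c:C" "c << 1" for c using that unit by (auto simp: negl_def)
 have "rc_subfield C"
  unfolding rc_subfield_def
 proof (intro conjI ballI impI)
  show "subfield_set C" by (rule C(1))
 next
  fix x assume x: "x:C" "0 <= x"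
  show "EX y:C. y * y = x"
  proof (cases "x = 0")
   case True
   thus ?thesis using sf_0[OF C(1)] by auto
  next
   case False
   then obtain y where y: "y > 0" "y ^ 2 = x" using unit_root[of x 2] x unit[of x] by auto
   have vy: "v y = 0" using v_power[of y 2] y unit[OF x(1)]
    by (simp add: nmul_eq_0_iff)
   obtain c where c: "c:C" "y - c << 1" using lift[of y] vy by auto
   have "c * c - x = (y + c) * (- (y - c))" using y(2) by (simp add: algebra_simps power2_eq_square)
   also have "\<dots> << 1" using c C(2)[OF c(1)] vy by (intro negl_1_mult v_ring_add) (auto simp del: minus_diff_eq)
   finally have "c * c - x = 0" using zero sf_diff[OF C(1) sf_mult[OF C(1) c(1) c(1)] x(1)] by blast
   thus ?thesis using c by auto
  qed
 next
  fix p assume p: "p:polys_over C" "odd (degree p)"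
  then obtain x where x: "0 <= v x" "poly p x << 1"
   using res_odd[of p] cO[OF p(1)] unit polys_overD[OF p(1)] by blast
  obtain c where c: "c:C" "x - c << 1" using lift[OF x(1)] by blast
  have "poly p x - poly p c << 1" using cO[OF p(1)] x(1) C(2)[OF c(1)] c(2) by (rule poly_cong_mod)
  hence "poly p c << 1" using negl_diff[OF x(2)] by fastforce
  hence "poly p c = 0" using zero po_poly[OF C(1) p(1) c(1)] by blast
  thus "EX x:C. poly p x = 0" using c(1) by blast
 qed
 thus ?thesis using C(2) lift by blast
qed

definition coef_field :: "'k set" where
 "coef_field = (SOME C. rc_subfield C & (ALL c:C. 0 <= v c) & (ALL x. 0 <= v x --> (EX c:C. x - c << 1)))"

lemma coef_field: "rc_subfield coef_field" "c:coef_field ==> 0 <= v c"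
 "0 <= v x ==> EX c:coef_field. x - c << 1"
 using someI_ex[OF coefficient_field_exists] unfolding coef_field_def by blast+

lemma coef_field_sf: "subfield_set coef_field" using coef_field(1) by (simp add: rc_subfield_def)

lemma coef_field_unit: "c:coef_field ==> v c = 0"
 using subfield_in_ring_unit[OF coef_field_sf coef_field(2)] by blast

text \<open>The residue map with values in the coefficient field, so residues are elements of
  \<open>K\<close> and share its order.\<close>

definition res :: "'k => 'k" where
 "res x = (SOME c. c:coef_field & x - c << 1)"

lemma res: "0 <= v x ==> res x:coef_field" "0 <= v x ==> x - res x << 1"
 using someI_ex[of "%c. c:coef_field & x - c << 1"] coef_field(3)[of x] unfolding res_def by blast+

lemma coef_field_zero: "c:coef_field ==> c << 1 ==> c = 0"
 using coef_field_unit by (auto simp: negl_def)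

lemma resI: "c:coef_field ==> x - c << 1 ==> res x = c"
proof -
 assume c: "c:coef_field" "x - c << 1"
 have x: "0 <= v x" using v_ring_add[OF negl_1_ring[OF c(2)] coef_field(2)[OF c(1)]] by simp
 have "res x - c = (x - c) - (x - res x)" by simp
 hence "res x - c << 1" using negl_diff[OF c(2) res(2)[OF x]] by simp
 thus ?thesis using coef_field_zero sf_diff[OF coef_field_sf res(1)[OF x] c(1)] by fastforce
qed

lemma res_id: "c:coef_field ==> res c = c" by (rule resI) auto

lemma res_add: "0 <= v x ==> 0 <= v y ==> res (x + y) = res x + res y"
proof (rule resI)
 assume xy: "0 <= v x" "0 <= v y"
 show "res x + res y:coef_field" by (intro sf_add[OF coef_field_sf] res xy)
 have "x + y - (res x + res y) = (x - res x) + (y - res y)" by simp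
 thus "x + y - (res x + res y) << 1" using negl_add[OF res(2) res(2)] xy by metis
qed

lemma res_mult: "0 <= v x ==> 0 <= v y ==> res (x * y) = res x * res y"
proof (rule resI)
 assume xy: "0 <= v x" "0 <= v y"
 show "res x * res y:coef_field" by (intro sf_mult[OF coef_field_sf] res xy)
 have "x * y - res x * res y = x * (y - res y) + res y * (x - res x)" by (simp add: algebra_simps)
 also have "\<dots> << 1" using xy res coef_field(2) by (intro negl_add negl_1_mult) auto
 finally show "x * y - res x * res y << 1" .
qed

lemma res_minus: "0 <= v x ==> res (- x) = - res x"
proof (rule resI)
 assume x: "0 <= v x"
 show "- res x:coef_field" by (intro sf_minus[OF coef_field_sf] res x)
 have "- x - - res x = - (x - res x)" by simp
 thus "- x - - res x << 1" using res(2)[OF x] negl_minus by metis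
qed

lemma res_diff: "0 <= v x ==> 0 <= v y ==> res (x - y) = res x - res y"
 using res_add[of x "- y"] res_minus[of y] by simp

lemma res_eq_0_iff: "0 <= v x ==> res x = 0 <-> x << 1"
 using res(2)[of x] resI[of 0 x] sf_0[OF coef_field_sf] by auto

lemma res_eq_iff: "0 <= v x ==> 0 <= v y ==> res x = res y <-> x - y << 1"
 using res_eq_0_iff[of "x - y"] res_diff[of x y] v_ring_diff[of x y] by simp

lemma res_1 [simp]: "res 1 = 1" by (rule res_id[OF sf_1[OF coef_field_sf]])
lemma res_0 [simp]: "res 0 = 0" by (rule res_id[OF sf_0[OF coef_field_sf]])

lemma res_inverse: "v x = 0 ==> x ~= 0 ==> res (inverse x) = inverse (res x)"
proof -
 assume x: "v x = 0" "x ~= 0"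
 hence "res x * res (inverse x) = 1" using res_mult[of x "inverse x"] by simp
 thus ?thesis by (rule inverse_unique[symmetric])
qed

lemma res_pos: "0 <= v x ==> res x > 0 ==> x > 0"
proof -
 assume x: "0 <= v x" "res x > 0"
 have "x - res x << res x" using res[OF x(1)] x(2) coef_field_unit by (auto simp: negl_def)
 thus ?thesis using pos_iff_of_negl_diff x(2) by blast
qed

lemma res_pos_iff: "v x = 0 ==> x ~= 0 ==> res x > 0 <-> x > 0"
proof -
 assume x: "v x = 0" "x ~= 0"
 have "x - res x << x" using res[of x] x by (auto simp: negl_def)
 hence "res x - x << x" by (simp add: negl_diff_commute)
 thus ?thesis using pos_iff_of_negl_diff by blast
qed

lemma res_poly:
 assumes "0 <= v x"
 shows "(!!i. 0 <= v (coeff f i)) ==> res (poly f x) = poly (map_poly res f) (res x)"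
proof (induction f)
 case (pCons c f)
 have f: "0 <= v (coeff f i)" for i using pCons.prems[of "Suc i"] by simp
 have c: "0 <= v c" using pCons.prems[of 0] by simp
 show ?case
  using pCons.IH f c assms by (simp add: map_poly_pCons res_add res_mult v_ring_mult v_ring_poly)
qed simp

end

section \<open>Partial isomorphisms that are elementary on the value group\<close>

definition Lval :: "(oring_fun, bool) language" where
 "Lval = \<lparr>fun_arity = fun_arity Lring, rel_arity = (%_. 2)\<rparr>"

text \<open>The relation symbol \<open>True\<close> is the order of the field, \<open>False\<close> compares values.\<close>

definition Val :: "('k::linordered_field => 'g::linorder) => (oring_fun, bool, 'k) struc" where
 "Val v = \<lparr>univ = UNIV, fun_interp = fun_interp OFld,
   rel_interp = (%r as. if r then as ! 0 < as ! 1 else negl v (as ! 0) (as ! 1))\<rparr>"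

abbreviation (input) "GP s t \<equiv> Fn GPlus [s, t]"

lemma ogroup_simps [simp]:
 "univ OGrp = UNIV"
 "fun_interp OGrp GPlus [a, b] = a + b"
 "fun_interp OGrp GZero as = 0"
 "rel_interp OGrp r [a, b] <-> a < b"
 "fun_arity Lgrp GPlus = 2" "fun_arity Lgrp GZero = 0" "rel_arity Lgrp r = 2"
 by (simp_all add: ogroup_structure_def ogroup_language_def)

lemma ogroup_is_structure [simp]: "is_structure Lgrp OGrp"
 by (simp add: is_structure_def)

lemma oring_simps [simp]:
 "univ OFld = UNIV"
 "fun_interp OFld RPlus [a, b] = a + b"
 "fun_interp OFld RMinus [a, b] = a - b"
 "fun_interp OFld RTimes [a, b] = a * b"
 "fun_interp OFld RZero as = 0"
 "fun_interp OFld ROne as = 1"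
 "rel_interp OFld r [a, b] <-> a < b"
 "fun_arity Lring RPlus = 2" "fun_arity Lring RMinus = 2"
 "fun_arity Lring RTimes = 2" "fun_arity Lring RZero = 0"
 "fun_arity Lring ROne = 0" "rel_arity Lring r = 2"
 by (simp_all add: ofield_structure_def oring_language_def)

lemma oring_is_structure [simp]: "is_structure Lring OFld"
 by (simp add: is_structure_def)

lemma vring_simps [simp]:
 "univ (Val v) = UNIV"
 "fun_interp (Val v) = fun_interp OFld"
 "rel_interp (Val v) True [a, b] <-> a < b"
 "rel_interp (Val v) False [a, b] <-> negl v a b"
 "fun_arity Lval = fun_arity Lring" "rel_arity Lval r = 2"
 by (simp_all add: Val_def Lval_def)

lemma vring_is_structure [simp]: "is_structure Lval (Val v)"
 by (simp add: is_structure_def)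

abbreviation tpG :: "('g \<times> 'g::linordered_ab_group_add) set => bool" where
 "tpG \<equiv> tpeq Lgrp OGrp OGrp"

lemma tpG_less: "tpG S ==> (g, g'):S ==> (h, h'):S ==> g < h <-> g' < h'"
 using tpeqD[of Lgrp OGrp OGrp S "Rel Less [Var 0, Var 1]"
   "%n. if n = 0 then g else h" "%n. if n = 0 then g' else h'"] by auto

lemma tpG_eq: "tpG S ==> (g, g'):S ==> (h, h'):S ==> g = h <-> g' = h'"
 using tpG_less[of S g g' h h'] tpG_less[of S h h' g g'] by (metis less_irrefl linorder_neqE)

lemma tpG_le: "tpG S ==> (g, g'):S ==> (h, h'):S ==> g <= h <-> g' <= h'"
 using tpG_less[of S h h' g g'] by (metis linorder_not_le)

primrec nmul_tm :: "nat => ogroup_fun tm => ogroup_fun tm" where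
 "nmul_tm 0 t = Fn GZero []"
| "nmul_tm (Suc n) t = GP t (nmul_tm n t)"

lemma nmul_tm [simp]: "tm_val OGrp e (nmul_tm n t) = nmul n (tm_val OGrp e t)"
 by (induction n) auto

lemma wf_nmul_tm [simp]: "wf_tm Lgrp t ==> wf_tm Lgrp (nmul_tm n t)"
 by (induction n) auto

text \<open>The sums \<open>g + k h\<close> are the values of monomials. Adding
  \<open>(0, 0)\<close> accounts for the convention \<open>v 0 = 0\<close>; it needs its own
  argument when \<open>S\<close> is empty, because terms are evaluated at members of
  \<open>S\<close>.\<close>

lemma tpG_span:
 assumes "tpG S"
 shows "tpG (insert (0, 0) {(g + nmul k h, g' + nmul k h') | g g' h h' k. (g, g'):S & (h, h'):S})"
proof (cases "S = {}")
 case True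
 have "tpG (insert (0, 0) S)"
 proof (rule tpeqI)
  fix p :: "(ogroup_fun, order_rel) fm" and e e' :: "nat => 'a"
  assume p: "wf_fm Lgrp p" "!!n. n:fv_fm p ==> (e n, e' n):insert (0, 0) S" "sat OGrp e p"
  hence "sat OGrp e p = sat OGrp e' p"
   using True by (intro sat_cong) auto
  thus "sat OGrp e' p" using p by simp
 qed
 thus ?thesis using True by simp
next
 case False
 then obtain s where s: "s:S" by blast
 let ?T = "{(tm_val OGrp (fst \<circ> \<rho>) t, tm_val OGrp (snd \<circ> \<rho>) t) | \<rho> t.
   wf_tm Lgrp t & range \<rho> \<subseteq> S}"
 show ?thesis
 proof (rule tpeq_mono[OF tpeq_terms[OF assms]], rule subsetI)
  fix x assume "x:insert (0, 0) {(g + nmul k h, g' + nmul k h') | g g' h h' k. (g, g'):S & (h, h'):S}"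
  then consider "x = (0, 0)" | g g' h h' k where "x = (g + nmul k h, g' + nmul k h')" "(g, g'):S" "(h, h'):S" by blast
  thus "x:?T"
  proof cases
   case 1
   thus ?thesis using s by (intro CollectI exI[of _ "%_. s"] exI[of _ "Fn GZero []"]) auto
  next
   case (2 g g' h h' k)
   thus ?thesis
    by (intro CollectI exI[of _ "%n. if n = 0 then (g, g') else (h, h')"] exI[of _ "GP (Var 0) (nmul_tm k (Var 1))"]) auto
  qed
 qed
qed

text \<open>The group language has no subtraction, so differences are not terms. Saturation extends
  the map to the differences, and the equation \<open>g = z + h\<close> identifies the
  images.\<close>

lemma tpG_diff:
 assumes S: "tpG S" "countable S"
  and sat: "aleph1_saturated Lgrp (OGrp :: (ogroup_fun, order_rel, 'g::linordered_ab_group_add) struc)"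
 shows "tpG {(g - h, g' - h' :: 'g) | g g' h h'. (g, g'):S & (h, h'):S}"
proof -
 define U where "U = (%((g :: 'g, _ :: 'g), (h :: 'g, _ :: 'g)). g - h) ` (S \<times> S)"
 have U: "countable U" unfolding U_def using S(2) by (intro countable_image countable_SIGMA)
 obtain R where R: "S \<subseteq> R" "tpG R" "U \<subseteq> fst ` R"
  using tpeq_extend_countable[OF S(1) S(2) _ sat _ U] by auto
 show ?thesis
 proof (rule tpeq_mono[OF R(2)], rule subsetI)
  fix x assume "x:{(g - h, g' - h' :: 'g) | g g' h h'. (g, g'):S & (h, h'):S}"
  then obtain g g' h h' where x: "x = (g - h, g' - h')" "(g, g'):S" "(h, h'):S" by blast
  have "g - h:U" unfolding U_def using x by force
  then obtain z where z: "(g - h, z):R" using R(3) by force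
  have "sat OGrp (%n. if n = 0 then g else if n = 1 then g - h else h) (Eq (Var 0) (GP (Var 1) (Var 2))) =
    sat OGrp (%n. if n = 0 then g' else if n = 1 then z else h') (Eq (Var 0) (GP (Var 1) (Var 2)))"
   by (rule tpeqD[OF R(2)]) (use x R(1) z in auto)
  hence "g' = z + h'" by simp
  thus "x:R" using x z by simp
 qed
qed

lemma nmul_tpG: "tpG S ==> (g, g'):S ==> (h, h'):S ==> nmul n g = h <-> nmul n g' = h'"
 using tpeqD[of Lgrp OGrp OGrp S "Eq (nmul_tm n (Var 0)) (Var 1)"
   "%n. if n = 0 then g else h" "%n. if n = 0 then g' else h'"]
proof -
 assume a: "tpG S" "(g, g'):S" "(h, h'):S"
 have "fv_tm (nmul_tm n (Var 0)) \<subseteq> {0}" by (induction n) auto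
 thus ?thesis
  using tpeqD[OF a(1), of "Eq (nmul_tm n (Var 0)) (Var 1)" "%n. if n = 0 then g else h" "%n. if n = 0 then g' else h'"] a
  by (auto simp: subset_iff split: if_splits)
qed

definition vR :: "('k => 'g) => ('k \<times> 'k) set => ('g \<times> 'g) set" where
 "vR v R = {(v x, v x') | x x'. (x, x'):R}"

lemma vR_I: "(x, x'):R ==> (v x, v x'):vR v R" by (auto simp: vR_def)

lemma vR_mono: "R \<subseteq> S ==> vR v R \<subseteq> vR v S" by (auto simp: vR_def)

lemma vR_converse: "vR v (R\<inverse>) = (vR v R)\<inverse>" by (auto simp: vR_def)

lemma countable_vR: "countable R ==> countable (vR v R)"
proof -
 assume "countable R"
 moreover have "vR v R = (%(x, x'). (v x, v x')) ` R" by (auto simp: vR_def)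
 ultimately show ?thesis by simp
qed

lemma countable_polys_over: "countable A ==> countable (polys_over A)"
proof -
 assume "countable A"
 have "coeffs ` polys_over A \<subseteq> lists A"
  by (auto simp: polys_over_def coeffs_def)
 hence "countable (coeffs ` polys_over A)"
  using countable_lists[OF \<open>countable A\<close>] countable_subset by blast
 thus ?thesis by (rule countable_image_inj_on) (simp add: inj_on_def coeffs_eq_iff)
qed

definition adjoin_rel :: "('k::field \<times> 'k) set => 'k => 'k => ('k \<times> 'k) set" where
 "adjoin_rel R c c' = {(poly p c / poly q c, poly p' c' / poly q' c') | p p' q q'.
   pairpoly R p p' & pairpoly R q q' & poly q c ~= 0}"

lemma countable_adjoin_rel:
 assumes R: "countable R"
 shows "countable (adjoin_rel R c c')"
proof -
 let ?A = "polys_over (fst ` R)" and ?B = "polys_over (snd ` R)"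
 have pp: "p:?A & p':?B" if "pairpoly R p p'" for p p'
  using that by (force simp: pairpoly_def polys_over_def)
 have "adjoin_rel R c c' \<subseteq> (%(p, p', q, q'). (poly p c / poly q c, poly p' c' / poly q' c')) ` (?A \<times> ?B \<times> ?A \<times> ?B)"
  unfolding adjoin_rel_def using pp by (fastforce simp: image_iff)
 moreover have "countable (?A \<times> ?B \<times> ?A \<times> ?B)"
  using R by (intro countable_SIGMA countable_polys_over) auto
 ultimately show ?thesis by (meson countable_image countable_subset)
qed

lemma adjoin_rel_subset:
 assumes M: "subfield_set M" "subfield_set M'" and R: "R \<subseteq> M \<times> M'" and c: "c:M" "c':M'"
 shows "adjoin_rel R c c' \<subseteq> M \<times> M'"
proof -
 have "p:polys_over M & p':polys_over M'" if "pairpoly R p p'" for p p'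
  using that R by (auto simp: pairpoly_def polys_over_def)
 thus ?thesis unfolding adjoin_rel_def using c
  by (auto intro!: sf_divide[OF M(1)] po_poly[OF M(1)] sf_divide[OF M(2)] po_poly[OF M(2)])
qed

context
 fixes R :: "('a::linordered_field \<times> 'a) set"
 assumes R: "ofield_rel R"
begin

lemma pp_const: "(a, a'):R ==> pairpoly R [:a:] [:a':]" by (intro pp_pCons[OF R] pp_0[OF R])
lemma pp_1: "pairpoly R 1 1" using pp_const[OF or_1[OF R]] by (simp add: one_pCons)

lemma pp_unique: "pairpoly R p p' ==> pairpoly R p p'' ==> p' = p''"
 by (rule poly_eqI) (metis pairpoly_def or_eq[OF R])

lemma pp_divmod:
 assumes "pairpoly R p p'" "pairpoly R d d'" "d ~= 0"
 shows "EX q q' r r'. pairpoly R q q' & pairpoly R r r' & p = q * d + r & p' = q' * d' + r' & (r = 0 | degree r < degree d)"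
proof -
 obtain q r where qr: "q:polys_over (fst ` R)" "r:polys_over (fst ` R)" "p = q * d + r" "r = 0 | degree r < degree d"
  using po_divmod[OF or_dom[OF R] pp_dom[OF R assms(2)] assms(3) pp_dom[OF R assms(1)]] by blast
 obtain q' where q': "pairpoly R q q'" using pp_exists[OF R qr(1)] by blast
 obtain r' where r': "pairpoly R r r'" using pp_exists[OF R qr(2)] by blast
 have "pairpoly R p (q' * d' + r')" unfolding qr(3) by (intro pp_add[OF R] pp_mult[OF R] q' r' assms)
 hence "p' = q' * d' + r'" using pp_unique assms(1) by blast
 thus ?thesis using q' r' qr by blast
qed

lemma adjoin_relI:
 assumes "!!p p'. pairpoly R p p' ==> poly p c = 0 <-> poly p' c' = 0" "pairpoly R p p'" "pairpoly R q q'"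
 shows "(poly p c / poly q c, poly p' c' / poly q' c'):adjoin_rel R c c'"
proof (cases "poly q c = 0")
 case True
 hence "poly q' c' = 0" using assms by blast
 thus ?thesis using True pp_0[OF R] pp_1 unfolding adjoin_rel_def
  by (intro CollectI exI[of _ 0] exI[of _ 1]) auto
next
 case False
 thus ?thesis unfolding adjoin_rel_def using assms by blast
qed

lemma adjoin_rel_base:
 assumes "!!p p'. pairpoly R p p' ==> poly p c = 0 <-> poly p' c' = 0"
 shows "R \<subseteq> adjoin_rel R c c'" "(c, c'):adjoin_rel R c c'"
proof -
 have *: "(poly p c, poly p' c'):adjoin_rel R c c'" if "pairpoly R p p'" for p p'
  using adjoin_relI[OF assms that pp_1] by simp
 show "R \<subseteq> adjoin_rel R c c'" using *[OF pp_const] by auto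
 show "(c, c'):adjoin_rel R c c'" using *[OF pp_pCons[OF R or_0[OF R] pp_const[OF or_1[OF R]]]] by simp
qed

lemma adjoin_rel_ofield:
 assumes z: "!!p p'. pairpoly R p p' ==> poly p c = 0 <-> poly p' c' = 0"
  and s: "!!p p'. pairpoly R p p' ==> poly p c > 0 <-> poly p' c' > 0"
 shows "ofield_rel (adjoin_rel R c c')"
 unfolding ofield_rel_def
proof (intro conjI allI impI)
 show "(1, 1):adjoin_rel R c c'" using adjoin_rel_base(1)[OF z] or_1[OF R] by blast
next
 fix x x' y y' assume "(x, x'):adjoin_rel R c c'" "(y, y'):adjoin_rel R c c'"
 then obtain p p' q q' r r' s s' where x: "x = poly p c / poly q c" "x' = poly p' c' / poly q' c'"
   "pairpoly R p p'" "pairpoly R q q'" "poly q c ~= 0"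
  and y: "y = poly r c / poly s c" "y' = poly r' c' / poly s' c'"
   "pairpoly R r r'" "pairpoly R s s'" "poly s c ~= 0"
  unfolding adjoin_rel_def by blast
 have ne: "poly q' c' ~= 0" "poly s' c' ~= 0" using x y z by blast+
 have "x - y = poly (p * s - r * q) c / poly (q * s) c" "x' - y' = poly (p' * s' - r' * q') c' / poly (q' * s') c'"
  unfolding x(1,2) y(1,2) using x(5) y(5) ne by (simp_all add: diff_frac_eq)
 thus "(x - y, x' - y'):adjoin_rel R c c'"
  using adjoin_relI[OF z pp_diff[OF R pp_mult[OF R x(3) y(4)] pp_mult[OF R y(3) x(4)]] pp_mult[OF R x(4) y(4)]] by simp
 have "x * y = poly (p * r) c / poly (q * s) c" "x' * y' = poly (p' * r') c' / poly (q' * s') c'"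
  unfolding x(1,2) y(1,2) by simp_all
 thus "(x * y, x' * y'):adjoin_rel R c c'"
  using adjoin_relI[OF z pp_mult[OF R x(3) y(3)] pp_mult[OF R x(4) y(4)]] by simp
next
 fix x x' assume "(x, x'):adjoin_rel R c c'"
 then obtain p p' q q' where x: "x = poly p c / poly q c" "x' = poly p' c' / poly q' c'"
   "pairpoly R p p'" "pairpoly R q q'" "poly q c ~= 0"
  unfolding adjoin_rel_def by blast
 show "(inverse x, inverse x'):adjoin_rel R c c'" using adjoin_relI[OF z x(4,3)] by (simp add: x)
 have "poly q' c' ~= 0" using x z by blast
 thus "0 < x <-> 0 < x'"
  using s[OF pp_mult[OF R x(3,4)]] x(5) unfolding x(1,2)
  by (auto simp: zero_less_divide_iff zero_less_mult_iff)
qed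

end

context arc_field
begin

text \<open>These relations form the back-and-forth system. Residues need no condition of their own,
  being governed by cuts in a real closed field; countability is what saturation can handle.\<close>

definition good :: "('k \<times> 'k) set => bool" where
 "good R <-> ofield_rel R & tpG (vR v R) & countable R"

abbreviation "good_adjoin R c c' \<equiv> good (adjoin_rel R c c') & R \<subseteq> adjoin_rel R c c' & (c, c'):adjoin_rel R c c'"

text \<open>\<open>p c\<close> itself need not be a monomial; only its value is that of some
  \<open>a c ^ k\<close>. The same exponent and corresponding coefficients on the other side are
  what lets values correspond.\<close>

abbreviation like_monomials :: "('k \<times> 'k) set => 'k => 'k => 'k poly => 'k poly => bool" where
 "like_monomials R c c' p p' \<equiv> EX a a' k. (a, a'):R & poly p c ~= 0 & poly p' c' ~= 0 &
   v (poly p c) = v a + nmul k (v c) & v (poly p' c') = v a' + nmul k (v c') & (poly p c > 0 <-> poly p' c' > 0)"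

lemma good_converse: "good R ==> good (R\<inverse>)"
proof -
 assume R: "good R"
 have "R\<inverse> = (%(x, y). (y, x)) ` R" by auto
 hence "countable (R\<inverse>)" using R by (simp add: good_def)
 thus ?thesis using R ofield_rel_converse[of R] tpeq_converse[of _ _ _ "vR v R"]
  unfolding good_def vR_converse by blast
qed

lemma goodD: "good R ==> ofield_rel R" "good R ==> tpG (vR v R)" "good R ==> countable R"
 by (simp_all add: good_def)

lemma good_negl: "good R ==> (x, x'):R ==> (y, y'):R ==> x << y <-> x' << y'"
 unfolding negl_def
 using tpG_less[OF goodD(2) vR_I vR_I, of R y y' x x'] or_zero[OF goodD(1)] by metis

lemma good_v_nonneg: "good R ==> (x, x'):R ==> 0 <= v x <-> 0 <= v x'"
 using tpG_le[OF goodD(2) vR_I[OF or_1[OF goodD(1)]] vR_I, of R x x'] by simp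

lemma good_v_eq: "good R ==> (x, x'):R ==> (y, y'):R ==> v x = v y <-> v x' = v y'"
 using tpG_eq[OF goodD(2) vR_I vR_I] by blast

end

locale arc_monster = arc_field v for v :: "'k::linordered_field => 'g::linordered_ab_group_add" +
 assumes satF: "aleph1_saturated Lval (Val v)"
  and satG: "aleph1_saturated Lgrp (OGrp :: (ogroup_fun, order_rel, 'g) struc)"
begin

text \<open>Every extension by one element goes through this criterion. The values of polynomials in
  \<open>c\<close> are sums covered by \<open>tpG_span\<close>, those of quotients are differences
  of such sums, covered by \<open>tpG_diff\<close>.\<close>

lemma good_extend:
 assumes R: "good R" and tp: "tpG (insert (v c, v c') (vR v R))"
  and cond: "!!p p'. pairpoly R p p' ==> poly p c = 0 & poly p' c' = 0 | like_monomials R c c' p p'"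
 shows "good_adjoin R c c'"
proof -
 let ?R = "adjoin_rel R c c'"
 note oR = goodD(1)[OF R]
 have z: "poly p c = 0 <-> poly p' c' = 0" if "pairpoly R p p'" for p p' using cond[OF that] by blast
 have s: "poly p c > 0 <-> poly p' c' > 0" if "pairpoly R p p'" for p p' using cond[OF that] by auto
 define S where "S = insert (v c, v c') (vR v R)"
 define T where "T = insert (0, 0) {(g + nmul k h, g' + nmul k h') | g g' h h' k. (g, g'):S & (h, h'):S}"
 have S: "countable S" unfolding S_def using countable_vR[OF goodD(3)[OF R]] by simp
 have T: "tpG T" unfolding T_def by (rule tpG_span) (use tp in \<open>simp add: S_def\<close>)
 have "T = insert (0, 0) ((%((g, g'), (h, h'), k). (g + nmul k h, g' + nmul k h')) ` (S \<times> S \<times> UNIV))"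
  by (force simp: T_def image_iff)
 hence "countable T" using S by simp
 hence D: "tpG {(g - h, g' - h') | g g' h h'. (g, g'):T & (h, h'):T}" (is "tpG ?D")
  using tpG_diff[OF T _ satG] by blast
 have inT: "(v (poly p c), v (poly p' c')):T" if "pairpoly R p p'" for p p'
 proof (cases "poly p c = 0 & poly p' c' = 0")
  case False
  then obtain a a' k where "(a, a'):R" "v (poly p c) = v a + nmul k (v c)" "v (poly p' c') = v a' + nmul k (v c')"
   using cond[OF \<open>pairpoly R p p'\<close>] by blast
  thus ?thesis unfolding T_def S_def by (intro insertI2 CollectI) (use vR_I in fastforce)
 qed (simp add: T_def)
 have "vR v ?R \<subseteq> ?D"
 proof
  fix x assume "x:vR v ?R"
  then obtain p p' q q' where x: "x = (v (poly p c / poly q c), v (poly p' c' / poly q' c'))"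
    "pairpoly R p p'" "pairpoly R q q'" "poly q c ~= 0"
   unfolding vR_def adjoin_rel_def by blast
  show "x:?D"
  proof (cases "poly p c = 0")
   case True
   hence "x = (0, 0)" using z[OF x(2)] by (simp add: x)
   hence "x = (0 - 0, 0 - 0)" by simp
   moreover have "(0, 0):T" by (simp add: T_def)
   ultimately show ?thesis by blast
  next
   case False
   hence "x = (v (poly p c) - v (poly q c), v (poly p' c') - v (poly q' c'))"
    using z[OF x(2)] z[OF x(3)] x(4) by (simp add: x(1) v_divide)
   thus ?thesis using inT[OF x(2)] inT[OF x(3)] by blast
  qed
 qed
 hence "tpG (vR v ?R)" using tpeq_mono[OF D] by blast
 thus ?thesis
  using adjoin_rel_ofield[OF oR z s] adjoin_rel_base[OF oR z] countable_adjoin_rel[OF goodD(3)[OF R]]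
  by (simp add: good_def)
qed

subsection \<open>New values\<close>

text \<open>Two monomials of equal value would make a multiple of \<open>v c\<close> a value of the
  domain; so all nonzero monomials have distinct values and the least one decides value and sign.
  Restricting \<open>n\<close> to the degree also admits radical extensions, where only small
  multiples are new.\<close>

lemma poly_dominant:
 assumes R: "good R" and p: "pairpoly R p p'" "p ~= 0" and c: "c ~= 0" "c' ~= 0" "c > 0 <-> c' > 0"
  and tp: "tpG (insert (v c, v c') (vR v R))"
  and new: "!!n a a'. 0 < n ==> n <= degree p ==> (a, a'):R ==> a ~= 0 ==> nmul n (v c) ~= v a"
 shows "like_monomials R c c' p p'"
proof -
 note oR = goodD(1)[OF R]
 have pc: "(coeff p i, coeff p' i):R" for i using p(1) by (simp add: pairpoly_def)
 have pz: "coeff p i = 0 <-> coeff p' i = 0" for i by (rule or_zero[OF oR pc])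
 define I where "I = {i. i <= degree p & coeff p i ~= 0}"
 have I: "finite I" "I ~= {}" using p(2) by (auto simp: I_def intro!: exI[of _ "degree p"])
 define t where "t i = coeff p i * c ^ i" for i
 define t' where "t' i = coeff p' i * c' ^ i" for i
 have vt: "v (t i) = v (coeff p i) + nmul i (v c)" "t i ~= 0" "v (t' i) = v (coeff p' i) + nmul i (v c')" "t' i ~= 0"
  if "i:I" for i using that c pz by (auto simp: t_def t'_def I_def v_mult v_power)
 have lt: "v (t i) < v (t j) <-> v (t' i) < v (t' j)" if "i:I" "j:I" for i j
  unfolding vt(1,3)[OF that(1)] vt(1,3)[OF that(2)]
  by (rule tpG_less[OF tpG_span[OF tp]]) (use vR_I[OF pc] in fastforce)+
 have aux: "v (t i) ~= v (t j)" if ij: "i:I" "j:I" "i < j" for i j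
 proof
  assume "v (t i) = v (t j)"
  hence "v (coeff p i) + nmul i (v c) = v (coeff p j) + nmul (i + (j - i)) (v c)"
   using vt ij by simp
  hence "nmul (j - i) (v c) = v (coeff p i / coeff p j)"
   unfolding nmul_add_left using ij by (simp add: I_def v_divide algebra_simps)
  moreover have "(coeff p i / coeff p j, coeff p' i / coeff p' j):R" by (rule or_divide[OF oR pc pc])
  moreover have "0 < j - i" "j - i <= degree p" "coeff p i / coeff p j ~= 0" using ij by (auto simp: I_def)
  ultimately show False using new by blast
 qed
 have dist: "v (t i) ~= v (t j)" if "i:I" "j:I" "i ~= j" for i j
  using aux[of i j] aux[of j i] that by (metis linorder_neqE_nat)
 obtain k where k: "k:I" "!!i. i:I ==> v (t k) <= v (t i)"
  using arg_min_if_finite[OF I, of "%i. v (t i)"] by (metis linorder_not_le)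
 have n1: "t i << t k" if "i ~= k" "i <= degree p" for i
 proof (cases "i:I")
  case True
  hence "v (t k) < v (t i)" using k(2)[of i] dist[of k i] k(1) that by (simp add: order.order_iff_strict)
  thus ?thesis using vt[OF k(1)] by (simp add: negl_def)
 next
  case False
  thus ?thesis using that vt[OF k(1)] by (simp add: I_def t_def)
 qed
 have n2: "t' i << t' k" if "i ~= k" "i <= degree p" for i
 proof (cases "i:I")
  case True
  hence "v (t k) < v (t i)" using k(2)[of i] dist[of k i] k(1) that by (simp add: order.order_iff_strict)
  thus ?thesis using lt[OF k(1) True] vt[OF k(1)] by (simp add: negl_def)
 next
  case False
  thus ?thesis using that vt[OF k(1)] pz by (simp add: I_def t'_def)
 qed
 have kd: "k <= degree p" using k(1) by (simp add: I_def)
 have "poly p c - t k = (\<Sum>i\<in>{..degree p} - {k}. t i)"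
  using kd by (simp add: poly_altdef t_def sum_diff1)
 also have "\<dots> << t k" by (rule negl_sum) (use vt k n1 in auto)
 finally have s1: "poly p c - t k << t k" .
 have "poly p' c' - t' k = (\<Sum>i\<in>{..degree p} - {k}. t' i)"
  using kd by (simp add: poly_altdef t'_def sum_diff1 pp_degree[OF oR p(1)])
 also have "\<dots> << t' k" by (rule negl_sum) (use vt k n2 in auto)
 finally have s2: "poly p' c' - t' k << t' k" .
 have cneg: "c < 0 <-> c' < 0" using c by (auto simp: neq_iff)
 have "t k > 0 <-> t' k > 0"
  using or_pos[OF oR pc, of k] or_neg[OF oR pc, of k] c cneg
  by (auto simp: t_def t'_def zero_less_mult_iff zero_less_power_eq power_less_zero_eq)
 hence "poly p c > 0 <-> poly p' c' > 0" using pos_iff_of_negl_diff s1 s2 by blast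
 thus ?thesis
  using v_eq_of_negl_diff[OF s1] v_eq_of_negl_diff[OF s2] vt[OF k(1)] pc[of k]
  by (intro exI[of _ "coeff p k"] exI[of _ "coeff p' k"] exI[of _ k]) auto
qed

lemma extend_new_value:
 assumes R: "good R" and c: "c ~= 0" "c' ~= 0" "c > 0 <-> c' > 0"
  and tp: "tpG (insert (v c, v c') (vR v R))"
  and new: "!!n a a'. 0 < n ==> (a, a'):R ==> a ~= 0 ==> nmul n (v c) ~= v a"
 shows "good_adjoin R c c'"
proof (rule good_extend[OF R tp])
 fix p p' assume p: "pairpoly R p p'"
 show "poly p c = 0 & poly p' c' = 0 | like_monomials R c c' p p'"
 proof (cases "p = 0")
  case True
  thus ?thesis using pp_zero[OF goodD(1)[OF R] p] by simp
 next
  case False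
  show ?thesis by (rule disjI2, rule poly_dominant[OF R p False c tp]) (use new in blast)
 qed
qed

text \<open>Modulo \<open>X ^ n - d\<close> only degrees below \<open>n\<close> remain, and below
  \<open>n\<close> the multiples of \<open>g\<close> are new. Choosing positive roots on both sides
  keeps the sign under control.\<close>

lemma extend_radical:
 assumes R: "good R" and d: "(d, d'):R" "d > 0" "v d = nmul n g" "n > 0"
  and new: "!!k a a'. 0 < k ==> k < n ==> (a, a'):R ==> a ~= 0 ==> nmul k g ~= v a"
 shows "EX c c'. c ^ n = d & c' ^ n = d' & v c = g & good_adjoin R c c'"
proof -
 note oR = goodD(1)[OF R]
 obtain g' where tp: "tpG (insert (g, g') (vR v R))"
  using tpeq_extend[OF goodD(2)[OF R] countable_vR[OF goodD(3)[OF R]] _ satG, of g] by auto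
 have vd': "v d' = nmul n g'"
  using nmul_tpG[OF tp, of g g' "v d" "v d'" n] vR_I[OF d(1), of v] d(3) by simp
 have d': "d' > 0" using or_pos[OF oR d(1)] d(2) by simp
 obtain c where c: "c > 0" "c ^ n = d" "v c = g" using root_exists[OF d(2,3,4)] by blast
 obtain c' where c': "c' > 0" "c' ^ n = d'" "v c' = g'" using root_exists[OF d' vd' d(4)] by blast
 define f where "f = monom 1 n - [:d:]"
 define f' where "f' = monom 1 n - [:d':]"
 have "pairpoly R (monom 1 n) (monom 1 n)" using or_0[OF oR] or_1[OF oR] by (simp add: pairpoly_def)
 hence ff': "pairpoly R f f'" unfolding f_def f'_def by (intro pp_diff[OF oR] pp_const[OF oR] d(1))
 have "coeff f n = 1" using d(4) by (cases n) (simp_all add: f_def)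
 moreover have "coeff f i = 0" if "i > n" for i using that by (cases i) (simp_all add: f_def)
 ultimately have df: "degree f = n" by (metis degree_le le_antisym le_degree zero_neq_one)
 have f0: "f ~= 0" using \<open>coeff f n = 1\<close> by auto
 have fc: "poly f c = 0" "poly f' c' = 0" by (simp_all add: f_def f'_def poly_monom c c')
 have tpc: "tpG (insert (v c, v c') (vR v R))" using tp c c' by simp
 have "good_adjoin R c c'"
 proof (rule good_extend[OF R tpc])
  fix p p' assume p: "pairpoly R p p'"
  obtain q q' r r' where qr: "pairpoly R q q'" "pairpoly R r r'" "p = q * f + r" "p' = q' * f' + r'"
    "r = 0 | degree r < degree f"
   using pp_divmod[OF oR p ff' f0] by blast
  have val: "poly p c = poly r c" "poly p' c' = poly r' c'" using fc by (simp_all add: qr(3,4))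
  show "poly p c = 0 & poly p' c' = 0 | like_monomials R c c' p p'"
  proof (cases "r = 0")
   case True
   thus ?thesis using pp_zero[OF oR qr(2)] val by simp
  next
   case False
   have cc: "c ~= 0" "c' ~= 0" "c > 0 <-> c' > 0" using c c' by auto
   show ?thesis unfolding val
    by (rule disjI2, rule poly_dominant[OF R qr(2) False cc tpc]) (use new qr(5) df c(3) False in auto)
  qed
 qed
 thus ?thesis using c c' by blast
qed

end

definition rel_alg_closed :: "'a::field set => bool" where
 "rel_alg_closed M <-> (ALL p:polys_over M. p ~= 0 --> (ALL x. poly p x = 0 --> x:M))"

context arc_monster
begin

text \<open>Algebraicity is expressed by what the extension cannot leave: any product of relatively
  algebraically closed subfields around \<open>R\<close>. In this form all extension steps stay in
  one countable set, as Zorn's lemma in \<open>closed_extension\<close> requires.\<close>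

definition alg_ext :: "('k \<times> 'k) set => ('k \<times> 'k) set => bool" where
 "alg_ext R R2 <-> good R2 & R \<subset> R2 &
   (ALL M M'. subfield_set M & rel_alg_closed M & subfield_set M' & rel_alg_closed M' & R \<subseteq> M \<times> M' -->
    R2 \<subseteq> M \<times> M')"

lemma alg_ext_converse: "alg_ext (R\<inverse>) R2 ==> alg_ext R (R2\<inverse>)"
proof -
 assume a: "alg_ext (R\<inverse>) R2"
 hence sub: "R \<subseteq> R2\<inverse>" "R ~= R2\<inverse>" by (auto simp: alg_ext_def)
 have "R2\<inverse> \<subseteq> M \<times> M'"
  if "subfield_set M" "rel_alg_closed M" "subfield_set M'" "rel_alg_closed M'" "R \<subseteq> M \<times> M'" for M M'
 proof -
  have "R\<inverse> \<subseteq> M' \<times> M" using that(5) by auto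
  hence "R2 \<subseteq> M' \<times> M" using a that by (simp add: alg_ext_def)
  thus ?thesis by auto
 qed
 thus ?thesis using a sub good_converse[of R2] by (auto simp: alg_ext_def)
qed

lemma alg_ext_adjoin:
 assumes f: "pairpoly R f f'" "f ~= 0" "poly f b = 0" "poly f' b' = 0" and R: "good R"
  and b: "b ~: fst ` R | b' ~: snd ` R"
  and g: "good_adjoin R b b'"
 shows "alg_ext R (adjoin_rel R b b')"
 unfolding alg_ext_def
proof (intro conjI allI impI)
 show "good (adjoin_rel R b b')" using g by blast
 have "(b, b') ~: R" using b by force
 thus "R \<subset> adjoin_rel R b b'" using g by blast
 fix M M'
 assume M: "subfield_set M & rel_alg_closed M & subfield_set M' & rel_alg_closed M' & R \<subseteq> M \<times> M'"
 hence "f:polys_over M" "f':polys_over M'" using f(1) by (auto simp: pairpoly_def polys_over_def)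
 moreover have "f' ~= 0" using pp_zero[OF goodD(1)[OF R] f(1)] f(2) by simp
 ultimately have "b:M" "b':M'" using M f unfolding rel_alg_closed_def by blast+
 thus "adjoin_rel R b b' \<subseteq> M \<times> M'" using adjoin_rel_subset M by blast
qed

subsection \<open>New residues\<close>

definition resR :: "('k \<times> 'k) set => ('k \<times> 'k) set" where
 "resR R = {(res a, res a') | a a'. (a, a'):R & 0 <= v a}"

lemma resR_I: "(a, a'):R ==> 0 <= v a ==> (res a, res a'):resR R"
 by (auto simp: resR_def)

lemma resR_subset: "good R ==> resR R \<subseteq> coef_field \<times> coef_field"
 using good_v_nonneg res(1) by (fastforce simp: resR_def)

lemma resR_converse: "good R ==> resR (R\<inverse>) = (resR R)\<inverse>"
 using good_v_nonneg by (fastforce simp: resR_def)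

lemma resR_ofield:
 assumes R: "good R"
 shows "ofield_rel (resR R)"
 unfolding ofield_rel_def
proof (intro conjI allI impI)
 note oR = goodD(1)[OF R]
 show "(1, 1):resR R" using resR_I[OF or_1[OF oR]] by simp
 fix x x' assume "(x, x'):resR R"
 then obtain a a' where a: "x = res a" "x' = res a'" "(a, a'):R" "0 <= v a" by (auto simp: resR_def)
 have a': "0 <= v a'" using good_v_nonneg[OF R a(3)] a(4) by simp
 have unit: "v a = 0 & a ~= 0 <-> v a' = 0 & a' ~= 0"
  using good_v_eq[OF R a(3) or_1[OF oR]] or_zero[OF oR a(3)] by simp
 have nz: "res b ~= 0 <-> v b = 0 & b ~= 0" if "0 <= v b" for b
  using res_eq_0_iff[OF that] not_negl_1[OF that] by blast
 show "(inverse x, inverse x'):resR R"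
 proof (cases "v a = 0 & a ~= 0")
  case True
  thus ?thesis using resR_I[OF or_inverse[OF oR a(3)]] unit res_inverse by (simp add: a)
 next
  case False
  hence "x = 0" "x' = 0" using nz[OF a(4)] nz[OF a'] unit a by auto
  thus ?thesis using resR_I[OF or_0[OF oR]] by simp
 qed
 show "0 < x <-> 0 < x'"
 proof (cases "v a = 0 & a ~= 0")
  case True
  thus ?thesis using res_pos_iff unit or_pos[OF oR a(3)] by (simp add: a)
 next
  case False
  hence "x = 0" "x' = 0" using nz[OF a(4)] nz[OF a'] unit a by auto
  thus ?thesis by simp
 qed
 fix y y' assume "(y, y'):resR R"
 then obtain b b' where b: "y = res b" "y' = res b'" "(b, b'):R" "0 <= v b" by (auto simp: resR_def)
 have b': "0 <= v b'" using good_v_nonneg[OF R b(3)] b(4) by simp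
 show "(x - y, x' - y'):resR R"
  using resR_I[OF or_diff[OF oR a(3) b(3)]] v_ring_diff a(4) b(4) a' b' by (simp add: a b res_diff)
 show "(x * y, x' * y'):resR R"
  using resR_I[OF or_mult[OF oR a(3) b(3)]] v_ring_mult a(4) b(4) a' b' by (simp add: a b res_mult)
qed

lemma lift_pairpoly:
 assumes R: "good R"
 shows "pairpoly (resR R) p p' ==> EX q q'. pairpoly R q q' & (ALL i. 0 <= v (coeff q i) & 0 <= v (coeff q' i)) &
  map_poly res q = p & map_poly res q' = p' & degree q = degree p & (q = 0 <-> p = 0)"
proof (induction p arbitrary: p')
 case 0
 hence "p' = 0" using pp_zero[OF resR_ofield[OF R]] by blast
 thus ?case using pp_0[OF goodD(1)[OF R]] by (intro exI[of _ 0]) auto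
next
 case (pCons a p)
 obtain a' p0' where p': "p' = pCons a' p0'" by (metis pCons_cases)
 have "(coeff (pCons a p) (Suc i), coeff (pCons a' p0') (Suc i)):resR R" for i
  using pCons.prems unfolding p' pairpoly_def by blast
 hence "pairpoly (resR R) p p0'" by (simp add: pairpoly_def)
 then obtain q q' where q: "pairpoly R q q'" "ALL i. 0 <= v (coeff q i) & 0 <= v (coeff q' i)"
  "map_poly res q = p" "map_poly res q' = p0'" "degree q = degree p" "q = 0 <-> p = 0" using pCons.IH by blast
 have "(a, a'):resR R" using pCons.prems unfolding p' pairpoly_def by (metis coeff_pCons_0)
 then obtain b b' where b: "a = res b" "a' = res b'" "(b, b'):R" "0 <= v b" by (auto simp: resR_def)
 have b': "0 <= v b'" using good_v_nonneg[OF R b(3)] b(4) by simp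
 show ?case
 proof (intro exI conjI)
  show "pairpoly R (pCons b q) (pCons b' q')" by (rule pp_pCons[OF goodD(1)[OF R] b(3) q(1)])
  show "ALL i. 0 <= v (coeff (pCons b q) i) & 0 <= v (coeff (pCons b' q') i)"
   using q(2) b(4) b' by (auto simp: coeff_pCons split: nat.splits)
  show "map_poly res (pCons b q) = pCons a p" "map_poly res (pCons b' q') = p'"
   using q b by (simp_all add: map_poly_pCons p')
  show "degree (pCons b q) = degree (pCons a p)" using q(5,6) by (simp add: degree_pCons_eq_if)
  show "pCons b q = 0 <-> pCons a p = 0" using pCons.hyps q(6) b by auto
 qed
qed

text \<open>\<open>D\<close> delimits the degrees left after reduction: those below a minimal
  polynomial in the algebraic case, all of them when every algebraic residue is already present. In
  both cases no residue polynomial of such a degree has a missing root, so cuts determine its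
  sign.\<close>

lemma extend_residue:
 assumes R: "good R" and c: "v c = 0" "c ~= 0" "v c' = 0" "c' ~= 0"
  and cut: "same_cut (resR R) (res c) (res c')"
  and D: "!!i j. D j ==> i <= j ==> D (i :: nat)"
  and red: "!!p p'. pairpoly R p p' ==> EX r r'. pairpoly R r r' & poly p c = poly r c & poly p' c' = poly r' c' &
    (r = 0 | D (degree r))"
  and roots: "!!q q' y. pairpoly (resR R) q q' ==> q ~= 0 ==> D (degree q) ==> y:coef_field ==>
    (poly q y = 0 --> y:fst ` resR R) & (poly q' y = 0 --> y:snd ` resR R)"
 shows "good_adjoin R c c'"
proof (rule good_extend[OF R])
 note oR = goodD(1)[OF R]
 have "(v c, v c'):vR v R" using vR_I[OF or_1[OF oR], of v] c by simp
 thus "tpG (insert (v c, v c') (vR v R))" using goodD(2)[OF R] by (simp add: insert_absorb)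
 fix p p' assume "pairpoly R p p'"
 then obtain r r' where r: "pairpoly R r r'" "poly p c = poly r c" "poly p' c' = poly r' c'" "r = 0 | D (degree r)"
  using red by blast
 show "poly p c = 0 & poly p' c' = 0 | like_monomials R c c' p p'"
  unfolding r(2,3)
 proof (cases "r = 0")
  case True
  thus "poly r c = 0 & poly r' c' = 0 | like_monomials R c c' r r'"
   using pp_zero[OF oR r(1)] by simp
 next
  case r0: False
  have pc: "(coeff r i, coeff r' i):R" for i using r(1) by (simp add: pairpoly_def)
  define I where "I = {i. i <= degree r & coeff r i ~= 0}"
  have I: "finite I" "I ~= {}" using r0 by (auto simp: I_def intro!: exI[of _ "degree r"])
  \<comment> \<open>Dividing by a coefficient of least value makes the polynomial primitive, so that
    its residue polynomial is not zero.\<close>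
  obtain j where j: "j:I" "!!i. i:I ==> v (coeff r j) <= v (coeff r i)"
   using arg_min_if_finite[OF I, of "%i. v (coeff r i)"] by (metis linorder_not_le)
  let ?a = "coeff r j" and ?a' = "coeff r' j"
  have a0: "?a ~= 0" using j(1) by (simp add: I_def)
  have a0': "?a' ~= 0" using or_zero[OF oR pc] a0 by simp
  define s where "s = smult (inverse ?a) r"
  define s' where "s' = smult (inverse ?a') r'"
  have ss': "pairpoly R s s'" unfolding s_def s'_def by (intro pp_smult[OF oR] or_inverse[OF oR] pc r(1))
  have sO: "0 <= v (coeff s i)" for i
  proof (cases "i:I")
   case True
   thus ?thesis using j(2)[OF True] a0 by (simp add: s_def I_def v_mult)
  next
   case False
   hence "coeff r i = 0" by (cases "i <= degree r") (auto simp: I_def coeff_eq_0)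
   thus ?thesis by (simp add: s_def)
  qed
  have sc: "(coeff s i, coeff s' i):R" for i using ss' by (simp add: pairpoly_def)
  have sO': "0 <= v (coeff s' i)" for i using good_v_nonneg[OF R sc] sO by simp
  let ?q = "map_poly res s" and ?q' = "map_poly res s'"
  have q: "pairpoly (resR R) ?q ?q'" using resR_I[OF sc sO] by (simp add: pairpoly_def coeff_map_poly)
  have "coeff ?q j = 1" using a0 by (simp add: coeff_map_poly s_def)
  hence q0: "?q ~= 0" by auto
  have "degree ?q <= degree s" by (rule degree_le) (simp add: coeff_map_poly coeff_eq_0)
  hence "degree ?q <= degree r" by (simp add: s_def a0)
  hence Dq: "D (degree ?q)" using D r(4) r0 by blast
  have rc: "res c:coef_field" "res c':coef_field" using res(1) c by simp_all
  have tr: "poly ?q (res c) > 0 <-> poly ?q' (res c') > 0" "poly ?q (res c) ~= 0" "poly ?q' (res c') ~= 0"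
   using rc_sign_transfer[OF coef_field(1) resR_ofield[OF R] resR_subset[OF R] rc cut q q0] roots[OF q q0 Dq] by blast+
  have cO: "0 <= v c" "0 <= v c'" using c by simp_all
  have rs: "res (poly s c) = poly ?q (res c)" "res (poly s' c') = poly ?q' (res c')"
   by (rule res_poly[OF cO(1) sO], rule res_poly[OF cO(2) sO'])
  have u: "v (poly s c) = 0 & poly s c ~= 0" "v (poly s' c') = 0 & poly s' c' ~= 0"
   using tr(2,3) res_eq_0_iff[OF v_ring_poly[OF sO cO(1)]] not_negl_1[OF v_ring_poly[OF sO cO(1)]]
    res_eq_0_iff[OF v_ring_poly[OF sO' cO(2)]] not_negl_1[OF v_ring_poly[OF sO' cO(2)]] unfolding rs by blast+
  have sgn: "poly s c > 0 <-> poly s' c' > 0" using tr(1) res_pos_iff u unfolding rs[symmetric] by metis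
  have rv: "poly r c = ?a * poly s c" "poly r' c' = ?a' * poly s' c'"
   using a0 a0' by (simp_all add: s_def s'_def)
  have "poly r c > 0 <-> poly r' c' > 0"
   unfolding rv using or_pos[OF oR pc, of j] or_neg[OF oR pc, of j] sgn u
   by (auto simp: zero_less_mult_iff neq_iff)
  thus "poly r c = 0 & poly r' c' = 0 | like_monomials R c c' r r'"
   using pc[of j] u a0 a0' by (intro disjI2 exI[of _ ?a] exI[of _ ?a'] exI[of _ 0]) (auto simp: rv v_mult)
 qed
qed

definition res_closed :: "('k \<times> 'k) set => bool" where
 "res_closed R <-> (ALL q q' y. pairpoly (resR R) q q' & q ~= 0 & y:coef_field -->
   (poly q y = 0 --> y:fst ` resR R) & (poly q' y = 0 --> y:snd ` resR R))"

lemma res_of_nat: "res (of_nat n) = of_nat n"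
 by (rule res_id[OF sf_of_nat[OF coef_field_sf]])

lemma map_poly_res_pderiv:
 assumes "!!i. 0 <= v (coeff f i)"
 shows "map_poly res (pderiv f) = pderiv (map_poly res f)"
proof (rule poly_eqI)
 fix i
 have "0 <= v (of_nat (Suc i))" using v_of_nat[of "Suc i"] by simp
 thus "coeff (map_poly res (pderiv f)) i = coeff (pderiv (map_poly res f)) i"
  using assms res_mult[of "of_nat (Suc i)" "coeff f (Suc i)"] res_of_nat[of "Suc i"]
  by (simp add: coeff_map_poly coeff_pderiv del: of_nat_Suc)
qed

lemma residue_root_lift:
 assumes f: "!!i. 0 <= v (coeff f i)" and y: "y:coef_field" "poly (map_poly res f) y = 0"
  "poly (pderiv (map_poly res f)) y ~= 0" "y ~= 0"
 shows "EX b. poly f b = 0 & res b = y & v b = 0 & b ~= 0"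
proof -
 have yO: "0 <= v y" by (rule coef_field(2)[OF y(1)])
 have "res (poly f y) = 0" using res_poly[OF yO f] y res_id by simp
 hence f0: "poly f y << 1" using res_eq_0_iff[OF v_ring_poly[OF f yO]] by blast
 have dO: "0 <= v (coeff (pderiv f) i)" for i
  unfolding coeff_pderiv using v_of_nat[of "Suc i"] f by (intro v_ring_mult) auto
 have "res (poly (pderiv f) y) ~= 0"
  using res_poly[OF yO dO] y res_id map_poly_res_pderiv[OF f] by simp
 hence "poly (pderiv f) y ~= 0 & v (poly (pderiv f) y) = 0"
  using res_eq_0_iff[OF v_ring_poly[OF dO yO]] not_negl_1[OF v_ring_poly[OF dO yO]] by blast
 then obtain b where b: "poly f b = 0" "b - y << 1" using hensel[OF f yO f0] by blast
 have "b - y << y" using b(2) y(4) coef_field_unit[OF y(1)] by (simp add: negl_def)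
 hence "v b = 0 & b ~= 0" using v_eq_of_negl_diff coef_field_unit[OF y(1)] by metis
 thus ?thesis using b resI[OF y(1) b(2)] by blast
qed

text \<open>Least degree makes the missing residue root simple. \<open>rc_root_transfer\<close>
  finds its counterpart in the same cut, and Hensel's lemma lifts both to roots of the lifted
  polynomials.\<close>

lemma extend_residue_alg_aux:
 assumes R: "good R" and p: "pairpoly (resR R) p p'" "p ~= 0" and y: "y:coef_field" "poly p y = 0" "y ~: fst ` resR R"
  and low: "!!q q' y. pairpoly (resR R) q q' ==> q ~= 0 ==> degree q < degree p ==> y:coef_field ==>
    (poly q y = 0 --> y:fst ` resR R) & (poly q' y = 0 --> y:snd ` resR R)"
 shows "EX R2. alg_ext R R2"
proof -
 let ?H = "resR R"
 note H = resR_ofield[OF R] resR_subset[OF R] and oR = goodD(1)[OF R]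
 obtain y' where y': "y':coef_field" "poly p' y' = 0" and cut: "same_cut ?H y y'"
  using rc_root_transfer[OF coef_field(1) H p y low] by blast
 have y'H: "y' ~: snd ` ?H" using cut by (force simp: same_cut_def)
 have dpos: "degree p > 0" by (rule poly_root_degree_pos[OF p(2) y(2)])
 have pd: "pairpoly ?H (pderiv p) (pderiv p')" by (rule pp_pderiv[OF H(1) p(1)])
 have pd0: "pderiv p ~= 0" "degree (pderiv p) < degree p"
  using dpos by (simp_all add: pderiv_eq_0_iff degree_pderiv)
 have dy: "poly (pderiv p) y ~= 0" using low[OF pd pd0 y(1)] y(3) by blast
 have dy': "poly (pderiv p') y' ~= 0" using low[OF pd pd0 y'(1)] y'H by blast
 have "(0, 0):?H" by (rule or_0[OF H(1)])
 hence ne: "y ~= 0" "y' ~= 0" using cut by (auto simp: same_cut_def)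
 obtain f f' where f: "pairpoly R f f'" "ALL i. 0 <= v (coeff f i) & 0 <= v (coeff f' i)"
  "map_poly res f = p" "map_poly res f' = p'" "degree f = degree p" "f = 0 <-> p = 0"
  using lift_pairpoly[OF R p(1)] by blast
 obtain b where b: "poly f b = 0" "res b = y" "v b = 0" "b ~= 0"
  using residue_root_lift[of f y] f(2,3) y dy ne by auto
 obtain b' where b': "poly f' b' = 0" "res b' = y'" "v b' = 0" "b' ~= 0"
  using residue_root_lift[of f' y'] f(2,4) y' dy' ne by auto
 have f0: "f ~= 0" using f(6) p(2) by simp
 have "good_adjoin R b b'"
 proof (rule extend_residue[OF R b(3,4) b'(3,4), where D = "%n. n < degree p"])
  show "same_cut ?H (res b) (res b')" using cut b b' by simp
  fix g g' assume "pairpoly R g g'"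
  then obtain q q' r r' where "pairpoly R q q'" "pairpoly R r r'" "g = q * f + r" "g' = q' * f' + r'"
    "r = 0 | degree r < degree f"
   using pp_divmod[OF oR _ f(1) f0] by blast
  thus "EX r r'. pairpoly R r r' & poly g b = poly r b & poly g' b' = poly r' b' & (r = 0 | degree r < degree p)"
   using b(1) b'(1) f(5) by (intro exI[of _ r] exI[of _ r']) auto
 qed (use low in auto)
 moreover have "b ~: fst ` R"
 proof
  assume "b:fst ` R"
  then obtain z where "(b, z):R" by auto
  hence "(res b, res z):?H" using resR_I b(3) by simp
  thus False using y(3) b(2) by force
 qed
 ultimately have "alg_ext R (adjoin_rel R b b')" using alg_ext_adjoin[OF f(1) f0 b(1) b'(1) R] by blast
 thus ?thesis by blast
qed

lemma extend_residue_alg: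
 assumes R: "good R" and nc: "~ res_closed R"
 shows "EX R2. alg_ext R R2"
proof -
 let ?P = "%q q' y. pairpoly (resR R) q q' & q ~= 0 & y:coef_field &
   ((poly q y = 0 & y ~: fst ` resR R) | (poly q' y = 0 & y ~: snd ` resR R))"
 have "EX t. ?P (fst t) (fst (snd t)) (snd (snd t))" using nc unfolding res_closed_def by auto
 then obtain t where t: "?P (fst t) (fst (snd t)) (snd (snd t))"
  and tmin: "!!u. ?P (fst u) (fst (snd u)) (snd (snd u)) ==> degree (fst t) <= degree (fst u)"
  using ex_has_least_nat[of "%t. ?P (fst t) (fst (snd t)) (snd (snd t))" _ "%t. degree (fst t)"] by blast
 obtain p p' y where tp: "t = (p, p', y)" by (metis prod.exhaust)
 have P: "?P p p' y" using t by (simp add: tp)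
 have low: "(poly q z = 0 --> z:fst ` resR R) & (poly q' z = 0 --> z:snd ` resR R)"
  if "pairpoly (resR R) q q'" "q ~= 0" "degree q < degree p" "z:coef_field" for q q' z
  using tmin[of "(q, q', z)"] that by (auto simp: tp)
 show ?thesis
 proof (cases "poly p y = 0 & y ~: fst ` resR R")
  case True
  thus ?thesis using extend_residue_alg_aux[OF R, of p p' y] P low by blast
 next
  case False
  hence y: "poly p' y = 0" "y ~: snd ` resR R" using P by auto
  note H = resR_ofield[OF R]
  have deg: "degree p' = degree p" "p' ~= 0" using pp_degree[OF H] pp_zero[OF H] P by auto
  have "EX R2. alg_ext (R\<inverse>) R2"
  proof (rule extend_residue_alg_aux[OF good_converse[OF R], of p' p y])
   show "pairpoly (resR (R\<inverse>)) p' p" using P pairpoly_converse resR_converse[OF R] by metis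
   show "y ~: fst ` resR (R\<inverse>)" using y(2) unfolding resR_converse[OF R] by force
   fix q q' z assume q: "pairpoly (resR (R\<inverse>)) q q'" "q ~= 0" "degree q < degree p'" "z:coef_field"
   have q': "pairpoly (resR R) q' q" using pairpoly_converse[OF q(1)] unfolding resR_converse[OF R] by simp
   have "q' ~= 0" "degree q' < degree p" using pp_degree[OF H q'] pp_zero[OF H q'] q deg by auto
   thus "(poly q z = 0 --> z:fst ` resR (R\<inverse>)) & (poly q' z = 0 --> z:snd ` resR (R\<inverse>))"
    using low[OF q' _ _ q(4)] unfolding resR_converse[OF R] by force
  qed (use P y deg in auto)
  thus ?thesis using alg_ext_converse by blast
 qed
qed

end

subsection \<open>Immediate extensions\<close>

text \<open>The Hasse derivative, that is, the i-th derivative divided by the factorial of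
  \<open>i\<close>: the coefficient of \<open>h ^ i\<close> in the Taylor expansion.\<close>

definition hasse :: "nat => 'a::comm_ring_1 poly => 'a poly" where
 "hasse i q = (\<Sum>m\<in>{i..degree q}. monom (of_nat (m choose i) * coeff q m) (m - i))"

lemma poly_hasse: "poly (hasse i q) a = (\<Sum>m\<in>{i..degree q}. of_nat (m choose i) * coeff q m * a ^ (m - i))"
 by (simp add: hasse_def poly_sum poly_monom)

lemma poly_taylor: "poly q (a + h) = (\<Sum>i\<le>degree q. poly (hasse i q) a * h ^ i)"
proof -
 have "poly q (a + h) = (\<Sum>m\<le>degree q. coeff q m * (h + a) ^ m)"
  by (simp only: poly_altdef add.commute[of a h])
 also have "\<dots> = (\<Sum>m\<le>degree q. \<Sum>i\<le>m. of_nat (m choose i) * coeff q m * a ^ (m - i) * h ^ i)"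
  by (simp add: binomial_ring sum_distrib_left mult_ac)
 also have "\<dots> = (\<Sum>i\<le>degree q. \<Sum>m\<in>{i..degree q}. of_nat (m choose i) * coeff q m * a ^ (m - i) * h ^ i)"
  unfolding sum.Sigma[OF finite_atMost ballI[OF finite_atMost]] sum.Sigma[OF finite_atMost ballI[OF finite_atLeastAtMost]]
  by (rule sum.reindex_bij_witness[of _ "%(i, m). (m, i)" "%(m, i). (i, m)"]) auto
 also have "\<dots> = (\<Sum>i\<le>degree q. poly (hasse i q) a * h ^ i)"
  by (simp add: poly_hasse sum_distrib_right)
 finally show ?thesis .
qed

lemma hasse_0 [simp]: "poly (hasse 0 q) a = poly q a"
 unfolding poly_hasse by (simp add: poly_altdef atLeast0AtMost)

lemma hasse_pderiv:
 fixes q :: "'a::field_char_0 poly"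
 assumes "degree q > 0"
 shows "poly (hasse j (pderiv q)) a = of_nat (Suc j) * poly (hasse (Suc j) q) a"
proof -
 have d: "degree q = Suc (degree (pderiv q))" using assms by (simp add: degree_pderiv)
 have *: "of_nat (m choose j) * coeff (pderiv q) m = of_nat (Suc j) * (of_nat (Suc m choose Suc j) * coeff q (Suc m))" for m
 proof -
  have "of_nat (m choose j) * (of_nat (Suc m) :: 'a) = of_nat (Suc j) * of_nat (Suc m choose Suc j)"
   by (metis Suc_times_binomial mult.commute of_nat_mult)
  thus ?thesis by (simp only: coeff_pderiv mult.assoc[symmetric])
 qed
 have "poly (hasse (Suc j) q) a = (\<Sum>m\<in>{j..degree (pderiv q)}. of_nat (Suc m choose Suc j) * coeff q (Suc m) * a ^ (Suc m - Suc j))"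
  unfolding poly_hasse d by (rule sum.shift_bounds_cl_Suc_ivl)
 thus ?thesis
  by (simp only: poly_hasse * sum_distrib_left) (simp add: mult.assoc)
qed

lemma pderiv_sum: "pderiv (sum f I) = (\<Sum>i\<in>I. pderiv (f i :: 'a::idom poly))"
 by (induction I rule: infinite_finite_induct) (simp_all add: pderiv_add)

lemma hasse_polys_over: "subfield_set A ==> q:polys_over A ==> hasse i q:polys_over A"
proof -
 assume A: "subfield_set A" "q:polys_over A"
 have S: "sum f I:polys_over A" if "!!i. i:I ==> f i:polys_over A" for f and I :: "nat set"
  using that by (induction I rule: infinite_finite_induct) (auto intro: po_add[OF A(1)] po_0[OF A(1)])
 show ?thesis unfolding hasse_def
  by (intro S po_monom[OF A(1)] sf_mult[OF A(1)] sf_of_nat[OF A(1)] polys_overD[OF A(2)])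
qed

lemma hasse_degree:
 fixes q :: "'a::field_char_0 poly"
 assumes "q ~= 0" "i <= degree q" "i > 0"
 shows "hasse i q ~= 0" "degree (hasse i q) < degree q"
proof -
 have "coeff (hasse i q) (degree q - i) = (\<Sum>m\<in>{i..degree q}. if m = degree q then of_nat (m choose i) * coeff q m else 0)"
  unfolding hasse_def coeff_sum by (rule sum.cong) (use assms in auto)
 also have "\<dots> = of_nat (degree q choose i) * lead_coeff q" using assms by simp
 also have "\<dots> ~= 0" using assms by simp
 finally show "hasse i q ~= 0" by auto
 have "degree (hasse i q) <= degree q - i"
  by (rule degree_le) (auto simp: hasse_def coeff_sum intro!: sum.neutral)
 thus "degree (hasse i q) < degree q" using assms by simp
qed

context arc_field
begin

text \<open>The distances \<open>v (c - a)\<close> with \<open>a \<in> A\<close> have no maximum; a property holds near \<open>c\<close> if it holds for all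
  \<open>a \<in> A\<close> that are close enough to \<open>c\<close>.\<close>

definition no_best :: "'k set => 'k => bool" where
 "no_best A c <-> c ~: A & (ALL a:A. EX b:A. v (c - a) < v (c - b))"

definition near :: "'k set => 'k => ('k => bool) => bool" where
 "near A c P <-> (EX a0:A. ALL a:A. v (c - a0) <= v (c - a) --> P a)"

text \<open>Kaplansky's distinction for pseudo-convergent sequences: the values of \<open>r\<close>
  become constant when \<open>c\<close> is approached. An unstable polynomial signals an algebraic
  immediate extension.\<close>

definition stable :: "'k set => 'k => 'k poly => bool" where
 "stable A c r <-> (EX w. near A c (%a. poly r a ~= 0 & v (poly r a) = w))"

lemma near_mono: "near A c P ==> (!!a. a:A ==> P a ==> Q a) ==> near A c Q"
 unfolding near_def by blast

lemma near_conj: "near A c P ==> near A c Q ==> near A c (%a. P a & Q a)"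
proof -
 assume "near A c P" "near A c Q"
 then obtain a0 b0 where a: "a0:A" "b0:A" "!!a. a:A ==> v (c - a0) <= v (c - a) ==> P a"
  "!!a. a:A ==> v (c - b0) <= v (c - a) ==> Q a" unfolding near_def by blast
 show ?thesis
 proof (cases "v (c - a0) <= v (c - b0)")
  case True
  thus ?thesis unfolding near_def using a order_trans by (intro bexI[of _ b0]) blast+
 next
  case False
  hence "v (c - b0) <= v (c - a0)" by simp
  thus ?thesis unfolding near_def using a order_trans by (intro bexI[of _ a0]) blast+
 qed
qed

lemma near_ball: "finite I ==> A ~= {} ==> (!!i. i:I ==> near A c (P i)) ==> near A c (%a. ALL i:I. P i a)"
proof (induction I rule: finite_induct)
 case empty
 thus ?case by (auto simp: near_def)
next
 case (insert i I)
 thus ?case using near_conj[of A c "P i" "%a. ALL i:I. P i a"] by simp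
qed

lemma near_ex: "near A c P ==> EX a:A. P a"
 unfolding near_def by blast

lemma near_ge: "a:A ==> near A c (%x. v (c - a) <= v (c - x))"
 unfolding near_def by blast

context
 fixes A c
 assumes A: "subfield_set A" and nb: "no_best A c"
begin

lemma nb_ne: "a:A ==> c - a ~= 0" using nb by (auto simp: no_best_def)

lemma A_ne: "A ~= {}" using sf_1[OF A] by blast

lemma near_gt: "a:A ==> near A c (%x. v (c - a) < v (c - x))"
proof -
 assume "a:A"
 then obtain b where b: "b:A" "v (c - a) < v (c - b)" using nb by (auto simp: no_best_def)
 show ?thesis using near_ge[OF b(1)] by (rule near_mono) (use b in auto)
qed

text \<open>The comparison reduces to \<open>\<beta> i\<close> against
  \<open>\<beta> j + (j - i) v (c - a)\<close>. The latter grows strictly along distances without a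
  maximum, so it either passes \<open>\<beta> i\<close> or stays strictly below it.\<close>

lemma near_compare:
 assumes "i < j"
 shows "near A c (%a. \<beta> i + nmul i (v (c - a)) < \<beta> j + nmul j (v (c - a))) |
     near A c (%a. \<beta> j + nmul j (v (c - a)) < \<beta> i + nmul i (v (c - a)))"
proof -
 define k where "k = j - i"
 have k: "k > 0" "j = i + k" using assms by (auto simp: k_def)
 have mono: "nmul k (v (c - a)) < nmul k (v (c - b))" if "v (c - a) < v (c - b)" for a b
  using nmul_less_iff[OF k(1)] that by blast
 have e: "\<beta> i + nmul i (v (c - a)) < \<beta> j + nmul j (v (c - a)) <-> \<beta> i < \<beta> j + nmul k (v (c - a))"
  "\<beta> j + nmul j (v (c - a)) < \<beta> i + nmul i (v (c - a)) <-> \<beta> j + nmul k (v (c - a)) < \<beta> i" for a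
 proof -
  have "\<beta> j + nmul j (v (c - a)) = (\<beta> j + nmul k (v (c - a))) + nmul i (v (c - a))"
   by (simp add: k nmul_add_left ac_simps)
  thus "\<beta> i + nmul i (v (c - a)) < \<beta> j + nmul j (v (c - a)) <-> \<beta> i < \<beta> j + nmul k (v (c - a))"
   "\<beta> j + nmul j (v (c - a)) < \<beta> i + nmul i (v (c - a)) <-> \<beta> j + nmul k (v (c - a)) < \<beta> i"
   by simp_all
 qed
 show ?thesis
 proof (cases "EX a:A. \<beta> i < \<beta> j + nmul k (v (c - a))")
  case True
  then obtain a where a: "a:A" "\<beta> i < \<beta> j + nmul k (v (c - a))" by blast
  have "near A c (%x. \<beta> i < \<beta> j + nmul k (v (c - x)))"
   using near_gt[OF a(1)]
  proof (rule near_mono)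
   fix x assume "v (c - a) < v (c - x)"
   hence "\<beta> j + nmul k (v (c - a)) < \<beta> j + nmul k (v (c - x))" using mono by simp
   thus "\<beta> i < \<beta> j + nmul k (v (c - x))" using a(2) by (rule less_trans[rotated])
  qed
  thus ?thesis unfolding e by blast
 next
  case False
  have "near A c (%x. \<beta> j + nmul k (v (c - x)) < \<beta> i)"
   unfolding near_def
  proof (intro bexI[of _ 1] ballI impI)
   fix a assume a: "a:A"
   then obtain b where b: "b:A" "v (c - a) < v (c - b)" using nb by (auto simp: no_best_def)
   have "\<beta> j + nmul k (v (c - a)) < \<beta> j + nmul k (v (c - b))" using mono[OF b(2)] by simp
   also have "\<dots> <= \<beta> i" using False b(1) by (meson linorder_not_le)
   finally show "\<beta> j + nmul k (v (c - a)) < \<beta> i" .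
  qed (rule sf_1[OF A])
  thus ?thesis unfolding e by blast
 qed
qed

lemma near_minimum:
 assumes I: "finite I" "I ~= {}"
 shows "EX i0:I. near A c (%a. ALL i:I. i ~= i0 --> \<beta> i0 + nmul i0 (v (c - a)) < \<beta> i + nmul i (v (c - a)))"
proof -
 define t where "t i a = \<beta> i + nmul i (v (c - a))" for i a
 define D where "D i j <-> near A c (%a. t i a < t j a)" for i j
 have D: "D i j | D j i" if "i ~= j" for i j
  using near_compare[of i j \<beta>] near_compare[of j i \<beta>] that unfolding D_def t_def
  by (cases "i < j") auto
 have "near A c (%a. ALL x:I \<times> I. D (fst x) (snd x) --> t (fst x) a < t (snd x) a)"
 proof (rule near_ball)
  fix x assume "x:I \<times> I"
  show "near A c (%a. D (fst x) (snd x) --> t (fst x) a < t (snd x) a)"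
  proof (cases "D (fst x) (snd x)")
   case True
   thus ?thesis unfolding D_def by (rule near_mono) simp
  next
   case False
   thus ?thesis using A_ne by (auto simp: near_def)
  qed
 qed (use I A_ne in auto)
 then obtain a where a: "!!i j. i:I ==> j:I ==> D i j ==> t i a < t j a" using near_ex by fastforce
 obtain i0 where i0: "i0:I" "!!i. i:I ==> t i0 a <= t i a"
  using arg_min_if_finite[OF I, of "%i. t i a"] by (metis linorder_not_le)
 have "near A c (%a. ALL i:I. i ~= i0 --> t i0 a < t i a)"
 proof (rule near_ball[OF I(1) A_ne])
  fix i assume i: "i:I"
  show "near A c (%a. i ~= i0 --> t i0 a < t i a)"
  proof (cases "i = i0")
   case True
   thus ?thesis using A_ne by (auto simp: near_def)
  next
   case False
   have "~ D i i0" using a[OF i i0(1)] i0(2)[OF i] by auto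
   hence "D i0 i" using D False by blast
   thus ?thesis unfolding D_def by (rule near_mono) simp
  qed
 qed
 thus ?thesis using i0(1) unfolding t_def by blast
qed

text \<open>Hasse derivatives have lower degree and are stable, so one Taylor term has the least
  value \<open>e a\<close>. If \<open>e\<close> never exceeded the constant value of
  \<open>r\<close>, that term would dominate the expansion and \<open>v (poly r c) = e a\<close>
  would hold for all \<open>a\<close> near \<open>c\<close>; but \<open>e\<close> is strictly
  increasing.\<close>

lemma taylor_terms_negl:
 assumes r: "r:polys_over A" "r ~= 0" "stable A c r"
  and low: "!!s. s:polys_over A ==> s ~= 0 ==> degree s < degree r ==> stable A c s"
 shows "near A c (%a. ALL i:{1..degree r}. poly (hasse i r) a * (c - a) ^ i << poly r a)"
proof (cases "degree r = 0")
 case True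
 thus ?thesis using A_ne by (auto simp: near_def)
next
 case False
 define I where "I = {1..degree r}"
 have I: "finite I" "I ~= {}" using False by (auto simp: I_def)
 define t where "t i a = poly (hasse i r) a * (c - a) ^ i" for i a
 have "stable A c (hasse i r)" if "i:I" for i
  using low[OF hasse_polys_over[OF A r(1)] hasse_degree[OF r(2)]] that by (auto simp: I_def)
 hence "ALL i:I. EX w. near A c (%a. poly (hasse i r) a ~= 0 & v (poly (hasse i r) a) = w)"
  unfolding stable_def by blast
 then obtain \<beta> where \<beta>: "!!i. i:I ==> near A c (%a. poly (hasse i r) a ~= 0 & v (poly (hasse i r) a) = \<beta> i)"
  unfolding bchoice_iff by blast
 have vt: "near A c (%a. ALL i:I. t i a ~= 0 & v (t i a) = \<beta> i + nmul i (v (c - a)))"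
 proof (rule near_ball[OF I(1) A_ne])
  fix i assume "i:I"
  from \<beta>[OF this] show "near A c (%a. t i a ~= 0 & v (t i a) = \<beta> i + nmul i (v (c - a)))"
   by (rule near_mono) (use nb_ne in \<open>simp add: t_def v_mult v_power\<close>)
 qed
 obtain i0 where i0: "i0:I" and min: "near A c (%a. ALL i:I. i ~= i0 --> \<beta> i0 + nmul i0 (v (c - a)) < \<beta> i + nmul i (v (c - a)))"
  using near_minimum[OF I] by blast
 define e where "e a = \<beta> i0 + nmul i0 (v (c - a))" for a
 have emono: "e a < e b" if "v (c - a) < v (c - b)" for a b
  using nmul_less_iff[of i0] that i0 by (auto simp: e_def I_def)
 obtain \<rho> where \<rho>: "near A c (%a. poly r a ~= 0 & v (poly r a) = \<rho>)" using r(3) unfolding stable_def by blast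
 show ?thesis
 proof (cases "EX a:A. \<rho> < e a")
  case True
  then obtain a0 where a0: "a0:A" "\<rho> < e a0" by blast
  from near_conj[OF near_conj[OF vt min] near_conj[OF \<rho> near_gt[OF a0(1)]]]
  have "near A c (%a. ALL i:I. t i a << poly r a)"
  proof (rule near_mono, intro ballI)
   fix a i
   assume h: "((ALL i:I. t i a ~= 0 & v (t i a) = \<beta> i + nmul i (v (c - a))) &
    (ALL i:I. i ~= i0 --> \<beta> i0 + nmul i0 (v (c - a)) < \<beta> i + nmul i (v (c - a)))) &
    (poly r a ~= 0 & v (poly r a) = \<rho>) & v (c - a0) < v (c - a)" and i: "i:I"
   have "\<rho> < e a" using a0(2) emono[of a0 a] h by (auto intro: less_trans)
   also have "e a <= \<beta> i + nmul i (v (c - a))" using h i unfolding e_def by (cases "i = i0") auto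
   finally show "t i a << poly r a" using h i by (simp add: negl_def)
  qed
  thus ?thesis by (simp add: I_def t_def)
 next
  case False
  have elt: "e a < \<rho>" if a: "a:A" for a
  proof -
   obtain b where b: "b:A" "v (c - a) < v (c - b)" using nb a by (auto simp: no_best_def)
   thus ?thesis using emono[OF b(2)] False by (meson less_le_trans linorder_not_le)
  qed
  from near_conj[OF near_conj[OF vt min] \<rho>] have n: "near A c (%a. v (poly r c) = e a)"
  proof (rule near_mono)
   fix a assume a: "a:A" and h: "((ALL i:I. t i a ~= 0 & v (t i a) = \<beta> i + nmul i (v (c - a))) &
    (ALL i:I. i ~= i0 --> \<beta> i0 + nmul i0 (v (c - a)) < \<beta> i + nmul i (v (c - a)))) &
    (poly r a ~= 0 & v (poly r a) = \<rho>)"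
   have t0: "t i0 a ~= 0" "v (t i0 a) = e a" using h i0 by (auto simp: e_def)
   have "poly r c = poly r (a + (c - a))" by simp
   also have "\<dots> = (\<Sum>i\<le>degree r. poly (hasse i r) a * (c - a) ^ i)" by (rule poly_taylor)
   also have "{..degree r} = insert 0 (insert i0 (I - {i0}))" using i0 by (auto simp: I_def)
   also have "(\<Sum>i\<in>insert 0 (insert i0 (I - {i0})). poly (hasse i r) a * (c - a) ^ i) =
     poly r a + (t i0 a + (\<Sum>i\<in>I - {i0}. t i a))"
   proof -
    have f: "finite (I - {i0})" "finite (insert i0 (I - {i0}))" "0 ~: insert i0 (I - {i0})" "i0 ~: I - {i0}"
     using I i0 by (auto simp: I_def)
    show ?thesis unfolding sum.insert[OF f(2,3)] sum.insert[OF f(1,4)] by (simp add: t_def)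
   qed
   finally have "poly r c = t i0 a + (poly r a + (\<Sum>i\<in>I - {i0}. t i a))" by simp
   moreover have "(\<Sum>i\<in>I - {i0}. t i a) << t i0 a"
    using h t0 by (intro negl_sum) (auto simp: negl_def e_def)
   moreover have "poly r a << t i0 a" using h t0 elt[OF a] by (simp add: negl_def)
   ultimately show "v (poly r c) = e a" using v_add_eq[OF negl_add] t0 by metis
  qed
  obtain a1 where a1: "a1:A" "v (poly r c) = e a1" using near_ex[OF n] by blast
  obtain a2 where "a2:A" "v (c - a1) < v (c - a2)" "v (poly r c) = e a2"
   using near_ex[OF near_conj[OF near_gt[OF a1(1)] n]] by blast
  thus ?thesis using emono[of a1 a2] a1(2) by simp
 qed
qed

lemma stable_approx:
 assumes r: "r:polys_over A" "r ~= 0" "stable A c r"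
  and low: "!!s. s:polys_over A ==> s ~= 0 ==> degree s < degree r ==> stable A c s"
 shows "near A c (%a. poly r c - poly r a << poly r a)"
proof -
 obtain w where "near A c (%a. poly r a ~= 0 & v (poly r a) = w)" using r(3) unfolding stable_def by blast
 from near_conj[OF this taylor_terms_negl[OF r low]] show ?thesis
 proof (rule near_mono)
  fix a assume h: "(poly r a ~= 0 & v (poly r a) = w) & (ALL i:{1..degree r}. poly (hasse i r) a * (c - a) ^ i << poly r a)"
  have "poly r c = poly r (a + (c - a))" by simp
  also have "\<dots> = (\<Sum>i\<le>degree r. poly (hasse i r) a * (c - a) ^ i)" by (rule poly_taylor)
  also have "{..degree r} = insert 0 {1..degree r}" by auto
  also have "(\<Sum>i\<in>insert 0 {1..degree r}. poly (hasse i r) a * (c - a) ^ i) = poly r a + (\<Sum>i\<in>{1..degree r}. poly (hasse i r) a * (c - a) ^ i)"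
   by (subst sum.insert) auto
  finally have "poly r c - poly r a = (\<Sum>i\<in>{1..degree r}. poly (hasse i r) a * (c - a) ^ i)" by simp
  also have "\<dots> << poly r a" by (rule negl_sum) (use h in auto)
  finally show "poly r c - poly r a << poly r a" .
 qed
qed

text \<open>For an unstable \<open>q\<close> of least degree the derivative is stable, so near
  \<open>c\<close> the linear Taylor term dominates the higher ones. This is the situation of
  Hensel's lemma, which turns the approximation \<open>c\<close> into a root.\<close>

lemma unstable_root:
 assumes q: "q:polys_over A" "q ~= 0" "~ stable A c q"
  and low: "!!s. s:polys_over A ==> s ~= 0 ==> degree s < degree q ==> stable A c s"
 shows "EX b. poly q b = 0 & (ALL a:A. c - b << c - a)"
proof -
 define n where "n = degree q"
 have npos: "n > 0"
 proof (rule ccontr)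
  assume "~ n > 0"
  then obtain x where x: "q = [:x:]" unfolding n_def by (auto elim: degree_eq_zeroE)
  hence "near A c (%a. poly q a ~= 0 & v (poly q a) = v x)" using q(2) A_ne by (auto simp: near_def)
  thus False using q(3) unfolding stable_def by blast
 qed
 define t where "t i a = poly (hasse i q) a * (c - a) ^ i" for i a
 define d where "d = pderiv q"
 have d: "d:polys_over A" "d ~= 0" "degree d < degree q"
  using npos po_pderiv[OF A q(1)] by (simp_all add: d_def n_def pderiv_eq_0_iff degree_pderiv)
 have sd: "stable A c d" by (rule low[OF d])
 obtain \<beta> where \<beta>: "near A c (%a. poly d a ~= 0 & v (poly d a) = \<beta>)" using sd unfolding stable_def by blast
 have h1: "poly d a = poly (hasse 1 q) a" for a using hasse_pderiv[of q 0 a] npos by (simp add: d_def n_def)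
 have "near A c (%a. ALL i:{1..degree d}. poly (hasse i d) a * (c - a) ^ i << poly d a)"
  by (rule taylor_terms_negl[OF d(1,2) sd]) (use low d(3) in auto)
 from near_conj[OF this \<beta>]
 have dom: "near A c (%a. (ALL i:{2..n}. t i a << t 1 a) & t 1 a ~= 0 & v (t 1 a) = \<beta> + v (c - a))"
 proof (rule near_mono)
  fix a assume a: "a:A" and h: "(ALL i:{1..degree d}. poly (hasse i d) a * (c - a) ^ i << poly d a) & poly d a ~= 0 & v (poly d a) = \<beta>"
  have t1: "t 1 a = (c - a) * poly d a" using h1[of a] by (simp add: t_def mult.commute)
  have "t i a << t 1 a" if i: "i:{2..n}" for i
  proof -
   obtain j where j: "i = Suc j" "j >= 1" "j <= degree d" using i npos
    by (cases i) (auto simp: d_def n_def degree_pderiv)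
   have e: "poly (hasse j d) a = of_nat (Suc j) * poly (hasse (Suc j) q) a"
    using hasse_pderiv[of q j a] npos by (simp only: d_def n_def)
   have "poly (hasse j d) a * (c - a) ^ j << poly d a" using h j by auto
   hence "of_nat (Suc j) * (poly (hasse (Suc j) q) a * (c - a) ^ j) << poly d a"
    by (simp only: e mult.assoc)
   hence "poly (hasse (Suc j) q) a * (c - a) ^ j << poly d a"
    using v_of_nat[of "Suc j"]
    by (cases "poly (hasse (Suc j) q) a * (c - a) ^ j = 0") (auto simp: negl_def v_mult simp del: of_nat_Suc)
   hence "(c - a) * (poly (hasse (Suc j) q) a * (c - a) ^ j) << (c - a) * poly d a"
    using negl_mult nb_ne[OF a] by blast
   thus ?thesis unfolding t1 by (simp add: t_def j mult.left_commute)
  qed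
  moreover have "t 1 a ~= 0 & v (t 1 a) = \<beta> + v (c - a)"
   unfolding t1 using h nb_ne[OF a] by (simp add: v_mult add.commute)
  ultimately show "(ALL i:{2..n}. t i a << t 1 a) & t 1 a ~= 0 & v (t 1 a) = \<beta> + v (c - a)" by blast
 qed
 have split: "poly q (a + (c - a) * y) = poly q a + t 1 a * y + (\<Sum>i\<in>{2..n}. t i a * y ^ i)" for a y
 proof -
  have "poly q (a + (c - a) * y) = (\<Sum>i\<le>n. t i a * y ^ i)"
   unfolding poly_taylor n_def t_def by (simp add: power_mult_distrib mult.assoc)
  also have "{..n} = insert 0 (insert 1 {2..n})" using npos by auto
  also have "(\<Sum>i\<in>insert 0 (insert 1 {2..n}). t i a * y ^ i) = t 0 a + (t 1 a * y + (\<Sum>i\<in>{2..n}. t i a * y ^ i))"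
   by (subst sum.insert; simp)+
  finally show ?thesis by (simp add: t_def)
 qed
 have diff: "(poly q c - poly q a) - t 1 a << t 1 a"
  if "(ALL i:{2..n}. t i a << t 1 a) & t 1 a ~= 0 & v (t 1 a) = \<beta> + v (c - a)" for a
 proof -
  have "(poly q c - poly q a) - t 1 a = (\<Sum>i\<in>{2..n}. t i a)" using split[of a 1] by simp
  also have "\<dots> << t 1 a" by (rule negl_sum) (use that in auto)
  finally show ?thesis .
 qed
 \<comment> \<open>Otherwise the linear term would be negligible against \<open>poly q c\<close>
   near \<open>c\<close>, so \<open>poly q x\<close> would keep the value of
   \<open>poly q c\<close>, and \<open>q\<close> would be stable.\<close>
 have qc: "poly q c = 0 | \<beta> + v (c - a) < v (poly q c)" if a: "a:A" for a
 proof (rule ccontr)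
  assume n: "~ ?thesis"
  from near_conj[OF dom near_gt[OF a]]
  have "near A c (%x. poly q x ~= 0 & v (poly q x) = v (poly q c))"
  proof (rule near_mono)
   fix x assume h: "((ALL i:{2..n}. t i x << t 1 x) & t 1 x ~= 0 & v (t 1 x) = \<beta> + v (c - x)) & v (c - a) < v (c - x)"
   have "v (poly q c) <= \<beta> + v (c - a)" using n by (simp add: not_less)
   also have "\<dots> < v (t 1 x)" using h by simp
   finally have s: "t 1 x << poly q c" using n by (simp add: negl_def)
   have "(poly q c - poly q x) - t 1 x << poly q c" using negl_trans[OF diff s] h by blast
   from negl_add[OF this s] have "poly q c - poly q x << poly q c" by simp
   hence "poly q x - poly q c << poly q c" by (simp add: negl_diff_commute)
   thus "poly q x ~= 0 & v (poly q x) = v (poly q c)" using v_eq_of_negl_diff by blast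
  qed
  thus False using q(3) unfolding stable_def by blast
 qed
 have root: "near A c (%a. EX b. poly q b = 0 & c - b << c - a)"
  using dom
 proof (rule near_mono)
  fix a assume a: "a:A" and h: "(ALL i:{2..n}. t i a << t 1 a) & t 1 a ~= 0 & v (t 1 a) = \<beta> + v (c - a)"
  let ?u = "t 1 a"
  have qcu: "poly q c << ?u" using qc[OF a] h by (auto simp: negl_def)
  have "poly q a + ?u = poly q c - ((poly q c - poly q a) - ?u)" by simp
  also have "\<dots> << ?u" by (rule negl_diff[OF qcu diff[OF h]])
  finally have "poly q a - (- ?u) << - ?u" by simp
  hence vqa: "v (poly q a) = v ?u" using v_eq_of_negl_diff[of "poly q a" "- ?u"] by simp
  \<comment> \<open>\<open>q (a + (c - a) y)\<close> divided by its linear Taylor term: coefficient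
    1 at \<open>y\<close>, negligible coefficients above, and a negligible value at
    \<open>y = 1\<close>, the point that stands for \<open>c\<close>.\<close>
  define f where "f = [:poly q a / ?u, 1:] + (\<Sum>i\<in>{2..n}. monom (t i a / ?u) i)"
  have fy: "poly f y = poly q (a + (c - a) * y) / ?u" for y
  proof -
   have "poly f y = poly q a / ?u + y + (\<Sum>i\<in>{2..n}. t i a / ?u * y ^ i)"
    by (simp add: f_def poly_sum poly_monom)
   also have "\<dots> = (poly q a + ?u * y + (\<Sum>i\<in>{2..n}. t i a * y ^ i)) / ?u"
    using h by (simp add: add_divide_distrib sum_divide_distrib)
   finally show ?thesis unfolding split .
  qed
  have ti: "t i a / ?u << 1" if "i:{2..n}" for i using h that negl_1_iff by blast
  have cf: "coeff f i = (if i = 0 then poly q a / ?u else if i = 1 then 1 else if i <= n then t i a / ?u else 0)" for i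
   by (cases "i = 0"; cases "i = 1") (auto simp: f_def coeff_sum coeff_pCons split: nat.splits)
  have fO: "0 <= v (coeff f i)" for i
   unfolding cf using ti[of i] vqa h by (cases "poly q a = 0") (auto simp: v_divide negl_1_ring)
  have f1: "poly f 1 << 1" using qcu h negl_1_iff[of ?u "poly q c"] by (simp add: fy)
  have "poly (pderiv f) 1 = 1 + (\<Sum>i\<in>{2..n}. of_nat i * (t i a / ?u))"
   by (simp add: f_def pderiv_add pderiv_sum pderiv_monom poly_sum poly_monom pderiv_pCons)
  moreover have "(\<Sum>i\<in>{2..n}. of_nat i * (t i a / ?u)) << 1"
   by (intro negl_sum negl_1_mult ti) (use v_of_nat in auto)
  ultimately have "poly (pderiv f) 1 ~= 0 & v (poly (pderiv f) 1) = 0" using v_add_eq by fastforce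
  then obtain y where y: "poly f y = 0" "y - 1 << 1" using hensel[OF fO _ f1] by auto
  have "c - (a + (c - a) * y) = (c - a) * (1 - y)" by (simp add: algebra_simps)
  moreover have "1 - y << 1" using y(2) by (simp add: negl_diff_commute)
  ultimately have "c - (a + (c - a) * y) << c - a"
   using negl_mult[OF _ nb_ne[OF a], of "1 - y" 1] by simp
  moreover have "poly q (a + (c - a) * y) = 0" using y(1) h by (simp add: fy)
  ultimately show "EX b. poly q b = 0 & c - b << c - a" by blast
 qed
 show ?thesis
 proof (rule ccontr)
  assume "~ ?thesis"
  \<comment> \<open>There are only finitely many roots. If each failed at some \<open>g b\<close>,
    an \<open>a\<close> at least as close to \<open>c\<close> as all these could have no root closer
    than itself.\<close>
  hence "ALL b:{b. poly q b = 0}. EX a. a:A & ~ c - b << c - a" by blast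
  then obtain g where g: "!!b. poly q b = 0 ==> g b:A & ~ c - b << c - g b" unfolding bchoice_iff by blast
  have "near A c (%a. ALL b:{b. poly q b = 0}. v (c - g b) <= v (c - a))"
   by (rule near_ball) (use g q(2) A_ne poly_roots_finite near_ge in auto)
  from near_ex[OF near_conj[OF this root]] obtain a b where
   "a:A" "poly q b = 0" "v (c - g b) <= v (c - a)" "c - b << c - a" by blast
  thus False using g[of b] negl_le_trans[of "c - b" "c - a" "c - g b"] nb_ne by blast
 qed
qed

end

end

lemma po_pcompose:
 assumes A: "subfield_set A" and q: "q:polys_over A"
 shows "p:polys_over A ==> pcompose p q:polys_over A"
proof (induction p)
 case (pCons c p)
 have "p:polys_over A" "c:A"
  using polys_overD[OF pCons.prems, of "Suc _"] polys_overD[OF pCons.prems, of 0] by (auto simp: polys_over_def)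
 moreover from this have "pcompose p q:polys_over A" using pCons.IH by blast
 ultimately show ?case unfolding pcompose_pCons
  by (intro po_add[OF A] po_mult[OF A] q po_pCons[OF A] po_0[OF A])
qed (simp add: po_0[OF A])

text \<open>Linear factors for roots in \<open>A\<close> are divided out; \<open>x\<close> remains a
  root because it is not in \<open>A\<close>.\<close>

lemma rel_alg_closed_minimal:
 assumes A: "subfield_set A" and p: "p:polys_over A" "p ~= 0" "poly p x = 0" "x ~: A"
 shows "EX q:polys_over A. q ~= 0 & poly q x = 0 & (ALL a:A. poly q a ~= 0)"
 using p
proof (induction "degree p" arbitrary: p rule: less_induct)
 case less
 show ?case
 proof (cases "EX a:A. poly p a = 0")
  case True
  then obtain a s where a: "a:A" and s: "s:polys_over A" "p = [:-a, 1:] * s"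
   using po_root_factor[OF A less.prems(1)] by blast
  have "s ~= 0" using s less.prems by auto
  moreover have "degree s < degree p" unfolding s(2) using \<open>s ~= 0\<close> by (subst degree_linear_mult) auto
  moreover have "poly s x = 0" using less.prems a unfolding s(2) by auto
  ultimately show ?thesis using less.hyps[OF _ s(1)] less.prems by blast
 next
  case False
  thus ?thesis using less.prems by blast
 qed
qed

lemma tpeq_chain_Union:
 assumes ch: "!!S T. S:Ch ==> T:Ch ==> S \<subseteq> T | T \<subseteq> S" and ne: "Ch ~= {}"
  and tp: "!!S. S:Ch ==> tpeq L M N (f S)" and mono: "!!S T. S \<subseteq> T ==> f S \<subseteq> f T"
 shows "tpeq L M N (\<Union>S\<in>Ch. f S)"
proof (rule tpeqI)
 fix p e e'
 assume p: "wf_fm L p" "!!n. n:fv_fm p ==> (e n, e' n):(\<Union>S\<in>Ch. f S)" "sat M e p"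
 have "EX S:Ch. ALL n:I. (e n, e' n):f S" if "finite I" "I \<subseteq> fv_fm p" for I
  using that
 proof (induction I rule: finite_induct)
  case empty
  thus ?case using ne by blast
 next
  case (insert n I)
  then obtain S T where S: "S:Ch" "ALL n:I. (e n, e' n):f S" and T: "T:Ch" "(e n, e' n):f T"
   using p(2)[of n] by blast
  from ch[OF S(1) T(1)] show ?case
  proof
   assume "S \<subseteq> T"
   thus ?case using S T mono[of S T] by blast
  next
   assume "T \<subseteq> S"
   thus ?case using S T mono[of T S] by blast
  qed
 qed
 from this[OF finite_fv_fm subset_refl] obtain S where "S:Ch" "!!n. n:fv_fm p ==> (e n, e' n):f S" by blast
 thus "sat N e' p" using tpeqD[OF tp p(1)] p(3) by blast
qed

lemma skolem_seq_poly_term: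
 fixes B :: "nat => 'k::linordered_field"
 assumes "p:polys_over (range B)"
 shows "EX t \<rho>. wf_tm Lval t & (ALL x. tm_val (Val v) ((%n. B (\<rho> n))(0 := x)) t = poly p x)"
 using assms
proof (induction p)
 case 0
 show ?case by (intro exI[of _ "Fn RZero []"]) simp
next
 case (pCons a p)
 have "p:polys_over (range B)" "a:range B"
  using polys_overD[OF pCons.prems, of "Suc _"] polys_overD[OF pCons.prems, of 0] by (auto simp: polys_over_def)
 then obtain t \<rho> i where t: "wf_tm Lval t"
   "!!x. tm_val (Val v) ((%n. B (\<rho> n))(0 := x)) t = poly p x" and i: "a = B i"
  using pCons.IH by blast
 define k where "k = Suc (Max (insert 0 (fv_tm t)))"
 have k: "k ~: fv_tm t" "k ~= 0"
 proof
  assume "k:fv_tm t"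
  hence "k <= Max (insert 0 (fv_tm t))" by (intro Max_ge) auto
  thus False by (simp add: k_def)
 qed (simp add: k_def)
 define e where "e x = (%n. B ((\<rho>(k := i)) n))(0 := x)" for x
 have e: "e x k = B i" "e x 0 = x" for x using k by (simp_all add: e_def)
 have "tm_val (Val v) (e x) t = tm_val (Val v) ((%n. B (\<rho> n))(0 := x)) t" for x
  by (rule tm_val_cong) (use k in \<open>auto simp: e_def\<close>)
 hence "tm_val (Val v) (e x) (Fn RPlus [Var k, Fn RTimes [Var 0, t]]) = poly (pCons a p) x" for x
  using t(2)[of x] by (simp add: e i del: fun_upd_apply)
 hence "ALL x. tm_val (Val v) ((%n. B ((\<rho>(k := i)) n))(0 := x)) (Fn RPlus [Var k, Fn RTimes [Var 0, t]])
   = poly (pCons a p) x" unfolding e_def by blast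
 moreover have "wf_tm Lval (Fn RPlus [Var k, Fn RTimes [Var 0, t]])" using t(1) by simp
 ultimately show ?case by blast
qed

text \<open>A polynomial over the hull that has a root anywhere has one in the hull. Applied to a
  polynomial without roots in the hull, this shows that nothing outside is algebraic over
  it.\<close>

lemma skolem_seq_field:
 fixes v :: "'k::linordered_field => 'g::linorder"
 assumes B: "skolem_seq Lval (Val v) B"
 shows "subfield_set (range B)" "rel_alg_closed (range B)"
proof -
 have T: "tm_val (Val v) e t:range B" if "wf_tm Lval t" "range e \<subseteq> range B" for t e
  using skolem_closed_tm[OF B vring_is_structure that] .
 have wf: "wf_tm Lval (Fn RMinus [Var 0, Var 1])" "wf_tm Lval (Fn RTimes [Var 0, Var 1])"
  "wf_tm Lval (Fn ROne [])" "wf_tm Lval (Fn RZero [])" by simp_all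
 show A: "subfield_set (range B)"
  unfolding subfield_set_def
 proof (intro conjI ballI)
  show "1:range B" using T[OF wf(3), of B] by simp
  fix x assume x: "x:range B"
  show "inverse x:range B"
  proof (cases "x = 0")
   case True
   thus ?thesis using x by simp
  next
   case False
   obtain i where i: "x = B i" using x by blast
   let ?p = "Eq (Fn RTimes [Var 0, Var 1]) (Fn ROne []) :: (oring_fun, bool) fm"
   have wfp: "wf_fm Lval ?p" by simp
   obtain m where "sat (Val v) ((%n. B ((%_. i) n))(0 := B m)) ?p"
    using skolem_seqD[OF B wfp, of "inverse x" "%_. i"] False i by auto
   hence "B m * x = 1" by (simp add: i)
   hence "inverse x = B m" by (metis inverse_unique mult.commute)
   thus ?thesis by simp
  qed
  fix y assume y: "y:range B"
  have r: "range (%n :: nat. if n = 0 then x else y) \<subseteq> range B" using x y by auto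
  show "x - y:range B" using T[OF wf(1) r] by simp
  show "x * y:range B" using T[OF wf(2) r] by simp
 qed
 show "rel_alg_closed (range B)"
  unfolding rel_alg_closed_def
 proof (intro ballI impI allI)
  fix p x assume p: "p:polys_over (range B)" "p ~= 0" "poly p x = 0"
  show "x:range B"
  proof (rule ccontr)
   assume "x ~: range B"
   then obtain q where q: "q:polys_over (range B)" "poly q x = 0" "ALL a:range B. poly q a ~= 0"
    using rel_alg_closed_minimal[OF A p] by blast
   obtain t \<rho> where t: "wf_tm Lval t"
    "!!x. tm_val (Val v) ((%n. B (\<rho> n))(0 := x)) t = poly q x"
    using skolem_seq_poly_term[OF q(1)] by blast
   have "wf_fm Lval (Eq t (Fn RZero []))" using t(1) by simp
   from skolem_seqD[OF B this, of x \<rho>] obtain m where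
    "sat (Val v) ((%n. B (\<rho> n))(0 := B m)) (Eq t (Fn RZero []))"
    using q(2) t(2) by auto
   thus False using t(2) q(3) by simp
  qed
 qed
qed

context arc_monster
begin

lemma realize_F:
 assumes "countable A" "!!p b. (p, b):\<Gamma> ==> wf_fm Lval p & b ` (fv_fm p - {0}) \<subseteq> A"
  and "!!\<Delta>. finite \<Delta> ==> \<Delta> \<subseteq> \<Gamma> ==> EX a. ALL (p, b):\<Delta>. sat (Val v) (b(0 := a)) p"
 shows "EX a. ALL (p, b):\<Gamma>. sat (Val v) (b(0 := a)) p"
proof -
 have "EX a:univ (Val v). ALL (p, b):\<Gamma>. sat (Val v) (b(0 := a)) p"
  by (rule saturated_realize[OF satF, of A]) (use assms in auto)
 thus ?thesis by blast
qed

lemma subset_alg_closed_hull: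
 assumes "countable (A :: 'k set)"
 shows "EX M. countable M & A \<subseteq> M & subfield_set M & rel_alg_closed M"
proof -
 define b where "b = from_nat_into (insert 0 A)"
 define B where "B = skolem_ext (Val v) b"
 have B: "skolem_seq Lval (Val v) B" unfolding B_def by (rule skolem_seq_ext) simp
 have "insert 0 A = range b" unfolding b_def using assms by (intro range_from_nat_into[symmetric]) auto
 also have "\<dots> \<subseteq> range B"
 proof
  fix x assume "x:range b"
  then obtain n where "x = b n" by blast
  hence "x = B (2 * n)" by (simp add: B_def skolem_ext_even)
  thus "x:range B" by blast
 qed
 finally have "A \<subseteq> range B" by simp
 thus ?thesis using skolem_seq_field[OF B] by (intro exI[of _ "range B"]) auto
qed

text \<open>The distances of \<open>c\<close> and \<open>c'\<close> need only be ordered alike.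
  Their types may be ignored, because when no element of the domain is closest to \<open>c\<close>,
  nearby elements of the domain already carry the values that occur.\<close>

definition nest :: "('k \<times> 'k) set => 'k => 'k => bool" where
 "nest R c c' <-> no_best (fst ` R) c & no_best (snd ` R) c' &
   (ALL a a' b b'. (a, a'):R --> (b, b'):R --> v (c - a) < v (c - b) <-> v (c' - a') < v (c' - b'))"

lemma nest_converse: "nest R c c' ==> nest (R\<inverse>) c' c"
proof -
 assume "nest R c c'"
 moreover have "fst ` (R\<inverse>) = snd ` R" "snd ` (R\<inverse>) = fst ` R" by force+
 ultimately show ?thesis by (simp add: nest_def)
qed

lemma fst_R: "(a, a'):R ==> a:fst ` R" by force
lemma snd_R: "(a, a'):R ==> a':snd ` R" by force

lemma negl_approx:
 assumes "c - x << c - a"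
 shows "v (x - a) = v (c - a) & x - a ~= 0"
proof -
 have "(x - a) - (c - a) << c - a" using assms by (simp add: negl_diff_commute)
 thus ?thesis using v_eq_of_negl_diff by blast
qed

lemma no_best_near:
 assumes "no_best A c" "finite I" "I \<subseteq> A" "A ~= {}"
 shows "EX x:A. ALL a:I. c - x << c - a"
 using assms(2,3)
proof (induction I rule: finite_induct)
 case empty
 thus ?case using assms(4) by blast
next
 case (insert a I)
 have ne: "c - x ~= 0" if "x:A" for x using that assms(1) by (auto simp: no_best_def)
 obtain x where x: "x:A" "ALL a:I. c - x << c - a" using insert by blast
 obtain y where y: "y:A" "v (c - a) < v (c - y)" using assms(1) insert.prems by (auto simp: no_best_def)
 show ?case
 proof (cases "v (c - y) <= v (c - x)")
  case True
  hence "c - x << c - a" using y ne[OF x(1)] ne[of a] insert.prems by (auto simp: negl_def)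
  thus ?thesis using x by (intro bexI[of _ x]) auto
 next
  case False
  hence "c - y << c - b" if "b:I" for b
   using x(2) that negl_trans[of "c - y" "c - x" "c - b"] ne[OF x(1)] by (auto simp: negl_def)
  moreover have "c - y << c - a" using y ne insert.prems by (simp add: negl_def)
  ultimately show ?thesis using y(1) by (intro bexI[of _ y]) auto
 qed
qed

text \<open>The order of the distances is a type over the range. Finite parts are satisfied by
  \<open>z'\<close> for an element \<open>z\<close> of the domain that is closer to \<open>c\<close>
  than all elements mentioned.\<close>

lemma nest_exists:
 assumes R: "good R" and nb: "no_best (fst ` R) c"
 shows "EX c'. nest R c c'"
proof -
 note oR = goodD(1)[OF R]
 have ne: "c - a ~= 0" if "(a, a'):R" for a a' using nb fst_R[OF that] by (auto simp: no_best_def)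
 define \<psi> :: "(oring_fun, bool) fm" where "\<psi> = Rel False [Fn RMinus [Var 0, Var 2], Fn RMinus [Var 0, Var 1]]"
 define g where "g = (%((a, a' :: 'k), (b, b' :: 'k)). (if c - b << c - a then \<psi> else Neg \<psi>, %n :: nat. if n = 1 then a' else b'))"
 have gs: "sat (Val v) ((snd (g ((a, a'), (b, b'))))(0 := x)) (fst (g ((a, a'), (b, b')))) <->
   (x - b' << x - a' <-> c - b << c - a)" for a a' b b' x
  by (auto simp: g_def \<psi>_def)
 have "EX x. ALL (p, e):g ` (R \<times> R). sat (Val v) (e(0 := x)) p"
 proof (rule realize_F[of "snd ` R"])
  show "countable (snd ` R)" using goodD(3)[OF R] by simp
  show "wf_fm Lval p & b ` (fv_fm p - {0}) \<subseteq> snd ` R" if "(p, b):g ` (R \<times> R)" for p b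
  proof -
   from that obtain a a' c1 c1' where "(a, a'):R" "(c1, c1'):R" "p = \<psi> | p = Neg \<psi>"
     "b = (%n :: nat. if n = 1 then a' else c1')" by (auto simp: g_def)
   thus ?thesis using snd_R[of a a' R] snd_R[of c1 c1' R] by (auto simp: \<psi>_def)
  qed
  fix \<Delta> assume "finite \<Delta>" "\<Delta> \<subseteq> g ` (R \<times> R)"
  then obtain P where P: "finite P" "P \<subseteq> R \<times> R" "\<Delta> = g ` P" by (meson finite_subset_image)
  define I where "I = (fst \<circ> fst) ` P \<union> (fst \<circ> snd) ` P"
  have I: "finite I" using P by (simp add: I_def)
  have "I \<subseteq> fst ` R" using P(2) unfolding I_def by force
  obtain z where z: "z:fst ` R" "ALL a:I. c - z << c - a"
   using no_best_near[OF nb I \<open>I \<subseteq> fst ` R\<close>] or_1[OF oR] by blast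
  then obtain z' where z': "(z, z'):R" by auto
  have "sat (Val v) ((snd (g t))(0 := z')) (fst (g t))" if t: "t:P" for t
  proof -
   obtain a a' b b' where t': "t = ((a, a'), (b, b'))" by (metis surj_pair)
   have ab: "(a, a'):R" "(b, b'):R" "a:I" "b:I" using t P(2) t' by (force simp: I_def)+
   have "v (z - a) = v (c - a) & z - a ~= 0" "v (z - b) = v (c - b) & z - b ~= 0"
    using negl_approx z(2) ab by blast+
   hence "z - b << z - a <-> c - b << c - a" using ne ab by (simp add: negl_def)
   moreover have "z - b << z - a <-> z' - b' << z' - a'"
    by (rule good_negl[OF R]) (intro or_diff[OF oR] z' ab)+
   ultimately show ?thesis unfolding t' gs by blast
  qed
  thus "EX a. ALL (p, b):\<Delta>. sat (Val v) (b(0 := a)) p"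
   unfolding P(3) by (intro exI[of _ z']) (auto simp: case_prod_beta)
 qed
 then obtain c' where c': "!!t. t:R \<times> R ==> sat (Val v) ((snd (g t))(0 := c')) (fst (g t))"
  by (auto simp: case_prod_beta)
 have iff: "c' - b' << c' - a' <-> c - b << c - a" if "(a, a'):R" "(b, b'):R" for a a' b b'
  using c'[of "((a, a'), (b, b'))"] that unfolding gs by simp
 have ex: "EX b b'. (b, b'):R & c - b << c - a" if a: "(a, a'):R" for a a'
 proof -
  obtain b where b: "b:fst ` R" "v (c - a) < v (c - b)" using nb fst_R[OF a] unfolding no_best_def by blast
  then obtain b' where "(b, b'):R" by auto
  thus ?thesis using b ne[OF a] by (auto simp: negl_def)
 qed
 have ne': "c' - a' ~= 0" if "(a, a'):R" for a a'
  using ex[OF that] iff[OF that] by (auto simp: negl_def)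
 have lt: "v (c - a) < v (c - b) <-> v (c' - a') < v (c' - b')" if "(a, a'):R" "(b, b'):R" for a a' b b'
  using iff[OF that] ne[OF that(1)] ne[OF that(2)] ne'[OF that(1)] ne'[OF that(2)] by (auto simp: negl_def)
 have "no_best (snd ` R) c'"
  unfolding no_best_def
 proof (intro conjI ballI)
  show "c' ~: snd ` R" using ne' by force
  fix a' assume "a':snd ` R"
  then obtain a where a: "(a, a'):R" by auto
  then obtain b b' where b: "(b, b'):R" "c - b << c - a" using ex by blast
  hence "v (c - a) < v (c - b)" using ne[OF b(1)] by (auto simp: negl_def)
  thus "EX b:snd ` R. v (c' - a') < v (c' - b)" using lt[OF a b(1)] snd_R[OF b(1)] by blast
 qed
 thus ?thesis using nb lt unfolding nest_def by blast
qed

lemma stable_transfer: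
 assumes R: "good R" and n: "nest R c c'" and r: "pairpoly R r r'" and st: "stable (fst ` R) c r"
 shows "stable (snd ` R) c' r'"
proof -
 obtain w a0 where a0: "a0:fst ` R"
   "!!a. a:fst ` R ==> v (c - a0) <= v (c - a) ==> poly r a ~= 0 & v (poly r a) = w"
  using st unfolding stable_def near_def by blast
 obtain a0' where a0': "(a0, a0'):R" using a0(1) by auto
 have "poly r' a' ~= 0 & v (poly r' a') = v (poly r' a0')" if a': "a':snd ` R" "v (c' - a0') <= v (c' - a')" for a'
 proof -
  obtain a where a: "(a, a'):R" using a'(1) by auto
  have "v (c - a0) <= v (c - a)" using n a'(2) a a0' unfolding nest_def by (meson linorder_not_le)
  hence "poly r a ~= 0" "v (poly r a) = v (poly r a0)" using a0(2)[OF fst_R[OF a]] a0(2)[OF a0(1)] by auto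
  thus ?thesis
   using or_zero[OF goodD(1)[OF R] pp_poly[OF goodD(1)[OF R] r a]]
    good_v_eq[OF R pp_poly[OF goodD(1)[OF R] r a] pp_poly[OF goodD(1)[OF R] r a0']] by simp
 qed
 thus ?thesis unfolding stable_def near_def using snd_R[OF a0'] by blast
qed

text \<open>For a stable \<open>r\<close> and \<open>a\<close> close enough to \<open>c\<close>, the
  value and sign of \<open>r c\<close> are those of \<open>r a\<close>, and \<open>a\<close> has a
  partner equally close to \<open>c'\<close>. \<open>D\<close> again delimits the degrees left after
  reduction.\<close>

lemma extend_immediate:
 assumes R: "good R" and n: "nest R c c'"
  and D: "!!i j. D j ==> i <= j ==> D (i :: nat)"
  and red: "!!p p'. pairpoly R p p' ==> EX r r'. pairpoly R r r' & poly p c = poly r c & poly p' c' = poly r' c' &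
    (r = 0 | D (degree r))"
  and st: "!!r. r:polys_over (fst ` R) ==> r ~= 0 ==> D (degree r) ==> stable (fst ` R) c r"
 shows "good_adjoin R c c'"
proof (rule good_extend[OF R])
 note oR = goodD(1)[OF R]
 have nb: "no_best (fst ` R) c" "no_best (snd ` R) c'" using n by (auto simp: nest_def)
 note sA = or_dom[OF oR] and sA' = or_ran[OF oR]
 have st': "stable (snd ` R) c' s'" if s': "s':polys_over (snd ` R)" "s' ~= 0" "D (degree s')" for s'
 proof -
  have "s':polys_over (fst ` (R\<inverse>))" using s'(1) by (simp add: Domain_fst[symmetric] Range_snd[symmetric])
  then obtain s where "pairpoly (R\<inverse>) s' s" using pp_exists[OF ofield_rel_converse[OF oR]] by blast
  hence s: "pairpoly R s s'" using pairpoly_converse by fastforce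
  thus ?thesis
   using stable_transfer[OF R n s] st[OF pp_dom[OF oR s]] pp_zero[OF oR s] pp_degree[OF oR s] s' by simp
 qed
 have "(v c, v c'):vR v R"
 proof -
  obtain a where a: "a:fst ` R" "v (c - 0) < v (c - a)" using nb(1) fst_R[OF or_0[OF oR]] unfolding no_best_def by blast
  then obtain a' where a': "(a, a'):R" by auto
  have "v (c' - 0) < v (c' - a')" using n a(2) or_0[OF oR] a' unfolding nest_def by blast
  moreover have "c - 0 ~= 0" "c' - 0 ~= 0"
   using nb fst_R[OF or_0[OF oR]] snd_R[OF or_0[OF oR]] by (auto simp: no_best_def)
  ultimately have "c - a << c - 0" "c' - a' << c' - 0" using a(2) by (auto simp: negl_def)
  hence "v a = v c" "v a' = v c'" using negl_approx[of c a 0] negl_approx[of c' a' 0] by auto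
  thus ?thesis using vR_I[OF a', of v] by simp
 qed
 thus "tpG (insert (v c, v c') (vR v R))" using goodD(2)[OF R] by (simp add: insert_absorb)
 fix p p' assume "pairpoly R p p'"
 then obtain r r' where r: "pairpoly R r r'" "poly p c = poly r c" "poly p' c' = poly r' c'" "r = 0 | D (degree r)"
  using red by blast
 show "poly p c = 0 & poly p' c' = 0 | like_monomials R c c' p p'"
 proof (cases "r = 0")
  case True
  thus ?thesis using pp_zero[OF oR r(1)] r(2,3) by simp
 next
  case False
  hence Dr: "D (degree r)" using r(4) by blast
  have r'0: "r' ~= 0" "D (degree r')" using pp_zero[OF oR r(1)] pp_degree[OF oR r(1)] False Dr by auto
  have rA: "r:polys_over (fst ` R)" "r':polys_over (snd ` R)"
   using r(1) by (force simp: pairpoly_def polys_over_def)+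
  have "near (fst ` R) c (%a. poly r c - poly r a << poly r a)"
   by (rule stable_approx[OF sA nb(1) rA(1) False]) (use st rA False Dr D[OF Dr] in auto)
  then obtain a0 where a0: "a0:fst ` R" "!!a. a:fst ` R ==> v (c - a0) <= v (c - a) ==> poly r c - poly r a << poly r a"
   unfolding near_def by blast
  have "near (snd ` R) c' (%a. poly r' c' - poly r' a << poly r' a)"
   by (rule stable_approx[OF sA' nb(2) rA(2) r'0(1)]) (use st' rA r'0 D[OF r'0(2)] in auto)
  then obtain a1' where a1': "a1':snd ` R" "!!a. a:snd ` R ==> v (c' - a1') <= v (c' - a) ==> poly r' c' - poly r' a << poly r' a"
   unfolding near_def by blast
  obtain a0' a1 where aa: "(a0, a0'):R" "(a1, a1'):R" using a0(1) a1'(1) by auto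
  have iff: "v (c - a) <= v (c - b) <-> v (c' - a') <= v (c' - b')" if "(a, a'):R" "(b, b'):R" for a a' b b'
   using n that unfolding nest_def by (meson linorder_not_le)
  have "EX a a'. (a, a'):R & v (c - a0) <= v (c - a) & v (c - a1) <= v (c - a)"
   using aa by (meson linear order_refl)
  then obtain a a' where a: "(a, a'):R" "v (c - a0) <= v (c - a)" "v (c - a1) <= v (c - a)" by blast
  have s1: "poly r c - poly r a << poly r a" using a0(2)[OF fst_R[OF a(1)] a(2)] .
  have s2: "poly r' c' - poly r' a' << poly r' a'" using a1'(2)[OF snd_R[OF a(1)]] iff[OF aa(2) a(1)] a(3) by blast
  have "poly r c > 0 <-> poly r' c' > 0"
   using pos_iff_of_negl_diff[OF s1] pos_iff_of_negl_diff[OF s2] or_pos[OF oR pp_poly[OF oR r(1) a(1)]] by simp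
  thus ?thesis unfolding r(2,3)
   using v_eq_of_negl_diff[OF s1] v_eq_of_negl_diff[OF s2] pp_poly[OF oR r(1) a(1)]
   by (intro disjI2 exI[of _ "poly r a"] exI[of _ "poly r' a'"] exI[of _ 0]) auto
 qed
qed

lemma nest_cong:
 assumes n: "nest R c c'" and b: "!!a. a:fst ` R ==> c - b << c - a" "!!a'. a':snd ` R ==> c' - b' << c' - a'"
 shows "nest R b b'" "!!r. stable (fst ` R) b r <-> stable (fst ` R) c r"
proof -
 have e: "v (b - a) = v (c - a) & b - a ~= 0" if "a:fst ` R" for a using negl_approx[OF b(1)[OF that]] .
 have e': "v (b' - a) = v (c' - a) & b' - a ~= 0" if "a:snd ` R" for a using negl_approx[OF b(2)[OF that]] .
 have "no_best (fst ` R) b" "no_best (snd ` R) b'"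
  using n e e' unfolding nest_def no_best_def by fastforce+
 moreover have "v (b - x) < v (b - y) <-> v (b' - x') < v (b' - y')" if "(x, x'):R" "(y, y'):R" for x x' y y'
  using n that e[OF fst_R[OF that(1)]] e[OF fst_R[OF that(2)]] e'[OF snd_R[OF that(1)]] e'[OF snd_R[OF that(2)]]
  unfolding nest_def by auto
 ultimately show "nest R b b'" unfolding nest_def by blast
 show "stable (fst ` R) b r <-> stable (fst ` R) c r" for r
  unfolding stable_def near_def using e by (auto cong: ball_cong bex_cong)
qed

text \<open>\<open>c\<close> only serves as a guide. A least unstable polynomial has a root
  \<open>b\<close> closer to \<open>c\<close> than the whole domain, likewise \<open>b'\<close> for
  \<open>c'\<close>, and it is the roots that are adjoined.\<close>

lemma immediate_alg:
 assumes R: "good R" and nb: "no_best (fst ` R) c"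
  and q0: "q0:polys_over (fst ` R)" "q0 ~= 0" "~ stable (fst ` R) c q0"
 shows "EX R2. alg_ext R R2"
proof -
 note oR = goodD(1)[OF R]
 obtain q where q: "q:polys_over (fst ` R)" "q ~= 0" "~ stable (fst ` R) c q"
  and qmin: "!!s. s:polys_over (fst ` R) ==> s ~= 0 ==> ~ stable (fst ` R) c s ==> degree q <= degree s"
  using ex_has_least_nat[of "%q. q:polys_over (fst ` R) & q ~= 0 & ~ stable (fst ` R) c q" q0 degree] q0 by blast
 have low: "stable (fst ` R) c s" if "s:polys_over (fst ` R)" "s ~= 0" "degree s < degree q" for s
  using qmin[of s] that by (meson linorder_not_le)
 obtain q' where q': "pairpoly R q q'" using pp_exists[OF oR q(1)] by blast
 obtain c' where n: "nest R c c'" using nest_exists[OF R nb] by blast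
 have nb': "no_best (snd ` R) c'" using n by (simp add: nest_def)
 have conv: "fst ` (R\<inverse>) = snd ` R" "snd ` (R\<inverse>) = fst ` R" by force+
 have low': "stable (snd ` R) c' s'" if s': "s':polys_over (snd ` R)" "s' ~= 0" "degree s' < degree q'" for s'
 proof -
  obtain s where "pairpoly (R\<inverse>) s' s" using pp_exists[OF ofield_rel_converse[OF oR], of s'] s'(1) unfolding conv by blast
  hence s: "pairpoly R s s'" using pairpoly_converse by fastforce
  thus ?thesis
   using stable_transfer[OF R n s] low[OF pp_dom[OF oR s]] pp_zero[OF oR s] pp_degree[OF oR s] pp_degree[OF oR q'] s' by simp
 qed
 have q'A: "q':polys_over (snd ` R)" "q' ~= 0"
  using q' pp_zero[OF oR q'] q(2) by (force simp: pairpoly_def polys_over_def)+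
 have q'u: "~ stable (snd ` R) c' q'"
  using stable_transfer[OF good_converse[OF R] nest_converse[OF n] pairpoly_converse[OF q']] q(3) unfolding conv by blast
 obtain b where b: "poly q b = 0" "!!a. a:fst ` R ==> c - b << c - a"
  using unstable_root[OF or_dom[OF oR] nb q low] by blast
 obtain b' where b': "poly q' b' = 0" "!!a. a:snd ` R ==> c' - b' << c' - a"
  using unstable_root[OF or_ran[OF oR] nb' q'A q'u low'] by blast
 note nn = nest_cong[OF n b(2) b'(2)]
 have "good_adjoin R b b'"
 proof (rule extend_immediate[OF R nn(1), where D = "%n. n < degree q"])
  fix g g' assume "pairpoly R g g'"
  then obtain s s' r r' where "pairpoly R s s'" "pairpoly R r r'" "g = s * q + r" "g' = s' * q' + r'"
    "r = 0 | degree r < degree q"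
   using pp_divmod[OF oR _ q' q(2)] by blast
  thus "EX r r'. pairpoly R r r' & poly g b = poly r b & poly g' b' = poly r' b' & (r = 0 | degree r < degree q)"
   using b(1) b'(1) by (intro exI[of _ r] exI[of _ r']) auto
 qed (use low nn(2) in auto)
 moreover have "b ~: fst ` R" using nn(1) by (auto simp: nest_def no_best_def)
 ultimately show ?thesis using alg_ext_adjoin[OF q' q(2) b(1) b'(1) R] by blast
qed

end

section \<open>Back and forth with good relations\<close>

lemma back_forth_tpeq:
 assumes fn: "!!R f as bs. R:\<R> ==> length as = fun_arity L f ==> list_all2 (%a b. (a, b):R) as bs ==>
   (fun_interp M f as, fun_interp N f bs):R"
  and rel: "!!R r as bs. R:\<R> ==> length as = rel_arity L r ==> list_all2 (%a b. (a, b):R) as bs ==>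
   rel_interp M r as <-> rel_interp N r bs"
  and eq: "!!R a a' b b'. R:\<R> ==> (a, b):R ==> (a', b'):R ==> a = a' <-> b = b'"
  and forth: "!!R a. R:\<R> ==> a:univ M ==> EX R':\<R>. R \<subseteq> R' & (EX b:univ N. (a, b):R')"
  and bck: "!!R b. R:\<R> ==> b:univ N ==> EX R':\<R>. R \<subseteq> R' & (EX a:univ M. (a, b):R')"
  and R: "R:\<R>"
 shows "tpeq L M N R"
proof -
 have tm: "(tm_val M e t, tm_val N e' t):R"
  if "R:\<R>" "wf_tm L t" "!!n. n:fv_tm t ==> (e n, e' n):R" for R e e' t
  using that(2,3)
 proof (induction t)
  case (Fn f ts)
  have "list_all2 (%a b. (a, b):R) (map (tm_val M e) ts) (map (tm_val N e') ts)"
   unfolding list.rel_map by (rule list.rel_refl_strong) (use Fn in \<open>auto simp: list_all_iff\<close>)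
  thus ?case using fn[OF that(1), of "map (tm_val M e) ts" f] Fn.prems by simp
 qed simp
 have "sat M e p = sat N e' p" if "R:\<R>" "wf_fm L p" "!!n. n:fv_fm p ==> (e n, e' n):R" for R e e' p
  using that
 proof (induction p arbitrary: R e e')
  case (Eq s t)
  thus ?case using eq[OF Eq(1) tm[OF Eq(1)] tm[OF Eq(1)], of s e e' t e e'] by simp
 next
  case (Rel r ts)
  have "list_all2 (%a b. (a, b):R) (map (tm_val M e) ts) (map (tm_val N e') ts)"
   unfolding list.rel_map by (rule list.rel_refl_strong) (use Rel in \<open>auto simp: list_all_iff intro!: tm\<close>)
  thus ?case using rel[OF Rel(1), of "map (tm_val M e) ts" r] Rel(2) by simp
 next
  case (Neg p)
  thus ?case using Neg.IH[of R e e'] by simp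
 next
  case (Conj p q)
  have "sat M e p = sat N e' p" "sat M e q = sat N e' q"
   by (rule Conj.IH[OF Conj.prems(1)]; use Conj.prems in simp)+
  thus ?case by simp
 next
  case (Exi x p)
  have wf: "wf_fm L p" using Exi by simp
  have upd: "(((e(x := a)) n), ((e'(x := b)) n)):R'" if "R \<subseteq> R'" "(a, b):R'" "n:fv_fm p" for a b R' n
   using Exi.prems(3)[of n] that by auto
  show ?case
  proof
   assume "sat M e (Exi x p)"
   then obtain a where a: "a:univ M" "sat M (e(x := a)) p" by auto
   from forth[OF Exi.prems(1) a(1)] obtain R' b where R': "R':\<R>" "R \<subseteq> R'" "b:univ N" "(a, b):R'" by blast
   hence "sat N (e'(x := b)) p" using Exi.IH[OF R'(1) wf, of "e(x := a)" "e'(x := b)"] upd[OF R'(2,4)] a(2) by blast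
   thus "sat N e' (Exi x p)" using R'(3) by auto
  next
   assume "sat N e' (Exi x p)"
   then obtain b where b: "b:univ N" "sat N (e'(x := b)) p" by auto
   from bck[OF Exi.prems(1) b(1)] obtain R' a where R': "R':\<R>" "R \<subseteq> R'" "a:univ M" "(a, b):R'" by blast
   hence "sat M (e(x := a)) p" using Exi.IH[OF R'(1) wf, of "e(x := a)" "e'(x := b)"] upd[OF R'(2,4)] b(2) by blast
   thus "sat M e (Exi x p)" using R'(3) by auto
  qed
 qed
 thus ?thesis using R by (intro tpeqI) metis
qed

context arc_monster
begin

lemma fst_converse_R: "fst ` (R\<inverse>) = snd ` R" "snd ` (R\<inverse>) = fst ` R" by force+

lemma res_less: "0 <= v x ==> 0 <= v y ==> res y < res x <-> y < x & ~ x - y << 1"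
 using res_diff[of x y] res_pos[of "x - y"] res_pos_iff[of "x - y"] not_negl_1[of "x - y"]
  res_eq_0_iff[of "x - y"] v_ring_diff[of x y] by auto

lemma primitive_scaling:
 assumes A: "subfield_set A" and p: "p:polys_over A" "p ~= 0"
 shows "EX a:A. a ~= 0 & smult a p:polys_over A & (ALL i. 0 <= v (coeff (smult a p) i)) & (EX j. coeff (smult a p) j = 1)"
proof -
 define I where "I = {i. i <= degree p & coeff p i ~= 0}"
 have I: "finite I" "I ~= {}" using p(2) by (auto simp: I_def intro!: exI[of _ "degree p"])
 obtain j where j: "j:I" "!!i. i:I ==> v (coeff p j) <= v (coeff p i)"
  using arg_min_if_finite[OF I, of "%i. v (coeff p i)"] by (metis linorder_not_le)
 let ?a = "inverse (coeff p j)"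
 have a0: "coeff p j ~= 0" using j(1) by (simp add: I_def)
 have "0 <= v (coeff (smult ?a p) i)" for i
 proof (cases "i:I")
  case True
  thus ?thesis using j(2)[OF True] a0 by (simp add: I_def v_mult)
 next
  case False
  hence "coeff p i = 0" by (cases "i <= degree p") (auto simp: I_def coeff_eq_0)
  thus ?thesis by simp
 qed
 moreover have "?a:A" using polys_overD[OF p(1)] sf_inverse[OF A] by blast
 moreover have "EX j. coeff (smult ?a p) j = 1" using a0 by (intro exI[of _ j]) simp
 moreover have "?a ~= 0" using a0 by simp
 ultimately show ?thesis using po_smult[OF A _ p(1)] by blast
qed

text \<open>If \<open>e / a\<close> had the residue of some \<open>b\<close>, then
  \<open>a * b\<close> would be a better approximation of \<open>e\<close> than 0, against the
  choice of \<open>e\<close>.\<close>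

lemma residue_not_in:
 assumes R: "good R" and a: "a:fst ` R" "a ~= 0" "v e = v a" and e: "e ~: fst ` R"
  and best: "!!b. b:fst ` R ==> v (e - b) <= v e"
 shows "v (e / a) = 0" "e / a ~= 0" "res (e / a) ~: fst ` resR R"
proof -
 note A = or_dom[OF goodD(1)[OF R]]
 have "e ~= 0" using e sf_0[OF A] by blast
 thus u: "e / a ~= 0" using a by simp
 have "v (e / a * a) = v (e / a) + v a" using u a(2) v_mult by blast
 thus v0: "v (e / a) = 0" using a by simp
 show "res (e / a) ~: fst ` resR R"
 proof
  assume "res (e / a):fst ` resR R"
  then obtain b where b: "b:fst ` R" "0 <= v b" "res (e / a) = res b" by (force simp: resR_def)
  have "e / a - b << 1" using b v0 res_eq_iff by simp
  hence "(e - a * b) / a << 1" using a(2) by (simp add: diff_divide_distrib)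
  hence n: "e - a * b << a" using negl_1_iff[OF a(2)] by blast
  have ab: "a * b:fst ` R" using sf_mult[OF A a(1) b(1)] .
  hence "e - a * b ~= 0" using e by force
  hence "v a < v (e - a * b)" using n by (auto simp: negl_def)
  thus False using best[OF ab] a(3) by simp
 qed
qed

lemma residue_algebraic:
 assumes R: "good R" and p: "p:polys_over (fst ` R)" "p ~= 0" "poly p u = 0" and u: "0 <= v u" "res u ~: fst ` resR R"
 shows "~ res_closed R"
proof -
 note oR = goodD(1)[OF R]
 note A = or_dom[OF oR]
 obtain a where a: "a ~= 0" "smult a p:polys_over (fst ` R)" "ALL i. 0 <= v (coeff (smult a p) i)" "EX j. coeff (smult a p) j = 1"
  using primitive_scaling[OF A p(1,2)] by blast
 define s where "s = smult a p"
 have sO: "0 <= v (coeff s i)" for i using a(3) by (simp add: s_def)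
 obtain s' where s': "pairpoly R s s'" using pp_exists[OF oR a(2)] by (auto simp: s_def)
 have "pairpoly (resR R) (map_poly res s) (map_poly res s')"
  using s' resR_I[OF _ sO] by (simp add: pairpoly_def coeff_map_poly)
 moreover have "map_poly res s ~= 0"
 proof -
  obtain j where "coeff s j = 1" using a(4) by (auto simp: s_def)
  hence "coeff (map_poly res s) j = 1" by (simp add: coeff_map_poly)
  thus ?thesis by auto
 qed
 moreover have "poly (map_poly res s) (res u) = 0"
  using res_poly[OF u(1) sO] p(3) by (simp add: s_def)
 ultimately show ?thesis unfolding res_closed_def using res(1)[OF u(1)] u(2) by blast
qed

lemma best_exists:
 assumes "~ no_best A d" "d ~: A" "subfield_set A"
 shows "EX a:A. d - a ~: A & d - a ~= 0 & (ALL b:A. v (d - a - b) <= v (d - a))"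
proof -
 obtain a where a: "a:A" "!!b. b:A ==> v (d - b) <= v (d - a)"
  using assms(1,2) by (force simp: no_best_def not_less)
 have "d - a ~: A" using sf_add[OF assms(3), of "d - a" a] a assms(2) by auto
 moreover from this have "d - a ~= 0" using sf_0[OF assms(3)] by auto
 ultimately show ?thesis using a sf_add[OF assms(3) a(1)] by (intro bexI[of _ a]) (auto simp: diff_diff_eq)
qed

lemma new_value_exists:
 assumes R: "good R" and e: "e ~= 0"
 shows "EX c'. c' ~= 0 & (e > 0 <-> c' > 0) & tpG (insert (v e, v c') (vR v R))"
proof -
 obtain g where g: "tpG (insert (v e, g) (vR v R))"
  using tpeq_extend[OF goodD(2)[OF R] countable_vR[OF goodD(3)[OF R]] _ satG, of "v e"] by auto
 obtain x where x: "x ~= 0" "v x = g" using v_surj by blast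
 have "v \<bar>x\<bar> = g" using x by (simp add: abs_if)
 thus ?thesis using g x e by (intro exI[of _ "if e > 0 then \<bar>x\<bar> else - \<bar>x\<bar>"]) (auto simp: abs_if)
qed

lemma monom_minus_root:
 assumes A: "subfield_set A" and a: "a:A" "n > 0" "x ^ n = a"
 shows "monom 1 n - [:a:]:polys_over A" "monom 1 n - [:a:] ~= 0" "poly (monom 1 n - [:a:]) x = 0"
proof -
 show "monom 1 n - [:a:]:polys_over A"
  by (intro po_diff[OF A] po_monom[OF A] po_pCons[OF A] sf_1[OF A] po_0[OF A] a)
 have "coeff (monom 1 n - [:a:]) n = 1" using a(2) by (cases n) simp_all
 thus "monom 1 n - [:a:] ~= 0" by (metis coeff_0 zero_neq_one)
 show "poly (monom 1 n - [:a:]) x = 0" using a(3) by (simp add: poly_monom)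
qed

text \<open>Some proper algebraic step is found, not necessarily one that adjoins \<open>d\<close>.
  After translation to a best-approximated \<open>e\<close> it is a missing residue, or a radical if
  only a proper multiple of \<open>v e\<close> is a value. A value without such a multiple is
  impossible, since by \<open>poly_dominant\<close> no polynomial over the domain would vanish at
  \<open>e\<close>.\<close>

lemma algebraic_alg:
 assumes R: "good R" and d: "d ~: fst ` R" and p: "p:polys_over (fst ` R)" "p ~= 0" "poly p d = 0"
 shows "EX R2. alg_ext R R2"
proof -
 note oR = goodD(1)[OF R]
 note A = or_dom[OF oR]
 show ?thesis
 proof (cases "no_best (fst ` R) d")
  case nb: True
  show ?thesis
  proof (rule ccontr)
   assume no: "\<nexists>R2. alg_ext R R2"
   have st: "stable (fst ` R) d r" if "r:polys_over (fst ` R)" "r ~= 0" for r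
    using immediate_alg[OF R nb that] no by blast
   have "near (fst ` R) d (%a. poly p d - poly p a << poly p a)"
    by (rule stable_approx[OF A nb p(1,2)]) (use st p in auto)
   thus False using p(3) near_ex by fastforce
  qed
 next
  case False
  then obtain a0 where a0: "a0:fst ` R" "d - a0 ~: fst ` R" "d - a0 ~= 0"
    "!!b. b:fst ` R ==> v (d - a0 - b) <= v (d - a0)"
   using best_exists[OF _ d A] by blast
  define e where "e = d - a0"
  define p1 where "p1 = pcompose p [:a0, 1:]"
  have p1: "p1:polys_over (fst ` R)" "poly p1 e = 0"
   unfolding p1_def using p a0(1)
   by (auto intro!: po_pcompose[OF A] po_pCons[OF A] sf_1[OF A] po_0[OF A] simp: poly_pcompose e_def)
  have p10: "p1 ~= 0" using p(2) by (auto simp: p1_def pcompose_eq_0_iff)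
  show ?thesis
  proof (cases "EX n>0. EX a:fst ` R. a ~= 0 & nmul n (v e) = v a")
   case True
   define n where "n = (LEAST n. n > 0 & (EX a:fst ` R. a ~= 0 & nmul n (v e) = v a))"
   have "n > 0 & (EX a:fst ` R. a ~= 0 & nmul n (v e) = v a)"
    unfolding n_def by (rule LeastI_ex) (use True in blast)
   then obtain a a' where n: "n > 0" and a: "(a, a'):R" "a ~= 0" "nmul n (v e) = v a" by auto
   have least: "nmul k (v e) ~= v b" if k: "0 < k" "k < n" and b: "(b, b'):R" "b ~= 0" for k b b'
   proof
    assume "nmul k (v e) = v b"
    hence "n <= k" unfolding n_def using k(1) fst_R[OF b(1)] b(2) by (intro Least_le) blast
    thus False using k(2) by simp
   qed
   show ?thesis
   proof (cases "n = 1")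
    case True
    hence ve: "v e = v a" using a(3) by simp
    note u = residue_not_in[OF R fst_R[OF a(1)] a(2) ve a0(2,4)[folded e_def], simplified]
    define p2 where "p2 = pcompose p1 [:0, a:]"
    have "p2:polys_over (fst ` R)" "poly p2 (e / a) = 0" "p2 ~= 0"
     unfolding p2_def using p1 p10 a(2) fst_R[OF a(1)]
     by (auto intro!: po_pcompose[OF A] po_pCons[OF A] sf_0[OF A] po_0[OF A] simp: poly_pcompose pcompose_eq_0_iff)
    from residue_algebraic[OF R this(1,3,2)] have "~ res_closed R" using u by simp
    thus ?thesis by (rule extend_residue_alg[OF R])
   next
    case False
    have "v \<bar>a\<bar> = nmul n (v e)" using a(3) by (simp add: abs_if)
    hence "EX c c'. c ^ n = \<bar>a\<bar> & c' ^ n = \<bar>a'\<bar> & v c = v e & good_adjoin R c c'"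
     by (intro extend_radical[OF R or_abs[OF oR a(1)]] n) (use a(2) least in auto)
    then obtain c c' where c: "c ^ n = \<bar>a\<bar>" "c' ^ n = \<bar>a'\<bar>" "v c = v e" and
      g: "good_adjoin R c c'" by blast
    have c0: "c ~= 0" using c(1) a(2) n by (metis abs_eq_0 zero_power)
    have cA: "c ~: fst ` R"
    proof
     assume "c:fst ` R"
     then obtain x where "(c, x):R" by auto
     thus False using least[of 1 c x] n False c0 c(3) by simp
    qed
    have pp: "pairpoly R (monom 1 n - [:\<bar>a\<bar>:]) (monom 1 n - [:\<bar>a'\<bar>:])"
     by (intro pp_diff[OF oR] pp_const[OF oR] or_abs[OF oR a(1)])
      (use or_0[OF oR] or_1[OF oR] in \<open>simp add: pairpoly_def\<close>)
    have f: "monom 1 n - [:\<bar>a\<bar>:] ~= 0" "poly (monom 1 n - [:\<bar>a\<bar>:]) c = 0" "poly (monom 1 n - [:\<bar>a'\<bar>:]) c' = 0"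
     using monom_minus_root[OF A fst_R[OF or_abs[OF oR a(1)]] n c(1)] c(2) by (simp_all add: poly_monom)
    show ?thesis using alg_ext_adjoin[OF pp f R _ g] cA by blast
   qed
  next
   case no: False
   obtain p1' where pp: "pairpoly R p1 p1'" using pp_exists[OF oR p1(1)] by blast
   obtain e' where e': "e' ~= 0" "e > 0 <-> e' > 0" "tpG (insert (v e, v e') (vR v R))"
    using new_value_exists[OF R a0(3)] by (auto simp: e_def)
   have new: "nmul n (v e) ~= v a" if "0 < n" "n <= degree p1" "(a, a'):R" "a ~= 0" for n a a'
    using no fst_R[OF that(3)] that by blast
   have "poly p1 e ~= 0" using poly_dominant[OF R pp p10 a0(3)[folded e_def] e'] new by blast
   thus ?thesis using p1(2) by blast
  qed
 qed
qed

definition closed_good :: "('k \<times> 'k) set => bool" where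
 "closed_good R <-> good R & rel_alg_closed (fst ` R) & rel_alg_closed (snd ` R)"

lemma good_Union:
 assumes ne: "Ch ~= {}" and ch: "!!S T. S:Ch ==> T:Ch ==> S \<subseteq> T | T \<subseteq> S"
  and g: "!!S. S:Ch ==> good S" and cnt: "countable (\<Union>Ch)"
 shows "good (\<Union>Ch)"
proof -
 have "vR v (\<Union>Ch) = (\<Union>S\<in>Ch. vR v S)" unfolding vR_def by fast
 hence "tpG (vR v (\<Union>Ch))"
  using tpeq_chain_Union[OF ch ne goodD(2)[OF g] vR_mono] by simp
 moreover have "ofield_rel (\<Union>Ch)"
  unfolding ofield_rel_def
 proof (intro conjI allI impI)
  show "(1, 1):\<Union>Ch" using ne g or_1[OF goodD(1)] by blast
  fix x x' assume x: "(x, x'):\<Union>Ch"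
  then obtain S where S: "S:Ch" "(x, x'):S" by blast
  show "(inverse x, inverse x'):\<Union>Ch" using or_inverse[OF goodD(1)[OF g[OF S(1)]] S(2)] S(1) by blast
  show "0 < x <-> 0 < x'" using or_pos[OF goodD(1)[OF g[OF S(1)]] S(2)] .
  fix y y' assume "(y, y'):\<Union>Ch"
  then obtain T where T: "T:Ch" "(y, y'):T" by blast
  obtain Q where Q: "Q:Ch" "(x, x'):Q" "(y, y'):Q" using ch[OF S(1) T(1)] S T by blast
  show "(x - y, x' - y'):\<Union>Ch" "(x * y, x' * y'):\<Union>Ch"
   using or_diff[OF goodD(1)[OF g[OF Q(1)]] Q(2,3)] or_mult[OF goodD(1)[OF g[OF Q(1)]] Q(2,3)] Q(1) by blast+
 qed
 ultimately show ?thesis using cnt by (simp add: good_def)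
qed

text \<open>Zorn's lemma inside \<open>M \<times> M\<close> for a countable relatively algebraically
  closed \<open>M\<close>, which keeps unions of chains countable. A maximal relation admits no
  algebraic step.\<close>

lemma closed_extension:
 assumes R: "good R"
 shows "EX R1. R \<subseteq> R1 & closed_good R1"
proof -
 have "countable (fst ` R \<union> snd ` R)" using goodD(3)[OF R] by simp
 from subset_alg_closed_hull[OF this] obtain M
  where M: "countable M" "fst ` R \<union> snd ` R \<subseteq> M" "subfield_set M" "rel_alg_closed M" by (elim exE conjE)
 define \<S> where "\<S> = {S. good S & R \<subseteq> S & S \<subseteq> M \<times> M}"
 have RM: "R \<subseteq> M \<times> M" using M(2) by force
 have "\<S> ~= {}" using R RM by (auto simp: \<S>_def)
 moreover have "\<Union>Ch \<in> \<S>" if ne: "Ch ~= {}" and ch: "subset.chain \<S> Ch" for Ch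
 proof -
  have sub: "Ch \<subseteq> \<S>" and lin: "!!S T. S:Ch ==> T:Ch ==> S \<subseteq> T | T \<subseteq> S"
   using ch by (auto simp: subset_chain_def)
  have MM: "\<Union>Ch \<subseteq> M \<times> M" using sub by (force simp: \<S>_def)
  hence "countable (\<Union>Ch)" using M(1) countable_SIGMA[OF M(1) M(1)] countable_subset by blast
  hence "good (\<Union>Ch)" using good_Union[OF ne lin] sub by (auto simp: \<S>_def)
  moreover have "R \<subseteq> \<Union>Ch" using ne sub by (force simp: \<S>_def)
  ultimately show ?thesis using MM by (simp add: \<S>_def)
 qed
 ultimately obtain S where S: "S:\<S>" "!!T. T:\<S> ==> S \<subseteq> T ==> T = S"
  using subset_Zorn_nonempty[of \<S>] by metis
 have gS: "good S" "R \<subseteq> S" "S \<subseteq> M \<times> M" using S(1) by (auto simp: \<S>_def)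
 have no: "~ alg_ext S S2" for S2
 proof
  assume "alg_ext S S2"
  hence "good S2" "S \<subset> S2" "S2 \<subseteq> M \<times> M" using M(3,4) gS(3) unfolding alg_ext_def by blast+
  thus False using S(2)[of S2] gS(2) by (auto simp: \<S>_def)
 qed
 have "rel_alg_closed (fst ` S)"
  unfolding rel_alg_closed_def using algebraic_alg[OF gS(1)] no by blast
 moreover have "rel_alg_closed (snd ` S)"
  unfolding rel_alg_closed_def
  using algebraic_alg[OF good_converse[OF gS(1)], unfolded fst_converse_R] alg_ext_converse no by blast
 ultimately show ?thesis using gS by (auto simp: closed_good_def)
qed

context
 fixes R
 assumes R: "closed_good R"
begin

lemma cg: "good R" "rel_alg_closed (fst ` R)" "rel_alg_closed (snd ` R)" "ofield_rel R"
 "subfield_set (fst ` R)" "subfield_set (snd ` R)"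
 using R goodD(1) or_dom or_ran by (auto simp: closed_good_def)

lemma closed_no_alg_ext: "~ alg_ext R R2"
proof
 assume a: "alg_ext R R2"
 have "R \<subseteq> fst ` R \<times> snd ` R" by force
 hence sub: "R2 \<subseteq> fst ` R \<times> snd ` R" using a cg unfolding alg_ext_def by blast
 have gR: "good R2" "R \<subset> R2" using a by (auto simp: alg_ext_def)
 have "R2 \<subseteq> R"
 proof
  fix t assume t: "t:R2"
  obtain x x' where t': "t = (x, x')" by (cases t)
  obtain y' where y': "(x, y'):R" using sub t t' by force
  hence "x' = y'" using or_eq[OF goodD(1)[OF gR(1)], of x x' x y'] t t' gR(2) by blast
  thus "t:R" using y' t' by simp
 qed
 thus False using gR(2) by blast
qed

lemma closed_res_closed: "res_closed R"
 using extend_residue_alg[OF cg(1)] closed_no_alg_ext by blast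

lemma closed_stable: "no_best (fst ` R) c ==> r:polys_over (fst ` R) ==> r ~= 0 ==> stable (fst ` R) c r"
 using immediate_alg[OF cg(1)] closed_no_alg_ext by blast

lemma extend_nest:
 assumes "nest R c c'"
 shows "EX R2. good R2 & R \<subseteq> R2 & (c, c'):R2"
proof -
 have nb: "no_best (fst ` R) c" using assms by (simp add: nest_def)
 have "good_adjoin R c c'"
  by (rule extend_immediate[OF cg(1) assms, where D = "%_. True"]) (use closed_stable[OF nb] in auto)
 thus ?thesis by blast
qed

lemma extend_by_residue:
 assumes c: "v c = 0" "c ~= 0" "v c' = 0" "c' ~= 0" and cut: "same_cut (resR R) (res c) (res c')"
 shows "EX R2. good R2 & R \<subseteq> R2 & (c, c'):R2"
proof -
 have "good_adjoin R c c'"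
  by (rule extend_residue[OF cg(1) c cut, where D = "%_. True"])
   (use closed_res_closed in \<open>auto simp: res_closed_def\<close>)
 thus ?thesis by blast
qed

text \<open>Relative algebraic closedness makes the value group of the domain pure, as roots of
  positive elements exist in \<open>K\<close>.\<close>

lemma closed_value:
 assumes "nmul n (v e) = v a" "a:fst ` R" "a ~= 0" "n > 0"
 shows "EX x x'. (x, x'):R & x > 0 & v x = v e"
proof -
 have "v \<bar>a\<bar> = nmul n (v e)" using assms by (simp add: abs_if)
 then obtain x where x: "x > 0" "x ^ n = \<bar>a\<bar>" "v x = v e" using root_exists[of "\<bar>a\<bar>" n "v e"] assms by auto
 have "\<bar>a\<bar>:fst ` R" using assms(2) sf_minus[OF cg(5)] by (simp add: abs_if)
 hence "x:fst ` R" using cg(2) monom_minus_root[OF cg(5) _ assms(4) x(2)] unfolding rel_alg_closed_def by blast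
 thus ?thesis using x by auto
qed

lemma residue_cut_exists:
 assumes u: "v u = 0" "u ~= 0" "res u ~: fst ` resR R"
 shows "EX u'. v u' = 0 & u' ~= 0 & same_cut (resR R) (res u) (res u')"
proof -
 have u0: "0 <= v u" using u by simp
 let ?one = "Fn ROne [] :: oring_fun tm"
 \<comment> \<open>\<open>\<theta> s t\<close> expresses that the residue of \<open>s\<close> is
   less than that of \<open>t\<close>, and also that the realised element lies in the valuation
   ring.\<close>
 define \<theta> :: "oring_fun tm => oring_fun tm => (oring_fun, bool) fm" where
  "\<theta> s t = Conj (Conj (Rel True [s, t]) (Neg (Rel False [Fn RMinus [t, s], ?one]))) (Neg (Rel False [?one, Var 0]))" for s t
 define P where "P = {(b, b'). (b, b'):R & 0 <= v b}"
 have P: "(b, b'):R" "0 <= v b" "0 <= v b'" if "(b, b'):P" for b b'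
  using that good_v_nonneg[OF cg(1), of b b'] by (auto simp: P_def)
 define g where "g = (%(b :: 'k, b' :: 'k). (if res b < res u then \<theta> (Var 1) (Var 0) else \<theta> (Var 0) (Var 1), %n :: nat. b'))"
 have gs: "sat (Val v) ((snd (g (b, b')))(0 := x)) (fst (g (b, b'))) <->
   0 <= v x & (if res b < res u then res b' < res x else res x < res b')" if "(b, b'):P" for b b' x
  using res_less[of x b'] res_less[of b' x] P[OF that] by (auto simp: g_def \<theta>_def negl_def not_less)
 have "EX x. ALL (p, e):g ` P. sat (Val v) (e(0 := x)) p"
 proof (rule realize_F[of "snd ` R"])
  show "countable (snd ` R)" using goodD(3)[OF cg(1)] by simp
  show "wf_fm Lval p & b ` (fv_fm p - {0}) \<subseteq> snd ` R" if pb: "(p, b):g ` P" for p b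
  proof -
   from pb obtain a a' where "(a, a'):P" "p = \<theta> (Var 1) (Var 0) | p = \<theta> (Var 0) (Var 1)" "b = (%n :: nat. a')"
    by (auto simp: g_def)
   thus ?thesis using snd_R[OF P(1)] by (auto simp: \<theta>_def)
  qed
  fix \<Delta> assume "finite \<Delta>" "\<Delta> \<subseteq> g ` P"
  then obtain Q where Q: "finite Q" "Q \<subseteq> P" "\<Delta> = g ` Q" by (meson finite_subset_image)
  have QR: "(res b, res b'):resR R" if "(b, b'):P" for b b' using resR_I P[OF that] by blast
  have "(res \<circ> fst) ` Q \<subseteq> fst ` resR R" using QR Q(2) by force
  then obtain z z' where z: "(z, z'):resR R" "ALL y:(res \<circ> fst) ` Q. y ~= z & (y < z <-> y < res u)"
   using cut_approx[OF resR_ofield[OF cg(1)], of "(res \<circ> fst) ` Q" "res u"] Q(1) u(3) by blast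
  obtain w w' where w: "(w, w'):R" "0 <= v w" "z = res w" "z' = res w'" using z(1) by (auto simp: resR_def)
  have "sat (Val v) ((snd (g t))(0 := w')) (fst (g t))" if t: "t:Q" for t
  proof -
   obtain b b' where t': "t = (b, b')" by (cases t)
   hence bP: "(b, b'):P" using t Q(2) by blast
   have "res b ~= res w" "res b < res w <-> res b < res u" using z(2) t t' w by auto
   thus ?thesis unfolding t' gs[OF bP]
    using good_v_nonneg[OF cg(1) w(1)] w or_less[OF resR_ofield[OF cg(1)] QR[OF bP], of "res w" "res w'"]
     or_less[OF resR_ofield[OF cg(1)] _ QR[OF bP], of "res w" "res w'"] z(1) by auto
  qed
  thus "EX a. ALL (p, b):\<Delta>. sat (Val v) (b(0 := a)) p"
   unfolding Q(3) by (intro exI[of _ w']) (auto simp: case_prod_beta)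
 qed
 then obtain u' where u': "!!t. t:P ==> sat (Val v) ((snd (g t))(0 := u')) (fst (g t))"
  by (auto simp: case_prod_beta)
 have cut: "0 <= v u' & (if res b < res u then res b' < res u' else res u' < res b')" if "(b, b'):P" for b b'
  using u'[OF that] unfolding gs[OF that] .
 have "(0, 0):P" using or_0[OF cg(4)] by (simp add: P_def)
 hence c0: "0 <= v u'" "res u' ~= 0" using cut[of 0 0] by (auto split: if_splits)
 hence "v u' = 0 & u' ~= 0" using res_eq_0_iff not_negl_1 by blast
 moreover have "same_cut (resR R) (res u) (res u')"
  unfolding same_cut_def
 proof (intro allI impI)
  fix b b' assume bb: "(b, b'):resR R"
  then obtain x x' where x: "(x, x'):P" "b = res x" "b' = res x'" by (auto simp: resR_def P_def)
  have "b ~= res u" using u(3) bb by force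
  thus "(b < res u <-> b' < res u') & b ~= res u & b' ~= res u'" using cut[OF x(1)] x(2,3) by (auto split: if_splits)
 qed
 ultimately show ?thesis by blast
qed

text \<open>Over a closed domain three transcendental cases remain: no best approximation, a new
  residue, a new value. In the last two the element is first translated by a best
  approximation.\<close>

lemma forth_closed: "EX R2. good R2 & R \<subseteq> R2 & c:fst ` R2"
proof (cases "c:fst ` R")
 case True
 thus ?thesis using cg(1) by blast
next
 case cA: False
 show ?thesis
 proof (cases "no_best (fst ` R) c")
  case True
  then obtain c' where "nest R c c'" using nest_exists[OF cg(1)] by blast
  then obtain R2 where "good R2" "R \<subseteq> R2" "(c, c'):R2" using extend_nest by blast
  thus ?thesis using fst_R[of c c' R2] by blast
 next
  case False
  then obtain a0 where a0: "a0:fst ` R" "c - a0 ~: fst ` R" "c - a0 ~= 0"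
    "!!b. b:fst ` R ==> v (c - a0 - b) <= v (c - a0)"
   using best_exists[OF _ cA cg(5)] by blast
  define e where "e = c - a0"
  have "EX R2. good R2 & R \<subseteq> R2 & e:fst ` R2"
  proof (cases "EX n>0. EX a:fst ` R. a ~= 0 & nmul n (v e) = v a")
   case True
   then obtain x x' where x: "(x, x'):R" "x > 0" "v x = v e" using closed_value by blast
   note u = residue_not_in[OF cg(1) fst_R[OF x(1)] _ x(3)[symmetric] a0(2,4)[folded e_def]]
   obtain u' R2 where R2: "good R2" "R \<subseteq> R2" "(e / x, u'):R2"
    using residue_cut_exists[OF u] extend_by_residue[OF u(1,2)] x(2) by blast
   have "e / x * x:fst ` R2" using sf_mult[OF or_dom[OF goodD(1)[OF R2(1)]] fst_R fst_R] R2 x(1) by blast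
   thus ?thesis using R2 x(2) by auto
  next
   case no: False
   obtain e' where e': "e' ~= 0" "e > 0 <-> e' > 0" "tpG (insert (v e, v e') (vR v R))"
    using new_value_exists[OF cg(1) a0(3)] by (auto simp: e_def)
   have new: "nmul n (v e) ~= v a" if "0 < n" "(a, a'):R" "a ~= 0" for n a a' using no fst_R[OF that(2)] that by blast
   have "good_adjoin R e e'"
    by (rule extend_new_value[OF cg(1) a0(3)[folded e_def] e']) (rule new)
   thus ?thesis using fst_R[of e e' "adjoin_rel R e e'"] by blast
  qed
  then obtain R2 where R2: "good R2" "R \<subseteq> R2" "e:fst ` R2" by blast
  have "e + a0:fst ` R2" using sf_add[OF or_dom[OF goodD(1)[OF R2(1)]] R2(3)] a0(1) R2(2) by blast
  thus ?thesis using R2 by (auto simp: e_def)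
 qed
qed

text \<open>Here \<open>c'\<close> is prescribed rather than chosen. The joint type of the distances
  fixes the nest or the new value, and together with the cut in \<open>K\<close> it also fixes the
  residue cut, since equality of residues is a comparison of distances.\<close>

lemma extend_given:
 assumes cut: "same_cut R c c'"
  and tp: "tpG ({(v (c - a), v (c' - a')) | a a'. (a, a'):R} \<union> vR v R)" (is "tpG (?V \<union> _)")
 shows "EX R2. good R2 & R \<subseteq> R2 & (c, c'):R2"
proof -
 have cne: "c ~= a" "c' ~= a'" if "(a, a'):R" for a a' using cut that by (auto simp: same_cut_def)
 have V: "(v (c - a), v (c' - a')):?V \<union> vR v R" if "(a, a'):R" for a a' using that by blast
 have cA: "c ~: fst ` R" "c' ~: snd ` R" using cne by force+
 have lt: "v (c - a) < v (c - b) <-> v (c' - a') < v (c' - b')" if "(a, a'):R" "(b, b'):R" for a a' b b'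
  using tpG_less[OF tp V V] that by blast
 show ?thesis
 proof (cases "no_best (fst ` R) c")
  case nb: True
  have "no_best (snd ` R) c'"
   unfolding no_best_def
  proof (intro conjI ballI cA)
   fix a' assume "a':snd ` R"
   then obtain a where a: "(a, a'):R" by auto
   obtain b where b: "b:fst ` R" "v (c - a) < v (c - b)" using nb fst_R[OF a] unfolding no_best_def by blast
   then obtain b' where b': "(b, b'):R" by auto
   show "EX b:snd ` R. v (c' - a') < v (c' - b)" using lt[OF a b'] b(2) snd_R[OF b'] by blast
  qed
  hence "nest R c c'" unfolding nest_def using nb lt by blast
  thus ?thesis by (rule extend_nest)
 next
  case False
  then obtain a0 where "a0:fst ` R" and a0: "c - a0 ~: fst ` R" "c - a0 ~= 0"
    "!!b. b:fst ` R ==> v (c - a0 - b) <= v (c - a0)"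
   using best_exists[OF _ cA(1) cg(5)] by blast
  then obtain a0' where aa: "(a0, a0'):R" by auto
  define e e' where "e = c - a0" and "e' = c' - a0'"
  have e: "e ~= 0" "e' ~= 0" using cne[OF aa] by (auto simp: e_def e'_def)
  have sgn: "b < e <-> b' < e'" if "(b, b'):R" for b b'
   using cut or_add[OF cg(4) that aa] unfolding same_cut_def e_def e'_def by (metis less_diff_eq)
  have "EX R2. good R2 & R \<subseteq> R2 & (e, e'):R2"
  proof (cases "EX n>0. EX a:fst ` R. a ~= 0 & nmul n (v e) = v a")
   case True
   then obtain x x' where x: "(x, x'):R" "x > 0" "v x = v e" using closed_value by blast
   have x': "x' > 0" using or_pos[OF cg(4) x(1)] x(2) by simp
   have Vx: "(v x, v x'):?V \<union> vR v R" using vR_I[OF x(1)] by blast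
   have vx': "v x' = v e'" using tpG_eq[OF tp Vx V[OF aa]] x(3) by (simp add: e_def e'_def)
   note u = residue_not_in[OF cg(1) fst_R[OF x(1)] _ x(3)[symmetric] a0(1,3)[folded e_def]]
   have "v (e' / x' * x') = v (e' / x') + v x'" using e x' v_mult[of "e' / x'" x'] by simp
   hence u': "v (e' / x') = 0" "e' / x' ~= 0" using vx' x' e by simp_all
   have ne: "v (e / x) = 0" "e / x ~= 0" "res (e / x) ~: fst ` resR R" using u x(2) by simp_all
   have "same_cut (resR R) (res (e / x)) (res (e' / x'))"
    unfolding same_cut_def
   proof (intro allI impI)
    fix r r' assume r: "(r, r'):resR R"
    then obtain b b' where b: "(b, b'):R" "0 <= v b" "r = res b" "r' = res b'" by (auto simp: resR_def)
    have b'0: "0 <= v b'" using good_v_nonneg[OF cg(1) b(1)] b(2) by simp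
    have rne: "r ~= res (e / x)" using ne(3) r by force
    have xb: "(a0 + x * b, a0' + x' * b'):R" by (intro or_add[OF cg(4)] or_mult[OF cg(4)] aa x(1) b(1))
    have eq: "e / x - b = (c - (a0 + x * b)) / x" "e' / x' - b' = (c' - (a0' + x' * b')) / x'"
     using x(2) x' by (simp_all add: e_def e'_def field_simps)
    have "e / x - b << 1 <-> v x < v (c - (a0 + x * b))"
     unfolding eq using cne(1)[OF xb] x(2) negl_1_iff[of x "c - (a0 + x * b)"] by (simp add: negl_def)
    also have "\<dots> <-> v x' < v (c' - (a0' + x' * b'))" by (rule tpG_less[OF tp Vx V[OF xb]])
    also have "\<dots> <-> e' / x' - b' << 1"
     unfolding eq using cne(2)[OF xb] x' negl_1_iff[of x' "c' - (a0' + x' * b')"] by (simp add: negl_def)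
    finally have n: "~ e / x - b << 1" "~ e' / x' - b' << 1" using rne res_eq_iff[of "e / x" b] ne(1) b by auto
    hence "r' ~= res (e' / x')" using res_eq_iff[of "e' / x'" b'] b'0 u'(1) b(4) by auto
    moreover have "b < e / x <-> b' < e' / x'"
     using sgn[OF or_mult[OF cg(4) b(1) x(1)]] x(2) x' by (simp add: less_divide_eq)
    ultimately show "(r < res (e / x) <-> r' < res (e' / x')) & r ~= res (e / x) & r' ~= res (e' / x')"
     using rne n res_less[of "e / x" b] res_less[of "e' / x'" b'] ne(1) u'(1) b b'0 by simp
   qed
   then obtain R2 where R2: "good R2" "R \<subseteq> R2" "(e / x, e' / x'):R2"
    using extend_by_residue[OF ne(1,2) u'] by blast
   have "(e / x * x, e' / x' * x'):R2" using or_mult[OF goodD(1)[OF R2(1)] R2(3)] R2(2) x(1) by blast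
   thus ?thesis using R2 x(2) x' by auto
  next
   case no: False
   have sub: "insert (v e, v e') (vR v R) \<subseteq> ?V \<union> vR v R" using V[OF aa] by (auto simp: e_def e'_def)
   have new: "nmul n (v e) ~= v a" if "0 < n" "(a, a'):R" "a ~= 0" for n a a' using no fst_R[OF that(2)] that by blast
   have "e > 0 <-> e' > 0" using sgn[OF or_0[OF cg(4)]] .
   hence "good_adjoin R e e'"
    by (rule extend_new_value[OF cg(1) e _ tpeq_mono[OF tp sub]]) (rule new)
   thus ?thesis by blast
  qed
  then obtain R2 where R2: "good R2" "R \<subseteq> R2" "(e, e'):R2" by blast
  have "(e + a0, e' + a0'):R2" using or_add[OF goodD(1)[OF R2(1)] R2(3)] aa R2(2) by blast
  thus ?thesis using R2 by (auto simp: e_def e'_def)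
 qed
qed

end

lemma good_forth:
 assumes "good R"
 shows "EX R2. good R2 & R \<subseteq> R2 & (EX c'. (c, c'):R2)"
proof -
 obtain R1 where R1: "R \<subseteq> R1" "closed_good R1" using closed_extension[OF assms] by blast
 obtain R2 where R2: "good R2" "R1 \<subseteq> R2" "c:fst ` R2" using forth_closed[OF R1(2), of c] by blast
 then obtain c' where "(c, c'):R2" by auto
 thus ?thesis using R1(1) R2 by blast
qed

text \<open>\<open>good_forth\<close> and its converse give both directions, so a good relation
  preserves all formulas of ordered rings although only the value group was required to match
  elementarily.\<close>

lemma good_tpeq:
 assumes "good R"
 shows "tpeq Lring OFld OFld R"
proof (rule back_forth_tpeq[where \<R> = "Collect good"])
 fix R f and as bs :: "'k list"
 assume R: "R:Collect good" and as: "length as = fun_arity Lring f" "list_all2 (%a b. (a, b):R) as bs"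
 hence oR: "ofield_rel R" by (simp add: goodD)
 show "(fun_interp OFld f as, fun_interp OFld f bs):R"
  using as by (cases f) (auto simp: numeral_2_eq_2 length_Suc_conv list_all2_Cons1
    intro!: or_add[OF oR] or_diff[OF oR] or_mult[OF oR] or_0[OF oR] or_1[OF oR])
next
 fix R r and as bs :: "'k list"
 assume R: "R:Collect good" and as: "length as = rel_arity Lring r" "list_all2 (%a b. (a, b):R) as bs"
 thus "rel_interp OFld r as = rel_interp OFld r bs"
  by (auto simp: numeral_2_eq_2 length_Suc_conv list_all2_Cons1 or_less[OF goodD(1)])
next
 fix R and b :: 'k assume "R:Collect good"
 hence "good (R\<inverse>)" using good_converse by simp
 from good_forth[OF this, of b] obtain R2 a where R2: "good R2" "R\<inverse> \<subseteq> R2" "(b, a):R2" by blast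
 thus "EX R':Collect good. R \<subseteq> R' & (EX a:univ OFld. (a, b):R')"
  using good_converse[OF R2(1)] by (intro bexI[of _ "R2\<inverse>"]) auto
qed (use assms good_forth or_eq[OF goodD(1)] in auto)

end

\<comment> \<open>Ultrapowers as ordered fields and groups\<close>
quotient_type 'a star = "nat => 'a" / "%f g. eventually (%n. f n = g n) \<U>"
 morphisms rep_star ulim
proof (rule equivpI)
 show "reflp (%f g :: nat => 'a. eventually (%n. f n = g n) \<U>)" by (rule reflpI) simp
 show "symp (%f g :: nat => 'a. eventually (%n. f n = g n) \<U>)"
  by (rule sympI) (auto elim: eventually_mono)
 show "transp (%f g :: nat => 'a. eventually (%n. f n = g n) \<U>)"
  by (rule transpI) (auto elim: eventually_elim2)
qed

lift_definition star_map :: "('a => 'b) => 'a star => 'b star" is "%h f n. h (f n)"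
 by (auto elim: eventually_mono)

instantiation star :: (plus) plus begin
lift_definition plus_star :: "'a star => 'a star => 'a star" is "%f g n. f n + g n" by (auto elim: eventually_elim2)
instance ..
end
instantiation star :: (minus) minus begin
lift_definition minus_star :: "'a star => 'a star => 'a star" is "%f g n. f n - g n" by (auto elim: eventually_elim2)
instance ..
end
instantiation star :: (times) times begin
lift_definition times_star :: "'a star => 'a star => 'a star" is "%f g n. f n * g n" by (auto elim: eventually_elim2)
instance ..
end
instantiation star :: (divide) divide begin
lift_definition divide_star :: "'a star => 'a star => 'a star" is "%f g n. f n div g n" by (auto elim: eventually_elim2)
instance ..
end
instantiation star :: (inverse) inverse begin
definition "inverse_star = star_map (inverse :: 'a => 'a)"
instance ..
end
instantiation star :: (uminus) uminus begin
definition "uminus_star = star_map (uminus :: 'a => 'a)"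
instance ..
end
instantiation star :: (abs) abs begin
definition "\<bar>x :: 'a star\<bar> = star_map abs x"
instance ..
end
instantiation star :: (sgn) sgn begin
definition "sgn_star = star_map (sgn :: 'a => 'a)"
instance ..
end
instantiation star :: (zero) zero begin
lift_definition zero_star :: "'a star" is "%_. 0" .
instance ..
end
instantiation star :: (one) one begin
lift_definition one_star :: "'a star" is "%_. 1" .
instance ..
end
instantiation star :: (ord) ord begin
lift_definition less_star :: "'a star => 'a star => bool" is "%f g. eventually (%n. f n < g n) \<U>"
 by (rule ultra_iff, erule (1) eventually_elim2) simp
lift_definition less_eq_star :: "'a star => 'a star => bool" is "%f g. eventually (%n. f n <= g n) \<U>"
 by (rule ultra_iff, erule (1) eventually_elim2) simp
instance ..
end

lemma ultra_disj: "eventually (%n. P n | Q n) \<U> <-> eventually P \<U> | eventually Q \<U>"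
 using ultra_conj[of "%n. ~ P n" "%n. ~ Q n"] ultra_not[of "%n. P n | Q n"] by (simp del: de_Morgan_disj add: de_Morgan_disj[symmetric])

lemma star_less_iff: "ulim f < ulim g <-> eventually (%n. f n < g n) \<U>" by transfer simp
lemma star_eq_iff: "ulim f = ulim g <-> eventually (%n. f n = g n) \<U>" by (rule star.abs_eq_iff)

lemma star_ops:
 "ulim f + ulim g = ulim (%n. f n + g n)" "ulim a - ulim b = ulim (%n. a n - b n)"
 "ulim x * ulim y = ulim (%n. x n * y n)" "0 = ulim (%_. 0)" "1 = ulim (%_. 1)"
 "star_map h (ulim k) = ulim (%n. h (k n))"
 by (transfer; simp)+

lemma ulim_surj: "EX f. x = ulim f" by (rule star.abs_induct) blast

instance star :: (linordered_ab_group_add) linordered_ab_group_add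
proof
 fix a b c :: "'a star"
 show "a + b + c = a + (b + c)" by transfer (simp add: add.assoc)
 show "a + b = b + a" by transfer (simp add: add.commute)
 show "0 + a = a" by transfer simp
 show "- a + a = 0" unfolding uminus_star_def by transfer simp
 show "a - b = a + - b" unfolding uminus_star_def by transfer simp
 show "a < b <-> a <= b & ~ b <= a"
  by transfer (simp only: less_le_not_le ultra_conj ultra_not)
 show "a <= a" by transfer simp
 show "a <= b ==> b <= c ==> a <= c" by transfer (erule (1) eventually_elim2, simp)
 show "a <= b ==> b <= a ==> a = b" by transfer (erule (1) eventually_elim2, simp)
 show "a <= b ==> c + a <= c + b" by transfer (erule eventually_mono, simp)
 show "a <= b | b <= a"
  by transfer (simp add: ultra_disj[symmetric] linear)
qed

instance star :: (linordered_field) linordered_field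
proof
 fix a b c :: "'a star"
 show "a * b * c = a * (b * c)" by transfer (simp add: mult.assoc)
 show "a * b = b * a" by transfer (simp add: mult.commute)
 show "1 * a = a" by transfer simp
 show "(a + b) * c = a * c + b * c" by transfer (simp add: algebra_simps)
 show "(0 :: 'a star) ~= 1" by transfer simp
 show "a ~= 0 ==> inverse a * a = 1"
  unfolding inverse_star_def by transfer (simp only: ultra_not[symmetric], erule eventually_mono, simp)
 show "0 * a = 0" "a * 0 = 0" by (transfer; simp)+
 show "a div b = a * inverse b" unfolding inverse_star_def by transfer (simp add: divide_inverse)
 show "inverse 0 = (0 :: 'a star)" unfolding inverse_star_def by transfer simp
 show "a < b ==> 0 < c ==> c * a < c * b" by transfer (erule (1) eventually_elim2, simp)
 obtain f where a: "a = ulim f" using ulim_surj by blast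
 have sg: "a < 0 <-> eventually (%n. f n < 0) \<U>" "0 < a <-> eventually (%n. 0 < f n) \<U>"
  "a = 0 <-> eventually (%n. f n = 0) \<U>"
  by (simp_all only: a star_ops(4) star_less_iff star_eq_iff)
 show "\<bar>a\<bar> = (if a < 0 then - a else a)"
  unfolding abs_star_def uminus_star_def if_distrib[of "%x. _ = x"] sg
  by (auto simp: a star_ops star_eq_iff ultra_not[symmetric] simp del: ultra_not elim: eventually_mono)
 show "sgn a = (if a = 0 then 0 else if 0 < a then 1 else - 1)"
  unfolding sgn_star_def uminus_star_def if_distrib[of "%x. _ = x"] sg
  by (auto simp: a star_ops star_eq_iff ultra_not[symmetric] simp del: ultra_not elim: eventually_mono eventually_elim2)
qed

lemma is_ultrapower_oring:
 "is_ultrapower Lring (OFld :: (oring_fun, order_rel, 'k::linordered_field) struc) OFld ulim"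
 unfolding is_ultrapower_def
proof (intro conjI allI impI)
 show "ulim ` {f. range f \<subseteq> univ OFld} = univ OFld"
  using ulim_surj by auto
 fix f g :: "nat => 'k"
 show "ulim f = ulim g <-> eventually (%n. f n = g n) \<U>" by (rule star_eq_iff)
next
 fix F and fs :: "(nat => 'k) list"
 assume "length fs = fun_arity Lring F & (ALL f:set fs. range f \<subseteq> univ OFld)"
 thus "fun_interp OFld F (map ulim fs) = ulim (%n. fun_interp OFld F (map (%f. f n) fs))"
  by (cases F) (auto simp: numeral_2_eq_2 length_Suc_conv star_ops)
next
 fix r and fs :: "(nat => 'k) list"
 assume "length fs = rel_arity Lring r & (ALL f:set fs. range f \<subseteq> univ OFld)"
 thus "rel_interp OFld r (map ulim fs) =
   eventually (%n. rel_interp OFld r (map (%f. f n) fs)) \<U>"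
  by (auto simp: numeral_2_eq_2 length_Suc_conv star_less_iff)
qed

lemma is_ultrapower_ogroup:
 "is_ultrapower Lgrp (OGrp :: (ogroup_fun, order_rel, 'g::linordered_ab_group_add) struc)
   OGrp ulim"
 unfolding is_ultrapower_def
proof (intro conjI allI impI)
 show "ulim ` {f. range f \<subseteq> univ OGrp} = univ OGrp"
  using ulim_surj by auto
 fix f g :: "nat => 'g"
 show "ulim f = ulim g <-> eventually (%n. f n = g n) \<U>" by (rule star_eq_iff)
next
 fix F and fs :: "(nat => 'g) list"
 assume "length fs = fun_arity Lgrp F & (ALL f:set fs. range f \<subseteq> univ OGrp)"
 thus "fun_interp OGrp F (map ulim fs) = ulim (%n. fun_interp OGrp F (map (%f. f n) fs))"
  by (cases F) (auto simp: numeral_2_eq_2 length_Suc_conv star_ops)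
next
 fix r and fs :: "(nat => 'g) list"
 assume "length fs = rel_arity Lgrp r & (ALL f:set fs. range f \<subseteq> univ OGrp)"
 thus "rel_interp OGrp r (map ulim fs) =
   eventually (%n. rel_interp OGrp r (map (%f. f n) fs)) \<U>"
  by (auto simp: numeral_2_eq_2 length_Suc_conv star_less_iff)
qed

lemma star_negl:
 fixes f g :: "nat => 'k::linordered_field" and v :: "'k => 'g::linordered_ab_group_add"
 shows "negl (star_map v) (ulim f) (ulim g) <-> eventually (%n. negl v (f n) (g n)) \<U>"
 unfolding negl_def by (simp add: star_ops star_less_iff star_eq_iff ultra_conj ultra_disj)

lemma is_ultrapower_vring:
 fixes v :: "'k::linordered_field => 'g::linordered_ab_group_add"
 shows "is_ultrapower Lval (Val v) (Val (star_map v)) ulim"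
 unfolding is_ultrapower_def
proof (intro conjI allI impI)
 note up = is_ultrapower_oring[where 'k = 'k, unfolded is_ultrapower_def]
 show "ulim ` {f. range f \<subseteq> univ (Val v)} = univ (Val (star_map v))"
  using ulim_surj by auto
 fix f g :: "nat => 'k"
 show "ulim f = ulim g <-> eventually (%n. f n = g n) \<U>" by (rule star_eq_iff)
next
 fix F and fs :: "(nat => 'k) list"
 assume "length fs = fun_arity Lval F & (ALL f:set fs. range f \<subseteq> univ (Val v))"
 thus "fun_interp (Val (star_map v)) F (map ulim fs) =
   ulim (%n. fun_interp (Val v) F (map (%f. f n) fs))"
  using is_ultrapower_oring[where 'k = 'k] unfolding is_ultrapower_def by simp
next
 fix r and fs :: "(nat => 'k) list"
 assume "length fs = rel_arity Lval r & (ALL f:set fs. range f \<subseteq> univ (Val v))"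
 thus "rel_interp (Val (star_map v)) r (map ulim fs) =
   eventually (%n. rel_interp (Val v) r (map (%f. f n) fs)) \<U>"
  by (cases r) (auto simp: numeral_2_eq_2 length_Suc_conv star_less_iff star_negl)
qed

lemma ulim_sum: "finite I ==> (\<Sum>i\<in>I. ulim (c i)) = ulim (%n. \<Sum>i\<in>I. c i n :: 'k::linordered_field)"
 by (induction I rule: finite_induct) (simp_all add: star_ops)

lemma ulim_power: "ulim f ^ i = ulim (%n. f n ^ i :: 'k::linordered_field)"
 by (induction i) (simp_all add: star_ops)

lemma ulim_of_nat: "of_nat m = ulim (%n. of_nat m :: 'k::linordered_field)"
 by (induction m) (simp_all add: star_ops)

definition poly_at :: "'k::linordered_field star poly => nat => 'k poly" where
 "poly_at f n = (\<Sum>i\<le>degree f. monom (rep_star (coeff f i) n) i)"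

lemma ulim_rep [simp]: "ulim (rep_star x) = x" using Quotient3_abs_rep[OF Quotient3_star] .

lemma coeff_poly_at: "coeff (poly_at f n) i = (if i <= degree f then rep_star (coeff f i) n else 0)"
 by (simp add: poly_at_def coeff_sum)

lemma star_poly: "poly f (ulim a) = ulim (%n. poly (poly_at f n) (a n))"
proof -
 have "poly f (ulim a) = (\<Sum>i\<le>degree f. ulim (rep_star (coeff f i)) * ulim a ^ i)" by (simp add: poly_altdef)
 also have "\<dots> = ulim (%n. \<Sum>i\<le>degree f. rep_star (coeff f i) n * a n ^ i)"
  by (simp only: ulim_power star_ops ulim_sum finite_atMost)
 finally show ?thesis by (simp add: poly_at_def poly_sum poly_monom)
qed

lemma star_pderiv: "poly (pderiv f) (ulim a) = ulim (%n. poly (pderiv (poly_at f n)) (a n))"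
proof -
 have "pderiv f = pderiv (\<Sum>i\<le>degree f. monom (coeff f i) i)" by (simp add: poly_as_sum_of_monoms)
 hence "poly (pderiv f) (ulim a) = (\<Sum>i\<le>degree f. of_nat i * ulim (rep_star (coeff f i)) * ulim a ^ (i - 1))"
  by (simp add: pderiv_sum pderiv_monom poly_sum poly_monom)
 also have "\<dots> = ulim (%n. \<Sum>i\<le>degree f. of_nat i * rep_star (coeff f i) n * a n ^ (i - 1))"
  by (simp only: ulim_power star_ops ulim_sum finite_atMost ulim_of_nat)
 finally show ?thesis by (simp add: poly_at_def pderiv_sum pderiv_monom poly_sum poly_monom)
qed

lemma ultra_ball: "finite I ==> (!!i. i:I ==> eventually (P i) \<U>) ==> eventually (%n. ALL i:I. P i n) \<U>"
 by (rule eventually_ball_finite) auto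

lemma ultra_choice: "eventually (%n. EX x. P n x) \<U> ==> EX f. eventually (%n. P n (f n)) \<U>"
 by (intro exI[of _ "%n. SOME x. P n x"]) (auto elim: eventually_mono intro: someI)

lemma star_le_iff: "ulim f <= (ulim g :: 'g::linordered_ab_group_add star) <-> eventually (%n. f n <= g n) \<U>"
 by transfer simp

context arc_field
begin

lemma coeffs_poly_at:
 assumes "!!i. 0 <= star_map v (coeff f i)"
 shows "eventually (%n. ALL i. 0 <= v (coeff (poly_at f n) i)) \<U>"
 proof -
  have "eventually (%n. 0 <= v (rep_star (coeff f i) n)) \<U>" for i
   using assms[of i] by (subst (asm) ulim_rep[symmetric], simp only: star_ops star_le_iff)
  hence "eventually (%n. ALL i:{..degree f}. 0 <= v (rep_star (coeff f i) n)) \<U>" by (intro ultra_ball) auto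
  thus ?thesis by (rule eventually_mono) (auto simp: coeff_poly_at)
 qed

text \<open>The axioms pass to the ultrapower coordinatewise. A polynomial over it has a fixed
  degree, so \<open>poly_at\<close> splits it into coordinate polynomials, and
  \<open>ultra_choice\<close> collects their roots.\<close>

lemma arc_monster_star: "arc_monster (star_map v)"
proof
 let ?v = "star_map v"
 show "aleph1_saturated Lval (Val ?v)"
  by (rule up_saturated[OF vring_is_structure is_ultrapower_vring])
 show "aleph1_saturated Lgrp (OGrp :: (_, _, 'g star) struc)"
  by (rule up_saturated[OF ogroup_is_structure is_ultrapower_ogroup])
 show "?v 0 = 0" by (simp add: star_ops)
 fix x y :: "'k star"
 obtain a b where ab: "x = ulim a" "y = ulim b" using ulim_surj by metis
 show "?v (x * y) = ?v x + ?v y" if "x ~= 0" "y ~= 0"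
  using that unfolding ab star_ops star_eq_iff ultra_not[symmetric]
  by (rule eventually_elim2) (simp add: v_mult)
 show "min (?v x) (?v y) <= ?v (x + y)" if ne: "x ~= 0" "y ~= 0" "x + y ~= 0"
 proof -
  have "eventually (%n. (a n ~= 0 & b n ~= 0) & a n + b n ~= 0) \<U>"
   using ne unfolding ab star_ops star_eq_iff by (simp add: ultra_conj)
  hence "eventually (%n. v (a n) <= v (a n + b n) | v (b n) <= v (a n + b n)) \<U>"
   by (rule eventually_mono) (use v_add in \<open>force simp: min_le_iff_disj\<close>)
  thus ?thesis unfolding ab star_ops min_le_iff_disj star_le_iff ultra_disj .
 qed
 fix g :: "'g star"
 obtain h where g: "g = ulim h" using ulim_surj by blast
 have "ALL n. EX x. x ~= 0 & v x = h n" using v_surj by blast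
 then obtain k where k: "!!n. k n ~= 0 & v (k n) = h n" by metis
 hence "ulim k ~= 0 & ?v (ulim k) = g" by (simp add: g star_ops star_eq_iff)
 thus "EX x. x ~= 0 & ?v x = g" by blast
next
 let ?v = "star_map v"
 fix n :: nat assume "n > 0"
 thus "?v (of_nat n) = 0" by (simp add: ulim_of_nat star_ops v_of_nat)
next
 let ?v = "star_map v"
 fix a assume "0 <= ?v a"
 moreover obtain f where a: "a = ulim f" using ulim_surj by blast
 ultimately have "eventually (%n. 0 <= v (f n)) \<U>" by (simp add: star_ops star_le_iff)
 hence "eventually (%n. EX b. negl v (f n - b * b) 1 | negl v (f n + b * b) 1) \<U>"
  by (rule eventually_mono) (rule res_square)
 then obtain b where "eventually (%n. negl v (f n - b n * b n) 1 | negl v (f n + b n * b n) 1) \<U>"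
  using ultra_choice[where P = "%n b. negl v (f n - b * b) 1 | negl v (f n + b * b) 1"] by blast
 hence "negl ?v (a - ulim b * ulim b) 1 | negl ?v (a + ulim b * ulim b) 1"
  unfolding a star_ops star_negl ultra_disj .
 thus "EX b. negl ?v (a - b * b) 1 | negl ?v (a + b * b) 1" by blast
next
 let ?v = "star_map v"
 fix f a
 assume f: "!!i. 0 <= ?v (coeff f i)" and a0: "0 <= ?v a" "negl ?v (poly f a) 1"
  "poly (pderiv f) a ~= 0" "?v (poly (pderiv f) a) = 0"
 obtain k where a: "a = ulim k" using ulim_surj by blast
 have "eventually (%n. (ALL i. 0 <= v (coeff (poly_at f n) i)) & 0 <= v (k n) & negl v (poly (poly_at f n) (k n)) 1 &
   poly (pderiv (poly_at f n)) (k n) ~= 0 & v (poly (pderiv (poly_at f n)) (k n)) = 0) \<U>"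
  using a0 coeffs_poly_at[OF f] unfolding a star_pderiv unfolding star_poly ultra_conj
  by (simp add: star_ops star_le_iff star_eq_iff star_negl)
 hence "eventually (%n. EX b. poly (poly_at f n) b = 0 & negl v (b - k n) 1) \<U>"
  by (rule eventually_mono) (use hensel in blast)
 then obtain b where "eventually (%n. poly (poly_at f n) (b n) = 0 & negl v (b n - k n) 1) \<U>"
  using ultra_choice[where P = "%n b. poly (poly_at f n) b = 0 & negl v (b - k n) 1"] by blast
 hence "poly f (ulim b) = 0 & negl ?v (ulim b - a) 1"
  unfolding ultra_conj by (simp add: a star_poly star_ops star_eq_iff star_negl)
 thus "EX b. poly f b = 0 & negl ?v (b - a) 1" by blast
next
 let ?v = "star_map v"
 fix f assume f: "odd (degree f)" "!!i. 0 <= ?v (coeff f i)" "?v (lead_coeff f) = 0"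
 have "lead_coeff f ~= 0" using f(1) by auto
 hence "eventually (%n. rep_star (lead_coeff f) n ~= 0) \<U>"
  using star_eq_iff[of "rep_star (lead_coeff f)" "%_. 0"] by (simp add: star_ops)
 moreover have "eventually (%n. v (rep_star (lead_coeff f) n) = 0) \<U>"
  using f(3) star_ops(6)[of v "rep_star (lead_coeff f)"] by (simp add: star_ops star_eq_iff)
 moreover have "eventually (%n. ALL i. 0 <= v (coeff (poly_at f n) i)) \<U>" using coeffs_poly_at[OF f(2)] .
 ultimately have "eventually (%n. EX x. 0 <= v x & negl v (poly (poly_at f n) x) 1) \<U>"
 proof eventually_elim
  case (elim n)
  have "degree (poly_at f n) = degree f"
   using elim(1) by (intro antisym degree_le le_degree) (auto simp: coeff_poly_at)
  thus ?case using res_odd[of "poly_at f n"] f(1) elim by (simp add: coeff_poly_at)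
 qed
 then obtain x where "eventually (%n. 0 <= v (x n) & negl v (poly (poly_at f n) (x n)) 1) \<U>"
  using ultra_choice[where P = "%n x. 0 <= v x & negl v (poly (poly_at f n) x) 1"] by blast
 hence "0 <= ?v (ulim x) & negl ?v (poly f (ulim x)) 1"
  unfolding ultra_conj by (simp add: star_poly star_ops star_le_iff star_negl)
 thus "EX x. 0 <= ?v x & negl ?v (poly f x) 1" by blast
qed

end

section \<open>From valuation rings and residue class rings to \<open>arc_field\<close>\<close>

context
 fixes v :: "'k::linordered_field => 'g::linordered_ab_group_add"
 assumes val: "valuation v"
begin

abbreviation "kv \<equiv> residue_field v"
abbreviation "vV \<equiv> valuation_ring v"
abbreviation "vI \<equiv> valuation_ideal v"

lemma vmul: "x ~= 0 ==> y ~= 0 ==> v (x * y) = v x + v y" using val by (simp add: valuation_def)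

lemma vadd: "x ~= 0 ==> y ~= 0 ==> x + y ~= 0 ==> min (v x) (v y) <= v (x + y)"
 using val by (simp add: valuation_def)

lemma vone: "v 1 = 0" using vmul[of 1 1] by simp

lemma vneg1: "v (- 1) = 0" using vmul[of "- 1" "- 1"] by (simp add: vone double_zero)

lemma vminus: "v (- x) = v x" using vmul[of "- 1" x] by (cases "x = 0") (simp_all add: vneg1)

lemma V_simps [simp]: "carrier vV = {x. x = 0 | 0 <= v x}" "x \<otimes>\<^bsub>vV\<^esub> y = x * y" "\<one>\<^bsub>vV\<^esub> = 1" "\<zero>\<^bsub>vV\<^esub> = 0" "x \<oplus>\<^bsub>vV\<^esub> y = x + y"
 by (simp_all add: valuation_ring_def)

lemma V_closed:
 assumes "x:carrier vV" "y:carrier vV"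
 shows "x + y:carrier vV" "x * y:carrier vV" "- x:carrier vV"
proof -
 have "0 <= v x ==> 0 <= v y ==> x ~= 0 ==> y ~= 0 ==> x + y ~= 0 ==> 0 <= v (x + y)"
  using vadd[of x y] by (meson min.boundedI order_trans)
 thus "x + y:carrier vV" using assms by (cases "x = 0"; cases "y = 0"; cases "x + y = 0") auto
 show "x * y:carrier vV" using assms vmul[of x y] by (cases "x = 0"; cases "y = 0") auto
 show "- x:carrier vV" using assms by (simp add: vminus)
qed

lemma V_cring: "cring vV"
proof (rule cringI)
 show "abelian_group vV"
 proof (rule abelian_groupI)
  fix x assume x: "x:carrier vV"
  show "EX y:carrier vV. y \<oplus>\<^bsub>vV\<^esub> x = \<zero>\<^bsub>vV\<^esub>" by (intro bexI[of _ "- x"] V_closed(3)[OF x x]) simp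
 qed (use V_closed in auto)
 show "comm_monoid vV" by (rule comm_monoidI) (use V_closed in \<open>auto simp: vone\<close>)
qed (simp add: algebra_simps)

lemma V_minus: "x:carrier vV ==> \<ominus>\<^bsub>vV\<^esub> x = - x"
 using abelian_group.minus_equality[OF ring.is_abelian_group[OF cring.axioms(1)[OF V_cring]], of "- x" x] V_closed(3) by simp

lemma I_ideal: "ideal vI vV"
proof (rule idealI)
 show "ring vV" using V_cring by (simp add: cring_def)
 show "subgroup vI (add_monoid vV)"
 proof
  show "vI \<subseteq> carrier (add_monoid vV)" by (auto simp: valuation_ideal_def)
  fix x assume x: "x:vI"
  hence "x:carrier vV" by (auto simp: valuation_ideal_def)
  hence "inv\<^bsub>add_monoid vV\<^esub> x = - x" using V_minus by (simp add: a_inv_def)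
  thus "inv\<^bsub>add_monoid vV\<^esub> x:vI" using x by (simp add: valuation_ideal_def vminus)
  fix y assume "y:vI"
  moreover have "0 < v x ==> 0 < v y ==> x ~= 0 ==> y ~= 0 ==> x + y ~= 0 ==> 0 < v (x + y)"
   using vadd[of x y] by (meson min_less_iff_conj less_le_trans)
  ultimately show "x \<otimes>\<^bsub>add_monoid vV\<^esub> y:vI" using x by (cases "x = 0"; cases "y = 0"; cases "x + y = 0") (auto simp: valuation_ideal_def)
 qed (simp add: valuation_ideal_def)
 fix a x assume "a:vI" "x:carrier vV"
 thus "x \<otimes>\<^bsub>vV\<^esub> a:vI" "a \<otimes>\<^bsub>vV\<^esub> x:vI"
  using vmul[of x a] by (cases "x = 0"; cases "a = 0"; auto simp: valuation_ideal_def mult.commute add_nonneg_pos)+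
qed

definition rcl :: "'k => 'k set" where "rcl x = vI +>\<^bsub>vV\<^esub> x"

lemma rcl_hom: "ring_hom_cring vV kv rcl"
proof -
 have "rcl:ring_hom vV kv"
  using ideal.rcos_ring_hom[OF I_ideal] by (simp add: residue_field_def rcl_def[abs_def])
 thus ?thesis
  using V_cring ideal.quotient_is_cring[OF I_ideal V_cring]
  by (auto simp: ring_hom_cring_def ring_hom_cring_axioms_def residue_field_def)
qed

lemma rcl_eq: "x:carrier vV ==> y:carrier vV ==> rcl x = rcl y <-> x - y:vI"
 using ring.quotient_eq_iff_same_a_r_cos[OF cring.axioms(1)[OF V_cring] I_ideal, of x y] V_minus[of y]
 by (simp add: rcl_def a_minus_def)

lemma rcl_surj: "Y:carrier kv ==> EX x:carrier vV. Y = rcl x"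
 by (auto simp: residue_field_def FactRing_def A_RCOSETS_def' rcl_def)

lemma rcl_sum:
 assumes "!!i. i < n ==> f i:carrier vV"
 shows "(\<Oplus>\<^bsub>kv\<^esub>i\<in>{..<n::nat}. rcl (f i)) = rcl (sum f {..<n}) & sum f {..<n}:carrier vV"
proof -
 interpret h: ring_hom_cring vV "kv" rcl by (rule rcl_hom)
 show ?thesis using assms
 proof (induction n)
  case 0
  thus ?case using h.hom_zero by simp
 next
  case (Suc n)
  have fn: "f n:carrier vV" and s: "sum f {..<n}:carrier vV" using Suc by auto
  have "(\<Oplus>\<^bsub>kv\<^esub>i\<in>{..<Suc n}. rcl (f i)) = rcl (f n) \<oplus>\<^bsub>kv\<^esub> (\<Oplus>\<^bsub>kv\<^esub>i\<in>{..<n}. rcl (f i))"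
   unfolding lessThan_Suc by (rule h.S.finsum_insert) (use Suc.prems h.hom_closed in auto)
  also have "\<dots> = rcl (f n + sum f {..<n})"
   using Suc h.hom_add[OF fn s] by simp
  finally show ?case using V_closed(1)[OF fn s] by (simp add: add.commute)
 qed
qed

lemma rcl_pow: "x:carrier vV ==> rcl x [^]\<^bsub>kv\<^esub> (n :: nat) = rcl (x ^ n) & x ^ n:carrier vV"
proof -
 interpret h: ring_hom_cring vV "kv" rcl by (rule rcl_hom)
 assume x: "x:carrier vV"
 show ?thesis
 proof (induction n)
  case 0
  thus ?case using h.hom_one by (simp add: vone)
 next
  case (Suc n)
  have "rcl x [^]\<^bsub>kv\<^esub> Suc n = rcl (x ^ n) \<otimes>\<^bsub>kv\<^esub> rcl x" using Suc by simp
  also have "\<dots> = rcl (x ^ n * x)" using Suc x h.hom_mult[of "x ^ n" x] by simp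
  finally show ?case using V_closed(2)[OF _ x, of "x ^ n"] Suc by (simp add: mult.commute)
 qed
qed

lemma arc_field_of_valuation:
 assumes hens: "henselian v" and rc: "real_closed kv" and surj: "value_group v = UNIV"
 shows "arc_field (%x. if x = 0 then 0 else v x)" (is "arc_field ?w")
proof
 interpret h: ring_hom_cring vV "kv" rcl by (rule rcl_hom)
 have wV: "0 <= ?w x <-> x:carrier vV" for x by auto
 have wI: "negl ?w x 1 <-> x:vI" for x by (auto simp: negl_def valuation_ideal_def vone)
 have one: "1:carrier vV" by (simp add: vone)
 have rclminus: "\<ominus>\<^bsub>kv\<^esub> rcl x = rcl (- x)" if "x:carrier vV" for x
  using h.hom_a_inv[OF that] V_minus[OF that] by simp
 show "?w 0 = 0" by simp
 fix x y :: 'k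
 show "x ~= 0 ==> y ~= 0 ==> ?w (x * y) = ?w x + ?w y" using vmul by simp
 show "x ~= 0 ==> y ~= 0 ==> x + y ~= 0 ==> min (?w x) (?w y) <= ?w (x + y)" using vadd by simp
 fix g
 have "g:v ` (UNIV - {0})" using surj by (simp add: value_group_def)
 then obtain x where "x ~= 0" "v x = g" by blast
 thus "EX x. x ~= 0 & ?w x = g" by (intro exI[of _ x]) simp
next
 interpret h: ring_hom_cring vV "kv" rcl by (rule rcl_hom)
 have wV: "0 <= ?w x <-> x:carrier vV" for x by auto
 have wI: "negl ?w x 1 <-> x:vI" for x by (auto simp: negl_def valuation_ideal_def vone)
 fix f :: "'k poly" and a
 assume "!!i. 0 <= ?w (coeff f i)" "0 <= ?w a" "negl ?w (poly f a) 1" "poly (pderiv f) a ~= 0" "?w (poly (pderiv f) a) = 0"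
 hence "EX b:carrier vV. poly f b = 0 & b - a:vI"
  using hens unfolding henselian_def wV wI by simp
 thus "EX b. poly f b = 0 & negl ?w (b - a) 1" unfolding wI by blast
next
 interpret h: ring_hom_cring vV "kv" rcl by (rule rcl_hom)
 have one: "1:carrier vV" by (simp add: vone)
 fix n :: nat assume n: "n > 0"
 \<comment> \<open>A sum of \<open>n - 1\<close> squares of 1 is not \<open>-1\<close> in a formally
   real field, so \<open>n\<close> is not zero there.\<close>
 define m where "m = n - 1"
 have s: "(\<Oplus>\<^bsub>kv\<^esub>i\<in>{..<m}. rcl 1) = rcl (of_nat m)" "of_nat m:carrier vV"
  using rcl_sum[of m "%_. 1"] one by simp_all
 have "(\<Oplus>\<^bsub>kv\<^esub>i\<in>{..<m}. rcl 1 \<otimes>\<^bsub>kv\<^esub> rcl 1) ~= \<ominus>\<^bsub>kv\<^esub> \<one>\<^bsub>kv\<^esub>"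
  using rc h.hom_closed[OF one] unfolding real_closed_def
  by (elim conjE allE[of _ m] allE[of _ "%_. rcl 1"]) auto
 moreover have "rcl 1 \<otimes>\<^bsub>kv\<^esub> rcl 1 = rcl 1" using h.hom_mult[OF one one] by simp
 moreover have "\<ominus>\<^bsub>kv\<^esub> \<one>\<^bsub>kv\<^esub> = rcl (- 1)"
  using h.hom_a_inv[OF one] V_minus[OF one] h.hom_one by simp
 ultimately have "rcl (of_nat m) ~= rcl (- 1)" using s(1) by simp
 hence "of_nat m - (- 1) ~: vI" using rcl_eq[OF s(2), of "- 1"] by (simp add: vneg1)
 hence "of_nat n ~: vI" using n by (simp add: m_def of_nat_diff)
 moreover have "of_nat n:carrier vV" using rcl_sum[of n "%_. 1"] one by simp
 ultimately show "?w (of_nat n) = 0" using n by (auto simp: valuation_ideal_def)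
next
 interpret h: ring_hom_cring vV "kv" rcl by (rule rcl_hom)
 have wV: "0 <= ?w x <-> x:carrier vV" for x by auto
 have wI: "negl ?w x 1 <-> x:vI" for x by (auto simp: negl_def valuation_ideal_def vone)
 fix a assume "0 <= ?w a"
 hence a: "a:carrier vV" by (simp only: wV)
 have "ALL a:carrier kv. EX b:carrier kv.
   a = b \<otimes>\<^bsub>kv\<^esub> b | \<ominus>\<^bsub>kv\<^esub> a = b \<otimes>\<^bsub>kv\<^esub> b"
  using rc unfolding real_closed_def by (elim conjE)
 from bspec[OF this h.hom_closed[OF a]] obtain Y where "Y:carrier kv"
   "rcl a = Y \<otimes>\<^bsub>kv\<^esub> Y | \<ominus>\<^bsub>kv\<^esub> rcl a = Y \<otimes>\<^bsub>kv\<^esub> Y" by (elim bexE)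
 then obtain b where b: "b:carrier vV" "rcl a = rcl b \<otimes>\<^bsub>kv\<^esub> rcl b | \<ominus>\<^bsub>kv\<^esub> rcl a = rcl b \<otimes>\<^bsub>kv\<^esub> rcl b"
  using rcl_surj by metis
 have bb: "rcl b \<otimes>\<^bsub>kv\<^esub> rcl b = rcl (b * b)" "b * b:carrier vV"
  using h.hom_mult[OF b(1) b(1)] V_closed(2)[OF b(1) b(1)] by simp_all
 have "\<ominus>\<^bsub>kv\<^esub> rcl a = rcl (- a)" using h.hom_a_inv[OF a] V_minus[OF a] by simp
 hence "a - b * b:vI | - a - b * b:vI"
  using b(2) rcl_eq[OF a bb(2)] rcl_eq[OF V_closed(3)[OF a a] bb(2)] unfolding bb(1) by auto
 hence "a - b * b:vI | a + b * b:vI"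
  using vminus[of "a + b * b"] by (auto simp: valuation_ideal_def eq_neg_iff_add_eq_0 algebra_simps)
 thus "EX b. negl ?w (a - b * b) 1 | negl ?w (a + b * b) 1" unfolding wI by blast
next
 interpret h: ring_hom_cring vV "kv" rcl by (rule rcl_hom)
 have wV: "0 <= ?w x <-> x:carrier vV" for x by auto
 have wI: "negl ?w x 1 <-> x:vI" for x by (auto simp: negl_def valuation_ideal_def vone)
 fix f :: "'k poly"
 assume f: "odd (degree f)" "!!i. 0 <= ?w (coeff f i)" "?w (lead_coeff f) = 0"
 have c: "coeff f i:carrier vV" for i using f(2) by (simp only: wV)
 have "lead_coeff f ~= 0" using f(1) by auto
 hence "lead_coeff f - 0 ~: vI" using f(3) by (simp add: valuation_ideal_def)
 hence "rcl (lead_coeff f) ~= rcl 0" using rcl_eq[OF c, of 0 "degree f"] by simp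
 hence l: "rcl (lead_coeff f) ~= \<zero>\<^bsub>kv\<^esub>" using h.hom_zero by simp
 have "EX x:carrier kv. (\<Oplus>\<^bsub>kv\<^esub>i\<in>{..degree f}. rcl (coeff f i) \<otimes>\<^bsub>kv\<^esub> x [^]\<^bsub>kv\<^esub> i)
   = \<zero>\<^bsub>kv\<^esub>"
  using rc f(1) l h.hom_closed[OF c] unfolding real_closed_def
  by (elim conjE allE[of _ "degree f"] allE[of _ "%i. rcl (coeff f i)"]) auto
 then obtain x where x: "x:carrier vV" and
  eq: "(\<Oplus>\<^bsub>kv\<^esub>i\<in>{..degree f}. rcl (coeff f i) \<otimes>\<^bsub>kv\<^esub> rcl x [^]\<^bsub>kv\<^esub> i) = \<zero>\<^bsub>kv\<^esub>"
  using rcl_surj by metis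
 have t: "rcl (coeff f i) \<otimes>\<^bsub>kv\<^esub> rcl x [^]\<^bsub>kv\<^esub> i = rcl (coeff f i * x ^ i)" "coeff f i * x ^ i:carrier vV" for i
  using rcl_pow[OF x, of i] h.hom_mult[OF c, of "x ^ i" i] V_closed(2)[OF c, of "x ^ i" i] by simp_all
 have "rcl (poly f x) = \<zero>\<^bsub>kv\<^esub>" "poly f x:carrier vV"
  using eq rcl_sum[of "Suc (degree f)" "%i. coeff f i * x ^ i", OF t(2)] unfolding t(1) lessThan_Suc_atMost poly_altdef by simp_all
 hence "poly f x - 0:vI" using rcl_eq[of "poly f x" 0] h.hom_zero by simp
 hence "0 <= ?w x & negl ?w (poly f x) 1" unfolding wV wI using x by simp
 thus "EX x. 0 <= ?w x & negl ?w (poly f x) 1" by blast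
qed

end

lemma almost_real_closed_arc_field:
 assumes "almost_real_closed TYPE('k::linordered_field) TYPE('g::linordered_ab_group_add)"
 shows "EX v :: 'k => 'g. arc_field v"
 using assms arc_field_of_valuation unfolding almost_real_closed_def henselian_def by blast

section \<open>Indiscernible arrays\<close>

text \<open>Iterated "for almost all" quantifiers, the first variable outermost. They commute with
  all connectives and so assign every property a definite truth value, which takes over the role of
  Ramsey's theorem.\<close>

primrec uq :: "'x list => (('x => nat) => bool) => ('x => nat) => bool" where
 "uq [] P s = P s"
| "uq (x # xs) P s = eventually (%m. uq xs P (s(x := m))) \<U>"

lemma uq_not: "uq xs (%s. ~ P s) s <-> ~ uq xs P s"
 by (induction xs arbitrary: s) simp_all

lemma uq_conj: "uq xs (%s. P s & Q s) s <-> uq xs P s & uq xs Q s"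
 by (induction xs arbitrary: s) (simp_all add: ultra_conj)

lemma uq_const [simp]: "uq xs (%_. b) s <-> b"
 by (induction xs arbitrary: s) (cases b; simp)+

lemma uq_iff: "uq xs (%s. P s <-> b) s <-> (uq xs P s <-> b)"
 by (cases b) (simp_all add: uq_not)

lemma uq_ball: "finite I ==> uq xs (%s. ALL i:I. P i s) s <-> (ALL i:I. uq xs (P i) s)"
 by (induction I rule: finite_induct) (simp_all add: uq_conj)

lemma uq_ex: "uq xs P s ==> EX s'. P s'"
 by (induction xs arbitrary: s) (auto dest: ultra_ex)

lemma uq_cong:
 assumes "!!s s'. (!!x. x:S ==> s x = s' x) ==> P s = P s'" "!!x. x:S - set xs ==> s x = s' x"
 shows "uq xs P s = uq xs P s'"
 using assms(2)
proof (induction xs arbitrary: s s')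
 case Nil
 thus ?case by (simp add: assms(1)[of s s'])
next
 case (Cons x xs)
 have "uq xs P (s(x := m)) = uq xs P (s'(x := m))" for m by (rule Cons.IH) (use Cons.prems in auto)
 thus ?case by simp
qed

lemma uq_filter:
 assumes dep: "!!s s'. (!!x. x:S ==> s x = s' x) ==> P s = P s'"
 shows "uq xs P s = uq (filter (%x. x:S) xs) P s"
proof (induction xs arbitrary: s)
 case (Cons x xs)
 show ?case
 proof (cases "x:S")
  case False
  have "uq (filter (%x. x:S) xs) P (s(x := m)) = uq (filter (%x. x:S) xs) P s" for m
   by (rule uq_cong[OF dep]) (use False in auto)
  thus ?thesis using False Cons.IH by (simp del: fun_upd_apply)
 qed (simp add: Cons.IH del: fun_upd_apply)
qed simp

lemma uq_rename: "inj f ==> uq (map f xs) (%s. P (s \<circ> f)) s = uq xs P (s \<circ> f)"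
proof (induction xs arbitrary: s)
 case (Cons x xs)
 have e: "(s(f x := m)) \<circ> f = (s \<circ> f)(x := m)" for m using Cons.prems by (auto simp: inj_eq)
 show ?case unfolding list.map uq.simps Cons.IH[OF Cons.prems] e ..
qed simp

text \<open>The truth value of a property of finitely many columns, the columns going to infinity in lexicographic order.\<close>

definition lim_truth :: "(nat \<times> int) set => ((nat \<times> int => nat) => bool) => bool" where
 "lim_truth S P = uq (sorted_list_of_set S) P (%_. 0)"

lemma sorted_list_of_set_filter: "finite T ==> S \<subseteq> T ==> filter (%x. x:S) (sorted_list_of_set T) = sorted_list_of_set S"
 by (frule (1) finite_subset[rotated], rule sorted_distinct_set_unique) (auto simp: sorted_wrt_filter)

lemma uq_lim_truth:
 assumes "!!s s'. (!!x. x:S ==> s x = s' x) ==> P s = P s'" "finite T" "S \<subseteq> T"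
 shows "uq (sorted_list_of_set T) P (%_. 0) = lim_truth S P"
 unfolding lim_truth_def by (subst uq_filter[of S, OF assms(1)]) (simp_all add: sorted_list_of_set_filter assms)

lemma lim_truth_rename:
 assumes f: "strict_mono f" and S: "finite S" and dep: "!!s s'. (!!x. x:S ==> s x = s' x) ==> P s = P s'"
 shows "lim_truth (f ` S) (%s. P (s \<circ> f)) = lim_truth S P"
proof -
 have "sorted_list_of_set (f ` S) = map f (sorted_list_of_set S)"
  by (rule sorted_distinct_set_unique)
   (use S f in \<open>auto simp: sorted_map distinct_map strict_mono_less_eq strict_mono_eq intro!: inj_onI\<close>)
 moreover have "inj f" using f by (rule strict_mono_imp_inj_on)
 ultimately show ?thesis unfolding lim_truth_def using uq_rename[of f "sorted_list_of_set S" P "%_. 0"] by (simp add: comp_def)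
qed

lemma lim_truth_distinct: "x < y ==> lim_truth {x, y} (%s. s x ~= s y)"
proof -
 assume "x < y"
 hence l: "sorted_list_of_set {x, y} = [x, y]" by (intro sorted_distinct_set_unique) auto
 have "eventually (%n. m ~= n) \<U>" for m using ultra_ge[of "Suc m"] by (rule eventually_mono) auto
 thus ?thesis using \<open>x < y\<close> by (simp add: lim_truth_def l)
qed

text \<open>Columns are integers, leaving room on both sides of columns 0 and 1. Stage
  \<open>m\<close> picks columns of \<open>M\<close> on which the first \<open>m\<close> formulas
  have their limiting truth values, together with an element splitting columns 0 and 1 in the first
  \<open>m\<close> rows; the ultrapower along \<open>m\<close> meets all requirements at
  once.\<close>

lemma indiscernible_array:
 fixes L :: "('f::countable, 'r::countable) language" and B :: "nat => nat => nat => 'a"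
 assumes M: "is_structure L M" and up: "is_ultrapower L M N q"
  and B: "!!i j. skolem_seq L M (B i j)" and wf: "!!i. wf_fm L (\<chi> i)"
  and con: "!!\<eta>. consistent_in M (pattern \<chi> B \<eta>)"
 shows "EX (A :: nat => int => nat => 'b) c. (ALL i j. skolem_seq L N (A i j)) & c:univ N &
  (ALL i. sat N ((A i 0)(0 := c)) (\<chi> i) & ~ sat N ((A i 1)(0 := c)) (\<chi> i)) &
  (ALL s. (ALL i. strict_mono (s i)) --> tpeq L N N {(A i (s i j) n, A i j n) | i j n. True})"
proof -
 have Bu: "B i j n:univ M" for i j n using B[of i j] unfolding skolem_seq_def by blast
 define dec where "dec k = (case prod_decode k of (i, k') => case prod_decode k' of (j, n) => ((i, int_decode j), n))" for k
 define enc where "enc = (%((i, j), n). prod_encode (i, prod_encode (int_encode j, n)))"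
 have dec_enc [simp]: "dec (enc t) = t" for t by (auto simp: dec_def enc_def split: prod.splits)
 define val where "val s t = B (fst (fst t)) (s (fst t)) (snd t)" for s :: "nat \<times> int => nat" and t
 define P where "P p = (%s. sat M (%k. val s (dec k)) p)" for p
 define sup where "sup p = (%k. fst (dec k)) ` fv_fm p" for p :: "('f, 'r) fm"
 have dep: "P p s = P p s'" if "!!x. x:sup p ==> s x = s' x" for p s s'
  unfolding P_def by (rule sat_cong) (use that in \<open>simp add: sup_def val_def\<close>)
 have fs: "finite (sup p)" for p by (simp add: sup_def)
 have step: "EX s c. c:univ M & (ALL p. to_nat p < m --> P p s = lim_truth (sup p) (P p)) &
   (ALL i<m. sat M ((B i (s (i, 0)))(0 := c)) (\<chi> i) & ~ sat M ((B i (s (i, 1)))(0 := c)) (\<chi> i))" for m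
 proof -
  define F where "F = {p :: ('f, 'r) fm. to_nat p < m}"
  have "finite (to_nat ` F)" by (rule finite_subset[of _ "{..<m}"]) (auto simp: F_def)
  hence F: "finite F" by (rule finite_imageD) (simp add: inj_on_def)
  define T where "T = (\<Union>p\<in>F. sup p) \<union> (\<Union>i<m. {(i, 0), (i, 1)})"
  have T: "finite T" by (simp add: T_def F fs)
  have "uq (sorted_list_of_set T) (%s. (ALL p:F. P p s = lim_truth (sup p) (P p)) & (ALL i:{..<m}. s (i, 0) ~= s (i, 1))) (%_. 0)"
   unfolding uq_conj uq_ball[OF F] uq_ball[OF finite_lessThan] uq_iff
  proof (intro conjI ballI)
   fix p assume "p:F"
   thus "uq (sorted_list_of_set T) (P p) (%_. 0) = lim_truth (sup p) (P p)"
    by (intro uq_lim_truth[OF dep T]) (auto simp: T_def)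
  next
   fix i assume "i:{..<m}"
   hence "uq (sorted_list_of_set T) (%s. s (i, 0) ~= s (i, 1)) (%_. 0) = lim_truth {(i, 0), (i, 1)} (%s. s (i, 0) ~= s (i, 1))"
    by (intro uq_lim_truth[OF _ T]) (auto simp: T_def)
   thus "uq (sorted_list_of_set T) (%s. s (i, 0) ~= s (i, 1)) (%_. 0)"
    using lim_truth_distinct[of "(i, 0)" "(i, 1)"] by simp
  qed
  from uq_ex[OF this] obtain s where s: "!!p. p:F ==> P p s = lim_truth (sup p) (P p)" "!!i. i < m ==> s (i, 0) ~= s (i, 1)"
   by auto
  define \<Delta> where "\<Delta> = (%i. (\<chi> i, B i (s (i, 0)))) ` {..<m} \<union> (%i. (Neg (\<chi> i), B i (s (i, 1)))) ` {..<m}"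
  have "\<Delta> \<subseteq> {(\<chi> i, B i (s (i, 0))) | i. True} \<union> {(Neg (\<chi> i), B i j) | i j. j ~= s (i, 0)}" "finite \<Delta>"
   using s(2) by (auto simp: \<Delta>_def) metis
  then obtain c where c: "c:univ M" "realizes M c \<Delta>"
   using con[of "%i. s (i, 0)"] unfolding consistent_in_def by blast
  have "sat M ((B i (s (i, 0)))(0 := c)) (\<chi> i) & sat M ((B i (s (i, 1)))(0 := c)) (Neg (\<chi> i))" if "i < m" for i
  proof -
   have "(\<chi> i, B i (s (i, 0))):\<Delta>" "(Neg (\<chi> i), B i (s (i, 1))):\<Delta>" using that unfolding \<Delta>_def by blast+
   thus ?thesis using c(2) unfolding realizes_def by fast
  qed
  thus ?thesis using s(1) c(1) by (intro exI[of _ s] exI[of _ c]) (auto simp: F_def)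
 qed
 then obtain s c where c: "!!m. c m:univ M" and lim: "!!m p. to_nat p < m ==> P p (s m) = lim_truth (sup p) (P p)"
  and sc: "!!m i. i < m ==> sat M ((B i (s m (i, 0)))(0 := c m)) (\<chi> i) & ~ sat M ((B i (s m (i, 1)))(0 := c m)) (\<chi> i)"
  by metis
 define A where "A i j n = q (%m. B i (s m (i, j)) n)" for i j n
 have los: "sat N (%k. q (e k)) p = eventually (%m. sat M (%k. e k m) p) \<U>"
  if "wf_fm L p" "!!k. range (e k) \<subseteq> univ M" for p e
  using Los[OF M up that] .
 have rB: "range (%m. B i (s m (i, j)) n) \<subseteq> univ M" for i j n using Bu by blast
 have AQ: "sat N (%k. A (fst (fst (dec k))) (snd (fst (dec k))) (snd (dec k))) p = lim_truth (sup p) (P p)" if "wf_fm L p" for p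
 proof -
  have "(%k. A (fst (fst (dec k))) (snd (fst (dec k))) (snd (dec k))) = (%k. q (%m. val (s m) (dec k)))"
   by (simp add: A_def val_def)
  hence "sat N (%k. A (fst (fst (dec k))) (snd (fst (dec k))) (snd (dec k))) p = eventually (%m. P p (s m)) \<U>"
   using los[OF that, of "%k m. val (s m) (dec k)"] Bu by (auto simp: P_def val_def)
  also have "\<dots> = eventually (%m. lim_truth (sup p) (P p)) \<U>"
   by (rule ultra_iff, rule eventually_mono[OF ultra_ge[of "Suc (to_nat p)"]]) (simp add: lim)
  finally show ?thesis by simp
 qed
 have "skolem_seq L N (A i j)" for i j
  unfolding skolem_seq_def
 proof (intro conjI allI impI)
  show "range (A i j) \<subseteq> univ N" using up_univ[OF M up rB] by (auto simp: A_def)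
  fix p assume p: "wf_fm L p" "sat N (%n. A i j (n - 1)) (Exi 0 p)"
  have "eventually (%m. sat M (%n. B i (s m (i, j)) (n - 1)) (Exi 0 p)) \<U>"
   using p(2) los[of "Exi 0 p" "%n m. B i (s m (i, j)) (n - 1)"] p(1) rB unfolding A_def by simp
  hence "eventually (%m. sat M ((%n. B i (s m (i, j)) (n - 1))(0 := B i (s m (i, j)) (wit p))) p) \<U>"
   by (rule eventually_mono) (use B p(1) in \<open>auto simp only: skolem_seq_def\<close>)
  moreover have "(%n. B i (s m (i, j)) (n - 1))(0 := B i (s m (i, j)) (wit p)) =
    (%n. B i (s m (i, j)) (if n = 0 then wit p else n - 1))" for m by auto
  ultimately have "sat N (%n. A i j (if n = 0 then wit p else n - 1)) p"
   using los[OF p(1), of "%n m. B i (s m (i, j)) (if n = 0 then wit p else n - 1)"] rB unfolding A_def by simp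
  moreover have "(%n. A i j (if n = 0 then wit p else n - 1)) = (%n. A i j (n - 1))(0 := A i j (wit p))" by auto
  ultimately show "sat N ((%n. A i j (n - 1))(0 := A i j (wit p))) p" by simp
 qed
 moreover have "q c:univ N" using up_univ[OF M up] c by blast
 moreover have "sat N ((A i 0)(0 := q c)) (\<chi> i) & ~ sat N ((A i 1)(0 := q c)) (\<chi> i)" for i
 proof -
  have e: "(A i j)(0 := q c) = (%k. q (%m. ((B i (s m (i, j)))(0 := c m)) k))" for j by (auto simp: A_def)
  have S: "sat N ((A i j)(0 := q c)) (\<chi> i) = eventually (%m. sat M ((B i (s m (i, j)))(0 := c m)) (\<chi> i)) \<U>" for j
   unfolding e by (rule los[OF wf]) (use Bu c in auto)
  have "eventually (%m. sat M ((B i (s m (i, 0)))(0 := c m)) (\<chi> i) & ~ sat M ((B i (s m (i, 1)))(0 := c m)) (\<chi> i)) \<U>"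
   by (rule eventually_mono[OF ultra_ge[of "Suc i"]]) (use sc in simp)
  thus ?thesis unfolding S ultra_conj ultra_not .
 qed
 moreover have "tpeq L N N {(A i (t i j) n, A i j n) | i j n. True}" if t: "!!i. strict_mono (t i)" for t
 proof (rule tpeqI)
  fix p e e'
  assume p: "wf_fm L p" and e: "!!n. n:fv_fm p ==> (e n, e' n):{(A i (t i j) n, A i j n) | i j n. True}"
   and sat: "sat N e p"
  \<comment> \<open>Reindexing every row by its own monotone map is monotone for the lexicographic
    order, under which limiting truth values are invariant. This is mutual indiscernibility.\<close>
  define f where "f = (%(i, j). (i, t i j))"
  have f: "strict_mono f"
   using t by (auto simp: strict_mono_def f_def less_prod_def order_le_less)
  have "EX x k. e n = A (fst x) (t (fst x) (snd x)) k & e' n = A (fst x) (snd x) k" if "n:fv_fm p" for n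
   using e[OF that] by force
  then obtain x k where xk: "!!n. n:fv_fm p ==> e n = A (fst (x n)) (t (fst (x n)) (snd (x n))) (k n) & e' n = A (fst (x n)) (snd (x n)) (k n)"
   by metis
  define p1 where "p1 = subst_fm p (%n. Var (enc (x n, k n)))"
  define p2 where "p2 = subst_fm p (%n. Var (enc (f (x n), k n)))"
  have wf12: "wf_fm L p1" "wf_fm L p2" unfolding p1_def p2_def by (rule wf_subst[OF p]; simp)+
  let ?A = "%k. A (fst (fst (dec k))) (snd (fst (dec k))) (snd (dec k))"
  have "sat N e' p = sat N ?A p1" "sat N e p = sat N ?A p2"
   unfolding p1_def p2_def sat_subst
   by (rule sat_cong; use xk in \<open>simp add: f_def case_prod_beta\<close>)+
  hence L: "sat N e' p = lim_truth (sup p1) (P p1)" "sat N e p = lim_truth (sup p2) (P p2)" using AQ wf12 by auto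
  define S where "S = x ` fv_fm p"
  have S: "finite S" by (simp add: S_def)
  have sub: "sup p1 \<subseteq> S" "sup p2 \<subseteq> f ` S"
   using fv_subst[of p "%n. Var (enc (x n, k n))"] fv_subst[of p "%n. Var (enc (f (x n), k n))"]
   by (force simp: sup_def p1_def p2_def S_def)+
  have "P p2 = (%s. P p1 (s \<circ> f))"
   by (rule ext) (simp add: P_def p1_def p2_def val_def f_def case_prod_beta)
  moreover have "lim_truth (sup p1) (P p1) = lim_truth S (P p1)"
   using uq_lim_truth[OF dep S sub(1)] by (simp add: lim_truth_def)
  moreover have "lim_truth (sup p2) (P p2) = lim_truth (f ` S) (P p2)"
   using uq_lim_truth[OF dep _ sub(2)] S by (simp add: lim_truth_def)
  moreover have "lim_truth (f ` S) (%s. P p1 (s \<circ> f)) = lim_truth S (P p1)"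
   by (rule lim_truth_rename[OF f S], rule dep) (use sub(1) in blast)
  ultimately show "sat N e' p" using L sat by simp
 qed
 ultimately show ?thesis by - (intro exI[of _ A] exI[of _ "q c"] conjI allI impI, simp_all)
qed

section \<open>From alternation on one element to a violation\<close>

lemma consistent_map:
 assumes con: "consistent_in N (pattern \<phi> b \<eta>)"
  and tr: "!!a. a:univ N ==> EX a':univ M. ALL i j. sat M ((b' i j)(0 := a')) (\<psi> i) <-> sat N ((b i j)(0 := a)) (\<phi> i)"
 shows "consistent_in M (pattern \<psi> b' \<eta>)"
 unfolding consistent_in_def
proof (intro allI impI)
 fix \<Delta> assume D: "\<Delta> \<subseteq> pattern \<psi> b' \<eta>" "finite \<Delta>"
 define g where "g = (%(i, j). (if j = \<eta> i then \<psi> i else Neg (\<psi> i), b' i j))"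
 define h where "h = (%(i, j). (if j = \<eta> i then \<phi> i else Neg (\<phi> i), b i j))"
 have "\<Delta> \<subseteq> g ` UNIV"
 proof
  fix d assume "d:\<Delta>"
  hence "EX i j. d = (if j = \<eta> i then \<psi> i else Neg (\<psi> i), b' i j)" using D(1) by fastforce
  then obtain i j where "d = g (i, j)" by (auto simp: g_def)
  thus "d:g ` UNIV" by blast
 qed
 then obtain Q where Q: "finite Q" "\<Delta> = g ` Q" using D(2) by (meson finite_subset_image)
 have "h ` Q \<subseteq> pattern \<phi> b \<eta>"
 proof
  fix d assume "d:h ` Q"
  then obtain i j where d: "d = (if j = \<eta> i then \<phi> i else Neg (\<phi> i), b i j)" by (auto simp: h_def)
  show "d:pattern \<phi> b \<eta>"
   unfolding d by (cases "j = \<eta> i"; simp; blast)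
 qed
 then obtain a where a: "a:univ N" "realizes N a (h ` Q)"
  using con Q(1) unfolding consistent_in_def by (meson finite_imageI)
 obtain a' where a': "a':univ M" "!!i j. sat M ((b' i j)(0 := a')) (\<psi> i) <-> sat N ((b i j)(0 := a)) (\<phi> i)"
  using tr[OF a(1)] by blast
 have "sat M ((snd (g q))(0 := a')) (fst (g q))" if "q:Q" for q
 proof -
  obtain i j where q: "q = (i, j)" by (cases q)
  have "sat N ((snd (h q))(0 := a)) (fst (h q))" using a(2) that by (auto simp: realizes_def case_prod_beta)
  thus ?thesis using a'(2)[of i j] by (auto simp: q g_def h_def simp del: fun_upd_apply split: if_splits)
 qed
 thus "EX a:univ M. realizes M a \<Delta>"
  unfolding Q(2) realizes_def using a'(1) by (intro bexI[of _ a']) (auto simp: case_prod_beta)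
qed

text \<open>Columns 0 and 1 stay; to the right and to the left \<open>t\<close> is thinned out until
  it is constant. In the pairs \<open>2 k\<close>, \<open>2 k + 1\<close> only pair 0 then
  alternates.\<close>

lemma alternation_columns:
 fixes t :: "int => bool"
 assumes "t 0 ~= t 1"
 shows "EX \<sigma> :: int => int. strict_mono \<sigma> & (ALL k. t (\<sigma> (2 * k)) ~= t (\<sigma> (2 * k + 1)) <-> k = 0)"
proof -
 have hom: "EX r :: nat => nat. strict_mono r & (EX b. ALL n. u (r n) = b)" for u :: "nat => bool"
 proof -
  have "infinite {n. u n} | infinite {n. ~ u n}"
   using infinite_UNIV_nat finite_UnI[of "{n. u n}" "{n. ~ u n}"] by (auto simp: Collect_disj_eq[symmetric])
  thus ?thesis using infinite_enumerate[of "{n. u n}"] infinite_enumerate[of "{n. ~ u n}"] by blast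
 qed
 obtain r :: "nat => nat" and b where r: "strict_mono r" "ALL n. t (int (r n) + 2) = b"
  using hom[of "%n. t (int n + 2)"] by blast
 obtain l :: "nat => nat" and b' where l: "strict_mono l" "ALL n. t (- int (l n) - 1) = b'"
  using hom[of "%n. t (- int n - 1)"] by blast
 define \<sigma> where "\<sigma> j = (if j >= 2 then int (r (nat (j - 2))) + 2 else if j >= 0 then j else - int (l (nat (- j - 1))) - 1)" for j
 have "\<sigma> j < \<sigma> (j + 1)" for j
 proof -
  consider "j >= 2" | "j = 1" | "j = 0" | "j = - 1" | "j < - 1" by linarith
  thus ?thesis
  proof cases
   case 1
   hence "nat (j - 2) < nat (j + 1 - 2)" by simp
   thus ?thesis using 1 r(1) unfolding \<sigma>_def strict_mono_def by auto
  next
   case 5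
   hence "nat (- (j + 1) - 1) < nat (- j - 1)" by simp
   thus ?thesis using 5 l(1) unfolding \<sigma>_def strict_mono_def by auto
  qed (auto simp: \<sigma>_def)
 qed
 hence step: "\<sigma> j < \<sigma> (j + 1 + int n)" for j n
 proof (induction n)
  case (Suc n)
  thus ?case using \<open>!!j. \<sigma> j < \<sigma> (j + 1)\<close>[of "j + 1 + int n"] by (force simp: algebra_simps)
 qed simp
 have "\<sigma> i < \<sigma> j" if "i < j" for i j using step[of i "nat (j - i - 1)"] that by simp
 hence "strict_mono \<sigma>" by (rule strict_monoI)
 moreover have "t (\<sigma> (2 * k)) ~= t (\<sigma> (2 * k + 1)) <-> k = 0" for k
 proof -
  consider "k >= 1" | "k = 0" | "k < 0" by linarith
  thus ?thesis using assms r(2) l(2) by cases (auto simp: \<sigma>_def)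
 qed
 ultimately show ?thesis by blast
qed

text \<open>\<open>\<Theta> i\<close> says that \<open>\<Psi> i\<close> changes its truth value
  between two columns, and its parameters are pairs of columns. After thinning, only pair 0 of each
  row satisfies it, and indiscernibility allows that pair to be moved to position
  \<open>\<eta> i\<close>.\<close>

lemma alternation_violation:
 fixes H :: "nat => int => nat => 'a" and N :: "('f, 'r, 'a) struc"
 assumes H: "!!i j n. H i j n:univ N" and g: "g:univ N"
  and ind: "!!s. (!!i. strict_mono (s i)) ==> tpeq L N N {(H i (s i j) n, H i j n) | i j n. True}"
  and wf: "!!i. wf_fm L (\<Psi> i)"
  and alt: "!!i. sat N ((H i 0)(0 := g)) (\<Psi> i) ~= sat N ((H i 1)(0 := g)) (\<Psi> i)"
 shows "EX \<phi> b. strong_NIP_violation L N \<phi> b"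
proof -
 define t where "t i j = sat N ((H i j)(0 := g)) (\<Psi> i)" for i j
 have "EX \<sigma> :: int => int. strict_mono \<sigma> & (ALL k. t i (\<sigma> (2 * k)) ~= t i (\<sigma> (2 * k + 1)) <-> k = 0)" for i
  by (rule alternation_columns) (use alt in \<open>simp add: t_def\<close>)
 then obtain \<sigma> :: "nat => int => int" where \<sigma>: "!!i. strict_mono (\<sigma> i)"
  "!!i k. t i (\<sigma> i (2 * k)) ~= t i (\<sigma> i (2 * k + 1)) <-> k = 0" by metis
 define p1 where "p1 i = subst_fm (\<Psi> i) (%n. Var (if n = 0 then 0 else 2 * n))" for i
 define p2 where "p2 i = subst_fm (\<Psi> i) (%n. Var (if n = 0 then 0 else 2 * n + 1))" for i
 define \<Theta> where "\<Theta> i = Neg (Conj (Neg (Conj (p1 i) (Neg (p2 i)))) (Neg (Conj (Neg (p1 i)) (p2 i))))" for i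
 have wf\<Theta>: "wf_fm L (\<Theta> i)" for i using wf by (auto simp: \<Theta>_def p1_def p2_def intro!: wf_subst)
 \<comment> \<open>Parameters of the two columns are interleaved: even variables read column
   \<open>2 k\<close>, odd ones column \<open>2 k + 1\<close>.\<close>
 define C where "C i j k n = (if even n then H i (j (2 * k)) (n div 2) else H i (j (2 * k + 1)) (n div 2))" for i and j :: "int => int" and k n
 define b where "b i k = C i id (int k)" for i k
 have sat\<Theta>: "sat N ((C i j k)(0 := x)) (\<Theta> i) <->
   sat N ((H i (j (2 * k)))(0 := x)) (\<Psi> i) ~= sat N ((H i (j (2 * k + 1)))(0 := x)) (\<Psi> i)" for i j k x
 proof -
  have "(%n. tm_val N ((C i j k)(0 := x)) (Var (if n = 0 then 0 else 2 * n))) = (H i (j (2 * k)))(0 := x)"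
   "(%n. tm_val N ((C i j k)(0 := x)) (Var (if n = 0 then 0 else 2 * n + 1))) = (H i (j (2 * k + 1)))(0 := x)"
   by (auto simp: C_def)
  thus ?thesis by (simp add: \<Theta>_def p1_def p2_def del: tm_val.simps) blast
 qed
 have "strong_NIP_violation L N \<Theta> b"
  unfolding strong_NIP_violation_def
 proof (intro conjI allI wf\<Theta>)
  show "range (b i j) \<subseteq> univ N" for i j using H by (auto simp: b_def C_def)
  fix \<eta> :: "nat => nat"
  \<comment> \<open>Moving back by \<open>2 * \<eta> i\<close> columns brings pair
    \<open>\<eta> i\<close> to the alternating pair 0.\<close>
  define s where "s i j = \<sigma> i (j - 2 * int (\<eta> i))" for i j
  have sm: "strict_mono (s i)" for i using \<sigma>(1)[of i] by (auto simp: s_def strict_mono_def)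
  define \<rho> where "\<rho> i k n = (C i (s i) k n, C i id k n)" for i k n
  have \<rho>R: "\<rho> i k n:{(H i (s i j) n, H i j n) | i j n. True}" for i k n
   unfolding \<rho>_def C_def by (cases "even n") (simp, blast)+
  have R: "tpeq L N N {(H i (s i j) n, H i j n) | i j n. True}" by (rule ind[OF sm])
  show "consistent_in N (pattern \<Theta> b \<eta>)"
   unfolding consistent_in_def
  proof (intro allI impI)
   fix \<Delta> assume D: "\<Delta> \<subseteq> pattern \<Theta> b \<eta>" "finite \<Delta>"
   define G where "G = (%(i, k :: nat). (if k = \<eta> i then \<Theta> i else Neg (\<Theta> i), \<rho> i (int k)))"
   define h where "h = (%(p :: ('f, 'r) fm, \<rho>' :: nat => 'a \<times> 'a). (p, snd \<circ> \<rho>'))"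
   have "\<Delta> \<subseteq> h ` (G ` UNIV)"
   proof
    fix d assume "d:\<Delta>"
    hence "EX i k. d = (if k = \<eta> i then \<Theta> i else Neg (\<Theta> i), b i k)" using D(1) by fastforce
    then obtain i k where "d = h (G (i, k))" by (auto simp: h_def G_def b_def \<rho>_def comp_def)
    thus "d:h ` (G ` UNIV)" by blast
   qed
   then obtain \<Delta>' where D': "\<Delta>' \<subseteq> G ` UNIV" "finite \<Delta>'" "\<Delta> = h ` \<Delta>'" using D(2) by (meson finite_subset_image)
   have "EX a:univ N. ALL (p, \<rho>'):\<Delta>'. sat N ((snd \<circ> \<rho>')(0 := a)) p"
   proof (rule tpeq_realizes[OF R D'(2) _ g])
    fix p \<rho>' assume "(p, \<rho>'):\<Delta>'"
    then obtain i k where p: "p = (if k = \<eta> i then \<Theta> i else Neg (\<Theta> i))" "\<rho>' = \<rho> i (int k)"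
     using D'(1) by (auto simp: G_def)
    show "wf_fm L p & \<rho>' ` (fv_fm p - {0}) \<subseteq> {(H i (s i j) n, H i j n) | i j n. True}"
     using wf\<Theta> \<rho>R unfolding p by auto
    have "fst \<circ> \<rho> i (int k) = C i (s i) (int k)" by (auto simp: \<rho>_def)
    moreover have "s i (2 * int k) = \<sigma> i (2 * (int k - int (\<eta> i)))" "s i (2 * int k + 1) = \<sigma> i (2 * (int k - int (\<eta> i)) + 1)"
     by (simp_all add: s_def algebra_simps)
    ultimately have "sat N ((fst \<circ> \<rho> i (int k))(0 := g)) (\<Theta> i) <-> k = \<eta> i"
     using sat\<Theta>[of i "s i" "int k" g] \<sigma>(2)[of i "int k - int (\<eta> i)"] unfolding t_def by simp
    thus "sat N ((fst \<circ> \<rho>')(0 := g)) p" unfolding p by auto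
   qed
   thus "EX a:univ N. realizes N a \<Delta>" unfolding D'(3) realizes_def h_def by (auto simp: case_prod_beta)
  qed
 qed
 thus ?thesis by blast
qed

section \<open>Translating formulas about groups into formulas about fields\<close>

text \<open>Formulas about ordered groups are interpreted in the multiplicative group of positive elements;
  the parameters \<open>E\<close>, \<open>Lt\<close> say when two positive elements have equal, respectively increasing images.\<close>

primrec tr_tm :: "ogroup_fun tm => oring_fun tm" where
 "tr_tm (Var n) = Var n"
| "tr_tm (Fn f ts) = Fn (case f of GPlus => RTimes | GZero => ROne) (map tr_tm ts)"

primrec tr_fm :: "(oring_fun tm => oring_fun tm => (oring_fun, 'r) fm) => (oring_fun tm => oring_fun tm => (oring_fun, 'r) fm) =>
  'r => (ogroup_fun, order_rel) fm => (oring_fun, 'r) fm" where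
 "tr_fm E Lt r (Eq s t) = E (tr_tm s) (tr_tm t)"
| "tr_fm E Lt r (Rel _ ts) = Lt (tr_tm (ts ! 0)) (tr_tm (ts ! 1))"
| "tr_fm E Lt r (Neg p) = Neg (tr_fm E Lt r p)"
| "tr_fm E Lt r (Conj p q) = Conj (tr_fm E Lt r p) (tr_fm E Lt r q)"
| "tr_fm E Lt r (Exi n p) = Exi n (Conj (Rel r [Fn RZero [], Var n]) (tr_fm E Lt r p))"

lemma wf_tr_tm: "fun_arity L = fun_arity Lring ==> wf_tm Lgrp t ==> wf_tm L (tr_tm t)"
proof (induction t)
 case (Fn f ts)
 thus ?case by (cases f) (auto simp: list_all_iff)
qed simp

lemma wf_tr_fm:
 assumes L: "fun_arity L = fun_arity Lring" "rel_arity L r = 2"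
  and "!!s t. wf_tm L s ==> wf_tm L t ==> wf_fm L (E s t)" "!!s t. wf_tm L s ==> wf_tm L t ==> wf_fm L (Lt s t)"
 shows "wf_fm Lgrp p ==> wf_fm L (tr_fm E Lt r p)"
 by (induction p) (auto simp: assms list_all_iff numeral_2_eq_2 length_Suc_conv intro!: assms(3,4) wf_tr_tm)

lemma sat_tr_fm:
 fixes M :: "(oring_fun, 'r, 'k::linordered_field) struc" and h :: "'k => 'g"
 assumes M: "univ M = UNIV" "fun_interp M = fun_interp OFld" "!!x y. rel_interp M r [x, y] <-> x < y"
  and N: "univ N = h ` {x. 0 < x}" "!!x y. 0 < x ==> 0 < y ==> fun_interp N GPlus [h x, h y] = h (x * y)"
   "fun_interp N GZero [] = h 1"
  and E: "!!e s t. 0 < tm_val M e s ==> 0 < tm_val M e t ==> sat M e (E s t) <-> h (tm_val M e s) = h (tm_val M e t)"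
  and Lt: "!!e s t. 0 < tm_val M e s ==> 0 < tm_val M e t ==>
    sat M e (Lt s t) <-> rel_interp N Less [h (tm_val M e s), h (tm_val M e t)]"
 shows "wf_fm Lgrp p ==> (!!n. 0 < e n) ==> sat M e (tr_fm E Lt r p) <-> sat N (h \<circ> e) p"
proof (induction p arbitrary: e)
 have tm: "0 < tm_val M e (tr_tm t) & tm_val N (h \<circ> e) t = h (tm_val M e (tr_tm t))"
  if "wf_tm Lgrp t" "!!n. 0 < e n" for e t
  using that(1)
 proof (induction t)
  case (Fn f ts)
  thus ?case by (cases f) (auto simp: numeral_2_eq_2 length_Suc_conv M N)
 qed (simp add: that(2))
 {
  case (Eq s t)
  thus ?case using tm[of s e] tm[of t e] E by (simp add: o_def)
 next
  case (Rel r' ts)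
  then obtain s t where "ts = [s, t]" by (auto simp: numeral_2_eq_2 length_Suc_conv)
  thus ?case using Rel tm[of s e] tm[of t e] Lt by (cases r') (simp add: o_def)
 next
  case (Exi n p)
  have c: "h \<circ> e(n := a) = (%b. h (e b))(n := h a)" for a by auto
  have "sat M (e(n := a)) (tr_fm E Lt r p) <-> sat N ((%b. h (e b))(n := h a)) p" if "0 < a" for a
   unfolding c[symmetric] by (rule Exi.IH) (use Exi.prems that in auto)
  thus ?case by (fastforce simp: M N(1) o_def fun_upd_same simp del: fun_upd_apply)
 }
qed auto

context arc_field
begin

text \<open>Only strict comparison of values is in the language; for positive elements, equality of
  values is the failure of both strict comparisons.\<close>

definition "vEq s t = Conj (Neg (Rel False [s, t])) (Neg (Rel False [t, s :: oring_fun tm]))"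
definition "vLt s t = Rel False [t, s :: oring_fun tm]"

lemma sat_tr_value:
 assumes "wf_fm Lgrp p" "!!n. 0 < e n"
 shows "sat (Val v) e (tr_fm vEq vLt True p) <-> sat OGrp (v \<circ> e) p"
proof (rule sat_tr_fm[OF _ _ _ _ _ _ _ _ assms])
 have "g:v ` {x. 0 < x}" for g
 proof -
  obtain x where "x ~= 0" "v x = g" using v_surj by blast
  thus ?thesis by (intro image_eqI[of _ _ "\<bar>x\<bar>"]) (auto simp: abs_if)
 qed
 thus "univ OGrp = v ` {x. 0 < x}" by auto
qed (auto simp: v_mult vEq_def vLt_def negl_def)

lemma wf_tr_value: "wf_fm Lgrp p ==> wf_fm Lval (tr_fm vEq vLt True p)"
 by (rule wf_tr_fm) (auto simp: vEq_def vLt_def)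

text \<open>The translation speaks about positive elements, so each pair is replaced by its absolute
  values, or by 1 when it is zero; the value is the same by the convention
  \<open>v 0 = 0\<close>.\<close>

lemma tpeq_values:
 assumes R: "tpeq Lval (Val v) (Val v) R"
 shows "tpG (vR v R)"
proof (cases "R = {}")
 case True
 show ?thesis
 proof (rule tpeqI)
  fix p and e e' :: "nat => 'g"
  assume e: "!!n. n:fv_fm p ==> (e n, e' n):vR v R" and "sat OGrp e p"
  moreover have "sat OGrp e p = sat OGrp e' p"
   by (rule sat_cong) (use e True in \<open>auto simp: vR_def\<close>)
  ultimately show "sat OGrp e' p" by simp
 qed
next
 case False
 then obtain r0 where r0: "r0:R" by blast
 define T where "T = {(tm_val (Val v) (fst \<circ> \<rho>) t, tm_val (Val v) (snd \<circ> \<rho>) t) | \<rho> t. wf_tm Lval t & range \<rho> \<subseteq> R}"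
 have T: "tpeq Lval (Val v) (Val v) T" unfolding T_def by (rule tpeq_terms[OF R])
 have tT: "(tm_val (Val v) (%_. x) t, tm_val (Val v) (%_. x') t):T"
  if "wf_tm Lval t" "(x, x'):R" for x x' t
  unfolding T_def using that by (intro CollectI exI[of _ "%_. (x, x')"] exI[of _ t]) (auto simp: comp_def)
 have pos: "EX y y'. (y, y'):T & 0 < y & 0 < y' & v y = v x & v y' = v x'" if "(x, x'):R" for x x'
 proof -
  have "0 < x <-> 0 < x'" "x < 0 <-> x' < 0"
   using tpeqD[OF R, of "Rel True [Fn RZero [], Var 0]" "%_. x" "%_. x'"]
    tpeqD[OF R, of "Rel True [Var 0, Fn RZero []]" "%_. x" "%_. x'"] that by auto
  then consider "0 < x" "0 < x'" | "x < 0" "x' < 0" | "x = 0" "x' = 0" by force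
  thus ?thesis
  proof cases
   case 1
   thus ?thesis using tT[of "Var 0", OF _ that] by (intro exI[of _ x] exI[of _ x']) auto
  next
   case 2
   thus ?thesis using tT[of "Fn RMinus [Fn RZero [], Var 0]", OF _ that] by (intro exI[of _ "- x"] exI[of _ "- x'"]) auto
  next
   case 3
   thus ?thesis using tT[of "Fn ROne []", OF _ that] by (intro exI[of _ 1]) auto
  qed
 qed
 show ?thesis
 proof (rule tpeqI)
  fix p and e e' :: "nat => 'g"
  assume p: "wf_fm Lgrp p" and e: "!!n. n:fv_fm p ==> (e n, e' n):vR v R" and s: "sat OGrp e p"
  have "EX y y'. (y, y'):T & 0 < y & 0 < y' & (n:fv_fm p --> v y = e n & v y' = e' n)" for n
  proof (cases "n:fv_fm p")
   case True
   then obtain x x' where "(x, x'):R" "e n = v x" "e' n = v x'" using e[OF True] by (auto simp: vR_def)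
   thus ?thesis using pos[of x x'] by auto
  next
   case False
   thus ?thesis using pos[of "fst r0" "snd r0"] r0 by auto
  qed
  then obtain y y' where y: "!!n. (y n, y' n):T" "!!n. 0 < y n" "!!n. 0 < y' n"
    "!!n. n:fv_fm p ==> v (y n) = e n & v (y' n) = e' n" by metis
  have "sat OGrp (v \<circ> y) p" using s by (subst sat_cong[of p _ e]) (auto simp: y(4))
  hence "sat (Val v) y (tr_fm vEq vLt True p)" using sat_tr_value[OF p y(2)] by simp
  hence "sat (Val v) y' (tr_fm vEq vLt True p)" using tpeqD[OF T wf_tr_value[OF p] y(1)] by simp
  hence "sat OGrp (v \<circ> y') p" using sat_tr_value[OF p y(3)] by simp
  thus "sat OGrp e' p" by (subst sat_cong[of p _ "v \<circ> y'"]) (auto simp: y(4))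
 qed
qed

end

context arc_monster
begin

abbreviation "tpV \<equiv> tpeq Lval (Val v) (Val v)"

abbreviation "DV T \<equiv> {(v (d - a), v (d' - a')) | d d' a a'. (d, d'):T & (a, a'):T} \<union> vR v T"

lemma tpV_diff_values:
 assumes R: "tpV R"
 shows "tpG (DV R)"
proof -
 define T where "T = {(tm_val (Val v) (fst \<circ> \<rho>) t, tm_val (Val v) (snd \<circ> \<rho>) t) | \<rho> t. wf_tm Lval t & range \<rho> \<subseteq> R}"
 have "(d - a, d' - a'):T" if "(d, d'):R" "(a, a'):R" for a a' d d'
  unfolding T_def by (intro CollectI exI[of _ "%n. if n = 0 then (d, d') else (a, a')"] exI[of _ "Fn RMinus [Var 0, Var 1]"])
   (use that in auto)
 moreover have "(a, a'):T" if "(a, a'):R" for a a'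
  unfolding T_def by (intro CollectI exI[of _ "%n. (a, a')"] exI[of _ "Var 0"]) (use that in auto)
 ultimately have "DV R \<subseteq> vR v T"
  using vR_I[of _ _ T v] by (fastforce simp: vR_def[of v R])
 moreover have "tpG (vR v T)" unfolding T_def by (rule tpeq_values[OF tpeq_terms[OF R]])
 ultimately show ?thesis by (rule tpeq_mono[rotated])
qed

text \<open>Witness positions depend on the formula only, so matching positions of two sequences of
  the same type match under all definable operations, in particular those of fields.\<close>

lemma tpV_skolem_closed_good:
 assumes B: "skolem_seq Lval (Val v) B" "skolem_seq Lval (Val v) B'"
  and tp: "tpV {(B n, B' n) | n. True}"
 shows "closed_good {(B n, B' n) | n. True}"
proof -
 let ?R = "{(B n, B' n) | n. True}"
 have S: "(x, x'):?R" if w: "wf_fm Lval p" and ab: "(a, a'):?R" "(b, b'):?R" "fv_fm p \<subseteq> {0, 1, 2}"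
   and u: "!!a b x. sat (Val v) ((%n. if n = 1 then a else b)(0 := x)) p <-> x = f a b"
   and x: "x = f a b" "x' = f a' b'" for f a a' b b' p x x'
 proof -
  obtain i j where ij: "a = B i" "a' = B' i" "b = B j" "b' = B' j" using ab by blast
  have e: "(%n. C (if n = Suc 0 then i else j)) = (%n. if n = Suc 0 then C i else C j)" for C :: "nat => 'k" by auto
  have "sat (Val v) ((%n. B (if n = 1 then i else j))(0 := x)) p"
   using u[of "B i" "B j" x] x(1) by (simp add: ij e del: fun_upd_apply)
  then obtain m where m: "sat (Val v) ((%n. B (if n = 1 then i else j))(0 := B m)) p"
   using skolem_seqD[OF B(1) w, of x "%n. if n = 1 then i else j"] by auto
  hence "B m = x" using u[of "B i" "B j" "B m"] x(1) by (simp add: ij e del: fun_upd_apply)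
  moreover have "sat (Val v) ((%n. B' (if n = 1 then i else j))(0 := B' m)) p"
  proof (rule iffD1[OF tpeqD[OF tp w] m])
   show "(((%n. B (if n = 1 then i else j))(0 := B m)) n, ((%n. B' (if n = 1 then i else j))(0 := B' m)) n):?R" for n
    by (cases "n = 0") auto
  qed
  hence "B' m = x'" using u[of "B' i" "B' j" "B' m"] x(2) by (simp add: ij e del: fun_upd_apply)
  ultimately show ?thesis by blast
 qed
 have pos: "0 < x <-> 0 < x'" if "(x, x'):?R" for x x'
  using tpeqD[OF tp, of "Rel True [Fn RZero [], Var 0]" "%_. x" "%_. x'"] that by auto
 have one: "(1, 1):?R"
  by (rule S[of "Eq (Var 0) (Fn ROne [])" "B 0" "B' 0" "B 0" "B' 0" "%_ _. 1"]) auto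
 have "ofield_rel ?R"
  unfolding ofield_rel_def
 proof (intro conjI allI impI one pos)
  fix x x' y y' assume xy: "(x, x'):?R" "(y, y'):?R"
  show "(x - y, x' - y'):?R"
   by (rule S[of "Eq (Var 0) (Fn RMinus [Var 1, Var 2])" x x' y y' "%a b. a - b", OF _ xy]) auto
  show "(x * y, x' * y'):?R"
   by (rule S[of "Eq (Var 0) (Fn RTimes [Var 1, Var 2])" x x' y y' "%a b. a * b", OF _ xy]) auto
 next
  fix x x' assume x: "(x, x'):?R"
  \<comment> \<open>These two equations define the inverse including the convention
    \<open>inverse 0 = 0\<close>, without a case distinction in the formula.\<close>
  have inv: "(a * (a * y) = a & y * (a * y) = y) <-> y = inverse a" for a y :: 'k
  proof (cases "a = 0")
   case False
   hence "a * (a * y) = a <-> a * y = 1" "a * y = 1 <-> y = inverse a"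
    by (simp, metis inverse_unique right_inverse)
   thus ?thesis using False by auto
  qed simp
  show "(inverse x, inverse x'):?R"
   by (rule S[of "Conj (Eq (Fn RTimes [Var 1, Fn RTimes [Var 1, Var 0]]) (Var 1)) (Eq (Fn RTimes [Var 0, Fn RTimes [Var 1, Var 0]]) (Var 0))"
      x x' x x' "%a b. inverse a", OF _ x x]) (simp_all add: inv[symmetric] subset_eq)
 qed
 moreover have "?R = (%n. (B n, B' n)) ` UNIV" by auto
 hence "countable ?R" by (metis countable_image uncountable_def countableI_type)
 moreover have "fst ` ?R = range B" "snd ` ?R = range B'" by force+
 ultimately show ?thesis unfolding closed_good_def good_def
  using tpeq_values[OF tp] skolem_seq_field(2)[OF B(1)] skolem_seq_field(2)[OF B(2)] by simp
qed

end

section \<open>From a violation in the field to one in the value group\<close>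

abbreviation vfm :: "(oring_fun, order_rel) fm => (oring_fun, bool) fm" where
 "vfm \<equiv> map_fm id (%_. True)"

lemma vfm_tm: "tm_val (Val v) e t = tm_val OFld e t"
 by (induction t) (simp_all cong: map_cong)

lemma sat_vfm: "wf_fm Lring p ==> sat (Val v) e (vfm p) = sat OFld e p"
 by (induction p arbitrary: e) (auto simp: vfm_tm tm.map_id tm.map_ident numeral_2_eq_2 length_Suc_conv)

lemma wf_vfm: "wf_fm Lring p ==> wf_fm Lval (vfm p)"
proof (induction p)
 have tm: "wf_tm Lring t ==> wf_tm Lval t" for t
  by (induction t) (auto simp: list_all_iff)
 {
  case (Eq s t)
  thus ?case using tm by (simp add: tm.map_id tm.map_ident)
 next
  case (Rel r ts)
  thus ?case using tm by (auto simp: tm.map_id tm.map_ident list_all_iff)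
 }
qed auto

context arc_monster
begin

lemma v_diff_eq: "v (c - e) > v (c - a) ==> c ~= e ==> c ~= a ==> v (e - a) = v (c - a) & e ~= a"
 using negl_approx[of c e a] by (auto simp: negl_def)

text \<open>\<open>R i\<close> moves row \<open>i\<close> from column 0 to column 1. No good
  relation containing it fixes \<open>c\<close>, since \<open>\<chi> i\<close> changes its truth
  value. One row is then sacrificed to the cut and one to provide the reference point
  \<open>d\<close>.\<close>

lemma array_violation:
 fixes A :: "nat => int => nat => 'k"
 assumes sk: "!!i j. skolem_seq Lval (Val v) (A i j)"
  and ind: "!!s. (!!i. strict_mono (s i)) ==> tpV {(A i (s i j) n, A i j n) | i j n. True}"
  and wf: "!!i. wf_fm Lring (\<chi> i)"
  and \<chi>: "!!i. sat OFld ((A i 0)(0 := c)) (\<chi> i)" "!!i. ~ sat OFld ((A i 1)(0 := c)) (\<chi> i)"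
 shows "EX \<phi> b. strong_NIP_violation Lgrp (OGrp :: (_, _, 'g) struc) \<phi> b"
proof -
 define R where "R i = {(A i 0 n, A i 1 n) | n. True}" for i
 have RI: "(A i 0 n, A i 1 n):R i" for i n by (auto simp: R_def)
 have shift: "tpV {(A k (j k) n, A k (j' k) n) | k n. True}" for j j' :: "nat => int"
 proof -
  have "tpV {(A k (l + (j k - j' k)) n, A k l n) | k l n. True}"
   by (rule ind[where s = "%k l. l + (j k - j' k)"]) (simp add: strict_mono_def)
  thus ?thesis by (rule tpeq_mono) (auto, metis add_diff_cancel_left' add.commute diff_add_cancel)
 qed
 have shift1: "tpV ({(A k (l k) n, A k (l k) n) | k n. k ~= i} \<union> R i)" for i l
 proof (rule tpeq_mono[OF shift[of "l(i := 0)" "l(i := 1)"]])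
  have *: "(A k ((l(i := 0)) k) n, A k ((l(i := 1)) k) n):{(A k ((l(i := 0)) k) n, A k ((l(i := 1)) k) n) | k n. True}" for k n
   by blast
  show "{(A k (l k) n, A k (l k) n) | k n. k ~= i} \<union> R i \<subseteq> {(A k ((l(i := 0)) k) n, A k ((l(i := 1)) k) n) | k n. True}"
  proof (intro Un_least subsetI)
   fix x assume "x:{(A k (l k) n, A k (l k) n) | k n. k ~= i}"
   then obtain k n where "k ~= i" "x = (A k (l k) n, A k (l k) n)" by blast
   hence "x = (A k ((l(i := 0)) k) n, A k ((l(i := 1)) k) n)" by simp
   thus "x:{(A k ((l(i := 0)) k) n, A k ((l(i := 1)) k) n) | k n. True}" by (simp only: *)
  next
   fix x assume "x:R i"
   then obtain n where "x = (A i ((l(i := 0)) i) n, A i ((l(i := 1)) i) n)" by (auto simp: R_def)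
   thus "x:{(A k ((l(i := 0)) k) n, A k ((l(i := 1)) k) n) | k n. True}" by (simp only: *)
  qed
 qed
 have cg: "closed_good (R i)" for i
  unfolding R_def
  by (rule tpV_skolem_closed_good[OF sk sk], rule tpeq_mono[OF shift1[of "%_. 0" i]]) (auto simp: R_def)
 have no: "~ (good S & R i \<subseteq> S & (c, c):S)" for S i
 proof
  assume S: "good S & R i \<subseteq> S & (c, c):S"
  hence "tpeq Lring OFld OFld S" using good_tpeq by blast
  hence "sat OFld ((A i 0)(0 := c)) (\<chi> i) = sat OFld ((A i 1)(0 := c)) (\<chi> i)"
   using wf by (rule tpeqD) (use S RI in auto)
  thus False using \<chi> by blast
 qed
 define ok where "ok i <-> same_cut (R i) c c" for i
 have ok: "EX i1. ALL i. i ~= i1 --> ok i"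
 proof -
  \<comment> \<open>In a bad row some pair of entries encloses \<open>c\<close>. The order between
    entries of different rows does not depend on the columns, so enclosing pairs from two rows lie
    apart and cannot both enclose \<open>c\<close>. \<open>no\<close> excludes that both entries
    equal \<open>c\<close>.\<close>
  have "i = k" if "~ ok i" "~ ok k" for i k
  proof (rule ccontr)
   assume ik: "i ~= k"
   have cross: "EX n. A i 0 n ~= A i 1 n & (A i 0 n <= c & c <= A i 1 n | A i 1 n <= c & c <= A i 0 n)" if nok: "~ ok i" for i
   proof -
    obtain n where n: "~ ((A i 0 n < c <-> A i 1 n < c) & A i 0 n ~= c & A i 1 n ~= c)"
     using nok by (auto simp: ok_def same_cut_def R_def)
    have "A i 0 n ~= c | A i 1 n ~= c" using no[of "R i" i] cg[of i] RI[of i n] by (auto simp: closed_good_def)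
    thus ?thesis using n by (intro exI[of _ n]) auto
   qed
   obtain n m where n: "A i 0 n ~= A i 1 n" "A i 0 n <= c & c <= A i 1 n | A i 1 n <= c & c <= A i 0 n"
    and m: "A k 0 m ~= A k 1 m" "A k 0 m <= c & c <= A k 1 m | A k 1 m <= c & c <= A k 0 m"
    using cross \<open>~ ok i\<close> \<open>~ ok k\<close> by metis
   have inv: "(A i j n < A k l m <-> A i 0 n < A k 0 m) & (A k l m < A i j n <-> A k 0 m < A i 0 n)" for j l
   proof -
    define J where "J = (%_. 0 :: int)(i := j, k := l)"
    define \<kappa> \<mu> where "\<kappa> x = (if x = 0 then i else k)" and "\<mu> x = (if x = 0 then n else m)" for x :: nat
    have "sat (Val v) (%x. A (\<kappa> x) (J (\<kappa> x)) (\<mu> x)) q = sat (Val v) (%x. A (\<kappa> x) 0 (\<mu> x)) q"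
     if "wf_fm Lval q" for q
     by (rule tpeqD[OF shift[of J "%_. 0"] that]) blast
    from this[of "Rel True [Var 0, Var 1]"] this[of "Rel True [Var 1, Var 0]"] show ?thesis
     using ik by (simp add: \<kappa>_def \<mu>_def J_def)
   qed
   show False using n m inv[of 0 0] inv[of 0 1] inv[of 1 0] inv[of 1 1] by (cases "A i 0 n" "A k 0 m" rule: linorder_cases) auto
  qed
  thus ?thesis by metis
 qed
 have cne: "c ~= A i 0 n" "c ~= A i 1 n" if "ok i" for i n using that RI[of i n] by (auto simp: ok_def same_cut_def)
 let "?ev e t \<nu> i j" = "%k::nat. if t k then v (e - A i j (\<nu> k)) else v (A i j (\<nu> k))"
 have wit: "EX p t (\<nu> :: nat => nat). wf_fm Lgrp p &
   sat OGrp (?ev c t \<nu> i 0) p ~=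
   sat OGrp (?ev c t \<nu> i 1) p" if "ok i" for i
 proof -
  define S where "S = {(v (c - a), v (c - a')) | a a'. (a, a'):R i} \<union> vR v (R i)"
  have "~ tpG S" using extend_given[OF cg, of i c c] no that unfolding ok_def S_def by blast
  then obtain p \<rho> where p: "wf_fm Lgrp p" "\<rho> ` fv_fm p \<subseteq> S"
    "sat OGrp (fst \<circ> \<rho>) p ~= sat OGrp (snd \<circ> \<rho>) p"
   unfolding tpeq_def by blast
  have "EX t n. \<rho> k = (if t then (v (c - A i 0 n), v (c - A i 1 n)) else (v (A i 0 n), v (A i 1 n)))" if "k:fv_fm p" for k
  proof -
   have "\<rho> k:S" using p(2) that by blast
   thus ?thesis unfolding S_def vR_def R_def by (auto intro: exI[of _ True] exI[of _ False])
  qed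
  then obtain t \<nu> where "!!k. k:fv_fm p ==>
    \<rho> k = (if t k then (v (c - A i 0 (\<nu> k)), v (c - A i 1 (\<nu> k))) else (v (A i 0 (\<nu> k)), v (A i 1 (\<nu> k))))" by metis
  hence "sat OGrp (fst \<circ> \<rho>) p = sat OGrp (?ev c t \<nu> i 0) p"
   "sat OGrp (snd \<circ> \<rho>) p = sat OGrp (?ev c t \<nu> i 1) p"
   by (auto intro!: sat_cong)
  thus ?thesis using p by blast
 qed
 define W where "W i x = (case x of (p, t, \<nu> :: nat => nat) => wf_fm Lgrp p &
   sat OGrp (?ev c t \<nu> i 0) p ~=
   sat OGrp (?ev c t \<nu> i 1) p)" for i x
 have "ALL i. EX x. ok i --> W i x" using wit unfolding W_def by fastforce
 then obtain x where x: "!!i. ok i ==> W i (x i)" by metis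
 define p t \<nu> where "p i = fst (x i)" and "t i = fst (snd (x i))" and "\<nu> i = snd (snd (x i))" for i
 have wfp: "wf_fm Lgrp (p i)"
  and alt: "sat OGrp (?ev c (t i) (\<nu> i) i 0) (p i) ~=
   sat OGrp (?ev c (t i) (\<nu> i) i 1) (p i)" if "ok i" for i
  using x[OF that] unfolding W_def p_def t_def \<nu>_def case_prod_beta by blast+
 \<comment> \<open>The positions of row \<open>i\<close> whose distance to \<open>c\<close> is
   mentioned by the distinguishing formula.\<close>
 define I where "I i = {n. EX k:fv_fm (p i). t i k & \<nu> i k = n}" for i
 have fI: "finite (I i)" for i by (rule finite_subset[of _ "\<nu> i ` fv_fm (p i)"]) (auto simp: I_def)
 \<comment> \<open>If an entry of another row were closer to \<open>c\<close> than all entries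
   mentioned, it could replace \<open>c\<close> in the distances; but over another row columns 0 and
   1 of row \<open>i\<close> have the same type, so the formula could not distinguish them.\<close>
 have best: "EX n:I i. v (c - A k l m) <= v (c - A i 0 n) | v (c - A k l m) <= v (c - A i 1 n)"
  if "ok i" "k ~= i" "c ~= A k l m" for i k l m
 proof (rule ccontr)
  assume "~ ?thesis"
  hence *: "v (c - A k l m) > v (c - A i 0 n)" "v (c - A k l m) > v (c - A i 1 n)" if "n:I i" for n
   using that by (auto simp: not_le)
  let ?T = "{(A q l n, A q l n) | q n. q ~= i} \<union> R i"
  have "(A k l m, A k l m):?T" using that(2) by blast
  hence m: "(v (A k l m - A i 0 n), v (A k l m - A i 1 n)):DV ?T"
   "(v (A i 0 n), v (A i 1 n)):DV ?T" for n
   using RI[of i n] vR_I[of "A i 0 n" "A i 1 n" ?T v] by blast+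
  have "sat OGrp (?ev (A k l m) (t i) (\<nu> i) i 0) (p i) =
    sat OGrp (?ev (A k l m) (t i) (\<nu> i) i 1) (p i)"
   by (rule tpeqD[OF tpV_diff_values[OF shift1[of "%_. l" i]] wfp[OF that(1)]]) (use m in auto)
  moreover have "sat OGrp (?ev (A k l m) (t i) (\<nu> i) i j) (p i) =
    sat OGrp (?ev c (t i) (\<nu> i) i j) (p i)" if "j = 0 | j = 1" for j
  proof (rule sat_cong)
   fix q assume q: "q:fv_fm (p i)"
   have "v (A k l m - A i j (\<nu> i q)) = v (c - A i j (\<nu> i q))" if "t i q"
   proof -
    have "\<nu> i q:I i" using q that by (auto simp: I_def)
    thus ?thesis using *[of "\<nu> i q"] v_diff_eq[of c "A i j (\<nu> i q)" "A k l m"] cne[OF \<open>ok i\<close>, of "\<nu> i q"] \<open>j = 0 | j = 1\<close>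
      \<open>c ~= A k l m\<close> by auto
   qed
   thus "(if t i q then v (A k l m - A i j (\<nu> i q)) else v (A i j (\<nu> i q))) =
     (if t i q then v (c - A i j (\<nu> i q)) else v (A i j (\<nu> i q)))" by simp
  qed
  ultimately show False using alt[OF that(1)] by simp
 qed
 obtain i1 where i1: "!!i. i ~= i1 ==> ok i" using ok by blast
 define i0 where "i0 = Suc i1"
 \<comment> \<open>This skips row \<open>i1\<close>, where the cut may change, and row
   \<open>i0 = i1 + 1\<close>, which supplies \<open>d\<close>.\<close>
 define f where "f i = i + i1 + 2" for i
 have f: "ok i0" "ok (f i)" "f i ~= i0" for i using i1 by (auto simp: i0_def f_def)
 define G where "G i = (%n. v (c - A i 0 n)) ` I i \<union> (%n. v (c - A i 1 n)) ` I i" for i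
 have G: "finite (G i)" "G i ~= {}" if "ok i" for i
 proof -
  show "finite (G i)" by (simp add: G_def fI)
  have "EX k. k ~= i & k ~= i1" by (intro exI[of _ "i + i1 + 1"]) simp
  then obtain k where k: "k ~= i" "ok k" using i1 by blast
  show "G i ~= {}" using best[OF that k(1) cne(1)[OF k(2)]] by (auto simp: G_def)
 qed
 \<comment> \<open>By \<open>best\<close> for row \<open>i0\<close>, no relevant entry of the rows
   \<open>f i\<close> is closer to \<open>c\<close> than the entry \<open>d\<close> that attains
   this maximum.\<close>
 define \<gamma> where "\<gamma> = Max (G i0)"
 have "\<gamma>:G i0" unfolding \<gamma>_def by (rule Max_in[OF G[OF f(1)]])
 then obtain l m where lm: "l = 0 | l = 1" "\<gamma> = v (c - A i0 l m)" by (force simp: G_def)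
 define d where "d = A i0 l m"
 have cd: "c ~= d" "v (c - d) = \<gamma>" using lm cne[OF f(1), of m] by (auto simp: d_def)
 have le: "v (c - A (f i) 0 n) <= \<gamma> & v (c - A (f i) 1 n) <= \<gamma>" if "n:I (f i)" for i n
 proof -
  have *: "g <= \<gamma>" if "g:G i0" for g unfolding \<gamma>_def by (rule Max_ge[OF G(1)[OF f(1)] that])
  have "v (c - A (f i) j n) <= \<gamma>" if "j = 0 | j = 1" for j
  proof -
   have "c ~= A (f i) j n" using cne[OF f(2)] that by blast
   from best[OF f(1) f(3) this] obtain n' where n': "n':I i0"
    "v (c - A (f i) j n) <= v (c - A i0 0 n') | v (c - A (f i) j n) <= v (c - A i0 1 n')" by blast
   thus ?thesis using *[of "v (c - A i0 0 n')"] *[of "v (c - A i0 1 n')"] by (auto simp: G_def)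
  qed
  thus ?thesis by blast
 qed
 \<comment> \<open>Below \<gamma> the distance to \<open>d\<close> equals the distance to
   \<open>c\<close>; otherwise the latter is \<gamma>. The case of \<open>d\<close> equal to the
   entry is excluded explicitly, because \<open>v 0\<close> is 0 rather than infinite.\<close>
 define bit where "bit i j n <-> d ~= A (f i) j n & v (d - A (f i) j n) < \<gamma>" for i j n
 have val: "v (c - A (f i) j n) = (if bit i j n then v (d - A (f i) j n) else \<gamma>)" if n: "n:I (f i)" and j: "j = 0 | j = 1" for i j n
 proof -
  let ?a = "A (f i) j n"
  have ca: "c ~= ?a" "v (c - ?a) <= \<gamma>" using cne[OF f(2)] le[OF n] j by blast+
  show ?thesis
  proof (cases "d = ?a")
   case True
   thus ?thesis using cd by (simp add: bit_def)
  next
   case False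
   have eq: "c - ?a = (c - d) + (d - ?a)" by simp
   show ?thesis
   proof (cases "v (d - ?a) < \<gamma>")
    case True
    hence "c - d << d - ?a" using False cd by (simp add: negl_def)
    hence "v ((d - ?a) + (c - d)) = v (d - ?a)" using v_add_eq by blast
    thus ?thesis using True False by (simp add: bit_def)
   next
    case lt: False
    have "min (v (c - d)) (v (d - ?a)) <= v ((c - d) + (d - ?a))"
     by (rule v_add) (use cd False ca in auto)
    thus ?thesis using lt ca(2) cd(2) by (simp add: bit_def)
   qed
  qed
 qed
 \<comment> \<open>Odd positions hold values of entries, positive even ones distances to
   \<open>d\<close>; position 0 is left to \<gamma>.\<close>
 define H where "H i j m = (if odd m then v (A (f i) j (m div 2)) else v (d - A (f i) j (m div 2 - 1)))" for i j m
 have "EX \<Psi>. wf_fm Lgrp \<Psi> & sat OGrp ((H i 0)(0 := \<gamma>)) \<Psi> ~= sat OGrp ((H i 1)(0 := \<gamma>)) \<Psi>" for i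
 \<comment> \<open>If some bit changes between the columns, comparing that distance with \<gamma>
   already alternates, as equality with \<open>d\<close> does not change. If none does, the
   distances in the formula can be rewritten uniformly by \<open>\<tau>\<close>.\<close>
 proof (cases "EX n:I (f i). bit i 0 n ~= bit i 1 n")
  case True
  then obtain n where n: "bit i 0 n ~= bit i 1 n" by blast
  let ?T = "{(A q l n, A q l n) | q n. q ~= f i} \<union> R (f i)"
  have "(d, d):?T" using f(3)[of i] unfolding d_def by blast
  hence "d = A (f i) 0 n <-> d = A (f i) 1 n"
   using tpeqD[OF shift1[of "%_. l" "f i"], of "Eq (Var 0) (Var 1)" "%x. if x = 0 then d else A (f i) 0 n"
     "%x. if x = 0 then d else A (f i) 1 n"] RI[of "f i" n] by auto
  hence "sat OGrp ((H i 0)(0 := \<gamma>)) (Rel Less [Var (2 * n + 2), Var 0]) ~=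
    sat OGrp ((H i 1)(0 := \<gamma>)) (Rel Less [Var (2 * n + 2), Var 0])"
   using n by (auto simp: H_def bit_def)
  thus ?thesis by (intro exI[of _ "Rel Less [Var (2 * n + 2), Var 0]"]) simp
 next
  case False
  define \<tau> where "\<tau> k = (if t (f i) k then if bit i 0 (\<nu> (f i) k) then 2 * \<nu> (f i) k + 2 else 0 else 2 * \<nu> (f i) k + 1)" for k
  have "sat OGrp ((H i j)(0 := \<gamma>)) (subst_fm (p (f i)) (%k. Var (\<tau> k))) =
    sat OGrp (?ev c (t (f i)) (\<nu> (f i)) (f i) j) (p (f i))"
   if j: "j = 0 | j = 1" for j
   unfolding sat_subst
  proof (rule sat_cong)
   fix k assume k: "k:fv_fm (p (f i))"
   show "tm_val OGrp ((H i j)(0 := \<gamma>)) (Var (\<tau> k)) =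
     (if t (f i) k then v (c - A (f i) j (\<nu> (f i) k)) else v (A (f i) j (\<nu> (f i) k)))"
   proof (cases "t (f i) k")
    case True
    hence n: "\<nu> (f i) k:I (f i)" using k by (auto simp: I_def)
    hence "bit i j (\<nu> (f i) k) = bit i 0 (\<nu> (f i) k)" using False j by blast
    thus ?thesis using val[OF n j] True by (simp add: \<tau>_def H_def)
   qed (simp add: \<tau>_def H_def)
  qed
  thus ?thesis using alt[OF f(2), of i] wfp[OF f(2), of i]
   by (intro exI[of _ "subst_fm (p (f i)) (%k. Var (\<tau> k))"]) (auto intro: wf_subst)
 qed
 then obtain \<Psi> where \<Psi>: "!!i. wf_fm Lgrp (\<Psi> i)"
  "!!i. sat OGrp ((H i 0)(0 := \<gamma>)) (\<Psi> i) ~= sat OGrp ((H i 1)(0 := \<gamma>)) (\<Psi> i)" by metis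
 show ?thesis
 proof (rule alternation_violation[OF _ _ _ \<Psi>])
  fix s :: "nat => int => int" assume s: "!!i. strict_mono (s i)"
  \<comment> \<open>Row \<open>i0\<close> is not moved, so \<open>d\<close> may be used as a fixed
    parameter.\<close>
  define s' where "s' k = (if k = i0 then id else s (k - i1 - 2))" for k
  have sf: "s' (f i) = s i" "s' i0 = id" for i using f(3) by (auto simp: s'_def f_def)
  define T where "T = {(A i (s' i j) n, A i j n) | i j n. True}"
  have T: "tpV T" unfolding T_def by (rule ind) (use s in \<open>auto simp: s'_def strict_mono_def\<close>)
  have "(A i0 (s' i0 l) m, A i0 l m):T" unfolding T_def by blast
  hence dT: "(d, d):T" unfolding sf d_def by simp
  have AT: "(A (f i) (s i j) n, A (f i) j n):T" for i j n unfolding T_def sf(1)[of i, symmetric] by blast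
  have "{(H i (s i j) n, H i j n) | i j n. True} \<subseteq> DV T"
  proof (rule subsetI, elim CollectE exE conjE)
   fix h i j n assume h: "h = (H i (s i j) n, H i j n)"
   show "h:DV T"
   proof (cases "odd n")
    case True
    thus ?thesis using vR_I[OF AT, of v i j "n div 2"] by (simp add: h H_def)
   next
    case False
    hence "h = (v (d - A (f i) (s i j) (n div 2 - 1)), v (d - A (f i) j (n div 2 - 1)))" by (simp add: h H_def)
    thus ?thesis using dT AT by blast
   qed
  qed
  thus "tpG {(H i (s i j) n, H i j n) | i j n. True}" by (rule tpeq_mono[OF tpV_diff_values[OF T]])
 qed auto
qed

end

context arc_field
begin

text \<open>Parameter tuples are enlarged to Skolem sequences, whose even positions keep the old
  parameters; hence variables are doubled. The array lives in an ultrapower, and so does the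
  resulting violation.\<close>

lemma field_violation_group:
 fixes b :: "nat => nat => nat => 'k"
 assumes viol: "strong_NIP_violation Lring (OFld :: (_, _, 'k) struc) \<phi> b"
 shows "EX \<phi> b. strong_NIP_violation Lgrp (OGrp :: (_, _, 'g star) struc) \<phi> b"
proof -
 interpret S: arc_monster "star_map v" by (rule arc_monster_star)
 have wf: "wf_fm Lring (\<phi> i)" for i using viol by (simp add: strong_NIP_violation_def)
 define \<chi> where "\<chi> i = subst_fm (\<phi> i) (%n. Var (2 * n))" for i
 have wf\<chi>: "wf_fm Lring (\<chi> i)" for i unfolding \<chi>_def by (rule wf_subst[OF wf]) simp
 define B where "B i j = skolem_ext (Val v) (b i j)" for i j
 have B: "skolem_seq Lval (Val v) (B i j)" for i j unfolding B_def by (rule skolem_seq_ext) simp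
 have sat\<chi>: "sat (Val v) ((B i j)(0 := x)) (vfm (\<chi> i)) = sat OFld ((b i j)(0 := x)) (\<phi> i)" for i j x
 proof -
  have "(%n. tm_val (Val v) ((B i j)(0 := x)) (Var (2 * n))) = (b i j)(0 := x)"
   by (auto simp: B_def skolem_ext_even)
  thus ?thesis unfolding sat_vfm[OF wf\<chi>] unfolding \<chi>_def by (simp add: del: fun_upd_apply)
 qed
 have con: "consistent_in (Val v) (pattern (%i. vfm (\<chi> i)) B \<eta>)" for \<eta>
 proof (rule consistent_map)
  show "consistent_in OFld (pattern \<phi> b \<eta>)"
   using viol by (simp add: strong_NIP_violation_def)
  show "EX a':univ (Val v). ALL i j. sat (Val v) ((B i j)(0 := a')) (vfm (\<chi> i)) <->
    sat OFld ((b i j)(0 := a)) (\<phi> i)" for a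
   by (intro bexI[of _ a] allI sat\<chi>) simp
 qed
 have "EX (A :: nat => int => nat => 'k star) c. (ALL i j. skolem_seq Lval (Val (star_map v)) (A i j)) &
   c:univ (Val (star_map v)) &
   (ALL i. sat (Val (star_map v)) ((A i 0)(0 := c)) (vfm (\<chi> i)) &
    ~ sat (Val (star_map v)) ((A i 1)(0 := c)) (vfm (\<chi> i))) &
   (ALL s. (ALL i. strict_mono (s i)) --> S.tpV {(A i (s i j) n, A i j n) | i j n. True})"
  by (rule indiscernible_array[OF vring_is_structure is_ultrapower_vring B wf_vfm[OF wf\<chi>] con])
 then obtain A :: "nat => int => nat => 'k star" and c where A: "ALL i j. skolem_seq Lval (Val (star_map v)) (A i j)"
   "ALL i. sat (Val (star_map v)) ((A i 0)(0 := c)) (vfm (\<chi> i)) &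
    ~ sat (Val (star_map v)) ((A i 1)(0 := c)) (vfm (\<chi> i))"
   "ALL s. (ALL i. strict_mono (s i)) --> S.tpV {(A i (s i j) n, A i j n) | i j n. True}"
  by (elim exE conjE) (rule that)
 show ?thesis
 proof (rule S.array_violation[OF _ _ wf\<chi>])
  show "S.tpV {(A i (s i j) n, A i j n) | i j n. True}" if "!!i. strict_mono (s i)" for s :: "nat => int => int"
   using A(3) that by simp
 qed (use A(1,2) sat_vfm[OF wf\<chi>] in blast)+
qed

end

section \<open>Ordered groups modulo their largest divisible convex subgroup\<close>

text \<open>Asking every element between 0 and \<open>g\<close> to be divisible, one
  \<open>n\<close> at a time, makes membership an intersection of the formulas
  \<open>divisible_fm n\<close>, which saturation can handle.\<close>

definition Dv :: "'a::linordered_ab_group_add set" where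
 "Dv = {g. ALL n>0. ALL y. (0 <= y & y <= g | g <= y & y <= 0) --> (EX w. nmul n w = y)}"

lemma Dv_0 [simp]: "0:Dv"
 by (auto simp: Dv_def intro!: exI[of _ 0])

lemma Dv_convex: "g:Dv ==> 0 <= h & h <= g | g <= h & h <= 0 ==> h:Dv"
 unfolding Dv_def by (auto dest: order_trans)

lemma Dv_div: "g:Dv ==> n > 0 ==> EX w. nmul n w = g"
 unfolding Dv_def using linear[of 0 g] by blast

lemma Dv_minus: "g:Dv ==> - g:Dv"
proof -
 assume g: "g:Dv"
 have "EX w. nmul n w = y" if n: "n > 0" and y: "0 <= y & y <= - g | - g <= y & y <= 0" for n y
 proof -
  have "0 <= - y & - y <= g | g <= - y & - y <= 0" using y by (metis minus_le_iff le_minus_iff neg_0_le_iff_le neg_le_0_iff_le)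
  then obtain w where "nmul n w = - y" using g n unfolding Dv_def by blast
  thus ?thesis by (intro exI[of _ "- w"]) (simp add: nmul_minus)
 qed
 thus ?thesis unfolding Dv_def by blast
qed

lemma Dv_add: "g:Dv ==> h:Dv ==> g + h:Dv"
proof -
 have pos: "g + h:Dv" if gh: "g:Dv" "h:Dv" "0 <= g" "0 <= h" for g h :: 'a
 proof -
  have "EX w. nmul n w = y" if n: "n > 0" and y: "0 <= y & y <= g + h | g + h <= y & y <= 0" for n y
  proof -
   have y': "0 <= y & y <= g + h" using y gh(3,4) by (auto intro: order_antisym order_trans add_nonneg_nonneg)
   have "min y g:Dv" "y - min y g:Dv"
    using y' gh by (auto simp: min_def le_diff_eq diff_le_eq add.commute intro: Dv_convex[of g] Dv_convex[of h])
   then obtain a b where "nmul n a = min y g" "nmul n b = y - min y g" using Dv_div n by metis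
   thus ?thesis by (intro exI[of _ "a + b"]) (simp add: nmul_add)
  qed
  thus ?thesis unfolding Dv_def by blast
 qed
 assume g: "g:Dv" and h: "h:Dv"
 have mixed: "a + b:Dv" if "a:Dv" "b:Dv" "0 <= a" "b <= 0" for a b :: 'a
 proof (cases "0 <= a + b")
  case True
  thus ?thesis using that by (intro Dv_convex[OF that(1)]) simp
 next
  case False
  thus ?thesis using that by (intro Dv_convex[OF that(2)]) simp
 qed
 have "- (- g + - h) = g + h" by simp
 thus ?thesis
  using pos[OF g h] mixed[OF g h] mixed[OF h g] Dv_minus[OF pos[OF Dv_minus[OF g] Dv_minus[OF h]]]
  by (cases "0 <= g"; cases "0 <= h") (auto simp: add.commute)
qed

lemma Dv_diff: "g:Dv ==> h:Dv ==> g - h:Dv"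
 using Dv_add[of g "- h"] Dv_minus[of h] by simp

lemma Dv_nmul: "g:Dv ==> nmul n g:Dv"
 by (induction n) (auto intro: Dv_add)

lemma nmul_eq_iff: "n > 0 ==> nmul n g = nmul n (h :: 'a::linordered_ab_group_add) <-> g = h"
 using nmul_eq_0_iff[of n "g - h"] by (simp add: nmul_diff)

lemma nmul_nonneg: "0 <= g ==> 0 <= nmul n (g :: 'a::linordered_ab_group_add)"
 by (induction n) auto

lemma Dv_root: "nmul n w:Dv ==> n > 0 ==> w:Dv"
proof -
 assume w: "nmul n w:Dv" "n > 0"
 then obtain m where n: "n = Suc m" by (cases n) auto
 have "0 <= w ==> w <= nmul n w" "w <= 0 ==> nmul n w <= w"
  using nmul_nonneg[of w m] nmul_nonneg[of "- w" m] by (simp_all add: n nmul_minus)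
 thus ?thesis using Dv_convex[OF w(1), of w] by (cases "0 <= w") auto
qed

lemma Dv_sign: "g ~: Dv ==> g - h:Dv ==> 0 < g <-> 0 < h"
proof -
 assume g: "g ~: Dv" "g - h:Dv"
 have "~ (0 <= g & g <= g - h)" "~ (g - h <= g & g <= 0)" using Dv_convex[OF g(2), of g] g(1) by blast+
 thus ?thesis by auto
qed

definition divisible_fm :: "nat => (ogroup_fun, order_rel) fm" where
 "divisible_fm n = Neg (Exi 1 (Conj (Neg (Conj
   (Neg (Conj (Neg (Rel Less [Var 1, Fn GZero []])) (Neg (Rel Less [Var 0, Var 1]))))
   (Neg (Conj (Neg (Rel Less [Var 1, Var 0])) (Neg (Rel Less [Fn GZero [], Var 1]))))))
   (Neg (Exi 2 (Eq (nmul_tm n (Var 2)) (Var 1))))))"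

lemma sat_divisible_fm: "sat OGrp e (divisible_fm n) <->
  (ALL y. (0 <= y & y <= e 0 | e 0 <= y & y <= 0) --> (EX w. nmul n w = y))"
 by (auto simp: divisible_fm_def not_less)

lemma divisible_fm_wf: "wf_fm Lgrp (divisible_fm n)" "fv_fm (divisible_fm n) \<subseteq> {0}"
proof -
 have "fv_tm (nmul_tm n (Var 2)) \<subseteq> {2}" by (induction n) auto
 thus "fv_fm (divisible_fm n) \<subseteq> {0}" by (auto simp: divisible_fm_def)
qed (simp add: divisible_fm_def)

lemma in_Dv_iff: "g:Dv <-> (ALL n>0. sat OGrp (e(0 := g)) (divisible_fm n))"
 by (simp add: Dv_def sat_divisible_fm)

text \<open>Finite parts of the cut are filled by a midpoint, or by a shift by
  \<open>\<delta>\<close> at an open end; both stay in \<open>Dv\<close> by divisibility and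
  convexity.\<close>

lemma Dv_cut_realize:
 assumes sat: "aleph1_saturated Lgrp (OGrp :: (_, _, 'a::linordered_ab_group_add) struc)"
  and nt: "\<delta>:(Dv :: 'a set)" "0 < \<delta>" and A: "countable A" "A \<subseteq> Dv" and B: "countable B" "B \<subseteq> Dv"
  and AB: "!!a b. a:A ==> b:B ==> a < b"
 shows "EX z:(Dv :: 'a set). (ALL a:A. a < z) & (ALL b:B. z < b)"
proof -
 have between: "EX z:Dv. (ALL a:A0. a < z) & (ALL b:B0. z < b)" if F: "finite A0" "A0 \<subseteq> A" "finite B0" "B0 \<subseteq> B" for A0 B0
 proof (cases "A0 = {} | B0 = {}")
  case True
  then consider "A0 = {}" "B0 = {}" | "A0 = {}" "B0 ~= {}" | "A0 ~= {}" "B0 = {}" by blast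
  thus ?thesis
  proof cases
   case 1
   thus ?thesis using Dv_0 by blast
  next
   case 2
   hence "Min B0 - \<delta>:Dv" using Min_in[OF F(3)] F(4) B(2) nt(1) by (intro Dv_diff) auto
   thus ?thesis using 2 F(3) nt(2) by (intro bexI[of _ "Min B0 - \<delta>"]) (auto simp: diff_less_eq intro: le_less_trans[OF Min_le] less_add_same_cancel1[THEN iffD2] dest: Min_le[OF F(3)] add_le_less_mono)
  next
   case 3
   hence "Max A0 + \<delta>:Dv" using Max_in[OF F(1)] F(2) A(2) nt(1) by (intro Dv_add) auto
   moreover have "a < Max A0 + \<delta>" if "a:A0" for a using add_le_less_mono[OF Max_ge[OF F(1) that] nt(2)] by simp
   ultimately show ?thesis using 3 by blast
  qed
 next
  case False
  let ?a = "Max A0" and ?b = "Min B0"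
  have ab: "?a:A" "?b:B" using False Max_in[OF F(1)] Min_in[OF F(3)] F(2,4) by auto
  hence lt: "?a < ?b" by (rule AB)
  have D: "?b - ?a:Dv" using ab A(2) B(2) by (intro Dv_diff) auto
  obtain w where w: "nmul 2 w = ?b - ?a" using Dv_div[OF D, of 2] by auto
  hence ww: "w + w = ?b - ?a" by (simp add: numeral_2_eq_2)
  have "0 < w" using lt ww by (metis add_nonpos_nonpos diff_gt_0_iff_gt not_less)
  moreover from this have "w < ?b - ?a" unfolding ww[symmetric] by simp
  moreover have "w:Dv" using Dv_root[of 2 w] w D by simp
  ultimately have z: "?a + w:Dv" "?a < ?a + w" "?a + w < ?b" using ab(1) A(2) by (auto intro: Dv_add simp: less_diff_eq add.commute)
  have "a < ?a + w" if "a:A0" for a using le_less_trans[OF Max_ge[OF F(1) that] z(2)] .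
  moreover have "?a + w < b" if "b:B0" for b using less_le_trans[OF z(3) Min_le[OF F(3) that]] .
  ultimately show ?thesis using z(1) by blast
 qed
 define \<Gamma> :: "((ogroup_fun, order_rel) fm \<times> (nat => 'a)) set" where
  "\<Gamma> = (%n. (divisible_fm n, %_. 0)) ` {0<..} \<union> (%a. (Rel Less [Var 1, Var 0], %_. a)) ` A \<union> (%b. (Rel Less [Var 0, Var 1], %_. b)) ` B"
 have "EX z:univ OGrp. ALL (p, b):\<Gamma>. sat OGrp (b(0 := z)) p"
 proof (rule saturated_realize[OF sat, of "insert 0 (A \<union> B)"])
  show "countable (insert 0 (A \<union> B))" using A B by simp
  show "wf_fm Lgrp p & b ` (fv_fm p - {0}) \<subseteq> insert 0 (A \<union> B)" if "(p, b):\<Gamma>" for p b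
   using that divisible_fm_wf by (auto simp: \<Gamma>_def)
  fix \<Delta> assume D: "finite \<Delta>" "\<Delta> \<subseteq> \<Gamma>"
  define A0 where "A0 = A \<inter> (%(p, b). b 1) ` \<Delta>"
  define B0 where "B0 = B \<inter> (%(p, b). b 1) ` \<Delta>"
  have "finite A0" "A0 \<subseteq> A" "finite B0" "B0 \<subseteq> B" using D(1) by (auto simp: A0_def B0_def)
  then obtain z where z: "z:Dv" "ALL a:A0. a < z" "ALL b:B0. z < b" using between by meson
  have "sat OGrp (b(0 := z)) p" if t: "(p, b):\<Delta>" for p b
  proof -
   have "b 1:(%(p, b). b 1) ` \<Delta>" using t by force
   moreover have "(p, b):\<Gamma>" using t D(2) by blast
   ultimately show ?thesis using z in_Dv_iff[of z "%_. 0"] by (auto simp: \<Gamma>_def A0_def B0_def simp del: fun_upd_apply) (auto)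
  qed
  thus "EX a:univ OGrp. ALL (p, b):\<Delta>. sat OGrp (b(0 := a)) p" by auto
 qed auto
 then obtain z where z: "!!p b. (p, b):\<Gamma> ==> sat OGrp (b(0 := z)) p" by blast
 have "sat OGrp ((%_. 0)(0 := z)) (divisible_fm n)" if "n > 0" for n
  by (rule z) (use that in \<open>auto simp: \<Gamma>_def\<close>)
 hence "z:Dv" using in_Dv_iff[of z "%_. 0"] by blast
 moreover have "a < z" if "a:A" for a using z[of "Rel Less [Var 1, Var 0]" "%_. a"] that by (auto simp: \<Gamma>_def)
 moreover have "z < b" if "b:B" for b using z[of "Rel Less [Var 0, Var 1]" "%_. b"] that by (auto simp: \<Gamma>_def)
 ultimately show ?thesis by blast
qed

text \<open>For finitely many \<open>n\<close> the smallest of the given bounds works, so by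
  saturation one positive element works for all \<open>n\<close>.\<close>

lemma Dv_nontrivial:
 assumes sat: "aleph1_saturated Lgrp (OGrp :: (_, _, 'a::linordered_ab_group_add) struc)"
  and ex: "!!n. n > 0 ==> EX x>(0 :: 'a). ALL y. 0 <= y & y <= x --> (EX w. nmul n w = y)"
 shows "EX \<delta>:(Dv :: 'a set). 0 < \<delta>"
proof -
 define \<Gamma> :: "((ogroup_fun, order_rel) fm \<times> (nat => 'a)) set" where
  "\<Gamma> = insert (Rel Less [Fn GZero [], Var 0], %_. 0) ((%n. (divisible_fm n, %_. 0)) ` {0<..})"
 have "EX z:univ OGrp. ALL (p, b):\<Gamma>. sat OGrp (b(0 := z)) p"
 proof (rule saturated_realize[OF sat, of "{0}"])
  show "wf_fm Lgrp p & b ` (fv_fm p - {0}) \<subseteq> {0}" if "(p, b):\<Gamma>" for p b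
   using that divisible_fm_wf by (auto simp: \<Gamma>_def)
  fix \<Delta> assume D: "finite \<Delta>" "\<Delta> \<subseteq> \<Gamma>"
  then obtain I where I: "finite I" "I \<subseteq> {0<..}" "\<Delta> \<subseteq> insert (Rel Less [Fn GZero [], Var 0], %_. 0) ((%n. (divisible_fm n, %_. 0)) ` I)"
  proof -
   assume r: "!!I. finite I ==> I \<subseteq> {0<..} ==> \<Delta> \<subseteq> insert (Rel Less [Fn GZero [], Var 0], %_. 0) ((%n. (divisible_fm n, %_. 0)) ` I) ==> thesis"
   have "\<Delta> - {(Rel Less [Fn GZero [], Var 0], %_. 0)} \<subseteq> (%n. (divisible_fm n, %_. 0)) ` {0<..}" using D(2) by (auto simp: \<Gamma>_def)
   then obtain I where I: "I \<subseteq> {0<..}" "finite I" "\<Delta> - {(Rel Less [Fn GZero [], Var 0], %_. 0)} = (%n. (divisible_fm n, %_. 0)) ` I"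
    using D(1) by (meson finite_Diff finite_subset_image)
   show thesis by (rule r[OF I(2,1)]) (use I(3) in blast)
  qed
  have "EX x>(0 :: 'a). ALL n:I. ALL y. 0 <= y & y <= x --> (EX w. nmul n w = y)"
   using I(1,2)
  proof (induction I rule: finite_induct)
   case empty
   thus ?case using ex[of 1] by auto
  next
   case (insert n I)
   have "I \<subseteq> {0<..}" using insert.prems by blast
   from insert.IH[OF this] obtain x :: 'a where x: "0 < x" "ALL n:I. ALL y. 0 <= y & y <= x --> (EX w. nmul n w = y)"
    by (elim exE conjE) (rule that)
   obtain x' :: 'a where "0 < x'" "ALL y. 0 <= y & y <= x' --> (EX w. nmul n w = y)" using ex[of n] insert.prems by auto
   thus ?case using x by (intro exI[of _ "min x x'"]) auto
  qed
  then obtain x :: 'a where x: "0 < x" "ALL n:I. ALL y. 0 <= y & y <= x --> (EX w. nmul n w = y)"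
   by (elim exE conjE) (rule that)
  have nx: "~ (x <= y & y <= 0)" for y using x(1) by auto
  have "sat OGrp ((%_. 0)(0 := x)) (divisible_fm n)" if "n:I" for n
   unfolding sat_divisible_fm fun_upd_same
  proof (intro allI impI)
   fix y assume "0 <= y & y <= x | x <= y & y <= 0"
   hence "0 <= y & y <= x" using nx by blast
   thus "EX w. nmul n w = y" using bspec[OF x(2) that] by simp
  qed
  thus "EX a:univ OGrp. ALL (p, b):\<Delta>. sat OGrp (b(0 := a)) p"
   using I(3) x(1) by (intro bexI[of _ x]) (auto simp del: fun_upd_apply, auto)
 qed auto
 then obtain z where z: "!!p b. (p, b):\<Gamma> ==> sat OGrp (b(0 := z)) p" by blast
 have "0 < z" using z[of "Rel Less [Fn GZero [], Var 0]" "%_. 0"] by (auto simp: \<Gamma>_def)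
 moreover have "sat OGrp ((%_. 0)(0 := z)) (divisible_fm n)" if "n > 0" for n
  by (rule z) (use that in \<open>auto simp: \<Gamma>_def\<close>)
 hence "z:Dv" using in_Dv_iff[of z "%_. 0"] by blast
 ultimately show ?thesis by blast
qed

text \<open>\<open>C g x\<close> says that \<open>g\<close> and \<open>x\<close> correspond to each other modulo the largest divisible convex subgroups \<open>Dv\<close>.\<close>

definition mod_Dv_corr :: "('a::linordered_ab_group_add => 'b::linordered_ab_group_add => bool) => bool" where
 "mod_Dv_corr C <->
   (ALL g h x y. C g x --> C h y --> C (g - h) (x - y)) & (ALL g. EX x. C g x) & (ALL x. EX g. C g x) &
   (ALL g x. C g x --> (g:Dv <-> x:Dv)) & (ALL g x. g:Dv --> x:Dv --> C g x) &
   (ALL g x. C g x --> g ~: Dv --> (0 < g <-> 0 < x)) &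
   (ALL g x n. C g x --> n > 0 --> ((EX w. nmul n w = g) <-> (EX w. nmul n w = x))) &
   (ALL u w n. n > 0 --> C (nmul n u) (nmul n w) --> C u w)"

definition group_rel :: "('a::linordered_ab_group_add => 'b::linordered_ab_group_add => bool) => ('a \<times> 'b) set => bool" where
 "group_rel C R <-> countable R & (0, 0):R &
   (ALL g h x y. (g, x):R --> (h, y):R --> (g - h, x - y):R) &
   (ALL g x. (g, x):R --> (0 < g <-> 0 < x) & C g x)"

text \<open>Purity brings the parts of domain elements that divisibility questions ask for into the
  domain; pairs outside \<open>Dv\<close> are controlled by \<open>C\<close>, those inside by
  cuts.\<close>

definition pure_rel :: "('a::linordered_ab_group_add \<times> 'b::linordered_ab_group_add) set => bool" where
 "pure_rel R <-> (ALL g x n. n > 0 --> ((nmul n g, x):R --> (EX y. (g, y):R)) & ((g, nmul n x):R --> (EX h. (h, x):R)))"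

lemma mod_Dv_corr_converse: "mod_Dv_corr C ==> mod_Dv_corr (%x g. C g x)"
 unfolding mod_Dv_corr_def by (elim conjE, intro conjI) metis+

lemma group_rel_converse:
 assumes "group_rel C R"
 shows "group_rel (%x g. C g x) (R\<inverse>)"
proof -
 have "R\<inverse> = prod.swap ` R" by auto
 hence "countable (R\<inverse>)" using assms by (simp add: group_rel_def)
 thus ?thesis using assms unfolding group_rel_def by blast
qed

lemma pure_rel_converse: "pure_rel R ==> pure_rel (R\<inverse>)"
 unfolding pure_rel_def by blast

context
 fixes C :: "'a::linordered_ab_group_add => 'b::linordered_ab_group_add => bool"
 assumes C: "mod_Dv_corr C"
begin

lemma C_simps: "C g x ==> C h y ==> C (g - h) (x - y)" "EX x. C g x" "C g x ==> g:Dv <-> x:Dv"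
 "g:Dv ==> x:Dv ==> C g x" "C g x ==> g ~: Dv ==> 0 < g <-> 0 < x"
 "C g x ==> n > 0 ==> (EX w. nmul n w = g) <-> (EX w. nmul n w = x)" "n > 0 ==> C (nmul n u) (nmul n w) ==> C u w"
proof -
 note c = C[unfolded mod_Dv_corr_def]
 show "C g x ==> C h y ==> C (g - h) (x - y)" using c[THEN conjunct1] by blast
 show "EX x. C g x" using c[THEN conjunct2, THEN conjunct1] by blast
 note c = c[THEN conjunct2, THEN conjunct2, THEN conjunct2]
 show "C g x ==> g:Dv <-> x:Dv" using c[THEN conjunct1] by blast
 note c = c[THEN conjunct2]
 show "g:Dv ==> x:Dv ==> C g x" using c[THEN conjunct1] by blast
 note c = c[THEN conjunct2]
 show "C g x ==> g ~: Dv ==> 0 < g <-> 0 < x" using c[THEN conjunct1] by blast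
 note c = c[THEN conjunct2]
 show "C g x ==> n > 0 ==> (EX w. nmul n w = g) <-> (EX w. nmul n w = x)" using c[THEN conjunct1] by blast
 show "n > 0 ==> C (nmul n u) (nmul n w) ==> C u w" using c[THEN conjunct2] by blast
qed

lemma C_add: "C g x ==> C h y ==> C (g + h) (x + y)"
 using C_simps(1)[of g x "0 - h" "0 - y"] C_simps(1)[OF C_simps(4)[OF Dv_0 Dv_0], of h y] by simp

lemma C_nmul: "C g x ==> C (nmul n g) (nmul n x)"
 by (induction n) (auto intro: C_add C_simps(4))

context
 fixes R
 assumes R: "group_rel C R"
begin

lemma gr_simps: "(0, 0):R" "(g, x):R ==> (h, y):R ==> (g - h, x - y):R" "(g, x):R ==> C g x"
 "(g, x):R ==> 0 < g <-> 0 < x"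
 using R unfolding group_rel_def by blast+

lemma gr_minus: "(g, x):R ==> (- g, - x):R"
 using gr_simps(2)[OF gr_simps(1), of g x] by simp

lemma gr_add: "(g, x):R ==> (h, y):R ==> (g + h, x + y):R"
 using gr_simps(2)[of g x "- h" "- y"] gr_minus[of h y] by simp

lemma gr_nmul: "(g, x):R ==> (nmul n g, nmul n x):R"
 by (induction n) (auto intro: gr_add gr_simps(1))

lemma gr_less: "(g, x):R ==> (h, y):R ==> g < h <-> x < y"
 using gr_simps(4)[OF gr_simps(2), of h y g x] by simp

lemma gr_eq: "(g, x):R ==> (h, y):R ==> g = h <-> x = y"
 using gr_less[of g x h y] gr_less[of h y g x] by (metis linorder_neqE less_irrefl)

lemma pure_closure:
 "EX R'. R \<subseteq> R' & group_rel C R' & pure_rel R'"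
proof -
 define R' where "R' = {(u, w). EX n>0. (nmul n u, nmul n w):R}"
 have sub: "R \<subseteq> R'" by (auto simp: R'_def intro!: exI[of _ 1])
 have C': "C u w" if "(u, w):R'" for u w using that C_simps(7) gr_simps(3) by (auto simp: R'_def)
 have "countable R'"
 proof -
  have "R' = (\<Union>n\<in>{0<..}. (%(u, w). (nmul n u, nmul n w)) -` R)" by (auto simp: R'_def)
  moreover have "countable ((%(u, w). (nmul n u, nmul n w)) -` R)" if "n > 0" for n
  proof (rule countable_image_inj_on[of "%(u, w). (nmul n u, nmul n w)"])
   show "countable ((%(u, w). (nmul n u, nmul n w)) ` ((%(u, w). (nmul n u, nmul n w)) -` R))"
    by (rule countable_subset[of _ R]) (use R in \<open>auto simp: group_rel_def\<close>)
   show "inj_on (%(u, w). (nmul n u, nmul n w)) ((%(u, w). (nmul n u, nmul n w)) -` R)"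
    using that by (auto simp: inj_on_def nmul_eq_iff)
  qed
  ultimately show ?thesis by auto
 qed
 moreover have "(g - h, x - y):R'" if "(g, x):R'" "(h, y):R'" for g h x y
 proof -
  obtain n m where nm: "n > 0" "(nmul n g, nmul n x):R" "m > 0" "(nmul m h, nmul m y):R"
   using \<open>(g, x):R'\<close> \<open>(h, y):R'\<close> by (auto simp: R'_def)
  have "(nmul (m * n) g - nmul (n * m) h, nmul (m * n) x - nmul (n * m) y):R"
   unfolding nmul_mult by (intro gr_simps(2) gr_nmul nm)
  thus ?thesis using nm by (auto simp: R'_def nmul_diff mult.commute intro!: exI[of _ "m * n"])
 qed
 moreover have "0 < g <-> 0 < x" if "(g, x):R'" for g x
 proof -
  obtain n where n: "n > 0" "(nmul n g, nmul n x):R" using \<open>(g, x):R'\<close> by (auto simp: R'_def)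
  thus ?thesis using gr_simps(4)[OF n(2)] nmul_less_iff[OF n(1), of 0 g] nmul_less_iff[OF n(1), of 0 x] by simp
 qed
 ultimately have g: "group_rel C R'" using sub gr_simps(1) C' unfolding group_rel_def by blast
 have "(EX y. (g, y):R')" if n: "n > 0" "(nmul n g, x):R'" for n g x
 proof -
  obtain y where y: "nmul n y = x" using C_simps(6)[OF C'[OF n(2)] n(1)] by blast
  obtain m where "m > 0" "(nmul m (nmul n g), nmul m (nmul n y)):R" using n(2) y by (auto simp: R'_def)
  thus ?thesis using n(1) unfolding R'_def nmul_mult[symmetric] by (auto intro!: exI[of _ y] exI[of _ "m * n"])
 qed
 moreover have "(EX h. (h, x):R')" if n: "n > 0" "(g, nmul n x):R'" for n g x
 proof -
  obtain y where y: "nmul n y = g" using C_simps(6)[OF C'[OF n(2)] n(1)] by blast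
  obtain m where "m > 0" "(nmul m (nmul n y), nmul m (nmul n x)):R" using n(2) y by (auto simp: R'_def)
  thus ?thesis using n(1) unfolding R'_def nmul_mult[symmetric] by (auto intro!: exI[of _ y] exI[of _ "m * n"])
 qed
 ultimately have "pure_rel R'" unfolding pure_rel_def by blast
 thus ?thesis using sub g by blast
qed

text \<open>Multiples by naturals suggest writing elements as \<open>a + i y - j y\<close>. Signs
  need checking only for \<open>a + k y\<close>, since negation exchanges the two cases.\<close>

lemma adjoin_element:
 assumes Cy: "C y z"
  and sgn: "!!a x k. (a, x):R ==> k > 0 ==> a + nmul k y ~= 0 & (0 < a + nmul k y <-> 0 < x + nmul k z) & x + nmul k z ~= 0"
 shows "EX R'. R \<subseteq> R' & (y, z):R' & group_rel C R'"
proof -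
 define R' where "R' = {(a + nmul i y - nmul j y, x + nmul i z - nmul j z) | a x i j. (a, x):R}"
 have I: "(a + nmul i y - nmul j y, x + nmul i z - nmul j z):R'" if "(a, x):R" for a x i j using that unfolding R'_def by blast
 have sub: "R \<subseteq> R'" "(y, z):R'" using I[of _ _ 0 0] I[OF gr_simps(1), of 1 0] by auto
 have "R' \<subseteq> (%((a, x), i, j). (a + nmul i y - nmul j y, x + nmul i z - nmul j z)) ` (R \<times> UNIV)"
 proof
  fix t assume "t:R'"
  then obtain a x i j where "(a, x):R" "t = (a + nmul i y - nmul j y, x + nmul i z - nmul j z)" unfolding R'_def by blast
  thus "t:(%((a, x), i, j). (a + nmul i y - nmul j y, x + nmul i z - nmul j z)) ` (R \<times> UNIV)"
   by (intro image_eqI[of _ _ "((a, x), i, j)"]) auto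
 qed
 moreover have "countable R" using R by (simp add: group_rel_def)
 ultimately have "countable R'" by (meson countable_SIGMA countable_image countableI_type countable_subset)
 moreover have "(g - h, x - w):R'" if "(g, x):R'" "(h, w):R'" for g h x w
 proof -
  obtain a b i j where g: "(a, b):R" "g = a + nmul i y - nmul j y" "x = b + nmul i z - nmul j z" using \<open>(g, x):R'\<close> unfolding R'_def by blast
  obtain a' b' i' j' where h: "(a', b'):R" "h = a' + nmul i' y - nmul j' y" "w = b' + nmul i' z - nmul j' z" using \<open>(h, w):R'\<close> unfolding R'_def by blast
  have "g - h = (a - a') + nmul (i + j') y - nmul (j + i') y" "x - w = (b - b') + nmul (i + j') z - nmul (j + i') z"
   by (simp_all add: g h nmul_add_left algebra_simps)
  thus ?thesis using I[OF gr_simps(2)[OF g(1) h(1)]] by simp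
 qed
 moreover have "0 < g <-> 0 < x" if "(g, x):R'" for g x
 proof -
  obtain a b i j where g: "(a, b):R" "g = a + nmul i y - nmul j y" "x = b + nmul i z - nmul j z" using \<open>(g, x):R'\<close> unfolding R'_def by blast
  consider "i = j" | k where "i = j + k" "k > 0" | k where "j = i + k" "k > 0"
   by (metis less_imp_add_positive linorder_neqE_nat)
  thus ?thesis
  proof cases
   case 1
   thus ?thesis using gr_simps(4)[OF g(1)] by (simp add: g)
  next
   case 2
   thus ?thesis using sgn[OF g(1) 2(2)] by (simp add: g nmul_add_left algebra_simps)
  next
   case 3
   have "g = - (- a + nmul k y)" "x = - (- b + nmul k z)" by (simp_all add: g 3 nmul_add_left algebra_simps)
   thus ?thesis using sgn[OF gr_minus[OF g(1)] 3(2)] by (simp only: neg_0_less_iff_less) (meson less_asym linorder_neqE)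
  qed
 qed
 moreover have "C g x" if "(g, x):R'" for g x
  using that gr_simps(3) C_nmul[OF Cy] by (auto simp: R'_def intro!: C_simps(1) C_add)
 moreover have "(0, 0):R'" using sub gr_simps(1) by blast
 ultimately have "group_rel C R'" unfolding group_rel_def by - (intro conjI allI impI; simp)
 thus ?thesis using sub by blast
qed

end

text \<open>If no \<open>a + k y\<close> falls into \<open>Dv\<close>, every \<open>z\<close>
  corresponding to \<open>y\<close> has the right signs. Otherwise \<open>y\<close> splits into a
  part \<open>e\<close> of \<open>Dv\<close> and a part in the domain, and for \<open>e\<close> only
  the cut inside \<open>Dv\<close> matters, because divisibility there is automatic.\<close>

lemma group_forth:
 assumes R: "group_rel C R" "pure_rel R"
  and sat: "aleph1_saturated Lgrp (OGrp :: (_, _, 'b) struc)" and nt: "\<delta>:(Dv :: 'b set)" "0 < \<delta>"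
 shows "EX R'. R \<subseteq> R' & (EX z. (y, z):R') & group_rel C R' & pure_rel R'"
proof -
 note gr = gr_simps[OF R(1)]
 have pure: "EX x. (g, x):R" if "n > 0" "(nmul n g, x):R" for n g x using R(2) that unfolding pure_rel_def by blast
 have pure': "EX g. (g, x):R" if "n > 0" "(g, nmul n x):R" for n g x using R(2) that unfolding pure_rel_def by blast
 have far: "a + nmul k e ~= 0 & (0 < a + nmul k e <-> 0 < x + nmul k z) & x + nmul k z ~= 0"
  if "(a, x):R" "C e z" "a + nmul k e ~: Dv" for a x k e z
 proof -
  have c: "C (a + nmul k e) (x + nmul k z)" using that gr(3) C_add C_nmul by blast
  hence "x + nmul k z ~: Dv" using C_simps(3) that(3) by blast
  thus ?thesis using that(3) C_simps(5)[OF c] Dv_0 by metis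
 qed
 have "EX R'. R \<subseteq> R' & (EX z. (y, z):R') & group_rel C R'"
 proof (cases "EX a x k. (a, x):R & k > 0 & a + nmul k y:Dv")
  case False
  obtain z where "C y z" using C_simps(2) by blast
  from adjoin_element[OF R(1) this] far[OF _ this] False show ?thesis by meson
 next
  case True
  then obtain a x k where a: "(a, x):R" "k > 0" "a + nmul k y:Dv" by blast
  obtain e where e: "nmul k e = a + nmul k y" using Dv_div[OF a(3,2)] by blast
  have eD: "e:Dv" using Dv_root[of k e] a e by simp
  have "nmul k (y - e) = - a" by (simp add: nmul_diff e)
  \<comment> \<open>\<open>k (y - e) = - a\<close> lies in the domain, so purity puts
    \<open>y - e\<close> there.\<close>
  then obtain x1 where x1: "(y - e, x1):R" using pure[OF a(2), of "y - e" "- x"] gr_minus[OF R(1) a(1)] by auto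
  show ?thesis
  proof (cases "EX z. (e, z):R")
   case True
   then obtain z where "(e, z):R" by blast
   hence "(y, z + x1):R" using gr_add[OF R(1) _ x1] by fastforce
   thus ?thesis using R(1) by blast
  next
   case False
   define P where "P = {t:R. fst t:Dv & fst t < e}"
   define Q where "Q = {t:R. fst t:Dv & e < fst t}"
   have cnt: "countable (snd ` P)" "countable (snd ` Q)"
    using R(1) by (auto simp: group_rel_def P_def Q_def)
   have "a:Dv ==> b:Dv" if "(a, b):R" for a b using C_simps(3)[OF gr(3)[OF that]] by blast
   hence D: "snd ` P \<subseteq> Dv" "snd ` Q \<subseteq> Dv" by (auto simp: P_def Q_def)
   have PQ: "p < q" if "p:snd ` P" "q:snd ` Q" for p q
    using that gr_less[OF R(1)] by (auto simp: P_def Q_def) (meson less_trans)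
   obtain z where z: "z:Dv" "ALL p:snd ` P. p < z" "ALL q:snd ` Q. z < q"
    using Dv_cut_realize[OF sat nt cnt(1) D(1) cnt(2) D(2) PQ] by blast
   have Ce: "C e z" using C_simps(4) eD z(1) by blast
   have "b + nmul m e ~= 0 & (0 < b + nmul m e <-> 0 < w + nmul m z) & w + nmul m z ~= 0"
    if b: "(b, w):R" and m: "m > 0" for b w m
   proof (cases "b + nmul m e:Dv")
    case True
    \<comment> \<open>When \<open>b + m e\<close> lies in \<open>Dv\<close>, so does
      \<open>b\<close>; then \<open>- b = m b1\<close> with \<open>b1\<close> in the domain, and the
      sign becomes the position of \<open>e\<close> relative to \<open>b1\<close>.\<close>
    hence bD: "- b:Dv" using Dv_diff[OF Dv_nmul[OF eD, of m]] by fastforce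
    obtain b1 where b1: "nmul m b1 = - b" using Dv_div[OF bD m] by blast
    have b1D: "b1:Dv" using Dv_root[of m b1] b1 bD m by simp
    obtain w1 where w1: "(b1, w1):R" using pure[OF m, of b1 "- w"] gr_minus[OF R(1) b] b1 by auto
    have "nmul m w1 = - w" using gr_eq[OF R(1) gr_nmul[OF R(1) w1, of m] gr_minus[OF R(1) b]] b1 by simp
    hence eqs: "b + nmul m e = nmul m (e - b1)" "w + nmul m z = nmul m (z - w1)" using b1 by (simp_all add: nmul_diff)
    have "b1 ~= e" using False w1 by blast
    moreover have "b1 < e ==> w1 < z" using z(2) w1 b1D by (force simp: P_def)
    moreover have "e < b1 ==> z < w1" using z(3) w1 b1D by (force simp: Q_def)
    ultimately have "0 < e - b1 <-> 0 < z - w1" "e - b1 ~= 0" "z - w1 ~= 0"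
     by (cases b1 e rule: linorder_cases; auto)+
    thus ?thesis unfolding eqs using m nmul_less_iff[OF m, of 0 "e - b1"] nmul_less_iff[OF m, of 0 "z - w1"] by (simp add: nmul_eq_0_iff)
   qed (rule far[OF b Ce])
   from adjoin_element[OF R(1) Ce this] obtain R' where R': "R \<subseteq> R'" "(e, z):R'" "group_rel C R'" by blast
   have "(e + (y - e), z + x1):R'" using gr_add[OF R'(3,2)] x1 R'(1) by blast
   thus ?thesis using R' by auto
  qed
 qed
 then obtain R' z where R': "R \<subseteq> R'" "(y, z):R'" "group_rel C R'" by blast
 from pure_closure[OF R'(3)] show ?thesis using R'(1,2) by (meson subset_iff order_trans)
qed

end

lemma tpeq_mod_Dv:
 fixes C :: "'a::linordered_ab_group_add => 'b::linordered_ab_group_add => bool"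
 assumes C: "mod_Dv_corr C"
  and sat: "aleph1_saturated Lgrp (OGrp :: (_, _, 'a) struc)"
   "aleph1_saturated Lgrp (OGrp :: (_, _, 'b) struc)"
  and nt: "\<delta>:(Dv :: 'a set)" "0 < \<delta>" "\<epsilon>:(Dv :: 'b set)" "0 < \<epsilon>"
 shows "tpeq Lgrp (OGrp :: (_, _, 'a) struc) (OGrp :: (_, _, 'b) struc) {}"
proof -
 have "tpeq Lgrp (OGrp :: (_, _, 'a) struc) (OGrp :: (_, _, 'b) struc) {(0, 0)}"
 proof (rule back_forth_tpeq[where \<R> = "{R. group_rel C R & pure_rel R}"])
  fix R f and as :: "'a list" and bs :: "'b list"
  assume R: "R:{R. group_rel C R & pure_rel R}" and as: "length as = fun_arity Lgrp f" "list_all2 (%a b. (a, b):R) as bs"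
  hence "group_rel C R" by simp
  with as show "(fun_interp OGrp f as, fun_interp OGrp f bs):R"
   by (cases f) (auto simp: numeral_2_eq_2 length_Suc_conv list_all2_Cons1 intro!: gr_add[OF C] gr_simps[OF C])
 next
  fix R r and as :: "'a list" and bs :: "'b list"
  assume "R:{R. group_rel C R & pure_rel R}" "length as = rel_arity Lgrp r" "list_all2 (%a b. (a, b):R) as bs"
  thus "rel_interp OGrp r as = rel_interp OGrp r bs"
   by (auto simp: numeral_2_eq_2 length_Suc_conv list_all2_Cons1 gr_less[OF C])
 next
  fix R and b :: 'b assume "R:{R. group_rel C R & pure_rel R}"
  hence "group_rel (%x g. C g x) (R\<inverse>)" "pure_rel (R\<inverse>)" using group_rel_converse pure_rel_converse by auto
  from group_forth[OF mod_Dv_corr_converse[OF C] this sat(1) nt(1,2), of b] obtain R' a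
   where R': "R\<inverse> \<subseteq> R'" "(b, a):R'" "group_rel (%x g. C g x) R'" "pure_rel R'" by blast
  have "group_rel C (R'\<inverse>)" using group_rel_converse[OF R'(3)] by simp
  thus "EX R':{R. group_rel C R & pure_rel R}. R \<subseteq> R' & (EX a:univ OGrp. (a, b):R')"
   using R' pure_rel_converse by (intro bexI[of _ "R'\<inverse>"]) auto
 next
  fix R and a :: 'a assume "R:{R. group_rel C R & pure_rel R}"
  thus "EX R':{R. group_rel C R & pure_rel R}. R \<subseteq> R' & (EX b:univ OGrp. (a, b):R')"
   using group_forth[OF C _ _ sat(2) nt(3,4), of R a] by auto
 next
  show "{(0, 0)}:{R. group_rel C R & pure_rel R}"
   using C_simps(4)[OF C Dv_0 Dv_0] by (auto simp: group_rel_def pure_rel_def nmul_eq_0_iff)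
 next
  fix R and a a' :: 'a and b b' :: 'b assume "R:{R. group_rel C R & pure_rel R}" "(a, b):R" "(a', b'):R"
  thus "a = a' <-> b = b'" using gr_eq[OF C, of R a b a' b'] by simp
 qed
 thus ?thesis by (rule tpeq_mono) simp
qed

section \<open>Interpreting the value group and the group of positive elements in the field\<close>

lemma interp_violation:
 fixes M :: "('f, 'r, 'k::{zero,ord}) struc"
 assumes viol: "strong_NIP_violation L' N \<phi> b" and N: "univ N \<subseteq> h ` {x. 0 < x}" and M: "univ M = UNIV"
  and wf: "!!p. wf_fm L' p ==> wf_fm L (T p)"
  and sat: "!!p e. wf_fm L' p ==> (!!n. 0 < e n) ==> sat M e (T p) <-> sat N (h \<circ> e) p"
 shows "EX \<phi> b. strong_NIP_violation L M \<phi> b"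
proof -
 have "EX x. y:univ N --> 0 < x & h x = y" for y using N by blast
 then obtain \<sigma> where \<sigma>: "!!y. y:univ N ==> 0 < \<sigma> y & h (\<sigma> y) = y" by metis
 have b: "b i j n:univ N" for i j n using viol unfolding strong_NIP_violation_def by blast
 have "strong_NIP_violation L M (%i. T (\<phi> i)) (%i j n. \<sigma> (b i j n))"
  unfolding strong_NIP_violation_def
 proof (intro conjI allI)
  have wf\<phi>: "wf_fm L' (\<phi> i)" for i using viol by (simp add: strong_NIP_violation_def)
  thus "wf_fm L (T (\<phi> i))" for i by (rule wf)
  fix \<eta> :: "nat => nat"
  have "consistent_in N (pattern \<phi> b \<eta>)"
   using viol by (simp add: strong_NIP_violation_def)
  thus "consistent_in M ({(T (\<phi> i), %n. \<sigma> (b i (\<eta> i) n)) | i. True} \<union> {(Neg (T (\<phi> i)), %n. \<sigma> (b i j n)) | i j. j ~= \<eta> i})"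
  proof (rule consistent_map)
   fix a assume a: "a:univ N"
   have "sat M ((%n. \<sigma> (b i j n))(0 := \<sigma> a)) (T (\<phi> i)) <-> sat N ((b i j)(0 := a)) (\<phi> i)" for i j
   proof -
    have "h \<circ> (%n. \<sigma> (b i j n))(0 := \<sigma> a) = (b i j)(0 := a)" using \<sigma> a b by auto
    thus ?thesis using sat[OF wf\<phi>, of "(%n. \<sigma> (b i j n))(0 := \<sigma> a)"] \<sigma> a b by auto
   qed
   thus "EX a':univ M. ALL i j. sat M ((%n. \<sigma> (b i j n))(0 := a')) (T (\<phi> i)) <-> sat N ((b i j)(0 := a)) (\<phi> i)"
    unfolding M by blast
  qed
 qed (simp add: M)
 thus ?thesis by blast
qed

text \<open>The multiplicative group in additive notation, so that \<open>nmul n\<close> is the n-th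
  power and the results on ordered groups apply.\<close>

typedef (overloaded) 'k pos = "{x :: 'k::linordered_field. 0 < x}" morphisms rep_pos abs_pos
 by (rule exI[of _ 1]) simp

setup_lifting type_definition_pos

instantiation pos :: (linordered_field) linordered_ab_group_add
begin
lift_definition zero_pos :: "'a pos" is 1 by simp
lift_definition plus_pos :: "'a pos => 'a pos => 'a pos" is "(*)" by simp
lift_definition minus_pos :: "'a pos => 'a pos => 'a pos" is "(/)" by simp
lift_definition uminus_pos :: "'a pos => 'a pos" is inverse by simp
lift_definition less_eq_pos :: "'a pos => 'a pos => bool" is "(<=)" .
lift_definition less_pos :: "'a pos => 'a pos => bool" is "(<)" .
instance
 by standard (transfer; auto simp: field_simps)+
end

lemma rep_pos_gt [simp]: "0 < rep_pos x" using rep_pos[of x] by simp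

lemma rep_pos_nonzero [simp]: "rep_pos x ~= 0" using rep_pos_gt[of x] by (metis less_irrefl)

lemma rep_abs_pos: "0 < x ==> rep_pos (abs_pos x) = x" by (simp add: abs_pos_inverse)

lemma rep_pos_nmul: "rep_pos (nmul n x) = rep_pos x ^ n"
 by (induction n) (simp_all add: zero_pos.rep_eq plus_pos.rep_eq)

definition tr_pos :: "'r => (ogroup_fun, order_rel) fm => (oring_fun, 'r) fm" where
 "tr_pos r = tr_fm Eq (%s t. Rel r [s, t]) r"

lemma sat_tr_pos:
 fixes M :: "(oring_fun, 'r, 'k::linordered_field) struc"
 assumes M: "univ M = UNIV" "fun_interp M = fun_interp OFld" "!!x y. rel_interp M r [x, y] <-> x < y"
  and p: "wf_fm Lgrp p" "!!n. 0 < e n"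
 shows "sat M e (tr_pos r p) <-> sat OGrp (abs_pos \<circ> e) p"
 unfolding tr_pos_def
proof (rule sat_tr_fm[OF M _ _ _ _ _ p])
 have "x:abs_pos ` {x. 0 < x}" for x :: "'k pos"
  by (rule image_eqI[of _ _ "rep_pos x"]) (simp_all add: rep_pos_inverse)
 thus "univ OGrp = abs_pos ` {x :: 'k. 0 < x}" by auto
qed (simp_all add: plus_pos.abs_eq eq_onp_same_args zero_pos_def abs_pos_inject less_pos.abs_eq M)

lemma wf_tr_pos: "fun_arity L = fun_arity Lring ==> rel_arity L r = 2 ==> wf_fm Lgrp p ==> wf_fm L (tr_pos r p)"
 unfolding tr_pos_def by (rule wf_tr_fm) auto

primrec pow_tm :: "nat => oring_fun tm => oring_fun tm" where
 "pow_tm 0 t = Fn ROne []"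
| "pow_tm (Suc n) t = Fn RTimes [t, pow_tm n t]"

lemma pow_tm [simp]: "tm_val OFld e (pow_tm n t) = tm_val OFld e t ^ n"
 "wf_tm Lring t ==> wf_tm Lring (pow_tm n t)"
 by (induction n) auto

text \<open>Every element of the interval from \<open>x\<close> to \<open>y\<close> is
  \<open>x\<close> times an \<open>N\<close>-th power. For \<open>x <= y\<close> this will define
  \<open>v x = v y\<close>; for \<open>x > y\<close> the interval is empty, so
  \<open>same_value\<close> takes both orders.\<close>

definition powers_between :: "nat => (oring_fun, order_rel) fm" where
 "powers_between N = Neg (Exi 2 (Conj (Conj (Neg (Rel Less [Var 2, Var 0])) (Neg (Rel Less [Var 1, Var 2])))
   (Neg (Exi 3 (Eq (Var 2) (Fn RTimes [Var 0, pow_tm N (Var 3)]))))))"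

definition same_value :: "nat => oring_fun tm => oring_fun tm => (oring_fun, order_rel) fm" where
 "same_value N s t = Conj (subst_fm (powers_between N) (%n. if n = 0 then s else t)) (subst_fm (powers_between N) (%n. if n = 0 then t else s))"

context arc_field
begin

text \<open>Elements between \<open>x\<close> and \<open>y\<close> of equal value differ by positive
  units, which are \<open>N\<close>-th powers. If the values differ, some \<open>h\<close> up to
  \<open>v x - v y\<close> is not \<open>N\<close>-divisible, and an element of value
  \<open>v x - h\<close> in the interval is not \<open>x\<close> times an \<open>N\<close>-th
  power.\<close>

lemma same_value_iff:
 assumes N: "N > 0" and A: "!!x :: 'g. 0 < x ==> EX y. 0 <= y & y <= x & (\<nexists>w. nmul N w = y)"
  and st: "0 < tm_val OFld e s" "0 < tm_val OFld e t"
 shows "sat OFld e (same_value N s t) <-> v (tm_val OFld e s) = v (tm_val OFld e t)"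
proof -
 have one: "(ALL z. x <= z & z <= y --> (EX w. z = x * w ^ N)) <-> v x = v y" if xy: "0 < x" "x <= y" for x y
 proof
  assume eq: "v x = v y"
  show "ALL z. x <= z & z <= y --> (EX w. z = x * w ^ N)"
  proof (intro allI impI)
   fix z assume z: "x <= z & z <= y"
   hence z0: "0 < z" using xy(1) by simp
   have "v z = v x" using convex[of x z] convex[of z y] xy z z0 eq by auto
   moreover have "v (z / x * x) = v (z / x) + v x" using v_mult[of "z / x" x] z0 xy(1) by simp
   ultimately have "v (z / x) = 0" using xy(1) by simp
   then obtain w where "w ^ N = z / x" using unit_root[of "z / x" N] N z0 xy(1) by auto
   thus "EX w. z = x * w ^ N" using xy(1) by (intro exI[of _ w]) simp
  qed
 next
  assume L: "ALL z. x <= z & z <= y --> (EX w. z = x * w ^ N)"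
  show "v x = v y"
  proof (rule ccontr)
   assume "v x ~= v y"
   hence lt: "0 < v x - v y" using convex[of x y] xy by simp
   obtain h where h: "0 <= h" "h <= v x - v y" "\<nexists>w. nmul N w = h" using A[OF lt] by blast
   have "h ~= 0" using h(3) by (metis nmul_zero)
   have "EX z. x <= z & z <= y & z ~= 0 & v z = v x - h"
   proof (cases "h = v x - v y")
    case True
    thus ?thesis using xy by (intro exI[of _ y]) auto
   next
    case False
    obtain z0 where z0: "z0 ~= 0" "v z0 = v x - h" using v_surj by blast
    define z where "z = \<bar>z0\<bar>"
    have z: "0 < z" "v z = v x - h" using z0 by (auto simp: z_def abs_if)
    have "0 < h" "h < v x - v y" using h \<open>h ~= 0\<close> False by auto
    hence "v z < v x" "v y < v z" unfolding z(2) by (simp_all add: less_diff_eq add.commute)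
    hence "x < z" "z < y" using z(1) xy less_of_negl[of z x] less_of_negl[of y z] by (auto simp: negl_def)
    thus ?thesis using z by (intro exI[of _ z]) auto
   qed
   then obtain z where z: "x <= z" "z <= y" "z ~= 0" "v z = v x - h" by blast
   then obtain w where w: "z = x * w ^ N" using L by blast
   hence "v z = v x + nmul N (v w)" using z(3) N v_mult[of x "w ^ N"] v_power[of w N] by (cases "w = 0") auto
   hence "nmul N (- v w) = h" using z(4) by (simp add: nmul_minus minus_equation_iff[of h])
   thus False using h(3) by blast
  qed
 qed
 have pb: "sat OFld e (powers_between N) <-> (ALL z. e 0 <= z & z <= e 1 --> (EX w. z = e 0 * w ^ N))" for e :: "nat => 'k"
  by (auto simp: powers_between_def not_less)
 show ?thesis
  unfolding same_value_def sat.simps sat_subst pb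
  using one[of "tm_val OFld e s" "tm_val OFld e t"] one[of "tm_val OFld e t" "tm_val OFld e s"] st
  by (cases "tm_val OFld e s" "tm_val OFld e t" rule: linorder_cases) (auto simp: not_le)
qed

lemma wf_same_value: "wf_tm Lring s ==> wf_tm Lring t ==> wf_fm Lring (same_value N s t)"
 unfolding same_value_def powers_between_def wf_fm.simps(4) by (intro conjI wf_subst) auto

end

context arc_monster
begin

text \<open>Types of the group are translated to types of the field; the extra condition
  \<open>P\<close> makes the realisation positive.\<close>

lemma pos_saturated: "aleph1_saturated Lgrp (OGrp :: (_, _, 'k pos) struc)"
 unfolding aleph1_saturated_def
proof (intro allI impI, elim conjE)
 fix A :: "'k pos set" and \<Gamma>
 assume A: "countable A" "A \<subseteq> univ OGrp" and \<Gamma>: "ALL (p, b):\<Gamma>. wf_fm Lgrp p & range b \<subseteq> A"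
  and con: "consistent_in OGrp \<Gamma>"
 have \<Gamma>': "wf_fm Lgrp p" "b n:A" if "(p, b):\<Gamma>" for p b n using bspec[OF \<Gamma> that] by auto
 define T :: "_ \<times> (nat => 'k pos) => _ \<times> (nat => 'k)" where "T = (%(p, b). (tr_pos True p :: (oring_fun, bool) fm, rep_pos \<circ> b))"
 define P :: "(oring_fun, bool) fm \<times> (nat => 'k)" where "P = (Rel True [Fn RZero [], Var 0], %_. 1)"
 have T: "sat (Val v) ((snd (T t))(0 := rep_pos a)) (fst (T t)) <-> sat OGrp ((snd t)(0 := a)) (fst t)"
  if t: "t:\<Gamma>" for t and a :: "'k pos"
 proof -
  obtain p b where pb: "t = (p, b)" by (cases t)
  have "abs_pos \<circ> (rep_pos \<circ> b)(0 := rep_pos a) = b(0 := a)" by (auto simp: rep_pos_inverse)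
  thus ?thesis using sat_tr_pos[of "Val v" True p "(rep_pos \<circ> b)(0 := rep_pos a)"] \<Gamma> t by (auto simp: pb T_def)
 qed
 have "EX x. ALL (p, b):insert P (T ` \<Gamma>). sat (Val v) (b(0 := x)) p"
 proof (rule realize_F[of "insert 1 (rep_pos ` A)"])
  show "countable (insert 1 (rep_pos ` A))" using A by simp
  show "wf_fm Lval p & b ` (fv_fm p - {0}) \<subseteq> insert 1 (rep_pos ` A)" if "(p, b):insert P (T ` \<Gamma>)" for p b
   using that \<Gamma>' by (auto simp: P_def T_def intro!: wf_tr_pos imageI)
  fix \<Delta> assume D: "finite \<Delta>" "\<Delta> \<subseteq> insert P (T ` \<Gamma>)"
  hence "\<Delta> - {P} \<subseteq> T ` \<Gamma>" by blast
  then obtain Q where Q: "Q \<subseteq> \<Gamma>" "finite Q" "\<Delta> - {P} = T ` Q" using D(1) by (meson finite_Diff finite_subset_image)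
  then obtain a where a: "ALL (p, b):Q. sat OGrp (b(0 := a)) p" using con by (auto simp: consistent_in_def realizes_def)
  have "sat (Val v) ((snd d)(0 := rep_pos a)) (fst d)" if d: "d:\<Delta>" for d
  proof (cases "d = P")
   case False
   hence "d:T ` Q" using d Q(3) by blast
   then obtain t where t: "t:Q" "d = T t" by blast
   have "sat OGrp ((snd t)(0 := a)) (fst t)" using bspec[OF a t(1)] by (simp add: case_prod_beta)
   thus ?thesis using T[OF subsetD[OF Q(1) t(1)], of a] by (simp add: t(2))
  qed (simp add: P_def)
  thus "EX a. ALL (p, b):\<Delta>. sat (Val v) (b(0 := a)) p"
   by (intro exI[of _ "rep_pos a"]) (simp add: case_prod_beta)
 qed
 then obtain x where xP: "ALL (p, b):insert P (T ` \<Gamma>). sat (Val v) (b(0 := x)) p" by blast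
 have x: "sat (Val v) ((snd d)(0 := x)) (fst d)" if "d:insert P (T ` \<Gamma>)" for d
  using bspec[OF xP that] by (simp add: case_prod_beta)
 have "0 < x" using x[of P] by (simp add: P_def)
 hence "rep_pos (abs_pos x) = x" by (rule rep_abs_pos)
 hence "sat OGrp ((snd t)(0 := abs_pos x)) (fst t)" if "t:\<Gamma>" for t
  using T[OF that, of "abs_pos x"] x[of "T t"] that by simp
 thus "EX a:univ OGrp. realizes OGrp a \<Gamma>"
  by (intro bexI[of _ "abs_pos x"]) (simp_all add: realizes_def case_prod_beta)
qed

lemma v_rep_diff: "v (rep_pos (x - y)) = v (rep_pos x) - v (rep_pos y)"
 using v_mult[of "rep_pos (x - y)" "rep_pos y"] by (simp add: minus_pos.rep_eq eq_diff_eq)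

lemma v_rep_nmul: "v (rep_pos (nmul n x)) = nmul n (v (rep_pos x))"
 by (simp add: rep_pos_nmul v_power)

lemma v_rep_surj: "EX x. v (rep_pos x) = g"
proof -
 obtain x where "x ~= 0" "v x = g" using v_surj by blast
 thus ?thesis by (intro exI[of _ "abs_pos \<bar>x\<bar>"]) (auto simp: rep_abs_pos abs_if)
qed

lemma pos_divisible_iff: "n > 0 ==> (EX w. nmul n w = x) <-> (EX w. nmul n w = v (rep_pos x))"
proof
 assume "EX w. nmul n w = x"
 thus "EX w. nmul n w = v (rep_pos x)" using v_rep_nmul by metis
next
 assume n: "n > 0" and "EX w. nmul n w = v (rep_pos x)"
 then obtain w where "v (rep_pos x) = nmul n w" by metis
 then obtain z where "z > 0" "z ^ n = rep_pos x" using root_exists[OF rep_pos_gt] n by blast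
 hence "nmul n (abs_pos z) = x" by (simp add: rep_pos_inject[symmetric] rep_pos_nmul rep_abs_pos)
 thus "EX w. nmul n w = x" by blast
qed

lemma pos_convex: "x <= y ==> v (rep_pos y) <= v (rep_pos x)"
 using convex[OF rep_pos_gt] by (simp add: less_eq_pos.rep_eq)

lemma pos_less_of_value: "v (rep_pos y) < v (rep_pos x) ==> x < y"
 using pos_convex[of y x] by (meson not_le)

lemma v_rep_0 [simp]: "v (rep_pos 0) = 0" by (simp add: zero_pos.rep_eq)

text \<open>The kernel of \<open>v\<close> on positive elements is convex and divisible, so
  divisibility and intervals are read off the value.\<close>

lemma pos_Dv_iff: "x:Dv <-> v (rep_pos x):Dv"
proof
 assume "v (rep_pos x):Dv"
 hence "EX w. nmul n w = y" if n: "n > 0" and y: "0 <= y & y <= x | x <= y & y <= 0" for n and y :: "'k pos"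
  using y pos_convex[of y x] pos_convex[of x y] pos_convex[of 0 y] pos_convex[of y 0]
  by (subst pos_divisible_iff[OF n], intro Dv_div[OF _ n], elim Dv_convex) auto
 thus "x:Dv" unfolding Dv_def by blast
next
 assume x: "x:Dv"
 have "EX w. nmul n w = y" if n: "n > 0" and y: "0 <= y & y <= v (rep_pos x) | v (rep_pos x) <= y & y <= 0" for n and y :: 'g
 proof -
  have "EX z. v (rep_pos z) = y & (0 <= z & z <= x | x <= z & z <= 0)"
  proof (cases "y = 0 | y = v (rep_pos x)")
   case True
   thus ?thesis using linear[of 0 x] by (metis order_refl v_rep_0)
  next
   case False
   obtain z where "v (rep_pos z) = y" using v_rep_surj by blast
   thus ?thesis using y False pos_less_of_value[of 0 z] pos_less_of_value[of z 0] pos_less_of_value[of x z] pos_less_of_value[of z x]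
    by (intro exI[of _ z]) (auto simp: le_less)
  qed
  then obtain z where z: "v (rep_pos z) = y" "0 <= z & z <= x | x <= z & z <= 0" by blast
  hence "EX w. nmul n w = z" using x n unfolding Dv_def by blast
  thus ?thesis using pos_divisible_iff[OF n] z(1) by blast
 qed
 thus "v (rep_pos x):Dv" unfolding Dv_def by blast
qed

text \<open>The valuation reverses the order, so \<open>g\<close> corresponds to elements of value
  \<open>- g\<close> modulo \<open>Dv\<close>; that is why a sum and not a difference is required to
  lie in \<open>Dv\<close>.\<close>

lemma pos_corr: "mod_Dv_corr (%g x. v (rep_pos x) + g:Dv)"
 unfolding mod_Dv_corr_def
proof (intro conjI allI impI)
 fix g h :: 'g and x y :: "'k pos"
 assume g: "v (rep_pos x) + g:Dv"
 have e: "v (rep_pos (x - y)) + (g - h) = (v (rep_pos x) + g) - (v (rep_pos y) + h)" by (simp add: v_rep_diff)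
 show "v (rep_pos y) + h:Dv ==> v (rep_pos (x - y)) + (g - h):Dv" unfolding e by (rule Dv_diff[OF g])
 have gx: "g:Dv <-> v (rep_pos x):Dv"
  using Dv_diff[OF g, of g] Dv_diff[OF g, of "v (rep_pos x)"] by (auto simp: add.commute)
 thus "g:Dv <-> x:Dv" by (simp add: pos_Dv_iff)
 show "0 < g <-> 0 < x" if "g ~: Dv"
 proof -
  have "0 < g <-> 0 < - v (rep_pos x)" using Dv_sign[OF that, of "- v (rep_pos x)"] g by (simp add: add.commute)
  moreover have "v (rep_pos x) ~= 0" using gx that Dv_0 by metis
  ultimately show ?thesis using pos_less_of_value[of x 0] pos_less_of_value[of 0 x] by (auto simp: neq_iff)
 qed
 fix n :: nat assume n: "n > 0"
 obtain w where w: "nmul n w = v (rep_pos x) + g" using Dv_div[OF g n] by blast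
 have "(EX a. nmul n a = g) <-> (EX a. nmul n a = v (rep_pos x))"
 proof
  assume "EX a. nmul n a = g"
  then obtain a where "nmul n a = g" by blast
  thus "EX a. nmul n a = v (rep_pos x)" using w by (intro exI[of _ "w - a"]) (simp add: nmul_diff)
 next
  assume "EX a. nmul n a = v (rep_pos x)"
  then obtain a where "nmul n a = v (rep_pos x)" by blast
  thus "EX a. nmul n a = g" using w by (intro exI[of _ "w - a"]) (simp add: nmul_diff)
 qed
 thus "(EX a. nmul n a = g) <-> (EX a. nmul n a = x)" using pos_divisible_iff[OF n] by simp
next
 show "EX x. v (rep_pos x) + g:Dv" for g
  using v_rep_surj[of "- g"] Dv_0 by (metis ab_left_minus)
 show "EX g. v (rep_pos x) + g:Dv" for x :: "'k pos" by (intro exI[of _ "- v (rep_pos x)"]) simp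
 show "g:Dv ==> x:Dv ==> v (rep_pos x) + g:Dv" for g and x :: "'k pos" by (simp add: pos_Dv_iff Dv_add)
 show "n > 0 ==> v (rep_pos (nmul n w)) + nmul n u:Dv ==> v (rep_pos w) + u:Dv" for n u and w :: "'k pos"
  by (simp add: v_rep_nmul nmul_add[symmetric] Dv_root)
qed

lemma group_violation_field:
 assumes viol: "strong_NIP_violation Lgrp (OGrp :: (_, _, 'g) struc) \<phi> b"
 shows "EX \<phi> b. strong_NIP_violation Lring (OFld :: (_, _, 'k) struc) \<phi> b"
proof (cases "EX N>0. ALL x>0 :: 'g. EX y. 0 <= y & y <= x & (\<nexists>w. nmul N w = y)")
 case True
 then obtain N where N: "N > 0" "!!x :: 'g. 0 < x ==> EX y. 0 <= y & y <= x & (\<nexists>w. nmul N w = y)" by blast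
 define Lt where "Lt s t = Conj (Rel Less [t, s]) (Neg (same_value N s t))" for s t
 have img: "univ OGrp = v ` {x. 0 < x}"
 proof -
  have "g:v ` {x. 0 < x}" for g
  proof -
   obtain x where "v (rep_pos x) = g" using v_rep_surj by blast
   thus ?thesis by (intro image_eqI[of _ _ "rep_pos x"]) simp_all
  qed
  thus ?thesis by auto
 qed
 have lt: "y < x & v x ~= v y <-> v x < v y" if "0 < x" "0 < y" for x y
  using convex[of y x] less_of_negl[of x y] that by (auto simp: negl_def)
 show ?thesis
 proof (rule interp_violation[OF viol, where T = "tr_fm (same_value N) Lt Less"])
  show "sat OFld e (tr_fm (same_value N) Lt Less p) <-> sat OGrp (v \<circ> e) p"
   if "wf_fm Lgrp p" "!!n. 0 < e n" for p e
   by (rule sat_tr_fm[OF _ _ _ img _ _ same_value_iff[OF N] _ that])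
    (auto simp: v_mult Lt_def same_value_iff[OF N] lt simp del: not_less)
  show "wf_fm Lgrp p ==> wf_fm Lring (tr_fm (same_value N) Lt Less p)" for p
   by (rule wf_tr_fm) (auto simp: Lt_def wf_same_value)
 qed (simp_all add: img[symmetric])
next
 case False
 have "EX x>0 :: 'g. ALL y. 0 <= y & y <= x --> (EX w. nmul n w = y)" if n: "n > 0" for n
 proof -
  have "ALL N. N = 0 | (EX x>0 :: 'g. ALL y<=x. 0 <= y --> (EX w. nmul N w = y))" using False by simp
  from spec[OF this, of n] n obtain x :: 'g where "0 < x" "ALL y<=x. 0 <= y --> (EX w. nmul n w = y)" by auto
  thus ?thesis by (intro exI[of _ x]) simp
 qed
 from Dv_nontrivial[OF satG this] obtain \<delta> :: 'g where \<delta>: "\<delta>:Dv" "0 < \<delta>" by blast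
 \<comment> \<open>As the valuation reverses the order, an element above 1 is obtained from a
   negative value.\<close>
 obtain \<epsilon> :: "'k pos" where e: "v (rep_pos \<epsilon>) = - \<delta>" using v_rep_surj by blast
 have \<epsilon>: "\<epsilon>:Dv" "0 < \<epsilon>"
  using \<delta> Dv_minus pos_less_of_value[of \<epsilon> 0] by (simp_all add: pos_Dv_iff e)
 have "tpeq Lgrp (OGrp :: (_, _, 'g) struc) (OGrp :: (_, _, 'k pos) struc) {}"
  by (rule tpeq_mod_Dv[OF pos_corr satG pos_saturated \<delta> \<epsilon>])
 from strong_NIP_violation_transfer[OF this ogroup_is_structure pos_saturated viol]
 obtain b' where b': "strong_NIP_violation Lgrp (OGrp :: (_, _, 'k pos) struc) \<phi> b'" by blast
 show ?thesis
 proof (rule interp_violation[OF b', where T = "tr_pos Less" and h = abs_pos])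
  have "x:abs_pos ` {x. 0 < x}" for x :: "'k pos"
   by (rule image_eqI[of _ _ "rep_pos x"]) (simp_all add: rep_pos_inverse)
  thus "univ OGrp \<subseteq> abs_pos ` {x :: 'k. 0 < x}" by blast
  show "sat OFld e (tr_pos Less p) <-> sat OGrp (abs_pos \<circ> e) p"
   if "wf_fm Lgrp p" "!!n. 0 < e n" for p and e :: "nat => 'k"
   by (rule sat_tr_pos[OF _ _ _ that]) simp_all
 qed (simp_all add: wf_tr_pos)
qed

end

theorem theorem1p5:
  assumes "almost_real_closed TYPE('k::linordered_field) TYPE('g::linordered_ab_group_add)"
  shows "strongly_NIP oring_language
           (ofield_structure :: (oring_fun, order_rel, 'k) struc) \<longleftrightarrow>
         strongly_NIP ogroup_language
           (ogroup_structure :: (ogroup_fun, order_rel, 'g) struc)"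
proof -
 obtain v :: "'k => 'g" where "arc_field v" using almost_real_closed_arc_field[OF assms] by blast
 then interpret arc_field v .
 interpret S: arc_monster "star_map v" by (rule arc_monster_star)
 let ?F = "OFld :: (_, _, 'k star) struc" and ?G = "OGrp :: (_, _, 'g star) struc"
 have F: "strongly_NIP Lring (OFld :: (_, _, 'k) struc) <-> (\<nexists>\<phi> b. strong_NIP_violation Lring ?F \<phi> b)"
  by (rule strongly_NIP_iff[OF oring_is_structure oring_is_structure up_saturated[OF oring_is_structure is_ultrapower_oring]
    up_tpeq[OF oring_is_structure is_ultrapower_oring]])
 have G: "strongly_NIP Lgrp (OGrp :: (_, _, 'g) struc) <-> (\<nexists>\<phi> b. strong_NIP_violation Lgrp ?G \<phi> b)"
  by (rule strongly_NIP_iff[OF ogroup_is_structure ogroup_is_structure S.satG up_tpeq[OF ogroup_is_structure is_ultrapower_ogroup]])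
 \<comment> \<open>The array for \<open>K star\<close> is built in a second ultrapower, so the
   violation first appears in \<open>'g star star\<close>; elementary equivalence and saturation
   bring it back to \<open>'g star\<close>.\<close>
 have "EX \<phi> b. strong_NIP_violation Lgrp ?G \<phi> b" if "strong_NIP_violation Lring ?F \<phi> b" for \<phi> b
 proof -
  obtain \<phi>' b' where "strong_NIP_violation Lgrp (OGrp :: (_, _, 'g star star) struc) \<phi>' b'"
   using S.field_violation_group[OF \<open>strong_NIP_violation Lring ?F \<phi> b\<close>] by blast
  from strong_NIP_violation_transfer[OF tpeq_converse[OF up_tpeq[OF ogroup_is_structure is_ultrapower_ogroup], unfolded converse_empty]
    ogroup_is_structure S.satG this] show ?thesis by blast
 qed
 thus ?thesis unfolding F G using S.group_violation_field by blast
qed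

end
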